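(* Let $n\geq2$ and let $\mathcal R$ be a potential class of resolvent type on $\mathbb R^n$ with associated functional $[\,\cdot\,]_{\mathcal R}$. There exist $\varepsilon>0$ and $C>0$, depending only on $n$ and $\mathcal R$, such that for every $V\in\mathcal R$ with $[V]_{\mathcal R}<\varepsilon$ the following holds. If $u_0\in L^2(\mathbb R^n)$ and $F\in L^2_{t,x}(|V|^{-1})$, then there exists a unique solution $u\in L^2_{t,x}(|V|)$ of the Cauchy problem $$i\partial_tu+\Delta u-V(x)u=F(x,t),\qquad u(x,0)=u_0(x).$$ Furthermore, $u$ belongs to $C_tL^2_x$ and satisfies $$\|u\|_{L^2_{t,x}(|V|)}\leq C[V]_{\mathcal R}^{1/2}\|u_0\|_{L^2}+C[V]_{\mathcal R}\|F\|_{L^2_{t,x}(|V|^{-1})}$$ and $$\sup_{t\in\mathbb R}\|u(\cdot,t)\|_{L^2_x}\leq C\|u_0\|_{L^2}+C[V]_{\mathcal R}^{1/2}\|F\|_{L^2_{t,x}(|V|^{-1})}.$$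
   Context: For a nonnegative $w$ on $\mathbb R^n$, $\|f\|_{L^2(w)}^2=\int_{\mathbb R^n}|f|^2w\,dx$ and $\|F\|_{L^2_{t,x}(w)}^2=\int_{\mathbb R}\int_{\mathbb R^n}|F(x,t)|^2w(x)\,dxdt$, with conventions $1/0=\infty$, $0\cdot\infty=0$. $C_tL^2_x$ is the space of continuous functions $\mathbb R\to L^2(\mathbb R^n)$. $e^{it\Delta}$ is the free Schrödinger propagator (Fourier multiplier $e^{-it|\xi|^2}$). Solution is understood in the integral (Duhamel) sense: $u(x,t)=e^{it\Delta}u_0(x)-i\int_0^te^{i(t-s)\Delta}F(\cdot,s)ds-i\int_0^te^{i(t-s)\Delta}(Vu)(\cdot,s)ds$. Resolvent type: a class $\mathcal R$ of measurable potentials $V:\mathbb R^n\to\mathbb C$ is of resolvent type if there is a function $[\,\cdot\,]_{\mathcal R}:\mathcal R\to[0,\infty)$ and a constant $C_{\mathcal R}$ such that for all $V\in\mathcal R$, all $z\in\mathbb C\setminus\mathbb R$ and all $f\in L^2(|V|^{-1})$, $\|(-\Delta-z)^{-1}f\|_{L^2(|V|)}\leq C_{\mathcal R}[V]_{\mathcal R}\|f\|_{L^2(|V|^{-1})}$. If $|V_1|\le|V_2|$ then $[V_1]_{\mathcal R}\le[V_2]_{\mathcal R}$. *)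

theory Defs
  imports "HOL-Analysis.Analysis"
begin

section \<open>Weighted spaces of square integrable functions\<close>

text \<open>
  Norms and weights are extended nonnegative reals, so that
  \<open>1 / 0 = \<infinity>\<close> and \<open>0 * \<infinity> = 0\<close> hold by definition of the operations of \<^typ>\<open>ennreal\<close>.
  Functions are Lebesgue measurable representatives.
\<close>

definition ennreal_sqrt :: "ennreal \<Rightarrow> ennreal" where
  "ennreal_sqrt a = (if a = top then top else ennreal (sqrt (enn2real a)))"

definition wnorm :: "('a::euclidean_space \<Rightarrow> ennreal) \<Rightarrow> ('a \<Rightarrow> complex) \<Rightarrow> ennreal" where
  "wnorm w f = ennreal_sqrt (\<integral>\<^sup>+x. ennreal ((cmod (f x))\<^sup>2) * w x \<partial>lebesgue)"

definition L2w :: "('a::euclidean_space \<Rightarrow> ennreal) \<Rightarrow> ('a \<Rightarrow> complex) set" where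
  "L2w w = {f \<in> borel_measurable lebesgue. wnorm w f < top}"

abbreviation L2norm :: "('a::euclidean_space \<Rightarrow> complex) \<Rightarrow> ennreal" where
  "L2norm \<equiv> wnorm (\<lambda>_. 1)"

abbreviation L2 :: "('a::euclidean_space \<Rightarrow> complex) set" where
  "L2 \<equiv> L2w (\<lambda>_. 1)"

definition weight :: "('a::euclidean_space \<Rightarrow> complex) \<Rightarrow> 'a \<Rightarrow> ennreal" where
  "weight V x = ennreal (cmod (V x))"

definition dual_weight :: "('a::euclidean_space \<Rightarrow> complex) \<Rightarrow> 'a \<Rightarrow> ennreal" where
  "dual_weight V x = inverse (ennreal (cmod (V x)))"

text \<open>
  A weight in \<open>x\<close> regarded as a weight in \<open>(x, t)\<close>. By Tonelli, \<open>wnorm (tx w)\<close> is the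
  norm given by the iterated integral in \<open>x\<close> and \<open>t\<close>.
\<close>

definition tx :: "('a::euclidean_space \<Rightarrow> ennreal) \<Rightarrow> 'a \<times> real \<Rightarrow> ennreal" where
  "tx w = (\<lambda>(x, t). w x)"


section \<open>Fourier multipliers on \<open>L\<^sup>2\<close>\<close>

definition fourier_L1 :: "('a::euclidean_space \<Rightarrow> complex) \<Rightarrow> 'a \<Rightarrow> complex" where
  "fourier_L1 f \<xi> =
     (\<integral>x. cis (- (x \<bullet> \<xi>)) * f x \<partial>lebesgue) / complex_of_real ((2 * pi) powr (DIM('a) / 2))"

text \<open>
  The Fourier--Plancherel transform: the limit in \<open>L\<^sup>2\<close> of the transforms of the truncations
  of \<open>f\<close> to balls. It is determined up to null sets; one representative is selected.
\<close>

definition fourier_L2 :: "('a::euclidean_space \<Rightarrow> complex) \<Rightarrow> 'a \<Rightarrow> complex" where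
  "fourier_L2 f = (SOME g. g \<in> L2 \<and>
     ((\<lambda>r. L2norm (\<lambda>\<xi>. g \<xi> - fourier_L1 (\<lambda>x. indicator (cball 0 r) x * f x) \<xi>)) \<longlongrightarrow> 0) at_top)"

text \<open>
  The operator with bounded symbol \<open>m\<close>, meaningful for \<open>f \<in> L2\<close>. The value is again a selected
  representative, so it may only be used through its almost-everywhere class.
\<close>

definition multiplier :: "('a::euclidean_space \<Rightarrow> complex) \<Rightarrow> ('a \<Rightarrow> complex) \<Rightarrow> 'a \<Rightarrow> complex" where
  "multiplier m f = (SOME h. h \<in> L2 \<and>
     (AE \<xi> in lebesgue. fourier_L2 h \<xi> = m \<xi> * fourier_L2 f \<xi>))"

definition propagator :: "real \<Rightarrow> ('a::euclidean_space \<Rightarrow> complex) \<Rightarrow> 'a \<Rightarrow> complex" where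
  "propagator t = multiplier (\<lambda>\<xi>. cis (- t * (norm \<xi>)\<^sup>2))"

definition free_resolvent :: "complex \<Rightarrow> ('a::euclidean_space \<Rightarrow> complex) \<Rightarrow> 'a \<Rightarrow> complex" where
  "free_resolvent z = multiplier (\<lambda>\<xi>. 1 / (complex_of_real ((norm \<xi>)\<^sup>2) - z))"


section \<open>Potential classes of resolvent type\<close>

text \<open>
  The free resolvent acts on \<open>L2\<close>, so the estimate is stated for \<open>f\<close> in the dense subspace
  \<open>L2 \<inter> L2w (dual_weight V)\<close> of \<open>L2w (dual_weight V)\<close>; the resolvent on all of
  \<open>L2w (dual_weight V)\<close>, with the same bound, is the extension by continuity.
\<close>

definition resolvent_type ::
  "('a::euclidean_space \<Rightarrow> complex) set \<Rightarrow> (('a \<Rightarrow> complex) \<Rightarrow> real) \<Rightarrow> bool" where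
  "resolvent_type R br \<longleftrightarrow>
     R \<subseteq> borel_measurable lebesgue \<and>
     (\<forall>V\<in>R. 0 \<le> br V) \<and>
     (\<exists>C\<ge>0. \<forall>V\<in>R. \<forall>z. z \<notin> \<real> \<longrightarrow> (\<forall>f \<in> L2 \<inter> L2w (dual_weight V).
        wnorm (weight V) (free_resolvent z f) \<le> ennreal (C * br V) * wnorm (dual_weight V) f)) \<and>
     (\<forall>V1\<in>R. \<forall>V2\<in>R. (\<forall>x. cmod (V1 x) \<le> cmod (V2 x)) \<longrightarrow> br V1 \<le> br V2)"


section \<open>Duhamel solutions\<close>

text \<open>
  \<open>is_duhamel F t D\<close>: the element \<open>D\<close> of \<open>L2\<close> is the integral of \<open>propagator (t - s) (F(\<cdot>, s))\<close> over \<open>s\<close>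
  from \<open>0\<close> to \<open>t\<close>, taken in the weak sense. A slice \<open>F(\<cdot>, s)\<close> with \<open>F \<in> L2w (tx (dual_weight V))\<close>
  need not lie in \<open>L2\<close>, so the propagator is moved to the test function: its adjoint is
  \<open>propagator (s - t)\<close>. The integral over \<open>s\<close> is oriented, so \<open>t\<close> may be negative.
\<close>

definition is_duhamel ::
  "('a::euclidean_space \<times> real \<Rightarrow> complex) \<Rightarrow> real \<Rightarrow> ('a \<Rightarrow> complex) \<Rightarrow> bool" where
  "is_duhamel F t D \<longleftrightarrow> D \<in> L2 \<and> (\<forall>\<phi>\<in>L2.
     (AE s in lebesgue. s \<in> closed_segment 0 t \<longrightarrow>
        integrable lebesgue (\<lambda>x. F (x, s) * cnj (propagator (s - t) \<phi> x))) \<and>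
     interval_lebesgue_integrable lebesgue 0 (ereal t)
        (\<lambda>s. \<integral>x. F (x, s) * cnj (propagator (s - t) \<phi> x) \<partial>lebesgue) \<and>
     (\<integral>x. D x * cnj (\<phi> x) \<partial>lebesgue) =
       interval_lebesgue_integral lebesgue 0 (ereal t)
        (\<lambda>s. \<integral>x. F (x, s) * cnj (propagator (s - t) \<phi> x) \<partial>lebesgue))"

text \<open>
  Since members of \<open>L2w (tx (weight V))\<close> are only determined up to null sets in \<open>(x, t)\<close>, the
  integral equation is required for almost every \<open>t\<close>.
\<close>

definition is_solution ::
  "('a::euclidean_space \<Rightarrow> complex) \<Rightarrow> ('a \<Rightarrow> complex) \<Rightarrow> ('a \<times> real \<Rightarrow> complex) \<Rightarrow>
   ('a \<times> real \<Rightarrow> complex) \<Rightarrow> bool" where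
  "is_solution V u0 F u \<longleftrightarrow> u \<in> L2w (tx (weight V)) \<and>
     (AE t in lebesgue. \<exists>D E.
        is_duhamel F t D \<and>
        is_duhamel (\<lambda>(x, s). V x * u (x, s)) t E \<and>
        (AE x in lebesgue. u (x, t) = propagator t u0 x - \<i> * D x - \<i> * E x))"

definition in_Ct_L2x :: "('a::euclidean_space \<times> real \<Rightarrow> complex) \<Rightarrow> bool" where
  "in_Ct_L2x u \<longleftrightarrow>
     (\<forall>t. (\<lambda>x. u (x, t)) \<in> L2 \<and>
          ((\<lambda>s. L2norm (\<lambda>x. u (x, s) - u (x, t))) \<longlongrightarrow> 0) (at t))"

end

theory Submission
  imports Defs "HOL-Probability.Probability"
begin

text \<open>
  Factor \<open>|V| = a\<^sup>2\<close> with \<open>a \<ge> 0\<close>, so that a source in the dual weighted space is \<open>F = a f\<close> with \<open>f\<close> in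
  \<open>L\<^sup>2\<close>, and a solution \<open>u\<close> in the weighted space corresponds to \<open>a u\<close> in \<open>L\<^sup>2\<close>. The Fourier transform in
  time turns the retarded Duhamel operator, damped by \<open>exp (- e (t - s))\<close>, into the free resolvent at the
  spectral points \<open>- l + \<i>e\<close>, so Plancherel in time converts the uniform resolvent bound into
  \<open>|\<integral>\<integral>\<^bsub>s < t\<^esub> \<langle>exp (\<i>(t - s)\<Delta>) a f(s), a g(t)\<rangle> ds dt| \<le> M \<parallel>f\<parallel> \<parallel>g\<parallel>\<close>, first with damping and then, by
  dominated convergence, without. Adding the adjoint form bounds \<open>\<parallel>\<integral> exp (- \<i>s\<Delta>) a f(s) ds\<parallel>\<^sup>2\<close> by
  \<open>2 M \<parallel>f\<parallel>\<^sup>2\<close>, which by duality is Kato smoothing for the free evolution and the bound and continuity of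
  the Duhamel term in \<open>L\<^sup>2\<close>. For \<open>4 M \<le> 1\<close> the integral equation, written for the amplitude \<open>g\<close> of
  \<open>V u = a g\<close>, is a contraction.

  Plancherel's theorem is obtained from Gaussian damping. The heat kernel gives \<open>\<parallel>ft f\<parallel> \<le> \<parallel>f\<parallel>\<close> for all
  integrable \<open>f\<close> in \<open>L\<^sup>2\<close> and equality on continuous functions of bounded support; since the transform and
  its adjoint (its conjugate by complex conjugation) are both isometries, the transform is onto.
\<close>

text \<open>Three obstacles shape the details. First, \<open>a\<close> may be unbounded and
  \<open>a f\<close> need not have slices in L2, so the Duhamel integral has no direct meaning;
  forms are computed on truncations for which \<open>f\<close> and \<open>a f\<close> are both
  bounded with bounded support, and the general case is reached through the estimates. Second,
  Fourier-Plancherel representatives are chosen separately at each time, so an evolution is not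
  defined as \<open>propagator t \<phi>\<close> but built as a jointly measurable function whose
  slices have the right transform. Third, the statement lives on completed measures, while Fubini
  arguments want Borel functions; the analysis runs on \<open>lborel\<close>, and Borel
  representatives carry it over at the end. Constants: the retarded bound M is spent once on each
  side of time zero, hence 2 M for the weighted Duhamel operator, and 4 M \<le> 1 makes it a
  contraction by 1/2. Absorbing that half doubles the remaining terms, which is the origin of 2 sqrt
  (2 M), 4 M and 2. The unknown is an amplitude and not u itself, because the weighted norm sees u
  only where V does not vanish.\<close>

abbreviation lborel2 :: "('a::euclidean_space \<times> 'b::euclidean_space) measure" where
  "lborel2 \<equiv> lborel \<Otimes>\<^sub>M lborel"

lemma borel_measurable_cnj [measurable]: "cnj \<in> borel_measurable borel"
  by (intro borel_measurable_continuous_onI continuous_intros)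

section \<open>Square integrable functions, kept as functions and not as classes modulo null
  sets\<close>

definition square_int :: "'a measure \<Rightarrow> ('a \<Rightarrow> complex) \<Rightarrow> bool" where
  "square_int M f \<longleftrightarrow> f \<in> borel_measurable M \<and> integrable M (\<lambda>x. (cmod (f x))\<^sup>2)"

text \<open>The Bochner integral of a non-integrable function is 0, so this value is a norm only
  together with \<open>square_int\<close>.\<close>

definition norm2 :: "'a measure \<Rightarrow> ('a \<Rightarrow> complex) \<Rightarrow> real" where
  "norm2 M f = sqrt (\<integral>x. (cmod (f x))\<^sup>2 \<partial>M)"

definition inner2 :: "'a measure \<Rightarrow> ('a \<Rightarrow> complex) \<Rightarrow> ('a \<Rightarrow> complex) \<Rightarrow> complex" where
  "inner2 M f g = (\<integral>x. f x * cnj (g x) \<partial>M)"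

lemma square_int_measurable [measurable_dest]: "square_int M f \<Longrightarrow> f \<in> borel_measurable M"
  by (simp add: square_int_def)

lemma norm2_nonneg [simp]: "0 \<le> norm2 M f"
  by (simp add: norm2_def)

lemma norm2_power2: "(norm2 M f)\<^sup>2 = (\<integral>x. (cmod (f x))\<^sup>2 \<partial>M)"
  by (simp add: norm2_def)

lemma square_int_iff_nn_integral:
  "square_int M f \<longleftrightarrow> f \<in> borel_measurable M \<and> (\<integral>\<^sup>+x. ennreal ((cmod (f x))\<^sup>2) \<partial>M) < \<infinity>"
  by (auto simp: square_int_def integrable_iff_bounded)

lemma nn_integral_square_int:
  assumes "square_int M f"
  shows "(\<integral>\<^sup>+x. ennreal ((cmod (f x))\<^sup>2) \<partial>M) = ennreal ((norm2 M f)\<^sup>2)"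
  using assms by (simp add: norm2_power2 square_int_def nn_integral_eq_integral)

text \<open>Tonelli and Fatou bound nonnegative integrals of functions not yet known to be square
  integrable; this turns such a bound into membership and norm at once.\<close>

lemma square_int_boundI:
  assumes "f \<in> borel_measurable M" "(\<integral>\<^sup>+x. ennreal ((cmod (f x))\<^sup>2) \<partial>M) \<le> ennreal (c\<^sup>2)" "0 \<le> c"
  shows "square_int M f" "norm2 M f \<le> c"
proof -
  show s: "square_int M f"
    using assms by (auto simp: square_int_iff_nn_integral) (metis ennreal_less_top order_le_less_trans)
  have "(norm2 M f)\<^sup>2 \<le> c\<^sup>2"
    using assms(2,3) nn_integral_square_int[OF s] by simp
  then show "norm2 M f \<le> c"
    using assms(3) by (rule power2_le_imp_le)
qed

lemma square_int_mono:
  assumes "square_int M g" "f \<in> borel_measurable M" "AE x in M. cmod (f x) \<le> c * cmod (g x)" "0 \<le> c"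
  shows "square_int M f" "norm2 M f \<le> c * norm2 M g"
proof -
  have "(\<integral>\<^sup>+x. ennreal ((cmod (f x))\<^sup>2) \<partial>M) \<le> (\<integral>\<^sup>+x. ennreal (c\<^sup>2) * ennreal ((cmod (g x))\<^sup>2) \<partial>M)"
    using assms(3)
    by (intro nn_integral_mono_AE, eventually_elim)
       (simp add: ennreal_mult[symmetric] power_mult_distrib[symmetric] power_mono)
  also have "\<dots> = ennreal (c\<^sup>2) * ennreal ((norm2 M g)\<^sup>2)"
    using assms(1) by (subst nn_integral_cmult) (auto simp: nn_integral_square_int square_int_def)
  also have "\<dots> = ennreal ((c * norm2 M g)\<^sup>2)"
    by (simp add: ennreal_mult[symmetric] power_mult_distrib)
  finally have *: "(\<integral>\<^sup>+x. ennreal ((cmod (f x))\<^sup>2) \<partial>M) \<le> ennreal ((c * norm2 M g)\<^sup>2)" .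
  show "square_int M f" "norm2 M f \<le> c * norm2 M g"
    using square_int_boundI[OF assms(2) *] assms(4) by auto
qed

lemma square_int_mono1:
  assumes "square_int M g" "f \<in> borel_measurable M" "\<And>x. cmod (f x) \<le> cmod (g x)"
  shows "square_int M f" "norm2 M f \<le> norm2 M g"
  using square_int_mono[OF assms(1,2), of 1] assms(3) by auto

lemma norm2_cong_AE:
  assumes "f \<in> borel_measurable M" "g \<in> borel_measurable M" "AE x in M. f x = g x"
  shows "norm2 M f = norm2 M g"
  unfolding norm2_def using assms by (subst integral_cong_AE[where g="\<lambda>x. (cmod (g x))\<^sup>2"]) auto

lemma square_int_zero [simp]: "square_int M (\<lambda>x. 0)" and norm2_zero [simp]: "norm2 M (\<lambda>x. 0) = 0"
  by (auto simp: square_int_def norm2_def)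

lemma square_int_mult_bounded:
  assumes "square_int M f" "m \<in> borel_measurable M" "\<And>x. cmod (m x) \<le> K" "0 \<le> K"
  shows "square_int M (\<lambda>x. m x * f x)" "norm2 M (\<lambda>x. m x * f x) \<le> K * norm2 M f"
proof -
  have [measurable]: "f \<in> borel_measurable M" "m \<in> borel_measurable M" using assms by (auto simp: square_int_def)
  show "square_int M (\<lambda>x. m x * f x)" "norm2 M (\<lambda>x. m x * f x) \<le> K * norm2 M f"
    using square_int_mono[OF assms(1), of "\<lambda>x. m x * f x" K] assms(3,4)
    by (auto simp: norm_mult mult_right_mono)
qed

lemma square_int_cmult [intro]: "square_int M f \<Longrightarrow> square_int M (\<lambda>x. c * f x)"
  by (rule square_int_mult_bounded(1)[where K="cmod c"]) auto

lemma norm2_cmult: "norm2 M (\<lambda>x. c * f x) = cmod c * norm2 M f"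
  by (simp add: norm2_def norm_mult power_mult_distrib real_sqrt_mult)

lemma norm2_minus: "norm2 M (\<lambda>x. - f x) = norm2 M f"
  by (simp add: norm2_def)

lemma norm2_cnj: "norm2 M (\<lambda>x. cnj (f x)) = norm2 M f"
  by (simp add: norm2_def)

lemma square_int_cnj [intro]: "square_int M f \<Longrightarrow> square_int M (\<lambda>x. cnj (f x))"
  unfolding square_int_def by auto

lemma norm2_commute: "norm2 M (\<lambda>x. f x - g x) = norm2 M (\<lambda>x. g x - f x)"
  by (simp add: norm2_def norm_minus_commute)

lemma square_int_mult_integrable:
  assumes "square_int M f" "square_int M g"
  shows "integrable M (\<lambda>x. f x * g x)" "integrable M (\<lambda>x. cmod (f x) * cmod (g x))"
    "integrable M (\<lambda>x. f x * cnj (g x))"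
proof -
  have [measurable]: "f \<in> borel_measurable M" "g \<in> borel_measurable M" using assms by (auto simp: square_int_def)
  have i: "integrable M (\<lambda>x. (cmod (f x))\<^sup>2 + (cmod (g x))\<^sup>2)"
    using assms by (auto simp: square_int_def)
  have b: "cmod (f x) * cmod (g x) \<le> (cmod (f x))\<^sup>2 + (cmod (g x))\<^sup>2" for x
    using sum_squares_bound[of "cmod (f x)" "cmod (g x)"] zero_le_mult_iff[of "cmod (f x)" "cmod (g x)"]
      norm_ge_zero[of "f x"] norm_ge_zero[of "g x"] by linarith
  show "integrable M (\<lambda>x. f x * g x)" "integrable M (\<lambda>x. cmod (f x) * cmod (g x))"
    "integrable M (\<lambda>x. f x * cnj (g x))"
    by (rule Bochner_Integration.integrable_bound[OF i]; auto simp: norm_mult b)+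
qed

lemma integral_mult_le_norm2:
  assumes "square_int M f" "square_int M g"
  shows "(\<integral>x. cmod (f x) * cmod (g x) \<partial>M) \<le> norm2 M f * norm2 M g"
proof -
  have [measurable]: "f \<in> borel_measurable M" "g \<in> borel_measurable M" using assms by (auto simp: square_int_def)
  let ?I = "(\<integral>x. cmod (f x) * cmod (g x) \<partial>M)"
  have e: "(\<integral>\<^sup>+x. ennreal (cmod (f x)) * ennreal (cmod (g x)) \<partial>M) = ennreal ?I"
    using square_int_mult_integrable(2)[OF assms]
    by (simp add: ennreal_mult[symmetric] nn_integral_eq_integral)
  have "ennreal (?I\<^sup>2) = (ennreal ?I)\<^sup>2"
    by (simp add: ennreal_power)
  also have "\<dots> \<le> (\<integral>\<^sup>+x. ennreal ((cmod (f x))\<^sup>2) \<partial>M) * (\<integral>\<^sup>+x. ennreal ((cmod (g x))\<^sup>2) \<partial>M)"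
    using Cauchy_Schwarz_nn_integral[of "\<lambda>x. ennreal (cmod (f x))" M "\<lambda>x. ennreal (cmod (g x))"]
    by (simp add: e ennreal_power)
  also have "\<dots> = ennreal ((norm2 M f * norm2 M g)\<^sup>2)"
    using assms by (simp add: nn_integral_square_int ennreal_mult power_mult_distrib)
  finally have "?I\<^sup>2 \<le> (norm2 M f * norm2 M g)\<^sup>2" by simp
  then show ?thesis by (rule power2_le_imp_le) simp
qed

lemma norm_inner2_le:
  assumes "square_int M f" "square_int M g"
  shows "cmod (inner2 M f g) \<le> norm2 M f * norm2 M g"
proof -
  have "cmod (inner2 M f g) \<le> (\<integral>x. cmod (f x * cnj (g x)) \<partial>M)"
    unfolding inner2_def by (rule integral_norm_bound)
  also have "\<dots> \<le> norm2 M f * norm2 M g"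
    using integral_mult_le_norm2[OF assms] by (simp add: norm_mult)
  finally show ?thesis .
qed

lemma inner2_self: "inner2 M f f = complex_of_real ((norm2 M f)\<^sup>2)"
proof -
  have "inner2 M f f = (\<integral>x. complex_of_real ((cmod (f x))\<^sup>2) \<partial>M)"
    unfolding inner2_def by (simp add: complex_norm_square[symmetric])
  also have "\<dots> = complex_of_real (\<integral>x. (cmod (f x))\<^sup>2 \<partial>M)"
    by (rule integral_complex_of_real)
  finally show ?thesis by (simp only: norm2_power2)
qed

lemma inner2_commute: "inner2 M g f = cnj (inner2 M f g)"
proof -
  have "cnj (inner2 M f g) = (\<integral>x. cnj (f x * cnj (g x)) \<partial>M)"
    unfolding inner2_def by (rule Bochner_Integration.integral_cnj[symmetric])
  also have "\<dots> = inner2 M g f"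
    unfolding inner2_def by (rule Bochner_Integration.integral_cong) (auto simp: mult.commute)
  finally show ?thesis by simp
qed

lemma square_int_add:
  assumes "square_int M f" "square_int M g"
  shows "square_int M (\<lambda>x. f x + g x)" "norm2 M (\<lambda>x. f x + g x) \<le> norm2 M f + norm2 M g"
proof -
  have [measurable]: "f \<in> borel_measurable M" "g \<in> borel_measurable M" using assms by (auto simp: square_int_def)
  note i = square_int_mult_integrable(2)[OF assms]
  have i2: "integrable M (\<lambda>x. (cmod (f x))\<^sup>2)" "integrable M (\<lambda>x. (cmod (g x))\<^sup>2)"
    using assms by (auto simp: square_int_def)
  have b: "(cmod (f x + g x))\<^sup>2 \<le> (cmod (f x))\<^sup>2 + 2 * (cmod (f x) * cmod (g x)) + (cmod (g x))\<^sup>2" for x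
    using power_mono[OF norm_triangle_ineq[of "f x" "g x"], of 2] by (simp add: power2_sum algebra_simps)
  have i3: "integrable M (\<lambda>x. (cmod (f x))\<^sup>2 + 2 * (cmod (f x) * cmod (g x)) + (cmod (g x))\<^sup>2)"
    using i i2 by auto
  show s: "square_int M (\<lambda>x. f x + g x)"
    unfolding square_int_def by (auto intro!: Bochner_Integration.integrable_bound[OF i3] simp: b)
  have "(norm2 M (\<lambda>x. f x + g x))\<^sup>2 \<le> (\<integral>x. (cmod (f x))\<^sup>2 + 2 * (cmod (f x) * cmod (g x)) + (cmod (g x))\<^sup>2 \<partial>M)"
    unfolding norm2_power2 using s i3 b by (intro integral_mono) (auto simp: square_int_def)
  also have "\<dots> = (norm2 M f)\<^sup>2 + 2 * (\<integral>x. cmod (f x) * cmod (g x) \<partial>M) + (norm2 M g)\<^sup>2"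
    using i i2 by (simp add: norm2_power2)
  also have "\<dots> \<le> (norm2 M f + norm2 M g)\<^sup>2"
    using integral_mult_le_norm2[OF assms] by (simp add: power2_sum)
  finally show "norm2 M (\<lambda>x. f x + g x) \<le> norm2 M f + norm2 M g"
    by (rule power2_le_imp_le) simp
qed

lemma square_int_diff:
  assumes "square_int M f" "square_int M g"
  shows "square_int M (\<lambda>x. f x - g x)" "norm2 M (\<lambda>x. f x - g x) \<le> norm2 M f + norm2 M g"
proof -
  have g: "square_int M (\<lambda>x. - g x)" using assms(2) by (simp add: square_int_def)
  show "square_int M (\<lambda>x. f x - g x)" "norm2 M (\<lambda>x. f x - g x) \<le> norm2 M f + norm2 M g"
    using square_int_add[OF assms(1) g] by (simp_all add: norm2_minus)
qed

lemma norm2_triangle: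
  assumes "square_int M f" "square_int M g" "square_int M h"
  shows "norm2 M (\<lambda>x. f x - h x) \<le> norm2 M (\<lambda>x. f x - g x) + norm2 M (\<lambda>x. g x - h x)"
  using square_int_add(2)[OF square_int_diff(1)[OF assms(1,2)] square_int_diff(1)[OF assms(2,3)]] by simp

lemma norm2_diff_abs:
  assumes "square_int M f" "square_int M g"
  shows "\<bar>norm2 M f - norm2 M g\<bar> \<le> norm2 M (\<lambda>x. f x - g x)"
  using square_int_add(2)[OF square_int_diff(1)[OF assms(1,2)] assms(2)] square_int_add(2)[OF square_int_diff(1)[OF assms(2,1)] assms(1)]
  by (simp add: norm2_commute[of M f g])

lemma norm2_eq_0_iff:
  assumes "square_int M f"
  shows "norm2 M f = 0 \<longleftrightarrow> (AE x in M. f x = 0)"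
  using assms unfolding norm2_def square_int_def
  by (subst real_sqrt_eq_0_iff) (subst integral_nonneg_eq_0_iff_AE; auto)

lemma norm2_tendsto_dominated:
  assumes "square_int M w" "\<And>k. f k \<in> borel_measurable M" "g \<in> borel_measurable M"
    and "AE x in M. (\<lambda>k. f k x) \<longlonglongrightarrow> g x"
    and "\<And>k. AE x in M. cmod (f k x) \<le> cmod (w x)"
  shows "(\<lambda>k. norm2 M (\<lambda>x. f k x - g x)) \<longlonglongrightarrow> 0"
proof -
  have [measurable]: "w \<in> borel_measurable M" "\<And>k. f k \<in> borel_measurable M" "g \<in> borel_measurable M"
    using assms by (auto simp: square_int_def)
  have g: "AE x in M. cmod (g x) \<le> cmod (w x)"
  proof -
    have "AE x in M. \<forall>k. cmod (f k x) \<le> cmod (w x)"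
      using assms(5) by (simp add: AE_all_countable)
    with assms(4) show ?thesis
    proof eventually_elim
      case (elim x)
      from elim(1) have "(\<lambda>k. cmod (f k x)) \<longlonglongrightarrow> cmod (g x)" by (rule tendsto_norm)
      then show ?case using elim(2) by (intro LIMSEQ_le_const2) auto
    qed
  qed
  have "(\<lambda>k. \<integral>x. (cmod (f k x - g x))\<^sup>2 \<partial>M) \<longlonglongrightarrow> (\<integral>x. 0 \<partial>M)"
  proof (rule integral_dominated_convergence)
    \<comment> \<open>The limit inherits the bound by \<open>w\<close>, so the difference is at most
      twice \<open>w\<close> and its square at most four times.\<close>
    show "integrable M (\<lambda>x. 4 * (cmod (w x))\<^sup>2)" using assms(1) by (simp add: square_int_def)
    show "AE x in M. (\<lambda>k. (cmod (f k x - g x))\<^sup>2) \<longlonglongrightarrow> 0"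
      using assms(4)
    proof eventually_elim
      case (elim x)
      have "(\<lambda>k. f k x - g x) \<longlonglongrightarrow> 0" using elim by (simp add: LIM_zero_iff)
      then show ?case using tendsto_power[OF tendsto_norm_zero, of _ _ 2] by fastforce
    qed
    fix k
    show "AE x in M. norm ((cmod (f k x - g x))\<^sup>2) \<le> 4 * (cmod (w x))\<^sup>2"
      using assms(5)[of k] g
    proof eventually_elim
      case (elim x)
      have "cmod (f k x - g x) \<le> 2 * cmod (w x)"
        using norm_triangle_ineq4[of "f k x" "g x"] elim by simp
      from power_mono[OF this, of 2] show ?case by (simp add: power_mult_distrib)
    qed
  qed auto
  then have "(\<lambda>k. sqrt (\<integral>x. (cmod (f k x - g x))\<^sup>2 \<partial>M)) \<longlonglongrightarrow> sqrt 0"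
    by (intro tendsto_real_sqrt) simp
  then show ?thesis by (simp add: norm2_def)
qed

lemma inner2_diff_left:
  assumes "square_int M f" "square_int M g" "square_int M h"
  shows "inner2 M (\<lambda>x. f x - g x) h = inner2 M f h - inner2 M g h"
  unfolding inner2_def using assms
  by (simp add: left_diff_distrib Bochner_Integration.integral_diff square_int_mult_integrable)

lemma inner2_tendsto:
  assumes "\<And>k. square_int M (f k)" "square_int M g" "square_int M h" "(\<lambda>k. norm2 M (\<lambda>x. f k x - g x)) \<longlonglongrightarrow> 0"
  shows "(\<lambda>k. inner2 M (f k) h) \<longlonglongrightarrow> inner2 M g h"
proof (rule LIM_zero_cancel, rule Lim_null_comparison)
  show "\<forall>\<^sub>F k in sequentially. norm (inner2 M (f k) h - inner2 M g h) \<le> norm2 M (\<lambda>x. f k x - g x) * norm2 M h"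
    using norm_inner2_le[OF square_int_diff(1)[OF assms(1,2)] assms(3)]
    by (simp add: inner2_diff_left assms)
  show "(\<lambda>k. norm2 M (\<lambda>x. f k x - g x) * norm2 M h) \<longlonglongrightarrow> 0"
    using assms(4) by (rule tendsto_mult_left_zero)
qed

lemma norm2_tendsto:
  assumes "\<And>k. square_int M (f k)" "square_int M g" "(\<lambda>k. norm2 M (\<lambda>x. f k x - g x)) \<longlonglongrightarrow> 0"
  shows "(\<lambda>k. norm2 M (f k)) \<longlonglongrightarrow> norm2 M g"
proof (rule LIM_zero_cancel, rule Lim_null_comparison[OF _ assms(3)])
  show "\<forall>\<^sub>F k in sequentially. norm (norm2 M (f k) - norm2 M g) \<le> norm2 M (\<lambda>x. f k x - g x)"
    using norm2_diff_abs[OF assms(1,2)] by simp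
qed

lemma norm2_limit_AE_unique:
  assumes "\<And>k. square_int M (f k)" "square_int M g" "square_int M h"
    "(\<lambda>k. norm2 M (\<lambda>x. f k x - g x)) \<longlonglongrightarrow> 0" "(\<lambda>k. norm2 M (\<lambda>x. f k x - h x)) \<longlonglongrightarrow> 0"
  shows "AE x in M. g x = h x"
proof -
  have "norm2 M (\<lambda>x. g x - h x) \<le> 0"
  proof (rule LIMSEQ_le_const)
    show "(\<lambda>k. norm2 M (\<lambda>x. f k x - g x) + norm2 M (\<lambda>x. f k x - h x)) \<longlonglongrightarrow> 0"
      using tendsto_add[OF assms(4,5)] by simp
    show "\<exists>N. \<forall>k\<ge>N. norm2 M (\<lambda>x. g x - h x) \<le> norm2 M (\<lambda>x. f k x - g x) + norm2 M (\<lambda>x. f k x - h x)"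
      using norm2_triangle[OF assms(2,1,3)] by (simp add: norm2_commute[of M g])
  qed
  then have "norm2 M (\<lambda>x. g x - h x) = 0" using norm2_nonneg[of M "\<lambda>x. g x - h x"] by linarith
  then show ?thesis using norm2_eq_0_iff[OF square_int_diff(1)[OF assms(2,3)]] by simp
qed

section \<open>Completeness of L2, with measurable dependence on a parameter\<close>

lemma ennreal_le_suminf: "f k \<le> (\<Sum>n. f n :: ennreal)"
  using sum_le_suminf[OF summableI, of "{k}" f] by simp

text \<open>The limit is prescribed by a formula, with value 0 where there is no convergence,
  instead of being asserted to exist: the formula is what makes a family of such limits jointly
  measurable.\<close>

lemma fast_Cauchy_limit:
  assumes sq: "\<And>k. square_int M (h k)"
    and fast: "\<And>k l. k \<le> l \<Longrightarrow> norm2 M (\<lambda>x. h l x - h k x) \<le> (1/2)^k"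
    and lim: "\<And>x. x \<in> space M \<Longrightarrow> g x = (if convergent (\<lambda>k. h k x) then lim (\<lambda>k. h k x) else 0)"
  shows "square_int M g" "\<And>k. norm2 M (\<lambda>x. h k x - g x) \<le> (1/2)^k"
    "AE x in M. (\<lambda>k. h k x) \<longlonglongrightarrow> g x"
proof -
  have [measurable]: "\<And>k. h k \<in> borel_measurable M" using sq by (simp add: square_int_def)
  have [measurable]: "g \<in> borel_measurable M"
  proof -
    have "(\<lambda>x. if convergent (\<lambda>k. h k x) then lim (\<lambda>k. h k x) else 0) \<in> borel_measurable M"
      unfolding convergent_eq_Cauchy Cauchy_convergent_iff[symmetric] by measurable
    then show ?thesis using lim by (subst measurable_cong) auto
  qed
  define d where "d k x = h (Suc k) x - h k x" for k x
  have dm [measurable]: "d k \<in> borel_measurable M" for k by (auto simp: d_def[abs_def])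
  have ds: "square_int M (d k)" for k unfolding d_def using sq by (intro square_int_diff)
  have dn: "(norm2 M (d k))\<^sup>2 \<le> (1/4)^k" for k
  proof -
    have "(norm2 M (d k))\<^sup>2 \<le> ((1/2)^k)\<^sup>2"
      using fast[of k "Suc k"] by (intro power_mono) (auto simp: d_def[abs_def])
    also have "\<dots> = (1/4)^k" by (simp add: power2_eq_square flip: power_mult_distrib)
    finally show ?thesis .
  qed
  \<comment> \<open>The weight 2^k is affordable because the increments have squared norm at most
    4^(-k). Finiteness of the sum at \<open>x\<close> then forces \<open>cmod (d k x)\<close> below
    a constant times 2^(-k/2), which is summable.\<close>
  have "(\<integral>\<^sup>+x. (\<Sum>k. ennreal (2^k * (cmod (d k x))\<^sup>2)) \<partial>M) = (\<Sum>k. \<integral>\<^sup>+x. ennreal (2^k * (cmod (d k x))\<^sup>2) \<partial>M)"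
    by (rule nn_integral_suminf) auto
  also have "\<dots> \<le> (\<Sum>k. ennreal ((1/2)^k))"
  proof (intro suminf_le)
    fix k
    have "(\<integral>\<^sup>+x. ennreal (2^k * (cmod (d k x))\<^sup>2) \<partial>M) = ennreal (2^k) * (\<integral>\<^sup>+x. ennreal ((cmod (d k x))\<^sup>2) \<partial>M)"
      by (simp add: ennreal_mult nn_integral_cmult)
    also have "\<dots> = ennreal (2^k * (norm2 M (d k))\<^sup>2)"
      by (simp add: nn_integral_square_int[OF ds] ennreal_mult)
    also have "\<dots> \<le> ennreal (2^k * (1/4)^k)"
      using dn by (intro ennreal_leI mult_left_mono) auto
    also have "(2::real)^k * (1/4)^k = (1/2)^k" by (simp add: power_mult_distrib[symmetric])
    finally show "(\<integral>\<^sup>+x. ennreal (2^k * (cmod (d k x))\<^sup>2) \<partial>M) \<le> ennreal ((1/2)^k)" .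
  qed auto
  also have "\<dots> = ennreal (\<Sum>k. (1/2)^k)"
    by (rule suminf_ennreal2) (auto intro: summable_geometric)
  also have "\<dots> < \<infinity>" by simp
  finally have "AE x in M. (\<Sum>k. ennreal (2^k * (cmod (d k x))\<^sup>2)) \<noteq> \<infinity>"
    by (intro nn_integral_PInf_AE) auto
  then have conv: "AE x in M. convergent (\<lambda>k. h k x)"
  proof eventually_elim
    case (elim x)
    define C where "C = enn2real (\<Sum>k. ennreal (2^k * (cmod (d k x))\<^sup>2))"
    have b: "2^k * (cmod (d k x))\<^sup>2 \<le> C" for k
    proof -
      have "ennreal (2^k * (cmod (d k x))\<^sup>2) \<le> (\<Sum>k. ennreal (2^k * (cmod (d k x))\<^sup>2))"
        by (rule ennreal_le_suminf)
      also have "\<dots> = ennreal C" unfolding C_def using elim by (intro ennreal_enn2real[symmetric]) (simp only: less_top infinity_ennreal_def)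
      finally show ?thesis
        by (subst (asm) ennreal_le_iff) (simp_all only: C_def enn2real_nonneg)
    qed
    have C0: "0 \<le> C" by (simp add: C_def)
    have "cmod (d k x) \<le> sqrt C * (1 / sqrt 2)^k" for k
    proof -
      have "(cmod (d k x))\<^sup>2 \<le> C / 2^k" using b[of k] by (simp add: field_simps)
      also have "\<dots> = (sqrt C * (1 / sqrt 2)^k)\<^sup>2"
        using C0 by (simp add: power_mult_distrib power_divide power_mult[symmetric] mult.commute[of k 2])
          (simp add: power_mult)
      finally show ?thesis by (rule power2_le_imp_le) (simp add: C0)
    qed
    note db = this
    have "summable (\<lambda>k. sqrt C * (1 / sqrt 2)^k)"
      by (intro summable_mult summable_geometric) auto
    then have "summable (\<lambda>k. d k x)"
      by (rule summable_comparison_test'[where N=0]) (rule db)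
    then have "convergent (\<lambda>n. h 0 x + (\<Sum>k<n. d k x))"
      by (intro convergent_add convergent_const) (simp add: summable_iff_convergent)
    also have "(\<lambda>n. h 0 x + (\<Sum>k<n. d k x)) = (\<lambda>n. h n x)"
      unfolding d_def by (subst sum_lessThan_telescope) simp
    finally show ?case .
  qed
  show lim': "AE x in M. (\<lambda>k. h k x) \<longlonglongrightarrow> g x"
    using conv AE_space by eventually_elim (simp add: lim convergent_LIMSEQ_iff)
  \<comment> \<open>The rate for the limit comes from Fatou's lemma, letting the second index tend
    to infinity in the Cauchy bound.\<close>
  have *: "(\<integral>\<^sup>+x. ennreal ((cmod (h k x - g x))\<^sup>2) \<partial>M) \<le> ennreal (((1/2)^k)\<^sup>2)" for k
  proof -
    have "(\<integral>\<^sup>+x. ennreal ((cmod (h k x - g x))\<^sup>2) \<partial>M) = (\<integral>\<^sup>+x. liminf (\<lambda>l. ennreal ((cmod (h k x - h l x))\<^sup>2)) \<partial>M)"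
      using lim'
    proof (intro nn_integral_cong_AE, eventually_elim)
      case (elim x)
      have "(\<lambda>l. ennreal ((cmod (h k x - h l x))\<^sup>2)) \<longlonglongrightarrow> ennreal ((cmod (h k x - g x))\<^sup>2)"
        by (intro tendsto_ennrealI tendsto_power tendsto_norm tendsto_diff tendsto_const elim)
      then show ?case by (intro lim_imp_Liminf[symmetric]) auto
    qed
    also have "\<dots> \<le> liminf (\<lambda>l. \<integral>\<^sup>+x. ennreal ((cmod (h k x - h l x))\<^sup>2) \<partial>M)"
      by (rule nn_integral_liminf) auto
    also have "\<dots> \<le> ennreal (((1/2)^k)\<^sup>2)"
    proof (rule Liminf_le)
      show "\<forall>\<^sub>F l in sequentially. (\<integral>\<^sup>+x. ennreal ((cmod (h k x - h l x))\<^sup>2) \<partial>M) \<le> ennreal (((1/2)^k)\<^sup>2)"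
        using eventually_ge_at_top[of k]
      proof eventually_elim
        case (elim l)
        have "(\<integral>\<^sup>+x. ennreal ((cmod (h k x - h l x))\<^sup>2) \<partial>M) = ennreal ((norm2 M (\<lambda>x. h k x - h l x))\<^sup>2)"
          by (intro nn_integral_square_int square_int_diff sq)
        also have "\<dots> \<le> ennreal (((1/2)^k)\<^sup>2)"
          using fast[OF elim] by (intro ennreal_leI power_mono) (auto simp: norm2_commute[of M "h k"])
        finally show ?case .
      qed
    qed simp
    finally show ?thesis .
  qed
  have s: "square_int M (\<lambda>x. h k x - g x)" and n: "norm2 M (\<lambda>x. h k x - g x) \<le> (1/2)^k" for k
    using square_int_boundI[OF _ *[of k]] by auto
  show "norm2 M (\<lambda>x. h k x - g x) \<le> (1/2)^k" for k by (rule n)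
  show "square_int M g" using square_int_diff(1)[OF sq[of 0] s[of 0]] by simp
qed

text \<open>
  The index along which the sequence is fast Cauchy depends measurably on the parameter \<open>t\<close>,
  so the limits for the different values of \<open>t\<close> can be chosen jointly measurable.
\<close>

lemma L2_limit_parametric:
  fixes h :: "nat \<Rightarrow> 'a \<times> 'b \<Rightarrow> complex"
  assumes "sigma_finite_measure M"
    and meas [measurable]: "\<And>k. h k \<in> borel_measurable (M \<Otimes>\<^sub>M N)"
    and sq: "\<And>k t. t \<in> space N \<Longrightarrow> square_int M (\<lambda>x. h k (x, t))"
    and cauchy: "\<And>t e. t \<in> space N \<Longrightarrow> 0 < e \<Longrightarrow> \<exists>K. \<forall>k\<ge>K. \<forall>l\<ge>K. norm2 M (\<lambda>x. h k (x, t) - h l (x, t)) \<le> e"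
  shows "\<exists>g \<in> borel_measurable (M \<Otimes>\<^sub>M N). \<forall>t\<in>space N. square_int M (\<lambda>x. g (x, t)) \<and>
    (\<lambda>k. norm2 M (\<lambda>x. h k (x, t) - g (x, t))) \<longlonglongrightarrow> 0"
proof -
  interpret sigma_finite_measure M by fact
  define P where "P j K t \<longleftrightarrow> (\<forall>k\<ge>K. \<forall>l\<ge>K. norm2 M (\<lambda>x. h k (x, t) - h l (x, t)) \<le> (1/2)^j)" for j K t
  have nm [measurable]: "(\<lambda>t. norm2 M (\<lambda>x. h k (x, t) - h l (x, t))) \<in> borel_measurable N" for k l
    unfolding norm2_def by measurable
  have [measurable]: "Measurable.pred N (P j K)" for j K
    unfolding P_def[abs_def] by measurable
  define K where "K j t = (LEAST K. P j K t)" for j t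
  have Km [measurable]: "K j \<in> measurable N (count_space UNIV)" for j
    unfolding K_def[abs_def] by measurable
  have PK: "P j (K j t) t" if "t \<in> space N" for j t
    unfolding K_def
  proof (rule LeastI_ex)
    show "\<exists>K. P j K t" unfolding P_def by (rule cauchy[OF that]) simp
  qed
  have P_mono: "P i k t" if "P j k t" "i \<le> j" for i j k t
  proof -
    have "(1/2::real)^j \<le> (1/2)^i" using that(2) by (intro power_decreasing) auto
    then show ?thesis using that(1) unfolding P_def by (meson order_trans)
  qed
  \<comment> \<open>Monotone indices ensure that \<open>H l\<close> with \<open>k \<le> l\<close>
    uses an index in the range controlled by \<open>P k\<close>, so the diagonal sequence is fast
    Cauchy for every \<open>t\<close>.\<close>
  have K_mono: "K i t \<le> K j t" if "t \<in> space N" "i \<le> j" for i j t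
    unfolding K_def[of i] by (intro Least_le P_mono[OF PK[OF that(1)] that(2)])
  define H where "H j p = h (K j (snd p)) p" for j p
  have Hm [measurable]: "H j \<in> borel_measurable (M \<Otimes>\<^sub>M N)" for j
    unfolding H_def[abs_def] by (rule measurable_compose_countable[where f="\<lambda>i p. h i p"]) measurable
  define g where "g p = (if convergent (\<lambda>j. H j p) then lim (\<lambda>j. H j p) else 0)" for p
  have gm: "g \<in> borel_measurable (M \<Otimes>\<^sub>M N)"
    unfolding g_def[abs_def] convergent_eq_Cauchy Cauchy_convergent_iff[symmetric] by measurable
  show ?thesis
  proof (intro bexI[OF _ gm] ballI conjI)
    fix t assume t: "t \<in> space N"
    have s: "square_int M (\<lambda>x. H j (x, t))" for j unfolding H_def using sq[OF t] by simp
    have f: "norm2 M (\<lambda>x. H l (x, t) - H k (x, t)) \<le> (1/2)^k" if "k \<le> l" for k l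
      using PK[OF t, of k] K_mono[OF t that] unfolding H_def P_def by simp
    note L = fast_Cauchy_limit[of M "\<lambda>j x. H j (x, t)", OF s f, of "\<lambda>x. g (x, t)"]
    show "square_int M (\<lambda>x. g (x, t))" by (rule L) (auto simp: g_def)
    have n: "norm2 M (\<lambda>x. H j (x, t) - g (x, t)) \<le> (1/2)^j" for j by (rule L) (auto simp: g_def)
    show "(\<lambda>k. norm2 M (\<lambda>x. h k (x, t) - g (x, t))) \<longlonglongrightarrow> 0"
    proof (rule LIMSEQ_I)
      fix e :: real assume "0 < e"
      then obtain j where j: "(1/2::real)^j < e/2" using real_arch_pow_inv[of "e/2" "1/2"] by auto
      show "\<exists>K. \<forall>k\<ge>K. norm (norm2 M (\<lambda>x. h k (x, t) - g (x, t)) - 0) < e"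
      proof (intro exI[of _ "K j t"] allI impI)
        fix k assume k: "K j t \<le> k"
        have "norm2 M (\<lambda>x. h k (x, t) - g (x, t)) \<le> norm2 M (\<lambda>x. h k (x, t) - H j (x, t)) + norm2 M (\<lambda>x. H j (x, t) - g (x, t))"
          by (intro norm2_triangle sq t s L) (auto simp: g_def)
        also have "norm2 M (\<lambda>x. h k (x, t) - H j (x, t)) \<le> (1/2)^j"
          using PK[OF t, of j] k unfolding H_def P_def by simp
        finally show "norm (norm2 M (\<lambda>x. h k (x, t) - g (x, t)) - 0) < e"
          using n[of j] j by simp
      qed
    qed
  qed
qed

text \<open>Ordinary completeness is the parametric statement over a one-point parameter
  space.\<close>

lemma L2_complete:
  assumes "\<And>k. square_int M (h k)" "\<And>e. 0 < e \<Longrightarrow> \<exists>K. \<forall>k\<ge>K. \<forall>l\<ge>K. norm2 M (\<lambda>x. h k x - h l x) \<le> e"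
    "sigma_finite_measure M"
  shows "\<exists>g. square_int M g \<and> (\<lambda>k. norm2 M (\<lambda>x. h k x - g x)) \<longlonglongrightarrow> 0"
proof -
  have [measurable]: "\<And>k. h k \<in> borel_measurable M" using assms(1) by (simp add: square_int_def)
  have "(\<lambda>p. h k (fst p)) \<in> borel_measurable (M \<Otimes>\<^sub>M count_space {()})" for k by measurable
  from L2_limit_parametric[OF assms(3), of "\<lambda>k p. h k (fst p)" "count_space {()}", OF this] assms(1,2)
  show ?thesis by auto
qed

section \<open>The Fourier integral of integrable functions\<close>

definition ft_const :: "'a::euclidean_space itself \<Rightarrow> real" where
  "ft_const _ = (2 * pi) powr (DIM('a) / 2)"

lemma ft_const_pos [simp]: "0 < ft_const TYPE('a::euclidean_space)"
  by (simp add: ft_const_def)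

lemma ft_const_nonzero [simp]: "ft_const TYPE('a::euclidean_space) \<noteq> 0"
  using less_imp_neq[OF ft_const_pos[where 'a='a]] by simp

text \<open>The integral of \<open>fourier_L1\<close> with \<open>lborel\<close> in place of its
  completion: products of \<open>lborel\<close> with itself are again of this kind, so parametrised
  transforms stay measurable and Fubini applies.\<close>

definition ft :: "('a::euclidean_space \<Rightarrow> complex) \<Rightarrow> 'a \<Rightarrow> complex" where
  "ft f \<xi> = (\<integral>x. cis (- (x \<bullet> \<xi>)) * f x \<partial>lborel) / complex_of_real (ft_const TYPE('a))"

lemma borel_measurable_cis [measurable]: "cis \<in> borel_measurable borel"
  by (intro borel_measurable_continuous_onI continuous_intros)

lemma norm_cis_mult [simp]: "cmod (cis a * z) = cmod z"
  by (simp add: norm_mult)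

lemma ft_integrand_integrable:
  assumes "integrable lborel f"
  shows "integrable lborel (\<lambda>x. cis (- (x \<bullet> \<xi>)) * f x)"
  by (rule Bochner_Integration.integrable_bound[OF assms]) (use assms in auto)

lemma ft_measurable [measurable]:
  assumes [measurable]: "f \<in> borel_measurable lborel"
  shows "ft f \<in> borel_measurable lborel"
  unfolding ft_def[abs_def] by measurable

lemma norm_ft_le:
  fixes f :: "'a::euclidean_space \<Rightarrow> complex"
  shows "cmod (ft f \<xi>) \<le> (\<integral>x. cmod (f x) \<partial>lborel) / ft_const TYPE('a)"
proof -
  have "cmod (\<integral>x. cis (- (x \<bullet> \<xi>)) * f x \<partial>lborel) \<le> (\<integral>x. cmod (cis (- (x \<bullet> \<xi>)) * f x) \<partial>lborel)"
    by (rule integral_norm_bound)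
  then show ?thesis
    by (simp add: ft_def norm_divide less_imp_le[OF ft_const_pos] divide_right_mono abs_of_pos)
qed

lemma ft_diff:
  assumes "integrable lborel f" "integrable lborel g"
  shows "ft (\<lambda>x. f x - g x) \<xi> = ft f \<xi> - ft g \<xi>"
  unfolding ft_def
  using Bochner_Integration.integral_diff[OF ft_integrand_integrable[OF assms(1), of \<xi>] ft_integrand_integrable[OF assms(2), of \<xi>]]
  by (simp add: right_diff_distrib diff_divide_distrib)

lemma ft_cmult: "ft (\<lambda>x. c * f x) \<xi> = c * ft f \<xi>"
  unfolding ft_def by (simp add: mult.left_commute[of _ c])

lemma ft_add:
  assumes "integrable lborel f" "integrable lborel g"
  shows "ft (\<lambda>x. f x + g x) \<xi> = ft f \<xi> + ft g \<xi>"
  using ft_diff[OF assms(1), of "\<lambda>x. - 1 * g x" \<xi>] ft_cmult[of "-1" g \<xi>] assms(2) by simp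

text \<open>The kernel is symmetric in \<open>x\<close> and \<open>\<xi>\<close>, so this is Fubini
  for a bounded kernel and integrable factors.\<close>

lemma ft_multiplication_formula:
  fixes f g :: "'a::euclidean_space \<Rightarrow> complex"
  assumes f: "integrable lborel f" and g: "integrable lborel g"
  shows "(\<integral>x. ft f x * g x \<partial>lborel) = (\<integral>x. f x * ft g x \<partial>lborel)"
proof -
  have [measurable]: "f \<in> borel_measurable borel" "g \<in> borel_measurable borel" using f g by auto
  have i0: "integrable lborel2 (\<lambda>(x, y). f x * g y)"
    by (rule lborel_pair.Fubini_integrable) (use f g in \<open>auto simp: norm_mult\<close>)
  have i: "integrable lborel2 (\<lambda>(x, y). cis (- (x \<bullet> y)) * f x * g y)"
    by (rule Bochner_Integration.integrable_bound[OF i0]) (auto simp: norm_mult)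
  have "(\<integral>y. (\<integral>x. cis (- (x \<bullet> y)) * f x * g y \<partial>lborel) \<partial>lborel)
      = (\<integral>x. (\<integral>y. cis (- (x \<bullet> y)) * f x * g y \<partial>lborel) \<partial>lborel)"
    by (rule lborel_pair.Fubini_integral[OF i])
  also have "(\<lambda>y. \<integral>x. cis (- (x \<bullet> y)) * f x * g y \<partial>lborel) = (\<lambda>y. ft_const TYPE('a) * (ft f y * g y))"
    by (simp add: ft_def)
  also have "(\<lambda>x. \<integral>y. cis (- (x \<bullet> y)) * f x * g y \<partial>lborel) = (\<lambda>x. ft_const TYPE('a) * (f x * ft g x))"
  proof
    fix x
    have "(\<integral>y. cis (- (x \<bullet> y)) * f x * g y \<partial>lborel) = (\<integral>y. f x * (cis (- (y \<bullet> x)) * g y) \<partial>lborel)"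
      by (intro Bochner_Integration.integral_cong refl) (simp add: inner_commute)
    also have "\<dots> = ft_const TYPE('a) * (f x * ft g x)" by (simp add: ft_def)
    finally show "(\<integral>y. cis (- (x \<bullet> y)) * f x * g y \<partial>lborel) = ft_const TYPE('a) * (f x * ft g x)" .
  qed
  finally show ?thesis by simp
qed

section \<open>Gaussians\<close>

text \<open>A rescaling of the characteristic function of the standard normal distribution.\<close>

lemma gaussian_1d:
  fixes y e :: real
  assumes e: "0 < e"
  shows "integrable lborel (\<lambda>s. cis (y * s) * exp (- e * s\<^sup>2))"
    "(\<integral>s. cis (y * s) * exp (- e * s\<^sup>2) \<partial>lborel) = sqrt (pi / e) * exp (- (y\<^sup>2) / (4 * e))"
proof -
  \<comment> \<open>Chosen so that the normal exponent (c s)^2 / 2 becomes e s^2.\<close>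
  define c where "c = sqrt (2 * e)"
  have c: "0 < c" "c\<^sup>2 = 2 * e" using e by (auto simp: c_def)
  have "has_bochner_integral lborel (\<lambda>x. cis (y / c * x) * std_normal_density x) (exp (- ((y / c)\<^sup>2) / 2))"
  proof -
    have int: "integrable lborel (\<lambda>x. std_normal_density x)" by simp
    have "integrable lborel (\<lambda>x. cis (y / c * x) * std_normal_density x)"
      by (rule Bochner_Integration.integrable_bound[OF int]) (auto simp: norm_mult)
    moreover have "(\<integral>x. cis (y / c * x) * std_normal_density x \<partial>lborel) = char std_normal_distribution (y / c)"
      unfolding char_def
      by (subst integral_density) (auto simp: cis_conv_exp scaleR_conv_of_real mult_ac)
    ultimately show ?thesis
      by (simp add: char_std_normal_distribution has_bochner_integral_iff)
  qed
  then have "has_bochner_integral lborel (\<lambda>s. cis (y / c * (0 + c * s)) * std_normal_density (0 + c * s)) (complex_of_real (exp (- ((y / c)\<^sup>2) / 2)) /\<^sub>R \<bar>c\<bar>)"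
    using c by (subst (asm) lborel_has_bochner_integral_real_affine_iff[of c _ _ 0]) (simp_all only:)
  then have "has_bochner_integral lborel (\<lambda>s. complex_of_real (sqrt (2 * pi)) * (cis (y / c * (0 + c * s)) * std_normal_density (0 + c * s)))
      (complex_of_real (sqrt (2 * pi)) * (complex_of_real (exp (- ((y / c)\<^sup>2) / 2)) /\<^sub>R \<bar>c\<bar>))"
    by (rule has_bochner_integral_mult_right)
  also have "(\<lambda>s. complex_of_real (sqrt (2 * pi)) * (cis (y / c * (0 + c * s)) * std_normal_density (0 + c * s)))
      = (\<lambda>s. cis (y * s) * exp (- e * s\<^sup>2))"
    using c by (auto simp: fun_eq_iff std_normal_density_def power_mult_distrib)
  also have "complex_of_real (sqrt (2 * pi)) * (complex_of_real (exp (- ((y / c)\<^sup>2) / 2)) /\<^sub>R \<bar>c\<bar>)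
      = complex_of_real (sqrt (2 * pi) / c * exp (- ((y / c)\<^sup>2) / 2))"
    using c by (simp add: scaleR_conv_of_real divide_simps)
  also have "sqrt (2 * pi) / c = sqrt (pi / e)"
    by (simp add: c_def real_sqrt_divide[symmetric])
  also have "(y / c)\<^sup>2 = y\<^sup>2 / (2 * e)" using c by (simp add: power_divide)
  finally have "has_bochner_integral lborel (\<lambda>s. cis (y * s) * exp (- e * s\<^sup>2)) (sqrt (pi / e) * exp (- (y\<^sup>2) / (4 * e)))"
    by simp
  then show "integrable lborel (\<lambda>s. cis (y * s) * exp (- e * s\<^sup>2))"
    "(\<integral>s. cis (y * s) * exp (- e * s\<^sup>2) \<partial>lborel) = sqrt (pi / e) * exp (- (y\<^sup>2) / (4 * e))"
    by (auto simp: has_bochner_integral_iff)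
qed

text \<open>\<open>lborel\<close> is the image of the product measure over the basis coordinates,
  and phase and Gaussian both factor, so the value is a product of one-dimensional
  integrals.\<close>

lemma gaussian_integral:
  fixes y :: "'a::euclidean_space"
  assumes e: "0 < e"
  shows "(\<integral>x. cis (x \<bullet> y) * exp (- e * (norm x)\<^sup>2) \<partial>lborel)
    = complex_of_real ((pi / e) powr (DIM('a) / 2) * exp (- ((norm y)\<^sup>2) / (4 * e)))"
proof -
  interpret product_sigma_finite "\<lambda>_::'a. lborel :: real measure" by standard
  let ?x = "\<lambda>f::'a \<Rightarrow> real. \<Sum>b\<in>Basis. f b *\<^sub>R b"
  have x_inner: "?x f \<bullet> z = (\<Sum>b\<in>Basis. f b * (z \<bullet> b))" for f z
    unfolding inner_sum_left inner_scaleR_left by (simp add: inner_commute)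
  have x_b: "?x f \<bullet> b = f b" if "b \<in> Basis" for f b
    using that by (simp add: inner_sum_left inner_Basis if_distrib sum.delta' cong: if_cong)
  have x_norm: "(norm (?x f))\<^sup>2 = (\<Sum>b\<in>Basis. (f b)\<^sup>2)" for f
    unfolding power2_norm_eq_inner euclidean_inner[of "?x f" "?x f"] by (simp add: x_b power2_eq_square)
  have y_norm: "(norm y)\<^sup>2 = (\<Sum>b\<in>Basis. (y \<bullet> b)\<^sup>2)"
    unfolding power2_norm_eq_inner euclidean_inner[of y y] by (simp add: power2_eq_square)
  have cis_sum: "cis (\<Sum>b\<in>B. g b) = (\<Prod>b\<in>B. cis (g b))" for B :: "'a set" and g
    by (induction B rule: infinite_finite_induct) (auto simp: cis_mult[symmetric])
  have "(\<integral>x. cis (x \<bullet> y) * exp (- e * (norm x)\<^sup>2) \<partial>lborel)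
     = (\<integral>f. cis (?x f \<bullet> y) * exp (- e * (norm (?x f))\<^sup>2) \<partial>(\<Pi>\<^sub>M b\<in>Basis. lborel))"
    by (subst lborel_eq, subst integral_distr) auto
  also have "\<dots> = (\<integral>f. (\<Prod>b\<in>Basis. cis ((y \<bullet> b) * f b) * exp (- e * (f b)\<^sup>2)) \<partial>(\<Pi>\<^sub>M b\<in>Basis. lborel))"
    by (intro Bochner_Integration.integral_cong refl)
       (simp add: x_inner x_norm cis_sum prod.distrib exp_sum[symmetric] sum_distrib_left mult.commute
         sum_negf[symmetric] flip: of_real_prod)
  also have "\<dots> = (\<Prod>b\<in>Basis. sqrt (pi / e) * exp (- ((y \<bullet> b)\<^sup>2) / (4 * e)))"
    by (subst product_integral_prod, simp, rule gaussian_1d(1)[OF e])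
       (simp only: gaussian_1d(2)[OF e] of_real_mult of_real_prod)
  also have "\<dots> = complex_of_real (sqrt (pi / e) ^ DIM('a) * exp (- ((norm y)\<^sup>2) / (4 * e)))"
    by (simp add: prod.distrib y_norm exp_sum[symmetric] sum_negf[symmetric] sum_divide_distrib flip: of_real_prod)
  also have "sqrt (pi / e) ^ DIM('a) = (pi / e) powr (DIM('a) / 2)"
    using e by (simp add: powr_half_sqrt[symmetric] powr_powr powr_realpow[symmetric])
  finally show ?thesis .
qed

lemma gaussian_integrable:
  assumes e: "0 < e"
  shows "integrable lborel (\<lambda>x::'a::euclidean_space. exp (- e * (norm x)\<^sup>2))"
    "(\<integral>x. exp (- e * (norm (x::'a))\<^sup>2) \<partial>lborel) = (pi / e) powr (DIM('a) / 2)"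
proof -
  have *: "(\<integral>x. complex_of_real (exp (- e * (norm (x::'a))\<^sup>2)) \<partial>lborel) = complex_of_real ((pi / e) powr (DIM('a) / 2))"
    using gaussian_integral[OF e, of "0::'a"] by simp
  \<comment> \<open>A nonzero Bochner integral certifies integrability, since the integral of a
    non-integrable function is 0.\<close>
  also have "\<dots> \<noteq> 0" using e by simp
  finally have "integrable lborel (\<lambda>x::'a. complex_of_real (exp (- e * (norm x)\<^sup>2)))"
    using not_integrable_integral_eq by blast
  then show "integrable lborel (\<lambda>x::'a. exp (- e * (norm x)\<^sup>2))"
    unfolding complex_of_real_integrable_eq .
  show "(\<integral>x. exp (- e * (norm (x::'a))\<^sup>2) \<partial>lborel) = (pi / e) powr (DIM('a) / 2)"
    using * unfolding integral_complex_of_real of_real_eq_iff .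
qed

text \<open>The heat kernel at time \<open>e\<close>. Up to a constant it is the transform of the
  damping factor exp (- e |\<xi>|^2).\<close>

definition heat :: "real \<Rightarrow> 'a::euclidean_space \<Rightarrow> real" where
  "heat e z = (4 * pi * e) powr (- (DIM('a) / 2)) * exp (- ((norm z)\<^sup>2) / (4 * e))"

lemma heat_nonneg [simp]: "0 \<le> heat e z"
  by (simp add: heat_def)

lemma heat_measurable [measurable]: "heat e \<in> borel_measurable borel"
  unfolding heat_def[abs_def] by measurable

lemma heat_integral:
  assumes e: "0 < e"
  shows "integrable lborel (heat e :: 'a::euclidean_space \<Rightarrow> real)" "(\<integral>z. heat e (z::'a) \<partial>lborel) = 1"
proof -
  have h: "heat e = (\<lambda>z::'a. (4 * pi * e) powr (- (DIM('a) / 2)) * exp (- (1 / (4 * e)) * (norm z)\<^sup>2))"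
    by (simp add: heat_def fun_eq_iff)
  show "integrable lborel (heat e :: 'a \<Rightarrow> real)"
    unfolding h using e by (intro integrable_mult_right gaussian_integrable) auto
  have "(\<integral>z. heat e (z::'a) \<partial>lborel) = (4 * pi * e) powr (- (DIM('a) / 2)) * (pi / (1 / (4 * e))) powr (DIM('a) / 2)"
    unfolding h using e by (subst integral_mult_right_zero, subst gaussian_integrable) auto
  also have "\<dots> = (4 * pi * e) powr (- (DIM('a) / 2)) * (4 * pi * e) powr (DIM('a) / 2)"
    by (simp add: mult.commute mult.left_commute)
  also have "\<dots> = 1" using e by (simp add: powr_add[symmetric])
  finally show "(\<integral>z. heat e (z::'a) \<partial>lborel) = 1" .
qed

lemma heat_nn_integral_shift:
  fixes x :: "'a::euclidean_space"
  assumes e: "0 < e"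
  shows "(\<integral>\<^sup>+y. ennreal (heat e (y - x)) \<partial>lborel) = 1" "(\<integral>\<^sup>+y. ennreal (heat e (x - y)) \<partial>lborel) = 1"
proof -
  have "(\<integral>\<^sup>+y. ennreal (heat e (y - x)) \<partial>lborel) = (\<integral>\<^sup>+y. ennreal (heat e ((- x) + y)) \<partial>lborel)"
    by simp
  also have "\<dots> = (\<integral>\<^sup>+y. ennreal (heat e y) \<partial>(distr lborel borel ((+) (- x))))"
    by (subst nn_integral_distr) auto
  also have "\<dots> = (\<integral>\<^sup>+y. ennreal (heat e y) \<partial>(lborel :: 'a measure))"
    by (simp add: lborel_distr_plus)
  also have "\<dots> = 1"
    using heat_integral[OF e, where 'a='a] by (subst nn_integral_eq_integral) auto
  finally show a: "(\<integral>\<^sup>+y. ennreal (heat e (y - x)) \<partial>lborel) = 1" .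
  have "heat e (x - y) = heat e (y - x)" for y by (simp add: heat_def norm_minus_commute)
  with a show "(\<integral>\<^sup>+y. ennreal (heat e (x - y)) \<partial>lborel) = 1" by simp
qed

text \<open>The damping makes every function involved integrable, so the multiplication formula can
  be used twice: once to move the transform off \<open>ft f\<close>, and once to recognise the
  transform of \<open>g\<close> as the conjugate of the heat convolution of
  \<open>f\<close>.\<close>

lemma ft_damped_norm:
  fixes f :: "'a::euclidean_space \<Rightarrow> complex"
  assumes f: "integrable lborel f" and e: "0 < e"
  shows "complex_of_real (\<integral>\<xi>. (cmod (ft f \<xi>))\<^sup>2 * exp (- e * (norm \<xi>)\<^sup>2) \<partial>lborel)
    = (\<integral>x. f x * cnj (\<integral>y. f y * heat e (x - y) \<partial>lborel) \<partial>lborel)"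
proof -
  have [measurable]: "f \<in> borel_measurable borel" using f by auto
  have ftm [measurable]: "ft f \<in> borel_measurable borel" using ft_measurable[of f] by simp
  define K where "K = (\<integral>x. cmod (f x) \<partial>lborel) / ft_const TYPE('a)"
  have K: "cmod (ft f \<xi>) \<le> K" for \<xi> unfolding K_def by (rule norm_ft_le)
  have gi: "integrable lborel (\<lambda>\<xi>::'a. K * exp (- e * (norm \<xi>)\<^sup>2))"
    by (intro integrable_mult_right gaussian_integrable e)
  define g where "g \<xi> = cnj (ft f \<xi>) * exp (- e * (norm \<xi>)\<^sup>2)" for \<xi>
  have g: "integrable lborel g"
    by (rule Bochner_Integration.integrable_bound[OF gi]) (auto simp: g_def[abs_def] norm_mult abs_mult intro!: mult_right_mono order_trans[OF K abs_ge_self])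
  have inner: "ft g x = cnj (\<integral>y. f y * heat e (x - y) \<partial>lborel)" for x
  proof -
    define k where "k \<xi> = cis (x \<bullet> \<xi>) * exp (- e * (norm \<xi>)\<^sup>2)" for \<xi>
    have k: "integrable lborel k"
      by (rule Bochner_Integration.integrable_bound[OF gaussian_integrable(1)[OF e]]) (auto simp: k_def[abs_def])
    have ftk: "ft k y = ft_const TYPE('a) * heat e (x - y)" for y
    proof -
      have "(\<integral>\<xi>. cis (- (\<xi> \<bullet> y)) * k \<xi> \<partial>lborel) = (\<integral>\<xi>. cis (\<xi> \<bullet> (x - y)) * exp (- e * (norm \<xi>)\<^sup>2) \<partial>lborel)"
        by (intro Bochner_Integration.integral_cong refl)
           (simp add: k_def cis_mult mult.assoc[symmetric] inner_diff_right inner_commute)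
      also have "\<dots> = complex_of_real ((pi / e) powr (DIM('a) / 2) * exp (- ((norm (x - y))\<^sup>2) / (4 * e)))"
        by (rule gaussian_integral[OF e])
      finally have "ft k y = complex_of_real ((pi / e) powr (DIM('a) / 2) / ft_const TYPE('a) * exp (- ((norm (x - y))\<^sup>2) / (4 * e)))"
        by (simp add: ft_def)
      \<comment> \<open>Multiplied by the heat normalisation (4 pi e)^(n/2), the left power becomes
        (4 pi^2)^(n/2), the square of \<open>ft_const\<close>.\<close>
      also have "(pi / e) powr (DIM('a) / 2) / ft_const TYPE('a) = ft_const TYPE('a) * (4 * pi * e) powr (- (DIM('a) / 2))"
      proof -
        have "(pi / e) powr (DIM('a) / 2) * (4 * pi * e) powr (DIM('a) / 2) = (pi / e * (4 * pi * e)) powr (DIM('a) / 2)"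
          by (rule powr_mult[symmetric])
        also have "pi / e * (4 * pi * e) = (2 * pi) * (2 * pi)" using e by simp
        also have "\<dots> powr (DIM('a) / 2) = ft_const TYPE('a) * ft_const TYPE('a)"
          by (subst powr_mult) (auto simp: ft_const_def)
        finally show ?thesis
          using e by (simp add: powr_minus field_simps)
      qed
      finally show ?thesis by (simp add: heat_def mult.assoc)
    qed
    have "ft g x = (\<integral>\<xi>. cnj (ft f \<xi> * k \<xi>) \<partial>lborel) / ft_const TYPE('a)"
      unfolding ft_def[of g]
      by (intro arg_cong2[where f="(/)"] refl Bochner_Integration.integral_cong)
         (simp add: g_def k_def inner_commute cis_cnj mult_ac)
    also have "\<dots> = cnj (\<integral>\<xi>. ft f \<xi> * k \<xi> \<partial>lborel) / ft_const TYPE('a)"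
      unfolding Bochner_Integration.integral_cnj ..
    also have "(\<integral>\<xi>. ft f \<xi> * k \<xi> \<partial>lborel) = (\<integral>y. f y * ft k y \<partial>lborel)"
      by (rule ft_multiplication_formula[OF f k])
    also have "\<dots> = (\<integral>y. ft_const TYPE('a) * (f y * heat e (x - y)) \<partial>lborel)"
      by (simp add: ftk mult_ac)
    also have "\<dots> = ft_const TYPE('a) * (\<integral>y. f y * heat e (x - y) \<partial>lborel)"
      by (rule integral_mult_right_zero)
    finally show ?thesis using ft_const_pos[where 'a='a] by (simp add: less_imp_neq)
  qed
  have "complex_of_real (\<integral>\<xi>. (cmod (ft f \<xi>))\<^sup>2 * exp (- e * (norm \<xi>)\<^sup>2) \<partial>lborel)
      = (\<integral>\<xi>. complex_of_real ((cmod (ft f \<xi>))\<^sup>2 * exp (- e * (norm \<xi>)\<^sup>2)) \<partial>lborel)"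
    by (rule integral_complex_of_real[symmetric])
  also have "\<dots> = (\<integral>\<xi>. ft f \<xi> * g \<xi> \<partial>lborel)"
    by (intro Bochner_Integration.integral_cong refl) (simp only: g_def of_real_mult complex_norm_square mult.assoc)
  also have "\<dots> = (\<integral>x. f x * ft g x \<partial>lborel)"
    by (rule ft_multiplication_formula[OF f g])
  finally show ?thesis by (simp add: inner)
qed

section \<open>Plancherel on integrable functions\<close>

lemma ennreal_norm_integral_le:
  fixes f :: "'a \<Rightarrow> 'b::{banach, second_countable_topology}"
  shows "ennreal (norm (integral\<^sup>L M f)) \<le> (\<integral>\<^sup>+x. ennreal (norm (f x)) \<partial>M)"
proof (cases "integrable M f")
  case True
  then show ?thesis by (rule integral_norm_bound_ennreal)
qed (simp add: not_integrable_integral_eq)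

text \<open>Schur's test: |f(x) f(y)| is at most half the sum of the squares, and the kernel has
  mass one in each variable.\<close>

lemma heat_form_le:
  fixes f :: "'a::euclidean_space \<Rightarrow> complex"
  assumes f: "square_int lborel f" and e: "0 < e"
  shows "cmod (\<integral>x. f x * cnj (\<integral>y. f y * heat e (x - y) \<partial>lborel) \<partial>lborel) \<le> (norm2 lborel f)\<^sup>2"
proof -
  have [measurable]: "f \<in> borel_measurable borel" using f by (auto simp: square_int_def)
  define c :: real where "c = 1 / 2"
  have c0: "0 \<le> c" by (simp add: c_def)
  let ?a = "\<lambda>x. ennreal ((cmod (f x))\<^sup>2)"
  have sq: "ennreal (cmod (f x)) * ennreal (cmod (f y)) \<le> ennreal c * (?a x + ?a y)" for x y
  proof -
    have "cmod (f x) * cmod (f y) \<le> c * ((cmod (f x))\<^sup>2 + (cmod (f y))\<^sup>2)"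
      using sum_squares_bound[of "cmod (f x)" "cmod (f y)"] by (simp add: c_def)
    then have "ennreal (cmod (f x) * cmod (f y)) \<le> ennreal (c * ((cmod (f x))\<^sup>2 + (cmod (f y))\<^sup>2))"
      by (rule ennreal_leI)
    then show ?thesis by (simp only: ennreal_mult norm_ge_zero zero_le_power2 c0 ennreal_plus add_nonneg_nonneg)
  qed
  have "ennreal (cmod (\<integral>x. f x * cnj (\<integral>y. f y * heat e (x - y) \<partial>lborel) \<partial>lborel))
      \<le> (\<integral>\<^sup>+x. ennreal (cmod (f x)) * ennreal (cmod (\<integral>y. f y * heat e (x - y) \<partial>lborel)) \<partial>lborel)"
    using ennreal_norm_integral_le[of lborel "\<lambda>x. f x * cnj (\<integral>y. f y * heat e (x - y) \<partial>lborel)"]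
    by (simp add: norm_mult ennreal_mult)
  also have "\<dots> \<le> (\<integral>\<^sup>+x. ennreal (cmod (f x)) * (\<integral>\<^sup>+y. ennreal (cmod (f y)) * ennreal (heat e (x - y)) \<partial>lborel) \<partial>lborel)"
  proof (intro nn_integral_mono mult_left_mono)
    fix x
    show "ennreal (cmod (\<integral>y. f y * heat e (x - y) \<partial>lborel)) \<le> (\<integral>\<^sup>+y. ennreal (cmod (f y)) * ennreal (heat e (x - y)) \<partial>lborel)"
      using ennreal_norm_integral_le[of lborel "\<lambda>y. f y * heat e (x - y)"]
      by (simp add: norm_mult ennreal_mult)
  qed simp
  also have "\<dots> = (\<integral>\<^sup>+x. \<integral>\<^sup>+y. ennreal (cmod (f x)) * ennreal (cmod (f y)) * ennreal (heat e (x - y)) \<partial>lborel \<partial>lborel)"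
    by (simp add: nn_integral_cmult[symmetric] mult.assoc)
  also have "\<dots> \<le> (\<integral>\<^sup>+x. \<integral>\<^sup>+y. ennreal c * (?a x + ?a y) * ennreal (heat e (x - y)) \<partial>lborel \<partial>lborel)"
    by (intro nn_integral_mono mult_right_mono sq) simp
  also have "\<dots> = (\<integral>\<^sup>+x. \<integral>\<^sup>+y. (ennreal c * ?a x) * ennreal (heat e (x - y)) + (ennreal c * ?a y) * ennreal (heat e (x - y)) \<partial>lborel \<partial>lborel)"
    by (simp add: algebra_simps)
  also have "\<dots> = (\<integral>\<^sup>+x. \<integral>\<^sup>+y. (ennreal c * ?a x) * ennreal (heat e (x - y)) \<partial>lborel \<partial>lborel)
     + (\<integral>\<^sup>+x. \<integral>\<^sup>+y. (ennreal c * ?a y) * ennreal (heat e (x - y)) \<partial>lborel \<partial>lborel)"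
    by (simp add: nn_integral_add)
  also have "(\<integral>\<^sup>+x. \<integral>\<^sup>+y. (ennreal c * ?a y) * ennreal (heat e (x - y)) \<partial>lborel \<partial>lborel)
     = (\<integral>\<^sup>+y. \<integral>\<^sup>+x. (ennreal c * ?a y) * ennreal (heat e (x - y)) \<partial>lborel \<partial>lborel)"
    by (rule lborel_pair.Fubini') measurable
  also have "(\<integral>\<^sup>+x. \<integral>\<^sup>+y. (ennreal c * ?a x) * ennreal (heat e (x - y)) \<partial>lborel \<partial>lborel) = (\<integral>\<^sup>+x. ennreal c * ?a x \<partial>lborel)"
    by (simp add: nn_integral_cmult heat_nn_integral_shift[OF e])
  also have "(\<integral>\<^sup>+y. \<integral>\<^sup>+x. (ennreal c * ?a y) * ennreal (heat e (x - y)) \<partial>lborel \<partial>lborel) = (\<integral>\<^sup>+x. ennreal c * ?a x \<partial>lborel)"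
    by (simp add: nn_integral_cmult heat_nn_integral_shift[OF e])
  also have "(\<integral>\<^sup>+x. ennreal c * ?a x \<partial>lborel) = ennreal c * ennreal ((norm2 lborel f)\<^sup>2)"
    by (simp only: nn_integral_square_int[OF f, symmetric], rule nn_integral_cmult) measurable
  also have "\<dots> + \<dots> = ennreal ((norm2 lborel f)\<^sup>2)"
    by (simp add: ennreal_mult[symmetric] ennreal_plus[symmetric] c0 del: ennreal_plus) (simp add: c_def)
  finally show ?thesis by simp
qed

text \<open>The damping is removed by Fatou's lemma, which yields an inequality only. It already
  makes the transform nonexpansive, and that is what later lets equality pass from a dense class to
  the limit.\<close>

lemma ft_norm2_le:
  fixes f :: "'a::euclidean_space \<Rightarrow> complex"
  assumes i: "integrable lborel f" and f: "square_int lborel f"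
  shows "square_int lborel (ft f)" "norm2 lborel (ft f) \<le> norm2 lborel f"
proof -
  have [measurable]: "f \<in> borel_measurable borel" using f by (auto simp: square_int_def)
  have m [measurable]: "ft f \<in> borel_measurable borel" using ft_measurable[of f] by simp
  define e where "e k = 1 / real (Suc k)" for k
  have e: "0 < e k" for k by (simp add: e_def)
  have e0: "e \<longlonglongrightarrow> 0" unfolding e_def[abs_def] using LIMSEQ_inverse_real_of_nat by (simp add: inverse_eq_divide)
  have ii: "integrable lborel (\<lambda>\<xi>. (cmod (ft f \<xi>))\<^sup>2 * exp (- e k * (norm \<xi>)\<^sup>2))" for k
  proof -
    define K where "K = (\<integral>x. cmod (f x) \<partial>lborel) / ft_const TYPE('a)"
    have K: "cmod (ft f \<xi>) \<le> K" for \<xi> unfolding K_def by (rule norm_ft_le)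
    show ?thesis
      by (rule Bochner_Integration.integrable_bound[OF integrable_mult_right[OF gaussian_integrable(1)[OF e[of k]], of "K\<^sup>2"]])
         (auto simp: abs_mult intro!: mult_right_mono power_mono K)
  qed
  have b: "(\<integral>\<^sup>+\<xi>. ennreal ((cmod (ft f \<xi>))\<^sup>2 * exp (- e k * (norm \<xi>)\<^sup>2)) \<partial>lborel) \<le> ennreal ((norm2 lborel f)\<^sup>2)" for k
  proof -
    have "(\<integral>\<xi>. (cmod (ft f \<xi>))\<^sup>2 * exp (- e k * (norm \<xi>)\<^sup>2) \<partial>lborel)
       \<le> cmod (complex_of_real (\<integral>\<xi>. (cmod (ft f \<xi>))\<^sup>2 * exp (- e k * (norm \<xi>)\<^sup>2) \<partial>lborel))"
      unfolding norm_of_real by (rule abs_ge_self)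
    also have "\<dots> \<le> (norm2 lborel f)\<^sup>2"
      unfolding ft_damped_norm[OF i e] by (rule heat_form_le[OF f e])
    finally show ?thesis
      using ii[of k] by (subst nn_integral_eq_integral) auto
  qed
  have "(\<integral>\<^sup>+\<xi>. ennreal ((cmod (ft f \<xi>))\<^sup>2) \<partial>lborel)
     = (\<integral>\<^sup>+\<xi>. liminf (\<lambda>k. ennreal ((cmod (ft f \<xi>))\<^sup>2 * exp (- e k * (norm \<xi>)\<^sup>2))) \<partial>lborel)"
  proof (rule nn_integral_cong)
    fix \<xi>
    have "(\<lambda>k. ennreal ((cmod (ft f \<xi>))\<^sup>2 * exp (- e k * (norm \<xi>)\<^sup>2))) \<longlonglongrightarrow> ennreal ((cmod (ft f \<xi>))\<^sup>2 * exp (- 0 * (norm \<xi>)\<^sup>2))"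
      by (intro tendsto_intros e0)
    then show "ennreal ((cmod (ft f \<xi>))\<^sup>2) = liminf (\<lambda>k. ennreal ((cmod (ft f \<xi>))\<^sup>2 * exp (- e k * (norm \<xi>)\<^sup>2)))"
      by (intro lim_imp_Liminf[symmetric]) auto
  qed
  also have "\<dots> \<le> liminf (\<lambda>k. \<integral>\<^sup>+\<xi>. ennreal ((cmod (ft f \<xi>))\<^sup>2 * exp (- e k * (norm \<xi>)\<^sup>2)) \<partial>lborel)"
    by (rule nn_integral_liminf) measurable
  also have "\<dots> \<le> ennreal ((norm2 lborel f)\<^sup>2)"
  proof (rule Liminf_le)
    show "\<forall>\<^sub>F k in sequentially. (\<integral>\<^sup>+\<xi>. ennreal ((cmod (ft f \<xi>))\<^sup>2 * exp (- e k * (norm \<xi>)\<^sup>2)) \<partial>lborel) \<le> ennreal ((norm2 lborel f)\<^sup>2)"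
      by (intro always_eventually allI b)
  qed simp
  finally have *: "(\<integral>\<^sup>+\<xi>. ennreal ((cmod (ft f \<xi>))\<^sup>2) \<partial>lborel) \<le> ennreal ((norm2 lborel f)\<^sup>2)" .
  show "square_int lborel (ft f)" "norm2 lborel (ft f) \<le> norm2 lborel f"
    using square_int_boundI[OF _ *] by auto
qed

text \<open>The substitution y = x + c w moves the small parameter from the kernel, where no
  majorant is available, into the argument of \<open>f\<close>, where continuity and boundedness
  give dominated convergence.\<close>

lemma heat_convolution_rescale:
  fixes f :: "'a::euclidean_space \<Rightarrow> complex"
  assumes [measurable]: "f \<in> borel_measurable borel" and c: "0 < c"
  shows "(\<integral>y. f y * heat (c\<^sup>2) (x - y) \<partial>lborel) = (\<integral>w. f (x + c *\<^sub>R w) * heat 1 w \<partial>lborel)"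
proof -
  have "(\<integral>y. f y * heat (c\<^sup>2) (x - y) \<partial>lborel)
      = (\<integral>y. f y * heat (c\<^sup>2) (x - y) \<partial>(density (distr lborel borel (\<lambda>w. x + c *\<^sub>R w)) (\<lambda>_. ennreal (\<bar>c\<bar> ^ DIM('a)))))"
    using lborel_affine[of c x] c by simp
  also have "\<dots> = (\<integral>y. (\<bar>c\<bar> ^ DIM('a)) *\<^sub>R (f y * heat (c\<^sup>2) (x - y)) \<partial>(distr lborel borel (\<lambda>w. x + c *\<^sub>R w)))"
    by (rule integral_density) auto
  also have "\<dots> = (\<integral>w. (\<bar>c\<bar> ^ DIM('a)) *\<^sub>R (f (x + c *\<^sub>R w) * heat (c\<^sup>2) (x - (x + c *\<^sub>R w))) \<partial>lborel)"
    by (rule integral_distr) auto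
  also have "\<dots> = (\<integral>w. f (x + c *\<^sub>R w) * heat 1 w \<partial>lborel)"
  proof (rule Bochner_Integration.integral_cong[OF refl])
    fix w :: 'a
    have "(4 * pi * c\<^sup>2) powr (- (DIM('a) / 2)) = (4 * pi) powr (- (DIM('a) / 2)) * (c\<^sup>2) powr (- (DIM('a) / 2))"
      by (rule powr_mult)
    also have "(c\<^sup>2) powr (- (DIM('a) / 2)) = c powr (- real DIM('a))"
      using c by (simp add: powr_powr flip: powr_numeral)
    finally have "c ^ DIM('a) * (4 * pi * c\<^sup>2) powr (- (DIM('a) / 2)) = (4 * pi) powr (- (DIM('a) / 2))"
      using c by (simp add: powr_minus powr_realpow)
    then have "c ^ DIM('a) * heat (c\<^sup>2) (x - (x + c *\<^sub>R w)) = heat 1 w"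
      using c by (simp add: heat_def power_mult_distrib mult.assoc[symmetric])
    then show "(\<bar>c\<bar> ^ DIM('a)) *\<^sub>R (f (x + c *\<^sub>R w) * heat (c\<^sup>2) (x - (x + c *\<^sub>R w))) = f (x + c *\<^sub>R w) * heat 1 w"
      using c by (simp add: scaleR_conv_of_real mult.left_commute flip: of_real_mult of_real_power)
  qed
  finally show ?thesis .
qed

section \<open>Bounded functions with bounded support, and equality in Plancherel by density\<close>

text \<open>A single constant bounds the values and the radius of the support. Continuity is not
  part of the notion, so that cutoffs of arbitrary measurable functions belong to it.\<close>

definition bdd_supp :: "('a::euclidean_space \<Rightarrow> complex) \<Rightarrow> bool" where
  "bdd_supp f \<longleftrightarrow> f \<in> borel_measurable lborel \<and> (\<exists>K\<ge>0. \<forall>x. cmod (f x) \<le> K \<and> (f x \<noteq> 0 \<longrightarrow> norm x \<le> K))"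

lemma bdd_suppE:
  assumes "bdd_supp f"
  obtains K where "0 \<le> K" "\<And>x. cmod (f x) \<le> K" "\<And>x. K < norm x \<Longrightarrow> f x = 0"
  using assms unfolding bdd_supp_def by force

lemma bdd_supp_measurable [measurable_dest]: "bdd_supp f \<Longrightarrow> f \<in> borel_measurable lborel"
  by (simp add: bdd_supp_def)

lemma integrable_indicator_cball: "integrable lborel (indicator (cball 0 r) :: 'a::euclidean_space \<Rightarrow> real)"
  using emeasure_lborel_cball_finite[of "0::'a" r] by (intro integrable_real_indicator) auto

lemma bdd_supp_le_indicator:
  assumes "\<And>x. cmod (f x) \<le> K" "\<And>x. K < norm x \<Longrightarrow> f x = 0"
  shows "cmod (f x) \<le> K * indicator (cball 0 K) x"
  using assms(1)[of x] assms(2)[of x] by (auto simp: indicator_def)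

lemma bdd_supp_integrable:
  assumes "bdd_supp f" shows "integrable lborel f" "square_int lborel f"
proof -
  have [measurable]: "f \<in> borel_measurable borel" using assms by (auto simp: bdd_supp_def)
  obtain K where K: "0 \<le> K" "\<And>x. cmod (f x) \<le> K" "\<And>x. K < norm x \<Longrightarrow> f x = 0" using assms by (rule bdd_suppE) blast
  have le: "cmod (f x) \<le> K * indicator (cball 0 K) x" for x by (rule bdd_supp_le_indicator[OF K(2,3)])
  show "integrable lborel f"
    by (rule Bochner_Integration.integrable_bound[OF integrable_mult_right[OF integrable_indicator_cball, of K K]])
       (use K le in \<open>auto simp: abs_mult\<close>)
  have "(cmod (f x))\<^sup>2 \<le> K\<^sup>2 * indicator (cball 0 K) x" for x
    using power_mono[OF le[of x], of 2] by (auto simp: indicator_def)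
  then have "integrable lborel (\<lambda>x. (cmod (f x))\<^sup>2)"
    by (intro Bochner_Integration.integrable_bound[OF integrable_mult_right[OF integrable_indicator_cball, of "K\<^sup>2" K]]) auto
  then show "square_int lborel f" by (simp add: square_int_def)
qed

lemma bdd_supp_mult_bounded:
  assumes "bdd_supp f" "m \<in> borel_measurable lborel" "\<And>x. cmod (m x) \<le> C"
  shows "bdd_supp (\<lambda>x. m x * f x)"
proof -
  obtain K where K: "0 \<le> K" "\<And>x. cmod (f x) \<le> K" "\<And>x. K < norm x \<Longrightarrow> f x = 0" using assms(1) by (rule bdd_suppE) blast
  have [measurable]: "f \<in> borel_measurable borel" "m \<in> borel_measurable borel" using assms by (auto simp: bdd_supp_def)
  have C: "0 \<le> C" using assms(3)[of 0] norm_ge_zero order_trans by blast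
  have "cmod (m x * f x) \<le> max K (C * K)" for x
    using mult_mono[OF assms(3)[of x] K(2)[of x] C norm_ge_zero] by (simp add: norm_mult max.coboundedI2)
  moreover have "m x * f x \<noteq> 0 \<Longrightarrow> norm x \<le> max K (C * K)" for x
    using K(3)[of x] by (auto simp: not_less[symmetric] less_max_iff_disj)
  ultimately show ?thesis
    unfolding bdd_supp_def using K(1) C by (intro conjI exI[of _ "max K (C * K)"]) (auto simp: max.coboundedI1)
qed

text \<open>The damped identity is evaluated on both sides as the damping tends to 0: heat averages
  converge pointwise to \<open>f\<close> by continuity, and on the Fourier side the damping factor
  tends to 1.\<close>

lemma ft_isometry_continuous:
  fixes f :: "'a::euclidean_space \<Rightarrow> complex"
  assumes bdd_supp: "bdd_supp f" and cont: "continuous_on UNIV f"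
  shows "norm2 lborel (ft f) = norm2 lborel f"
proof -
  note i = bdd_supp_integrable[OF bdd_supp]
  have [measurable]: "f \<in> borel_measurable borel" using bdd_supp by (auto simp: bdd_supp_def)
  have m [measurable]: "ft f \<in> borel_measurable borel" using ft_measurable[of f] by simp
  obtain K where K: "0 \<le> K" "\<And>x. cmod (f x) \<le> K" "\<And>x. K < norm x \<Longrightarrow> f x = 0" using bdd_supp by (rule bdd_suppE) blast
  define c where "c k = 1 / real (Suc k)" for k
  have c: "0 < c k" for k by (simp add: c_def)
  have c0: "c \<longlonglongrightarrow> 0" unfolding c_def[abs_def] using LIMSEQ_inverse_real_of_nat by (simp add: inverse_eq_divide)
  define g where "g k x = (\<integral>w. f (x + c k *\<^sub>R w) * heat 1 w \<partial>lborel)" for k x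
  have [measurable]: "g k \<in> borel_measurable borel" for k unfolding g_def[abs_def] by measurable
  have hi: "integrable lborel (\<lambda>w::'a. K * heat 1 w)" by (intro integrable_mult_right heat_integral) simp
  have g_le: "cmod (g k x) \<le> K" for k x
  proof -
    have "cmod (g k x) \<le> (\<integral>w. cmod (f (x + c k *\<^sub>R w) * heat 1 w) \<partial>lborel)" unfolding g_def by (rule integral_norm_bound)
    also have "\<dots> \<le> (\<integral>w. K * heat 1 (w::'a) \<partial>lborel)"
      by (intro integral_mono' hi) (auto simp: norm_mult K(1) intro!: mult_right_mono K(2))
    also have "\<dots> = K" by (simp add: heat_integral(2))
    finally show ?thesis .
  qed
  have g_lim: "(\<lambda>k. g k x) \<longlonglongrightarrow> f x" for x
  proof -
    have "(\<lambda>k. g k x) \<longlonglongrightarrow> (\<integral>w. f x * heat 1 (w::'a) \<partial>lborel)"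
      unfolding g_def
    proof (rule integral_dominated_convergence[OF _ _ hi])
      show "AE w in lborel. (\<lambda>k. f (x + c k *\<^sub>R w) * heat 1 w) \<longlonglongrightarrow> f x * heat 1 w"
      proof (intro AE_I2 tendsto_mult_right)
        fix w :: 'a
        have "(\<lambda>k. x + c k *\<^sub>R w) \<longlonglongrightarrow> x + 0 *\<^sub>R w" by (intro tendsto_intros c0)
        then have "(\<lambda>k. x + c k *\<^sub>R w) \<longlonglongrightarrow> x" by simp
        moreover have "isCont f x" using cont by (simp add: continuous_on_eq_continuous_at)
        ultimately show "(\<lambda>k. f (x + c k *\<^sub>R w)) \<longlonglongrightarrow> f x" by (rule isCont_tendsto_compose[rotated])
      qed
      show "AE w in lborel. norm (f (x + c k *\<^sub>R w) * heat 1 w) \<le> K * heat 1 w" for k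
        by (auto simp: norm_mult intro!: mult_right_mono K)
    qed auto
    also have "(\<integral>w. f x * heat 1 (w::'a) \<partial>lborel) = f x * complex_of_real (\<integral>w. heat 1 (w::'a) \<partial>lborel)"
      by (simp only: integral_mult_right_zero integral_complex_of_real)
    finally show ?thesis by (simp add: heat_integral(2))
  qed
  have "(\<lambda>k. \<integral>x. f x * cnj (g k x) \<partial>lborel) \<longlonglongrightarrow> (\<integral>x. f x * cnj (f x) \<partial>lborel)"
  proof (rule integral_dominated_convergence)
    show "integrable lborel (\<lambda>x. K * cmod (f x))" using i by auto
    show "AE x in lborel. (\<lambda>k. f x * cnj (g k x)) \<longlonglongrightarrow> f x * cnj (f x)"
      by (intro AE_I2 tendsto_intros g_lim)
    show "AE x in lborel. norm (f x * cnj (g k x)) \<le> K * cmod (f x)" for k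
      by (auto simp: norm_mult mult.commute[of K] intro!: mult_left_mono g_le)
  qed auto
  moreover have "(\<integral>x. f x * cnj (f x) \<partial>lborel) = complex_of_real ((norm2 lborel f)\<^sup>2)"
    using inner2_self[of lborel f] by (simp add: inner2_def)
  moreover have "(\<integral>x. f x * cnj (g k x) \<partial>lborel)
      = complex_of_real (\<integral>\<xi>. (cmod (ft f \<xi>))\<^sup>2 * exp (- (c k)\<^sup>2 * (norm \<xi>)\<^sup>2) \<partial>lborel)" for k
    by (subst ft_damped_norm) (use i c[of k] heat_convolution_rescale[OF _ c[of k], of f] in \<open>auto simp: g_def\<close>)
  ultimately have A: "(\<lambda>k. \<integral>\<xi>. (cmod (ft f \<xi>))\<^sup>2 * exp (- (c k)\<^sup>2 * (norm \<xi>)\<^sup>2) \<partial>lborel) \<longlonglongrightarrow> (norm2 lborel f)\<^sup>2"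
    by (simp only: tendsto_of_real_iff)
  \<comment> \<open>The majorant is the undamped |ft f|^2, integrable by the one-sided bound proved
    before.\<close>
  have "(\<lambda>k. \<integral>\<xi>. (cmod (ft f \<xi>))\<^sup>2 * exp (- (c k)\<^sup>2 * (norm \<xi>)\<^sup>2) \<partial>lborel) \<longlonglongrightarrow> (\<integral>\<xi>. (cmod (ft f \<xi>))\<^sup>2 \<partial>lborel)"
  proof (rule integral_dominated_convergence)
    show "integrable lborel (\<lambda>\<xi>. (cmod (ft f \<xi>))\<^sup>2)" using ft_norm2_le(1)[OF i] by (simp add: square_int_def)
    show "AE \<xi> in lborel. (\<lambda>k. (cmod (ft f \<xi>))\<^sup>2 * exp (- (c k)\<^sup>2 * (norm \<xi>)\<^sup>2)) \<longlonglongrightarrow> (cmod (ft f \<xi>))\<^sup>2"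
    proof (rule AE_I2)
      fix \<xi> :: 'a
      have "(\<lambda>k. (cmod (ft f \<xi>))\<^sup>2 * exp (- (c k)\<^sup>2 * (norm \<xi>)\<^sup>2)) \<longlonglongrightarrow> (cmod (ft f \<xi>))\<^sup>2 * exp (- 0\<^sup>2 * (norm \<xi>)\<^sup>2)"
        by (intro tendsto_intros c0)
      then show "(\<lambda>k. (cmod (ft f \<xi>))\<^sup>2 * exp (- (c k)\<^sup>2 * (norm \<xi>)\<^sup>2)) \<longlonglongrightarrow> (cmod (ft f \<xi>))\<^sup>2" by simp
    qed
    show "AE \<xi> in lborel. norm ((cmod (ft f \<xi>))\<^sup>2 * exp (- (c k)\<^sup>2 * (norm \<xi>)\<^sup>2)) \<le> (cmod (ft f \<xi>))\<^sup>2" for k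
      by (auto simp: mult_left_le)
  qed auto
  from LIMSEQ_unique[OF A this] have "(norm2 lborel f)\<^sup>2 = (norm2 lborel (ft f))\<^sup>2" by (simp add: norm2_power2)
  then show ?thesis using power2_eq_iff_nonneg[of "norm2 lborel f" "norm2 lborel (ft f)"] by simp
qed

definition cutoff :: "real \<Rightarrow> ('a::euclidean_space \<Rightarrow> complex) \<Rightarrow> 'a \<Rightarrow> complex" where
  "cutoff r f x = (if cmod (f x) \<le> r \<and> norm x \<le> r then f x else 0)"

lemma bdd_supp_cutoff: "f \<in> borel_measurable lborel \<Longrightarrow> bdd_supp (cutoff r f)"
  unfolding bdd_supp_def cutoff_def[abs_def] by (intro conjI exI[of _ "\<bar>r\<bar>"]) auto

lemma cutoff_tendsto:
  assumes "square_int lborel f"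
  shows "(\<lambda>k. norm2 lborel (\<lambda>x. cutoff (real k) f x - f x)) \<longlonglongrightarrow> 0"
proof (rule norm2_tendsto_dominated[OF assms])
  have [measurable]: "f \<in> borel_measurable borel" using assms by (auto simp: square_int_def)
  show "cutoff (real k) f \<in> borel_measurable lborel" for k unfolding cutoff_def[abs_def] by measurable
  show "AE x in lborel. cmod (cutoff (real k) f x) \<le> cmod (f x)" for k by (auto simp: cutoff_def)
  show "AE x in lborel. (\<lambda>k. cutoff (real k) f x) \<longlonglongrightarrow> f x"
  proof (intro AE_I2 tendsto_eventually)
    fix x
    show "\<forall>\<^sub>F k in sequentially. cutoff (real k) f x = f x"
      using eventually_ge_at_top[of "nat \<lceil>max (cmod (f x)) (norm x)\<rceil>"]
    proof eventually_elim
      case (elim k)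
      then have "max (cmod (f x)) (norm x) \<le> real k" by linarith
      then show ?case by (simp add: cutoff_def)
    qed
  qed
qed (use assms in \<open>auto simp: square_int_def\<close>)

text \<open>Almost everywhere approximation by continuous functions becomes L2 approximation once
  the approximants are given a common bound and a common bounded support.\<close>

lemma continuous_approx_bdd_supp:
  fixes f :: "'a::euclidean_space \<Rightarrow> complex"
  assumes "bdd_supp f"
  shows "\<exists>h. (\<forall>k. bdd_supp (h k) \<and> continuous_on UNIV (h k)) \<and> (\<lambda>k. norm2 lborel (\<lambda>x. h k x - f x)) \<longlonglongrightarrow> 0"
proof -
  have fm [measurable]: "f \<in> borel_measurable borel" using assms by (auto simp: bdd_supp_def)
  obtain K0 where K0: "0 \<le> K0" "\<And>x. cmod (f x) \<le> K0" "\<And>x. K0 < norm x \<Longrightarrow> f x = 0" using assms by (rule bdd_suppE) blast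
  \<comment> \<open>The added 1 makes the radius positive, as the division in \<open>p\<close>
    requires.\<close>
  define K where "K = K0 + 1"
  have K: "0 < K" "\<And>x. cmod (f x) \<le> K" "\<And>x. K < norm x \<Longrightarrow> f x = 0"
  proof -
    show "0 < K" using K0(1) by (simp add: K_def)
    show "cmod (f x) \<le> K" for x using K0(2)[of x] by (simp add: K_def)
    show "f x = 0" if "K < norm x" for x using K0(3)[of x] that by (simp add: K_def)
  qed
  \<comment> \<open>Measurability in this sense supplies continuous functions tending to
    \<open>f\<close> off a negligible set, with no control of their size or support.\<close>
  have "f measurable_on UNIV"
    by (subst measurable_on_iff_borel_measurable) (auto intro: measurable_completion simp: lebesgue_on_UNIV_eq)
  then obtain N g where N: "negligible N" "\<And>n. continuous_on UNIV (g n)" "\<And>x. x \<notin> N \<Longrightarrow> (\<lambda>n. g n x) \<longlonglongrightarrow> f x"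
    unfolding measurable_on_def by auto
  \<comment> \<open>The radial retraction onto the disc of radius \<open>K\<close>. It fixes the
    values of \<open>f\<close>, so composing with it keeps the limit.\<close>
  define p where "p z = z / max 1 (cmod z / K)" for z :: complex
  \<comment> \<open>A continuous ramp, equal to 1 on the ball of radius \<open>K\<close> and to 0
    outside the ball of radius \<open>K + 1\<close>.\<close>
  define cut where "cut x = max 0 (min 1 (K + 1 - norm x))" for x :: 'a
  define h where "h k x = complex_of_real (cut x) * p (g k x)" for k x
  have p_le: "cmod (p z) \<le> K" for z
  proof -
    have "cmod z \<le> K * max 1 (cmod z / K)" using K(1) by (cases "cmod z \<le> K") (auto simp: max_def field_simps)
    then show ?thesis unfolding p_def using K(1)
      by (simp add: norm_divide abs_of_pos less_max_iff_disj pos_divide_le_eq)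
  qed
  have p_id: "p z = z" if "cmod z \<le> K" for z using that K(1) by (simp add: p_def max_def)
  have p_cont: "continuous_on UNIV p"
    unfolding p_def using K(1) by (intro continuous_intros) (auto simp: max_def)
  have cut: "0 \<le> cut x" "cut x \<le> 1" for x by (auto simp: cut_def)
  have h_le: "cmod (h k x) \<le> K" for k x
    using mult_mono[OF cut(2)[of x] p_le[of "g k x"]] cut(1)[of x] by (simp add: h_def norm_mult)
  have h_0: "h k x = 0" if "K + 1 < norm x" for k x using that by (simp add: h_def cut_def)
  have cont: "continuous_on UNIV (h k)" for k
    unfolding h_def[abs_def] cut_def
    by (intro continuous_intros continuous_on_compose2[OF p_cont N(2)]) auto
  have hm [measurable]: "h k \<in> borel_measurable borel" for k by (intro borel_measurable_continuous_onI cont)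
  have bdd_supp: "bdd_supp (h k)" for k
  proof -
    have "cmod (h k x) \<le> K + 1" for x using h_le[of k x] by simp
    moreover have "norm x \<le> K + 1" if "h k x \<noteq> 0" for x using h_0[of x k] that by force
    ultimately show ?thesis unfolding bdd_supp_def using K(1) by (intro conjI exI[of _ "K + 1"]) auto
  qed
  have "(\<lambda>k. norm2 lborel (\<lambda>x. h k x - f x)) \<longlonglongrightarrow> 0"
  proof (rule norm2_tendsto_dominated)
    let ?w = "\<lambda>x::'a. complex_of_real (K * indicator (cball 0 (K + 1)) x)"
    have "bdd_supp ?w" unfolding bdd_supp_def using K(1) by (intro conjI exI[of _ "K+1"]) (auto simp: indicator_def)
    then show "square_int lborel ?w" by (rule bdd_supp_integrable)
    show "AE x in lborel. cmod (h k x) \<le> cmod (?w x)" for k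
      using h_le[of k] h_0[of _ k] K(1) by (auto simp: indicator_def)
    have "AE x in lebesgue. x \<notin> N" using N(1) by (simp add: negligible_iff_null_sets AE_not_in)
    then have "AE x in lborel. x \<notin> N" by (simp add: AE_completion_iff)
    then show "AE x in lborel. (\<lambda>k. h k x) \<longlonglongrightarrow> f x"
    proof eventually_elim
      case (elim x)
      have "isCont p (f x)" using p_cont by (simp add: continuous_on_eq_continuous_at)
      then have "(\<lambda>k. complex_of_real (cut x) * p (g k x)) \<longlonglongrightarrow> complex_of_real (cut x) * p (f x)"
        by (intro tendsto_mult_left isCont_tendsto_compose[OF _ N(3)[OF elim]])
      moreover have "complex_of_real (cut x) * p (f x) = f x"
        using K(3)[of x] p_id[OF K(2)[of x]] by (cases "K < norm x") (auto simp: cut_def p_def)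
      ultimately show ?case by (simp add: h_def)
    qed
  qed auto
  with bdd_supp cont show ?thesis by blast
qed

lemma norm2_ft_diff_le:
  assumes "integrable lborel f" "square_int lborel f" "integrable lborel g" "square_int lborel g"
  shows "norm2 lborel (\<lambda>x. ft f x - ft g x) \<le> norm2 lborel (\<lambda>x. f x - g x)"
proof -
  have "ft (\<lambda>x. f x - g x) = (\<lambda>x. ft f x - ft g x)"
    by (rule ext, rule ft_diff) (use assms in auto)
  then show ?thesis
    using ft_norm2_le(2)[of "\<lambda>x. f x - g x"] assms by (simp add: square_int_diff)
qed

text \<open>Nonexpansiveness makes the transforms converge as fast as the functions, so equality of
  norms survives the limit. It is applied twice: from continuous functions to bounded support, and
  from there to all integrable L2 functions.\<close>

lemma ft_isometry_closure:
  assumes h: "\<And>k. bdd_supp (h k)" "\<And>k. norm2 lborel (ft (h k)) = norm2 lborel (h k)"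
    and lim: "(\<lambda>k. norm2 lborel (\<lambda>x. h k x - f x)) \<longlonglongrightarrow> 0"
    and f: "integrable lborel f" "square_int lborel f"
  shows "norm2 lborel (ft f) = norm2 lborel f"
proof (rule LIMSEQ_unique)
  note hi = bdd_supp_integrable[OF h(1)]
  show "(\<lambda>k. norm2 lborel (h k)) \<longlonglongrightarrow> norm2 lborel f" by (rule norm2_tendsto[OF hi(2) f(2) lim])
  have "(\<lambda>k. norm2 lborel (\<lambda>x. ft (h k) x - ft f x)) \<longlonglongrightarrow> 0"
    by (rule Lim_null_comparison[OF always_eventually lim]) (simp add: norm2_ft_diff_le hi f)
  from norm2_tendsto[OF ft_norm2_le(1)[OF hi] ft_norm2_le(1)[OF f] this]
  show "(\<lambda>k. norm2 lborel (h k)) \<longlonglongrightarrow> norm2 lborel (ft f)" by (simp add: h(2))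
qed

theorem ft_isometry:
  assumes f: "integrable lborel f" "square_int lborel f"
  shows "norm2 lborel (ft f) = norm2 lborel f"
proof (rule ft_isometry_closure[OF _ _ cutoff_tendsto[OF f(2)] f])
  fix k
  show bdd_supp: "bdd_supp (cutoff (real k) f)" using f by (intro bdd_supp_cutoff) auto
  obtain h where h: "\<And>k. bdd_supp (h k)" "\<And>k. continuous_on UNIV (h k)"
    "(\<lambda>i. norm2 lborel (\<lambda>x. h i x - cutoff (real k) f x)) \<longlonglongrightarrow> 0"
    using continuous_approx_bdd_supp[OF bdd_supp] by blast
  show "norm2 lborel (ft (cutoff (real k) f)) = norm2 lborel (cutoff (real k) f)"
    by (rule ft_isometry_closure[OF h(1) ft_isometry_continuous[OF h(1,2)] h(3) bdd_supp_integrable[OF bdd_supp]])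
qed

section \<open>The Fourier--Plancherel transform\<close>

text \<open>The approximants cut off values as well as the domain, unlike the balls in
  \<open>fourier_L2\<close>. The value is one selected representative, so statements about it hold
  almost everywhere.\<close>

definition FT :: "('a::euclidean_space \<Rightarrow> complex) \<Rightarrow> 'a \<Rightarrow> complex" where
  "FT f = (SOME g. square_int lborel g \<and>
     (\<lambda>k. norm2 lborel (\<lambda>x. ft (cutoff (real k) f) x - g x)) \<longlonglongrightarrow> 0)"

text \<open>Conjugating before and after turns the kernel into its conjugate; for the unitary
  normalisation this is at the same time the adjoint and the inverse.\<close>

definition IFT :: "('a::euclidean_space \<Rightarrow> complex) \<Rightarrow> 'a \<Rightarrow> complex" where
  "IFT g x = cnj (FT (\<lambda>\<xi>. cnj (g \<xi>)) x)"

lemma norm2_ft_diff: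
  assumes "integrable lborel f" "square_int lborel f" "integrable lborel g" "square_int lborel g"
  shows "norm2 lborel (\<lambda>x. ft f x - ft g x) = norm2 lborel (\<lambda>x. f x - g x)"
proof -
  have "ft (\<lambda>x. f x - g x) = (\<lambda>x. ft f x - ft g x)"
    by (rule ext, rule ft_diff) (use assms in auto)
  then show ?thesis
    using ft_isometry[of "\<lambda>x. f x - g x"] assms by (simp add: square_int_diff)
qed

lemma norm2_Cauchy:
  assumes "\<And>k. square_int M (h k)" "square_int M f" "(\<lambda>k. norm2 M (\<lambda>x. h k x - f x)) \<longlonglongrightarrow> 0" "0 < e"
  shows "\<exists>K. \<forall>k\<ge>K. \<forall>l\<ge>K. norm2 M (\<lambda>x. h k x - h l x) \<le> e"
proof -
  from LIMSEQ_D[OF assms(3), of "e/2"] assms(4)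
  obtain K where K: "\<And>k. k \<ge> K \<Longrightarrow> norm2 M (\<lambda>x. h k x - f x) < e / 2" by auto
  have "norm2 M (\<lambda>x. h k x - h l x) \<le> e" if "k \<ge> K" "l \<ge> K" for k l
    using norm2_triangle[OF assms(1,2,1), of k l] K[OF that(1)] K[OF that(2)]
    by (simp add: norm2_commute[of M f])
  then show ?thesis by blast
qed

lemma FT_approx_exists:
  assumes h: "\<And>k. integrable lborel (h k)" "\<And>k. square_int lborel (h k)" and f: "square_int lborel f"
    and lim: "(\<lambda>k. norm2 lborel (\<lambda>x. h k x - f x)) \<longlonglongrightarrow> 0"
  shows "\<exists>g. square_int lborel g \<and> (\<lambda>k. norm2 lborel (\<lambda>x. ft (h k) x - g x)) \<longlonglongrightarrow> 0"
proof (rule L2_complete)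
  show "square_int lborel (ft (h k))" for k by (intro ft_norm2_le h)
  show "\<exists>K. \<forall>k\<ge>K. \<forall>l\<ge>K. norm2 lborel (\<lambda>x. ft (h k) x - ft (h l) x) \<le> e" if "0 < e" for e
    using norm2_Cauchy[OF h(2) f lim that] by (simp add: norm2_ft_diff h)
qed (rule lborel.sigma_finite_measure_axioms)

lemma FT_spec:
  assumes f: "square_int lborel f"
  shows "square_int lborel (FT f)" "(\<lambda>k. norm2 lborel (\<lambda>x. ft (cutoff (real k) f) x - FT f x)) \<longlonglongrightarrow> 0"
proof -
  have "bdd_supp (cutoff (real k) f)" for k using f by (intro bdd_supp_cutoff) (auto simp: square_int_def)
  note i = bdd_supp_integrable[OF this]
  from someI_ex[OF FT_approx_exists[OF i f cutoff_tendsto[OF f]], folded FT_def]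
  show "square_int lborel (FT f)" "(\<lambda>k. norm2 lborel (\<lambda>x. ft (cutoff (real k) f) x - FT f x)) \<longlonglongrightarrow> 0" by auto
qed

text \<open>One distance formula with several uses: g = f identifies \<open>FT\<close> with the
  integral, a sequence g gives convergence along any approximation, and g = 0 gives the
  isometry.\<close>

lemma FT_norm2_diff_ft:
  assumes f: "square_int lborel f" and g: "integrable lborel g" "square_int lborel g"
  shows "norm2 lborel (\<lambda>x. FT f x - ft g x) = norm2 lborel (\<lambda>x. f x - g x)"
proof (rule LIMSEQ_unique)
  have "bdd_supp (cutoff (real k) f)" for k using f by (intro bdd_supp_cutoff) (auto simp: square_int_def)
  note i = bdd_supp_integrable[OF this]
  have "(\<lambda>k. norm2 lborel (\<lambda>x. (ft (cutoff (real k) f) x - ft g x) - (FT f x - ft g x))) \<longlonglongrightarrow> 0"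
    using FT_spec(2)[OF f] by simp
  from norm2_tendsto[OF square_int_diff(1)[OF ft_norm2_le(1)[OF i] ft_norm2_le(1)[OF g]] square_int_diff(1)[OF FT_spec(1)[OF f] ft_norm2_le(1)[OF g]] this]
  show "(\<lambda>k. norm2 lborel (\<lambda>x. ft (cutoff (real k) f) x - ft g x)) \<longlonglongrightarrow> norm2 lborel (\<lambda>x. FT f x - ft g x)" .
  have "(\<lambda>k. norm2 lborel (\<lambda>x. (cutoff (real k) f x - g x) - (f x - g x))) \<longlonglongrightarrow> 0"
    using cutoff_tendsto[OF f] by simp
  from norm2_tendsto[OF square_int_diff(1)[OF i(2) g(2)] square_int_diff(1)[OF f g(2)] this]
  show "(\<lambda>k. norm2 lborel (\<lambda>x. ft (cutoff (real k) f) x - ft g x)) \<longlonglongrightarrow> norm2 lborel (\<lambda>x. f x - g x)"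
    by (simp add: norm2_ft_diff i g)
qed

lemma AE_eq_norm2:
  assumes "square_int M f" "square_int M g"
  shows "(AE x in M. f x = g x) \<longleftrightarrow> norm2 M (\<lambda>x. f x - g x) = 0"
  using norm2_eq_0_iff[OF square_int_diff(1)[OF assms]] by simp

lemma FT_eq_ft:
  assumes "integrable lborel f" "square_int lborel f"
  shows "AE x in lborel. FT f x = ft f x"
  using FT_norm2_diff_ft[OF assms(2) assms] AE_eq_norm2[OF FT_spec(1)[OF assms(2)] ft_norm2_le(1)[OF assms]] by simp

lemma FT_tendsto_ft:
  assumes h: "\<And>k. integrable lborel (h k)" "\<And>k. square_int lborel (h k)" and f: "square_int lborel f"
    and lim: "(\<lambda>k. norm2 lborel (\<lambda>x. h k x - f x)) \<longlonglongrightarrow> 0"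
  shows "(\<lambda>k. norm2 lborel (\<lambda>x. ft (h k) x - FT f x)) \<longlonglongrightarrow> 0"
  using lim FT_norm2_diff_ft[OF f h(1,2)] by (simp add: norm2_commute[of lborel "ft _"] norm2_commute[of lborel f])

text \<open>\<open>cutoff\<close> is not linear, so the approximants are combinations of cutoffs and
  not cutoffs of the combination. This is legitimate because \<open>FT\<close> is the limit along
  every integrable approximating sequence.\<close>

lemma FT_linear:
  assumes f: "square_int lborel f" and g: "square_int lborel g"
  shows "AE x in lborel. FT (\<lambda>x. f x + c * g x) x = FT f x + c * FT g x"
proof -
  have bf: "bdd_supp (cutoff (real k) f)" and bg: "bdd_supp (cutoff (real k) g)" for k
    using f g by (auto intro!: bdd_supp_cutoff simp: square_int_def)
  note i = bdd_supp_integrable[OF bf] and j = bdd_supp_integrable[OF bg]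
  have s: "square_int lborel (\<lambda>x. f x + c * g x)" by (intro square_int_add square_int_cmult f g)
  have sk: "integrable lborel (\<lambda>x. cutoff (real k) f x + c * cutoff (real k) g x)"
    "square_int lborel (\<lambda>x. cutoff (real k) f x + c * cutoff (real k) g x)" for k
    using i[of k] j[of k] by (auto intro!: square_int_add)
  have lin: "norm2 M (\<lambda>x. (f' x + c * g' x) - (f x + c * g x)) \<le> norm2 M (\<lambda>x. f' x - f x) + cmod c * norm2 M (\<lambda>x. g' x - g x)"
    if "square_int M f'" "square_int M g'" "square_int M f" "square_int M g" for f' g' f g :: "'a \<Rightarrow> complex" and M
  proof -
    have "norm2 M (\<lambda>x. (f' x + c * g' x) - (f x + c * g x)) = norm2 M (\<lambda>x. (f' x - f x) + c * (g' x - g x))"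
      by (simp add: algebra_simps)
    also have "\<dots> \<le> norm2 M (\<lambda>x. f' x - f x) + norm2 M (\<lambda>x. c * (g' x - g x))"
      by (intro square_int_add square_int_cmult square_int_diff that)
    finally show ?thesis by (simp only: norm2_cmult)
  qed
  have L: "(\<lambda>k. norm2 lborel (\<lambda>x. (cutoff (real k) f x + c * cutoff (real k) g x) - (f x + c * g x))) \<longlonglongrightarrow> 0"
  proof (rule Lim_null_comparison[OF always_eventually])
    show "\<forall>k. norm (norm2 lborel (\<lambda>x. (cutoff (real k) f x + c * cutoff (real k) g x) - (f x + c * g x)))
      \<le> norm2 lborel (\<lambda>x. cutoff (real k) f x - f x) + cmod c * norm2 lborel (\<lambda>x. cutoff (real k) g x - g x)"
      using lin[OF i(2) j(2) f g] by simp
    show "(\<lambda>k. norm2 lborel (\<lambda>x. cutoff (real k) f x - f x) + cmod c * norm2 lborel (\<lambda>x. cutoff (real k) g x - g x)) \<longlonglongrightarrow> 0"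
      by (intro tendsto_add_zero tendsto_mult_right_zero cutoff_tendsto f g)
  qed
  have ftl: "ft (\<lambda>x. cutoff (real k) f x + c * cutoff (real k) g x) = (\<lambda>x. ft (cutoff (real k) f) x + c * ft (cutoff (real k) g) x)" for k
    by (rule ext, subst ft_add) (use i[of k] j[of k] in \<open>auto simp: ft_cmult\<close>)
  show ?thesis
  proof (rule norm2_limit_AE_unique)
    show "square_int lborel (ft (\<lambda>x. cutoff (real k) f x + c * cutoff (real k) g x))" for k by (intro ft_norm2_le sk)
    show "square_int lborel (FT (\<lambda>x. f x + c * g x))" by (intro FT_spec s)
    show "square_int lborel (\<lambda>x. FT f x + c * FT g x)" by (intro square_int_add square_int_cmult FT_spec f g)
    show "(\<lambda>k. norm2 lborel (\<lambda>x. ft (\<lambda>x. cutoff (real k) f x + c * cutoff (real k) g x) x - FT (\<lambda>x. f x + c * g x) x)) \<longlonglongrightarrow> 0"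
      by (rule FT_tendsto_ft[OF sk s L])
    show "(\<lambda>k. norm2 lborel (\<lambda>x. ft (\<lambda>x. cutoff (real k) f x + c * cutoff (real k) g x) x - (FT f x + c * FT g x))) \<longlonglongrightarrow> 0"
      unfolding ftl
    proof (rule Lim_null_comparison[OF always_eventually])
      show "\<forall>k. norm (norm2 lborel (\<lambda>x. (ft (cutoff (real k) f) x + c * ft (cutoff (real k) g) x) - (FT f x + c * FT g x)))
        \<le> norm2 lborel (\<lambda>x. ft (cutoff (real k) f) x - FT f x) + cmod c * norm2 lborel (\<lambda>x. ft (cutoff (real k) g) x - FT g x)"
        using lin[OF ft_norm2_le(1)[OF i] ft_norm2_le(1)[OF j] FT_spec(1)[OF f] FT_spec(1)[OF g]] by simp
      show "(\<lambda>k. norm2 lborel (\<lambda>x. ft (cutoff (real k) f) x - FT f x) + cmod c * norm2 lborel (\<lambda>x. ft (cutoff (real k) g) x - FT g x)) \<longlonglongrightarrow> 0"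
        by (intro tendsto_add_zero tendsto_mult_right_zero FT_spec f g)
    qed
  qed
qed

lemma FT_isometry:
  assumes "square_int lborel f" shows "norm2 lborel (FT f) = norm2 lborel f"
  using FT_norm2_diff_ft[OF assms, of "\<lambda>x. 0"] by (simp add: ft_def)

lemma FT_norm2_diff:
  assumes f: "square_int lborel f" and g: "square_int lborel g"
  shows "norm2 lborel (\<lambda>x. FT f x - FT g x) = norm2 lborel (\<lambda>x. f x - g x)"
proof -
  have "norm2 lborel (\<lambda>x. FT f x - FT g x) = norm2 lborel (FT (\<lambda>x. f x + (-1) * g x))"
    using FT_linear[OF f g, of "-1"] FT_spec(1)[OF f] FT_spec(1)[OF g] FT_spec(1)[OF square_int_diff(1)[OF f g]]
    by (intro norm2_cong_AE) (auto simp: square_int_def)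
  also have "\<dots> = norm2 lborel (\<lambda>x. f x + (-1) * g x)"
    by (rule FT_isometry) (use square_int_diff(1)[OF f g] in simp)
  finally show ?thesis by simp
qed

lemma FT_cong_AE:
  assumes "square_int lborel f" "square_int lborel g" "AE x in lborel. f x = g x"
  shows "AE x in lborel. FT f x = FT g x"
  using FT_norm2_diff[OF assms(1,2)] AE_eq_norm2[OF assms(1,2)] assms(3)
    AE_eq_norm2[OF FT_spec(1)[OF assms(1)] FT_spec(1)[OF assms(2)]] by simp

lemma FT_inject:
  assumes "square_int lborel f" "square_int lborel g" "AE x in lborel. FT f x = FT g x"
  shows "AE x in lborel. f x = g x"
  using FT_norm2_diff[OF assms(1,2)] AE_eq_norm2[OF assms(1,2)] assms(3)
    AE_eq_norm2[OF FT_spec(1)[OF assms(1)] FT_spec(1)[OF assms(2)]] by simp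

lemma inner2_polarization:
  assumes f: "square_int M f" and g: "square_int M g"
  shows "(norm2 M (\<lambda>x. f x + c * g x))\<^sup>2 = (norm2 M f)\<^sup>2 + 2 * Re (cnj c * inner2 M f g) + (cmod c)\<^sup>2 * (norm2 M g)\<^sup>2"
proof -
  have i: "integrable M (\<lambda>x. f x * cnj (g x))" using square_int_mult_integrable[OF f g] by simp
  have i2: "integrable M (\<lambda>x. (cmod (f x))\<^sup>2)" "integrable M (\<lambda>x. (cmod (g x))\<^sup>2)" using f g by (auto simp: square_int_def)
  have p: "(cmod (a + c * b))\<^sup>2 = (cmod a)\<^sup>2 + 2 * Re (cnj c * (a * cnj b)) + (cmod c)\<^sup>2 * (cmod b)\<^sup>2" for a b
    unfolding cmod_power2 by (simp add: power2_eq_square algebra_simps)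
  have "(norm2 M (\<lambda>x. f x + c * g x))\<^sup>2
     = (\<integral>x. (cmod (f x))\<^sup>2 + 2 * Re (cnj c * (f x * cnj (g x))) + (cmod c)\<^sup>2 * (cmod (g x))\<^sup>2 \<partial>M)"
    unfolding norm2_power2 p ..
  also have "\<dots> = (\<integral>x. (cmod (f x))\<^sup>2 \<partial>M) + 2 * (\<integral>x. Re (cnj c * (f x * cnj (g x))) \<partial>M) + (cmod c)\<^sup>2 * (\<integral>x. (cmod (g x))\<^sup>2 \<partial>M)"
  proof -
    define r where "r x = Re (cnj c * (f x * cnj (g x)))" for x
    have "integrable M r" unfolding r_def[abs_def] by (intro integrable_Re integrable_mult_right i)
    with i2 show ?thesis unfolding r_def[symmetric] by simp
  qed
  also have "(\<integral>x. Re (cnj c * (f x * cnj (g x))) \<partial>M) = Re (\<integral>x. cnj c * (f x * cnj (g x)) \<partial>M)"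
    by (intro integral_Re integrable_mult_right i)
  also have "(\<integral>x. cnj c * (f x * cnj (g x)) \<partial>M) = cnj c * inner2 M f g"
    unfolding inner2_def by (rule integral_mult_right_zero)
  finally show ?thesis by (simp only: norm2_power2)
qed

theorem FT_Parseval:
  assumes f: "square_int lborel f" and g: "square_int lborel g"
  shows "inner2 lborel (FT f) (FT g) = inner2 lborel f g"
proof -
  have "Re (cnj c * inner2 lborel (FT f) (FT g)) = Re (cnj c * inner2 lborel f g)" for c
  proof -
    have "norm2 lborel (\<lambda>x. FT f x + c * FT g x) = norm2 lborel (FT (\<lambda>x. f x + c * g x))"
      using FT_linear[OF f g, of c] FT_spec(1)[OF f] FT_spec(1)[OF g] FT_spec(1)[OF square_int_add(1)[OF f square_int_cmult[OF g, of c]]]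
      by (intro norm2_cong_AE) (auto simp: square_int_def)
    also have "\<dots> = norm2 lborel (\<lambda>x. f x + c * g x)" by (intro FT_isometry square_int_add square_int_cmult f g)
    finally have "(norm2 lborel (\<lambda>x. FT f x + c * FT g x))\<^sup>2 = (norm2 lborel (\<lambda>x. f x + c * g x))\<^sup>2" by simp
    then show ?thesis
      unfolding inner2_polarization[OF f g] inner2_polarization[OF FT_spec(1)[OF f] FT_spec(1)[OF g]]
      by (simp add: FT_isometry f g)
  qed
  \<comment> \<open>Polarization: c = 1 compares the real parts and c = \<i> the imaginary
    parts.\<close>
  from this[of 1] this[of "\<i>"] show ?thesis by (simp add: complex_eq_iff)
qed

text \<open>Extends the Fubini identity from cutoffs to L2. Its role is to identify
  \<open>IFT\<close> as the adjoint of \<open>FT\<close>.\<close>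

lemma FT_multiplication_formula:
  assumes f: "square_int lborel f" and g: "square_int lborel g"
  shows "(\<integral>x. FT f x * g x \<partial>lborel) = (\<integral>x. f x * FT g x \<partial>lborel)"
proof -
  have bf: "bdd_supp (cutoff (real k) f)" and bg: "bdd_supp (cutoff (real k) g)" for k
    using f g by (auto intro!: bdd_supp_cutoff simp: square_int_def)
  note i = bdd_supp_integrable[OF bf] and j = bdd_supp_integrable[OF bg]
  have lim: "(\<lambda>k. inner2 lborel (F k) (G k)) \<longlonglongrightarrow> inner2 lborel F' G'"
    if "\<And>k. square_int lborel (F k)" "\<And>k. square_int lborel (G k)" "square_int lborel F'" "square_int lborel G'"
      and l: "(\<lambda>k. norm2 lborel (\<lambda>x. F k x - F' x)) \<longlonglongrightarrow> 0" "(\<lambda>k. norm2 lborel (\<lambda>x. G k x - G' x)) \<longlonglongrightarrow> 0"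
    for F G :: "nat \<Rightarrow> 'a \<Rightarrow> complex" and F' G'
  proof (rule LIM_zero_cancel, rule Lim_null_comparison[OF always_eventually])
    show "\<forall>k. norm (inner2 lborel (F k) (G k) - inner2 lborel F' G')
       \<le> norm2 lborel (\<lambda>x. F k x - F' x) * norm2 lborel (G k) + norm2 lborel F' * norm2 lborel (\<lambda>x. G k x - G' x)"
    proof
      fix k
      have "inner2 lborel (F k) (G k) - inner2 lborel F' G' = inner2 lborel (\<lambda>x. F k x - F' x) (G k) + cnj (inner2 lborel (\<lambda>x. G k x - G' x) F')"
        using that by (simp add: inner2_diff_left inner2_commute[of lborel F'])
      also have "cmod \<dots> \<le> norm2 lborel (\<lambda>x. F k x - F' x) * norm2 lborel (G k) + norm2 lborel (\<lambda>x. G k x - G' x) * norm2 lborel F'"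
        unfolding complex_mod_cnj[symmetric, of "inner2 lborel (\<lambda>x. G k x - G' x) F'"]
        by (intro order_trans[OF norm_triangle_ineq] add_mono norm_inner2_le square_int_diff that)
           (simp only: complex_mod_cnj, intro norm_inner2_le square_int_diff that)
      finally show "norm (inner2 lborel (F k) (G k) - inner2 lborel F' G')
       \<le> norm2 lborel (\<lambda>x. F k x - F' x) * norm2 lborel (G k) + norm2 lborel F' * norm2 lborel (\<lambda>x. G k x - G' x)"
        by (simp add: mult.commute)
    qed
    have "(\<lambda>k. norm2 lborel (\<lambda>x. F k x - F' x) * norm2 lborel (G k)) \<longlonglongrightarrow> 0 * norm2 lborel G'"
      by (intro tendsto_mult l norm2_tendsto that)
    moreover have "(\<lambda>k. norm2 lborel F' * norm2 lborel (\<lambda>x. G k x - G' x)) \<longlonglongrightarrow> 0"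
      by (intro tendsto_mult_right_zero l)
    ultimately show "(\<lambda>k. norm2 lborel (\<lambda>x. F k x - F' x) * norm2 lborel (G k) + norm2 lborel F' * norm2 lborel (\<lambda>x. G k x - G' x)) \<longlonglongrightarrow> 0"
      by (intro tendsto_add_zero) auto
  qed
  have c: "(\<lambda>k. norm2 lborel (\<lambda>x. cnj (h k x) - cnj (h' x))) \<longlonglongrightarrow> 0" if "(\<lambda>k. norm2 lborel (\<lambda>x. h k x - h' x)) \<longlonglongrightarrow> 0"
    for h and h' :: "'a \<Rightarrow> complex"
    using that by (simp add: norm2_cnj flip: complex_cnj_diff)
  have A: "(\<lambda>k. inner2 lborel (ft (cutoff (real k) f)) (\<lambda>x. cnj (cutoff (real k) g x))) \<longlonglongrightarrow> inner2 lborel (FT f) (\<lambda>x. cnj (g x))"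
    by (intro lim ft_norm2_le i j square_int_cnj FT_spec f g c cutoff_tendsto)
  have B: "(\<lambda>k. inner2 lborel (cutoff (real k) f) (\<lambda>x. cnj (ft (cutoff (real k) g) x))) \<longlonglongrightarrow> inner2 lborel f (\<lambda>x. cnj (FT g x))"
    by (intro lim ft_norm2_le i j square_int_cnj FT_spec f g c cutoff_tendsto)
  have "inner2 lborel (ft (cutoff (real k) f)) (\<lambda>x. cnj (cutoff (real k) g x)) = inner2 lborel (cutoff (real k) f) (\<lambda>x. cnj (ft (cutoff (real k) g) x))" for k
    using ft_multiplication_formula[OF i(1) j(1), of k k] by (simp add: inner2_def)
  with A B have "inner2 lborel (FT f) (\<lambda>x. cnj (g x)) = inner2 lborel f (\<lambda>x. cnj (FT g x))"
    by (intro LIMSEQ_unique[OF A]) simp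
  then show ?thesis by (simp add: inner2_def)
qed

lemma IFT_square_int: "square_int lborel g \<Longrightarrow> square_int lborel (IFT g)"
  unfolding IFT_def[abs_def] by (intro square_int_cnj FT_spec)

lemma FT_adjoint:
  assumes "square_int lborel f" "square_int lborel g"
  shows "inner2 lborel (FT f) g = inner2 lborel f (IFT g)"
  using FT_multiplication_formula[OF assms(1) square_int_cnj[OF assms(2)]] by (simp add: inner2_def IFT_def)

lemma inner2_eq_imp_AE_eq:
  assumes "square_int M f" "square_int M g" "\<And>h. square_int M h \<Longrightarrow> inner2 M f h = inner2 M g h"
  shows "AE x in M. f x = g x"
proof -
  have d: "square_int M (\<lambda>x. f x - g x)" by (intro square_int_diff assms)
  have "complex_of_real ((norm2 M (\<lambda>x. f x - g x))\<^sup>2) = 0"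
    unfolding inner2_self[symmetric] inner2_diff_left[OF assms(1,2) d] using assms(3)[OF d] by simp
  then show ?thesis by (simp add: AE_eq_norm2 assms)
qed

lemma IFT_Parseval:
  assumes f: "square_int lborel f" and g: "square_int lborel g"
  shows "inner2 lborel (IFT f) (IFT g) = inner2 lborel f g"
proof -
  have c: "inner2 lborel (\<lambda>x. cnj (F x)) (\<lambda>x. cnj (G x)) = cnj (inner2 lborel F G)" for F G :: "'a \<Rightarrow> complex"
    unfolding inner2_def Bochner_Integration.integral_cnj[symmetric] by simp
  show ?thesis
    unfolding IFT_def[abs_def] c FT_Parseval[OF square_int_cnj[OF f] square_int_cnj[OF g]] by simp
qed

text \<open>For every test function h, adjointness and the isometry of \<open>IFT\<close> give <FT
  (IFT g), h> = <IFT g, IFT h> = <g, h>.\<close>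

theorem FT_IFT:
  assumes g: "square_int lborel g"
  shows "AE x in lborel. FT (IFT g) x = g x"
proof (rule inner2_eq_imp_AE_eq)
  fix h :: "'a \<Rightarrow> complex" assume h: "square_int lborel h"
  show "inner2 lborel (FT (IFT g)) h = inner2 lborel g h"
    by (simp add: FT_adjoint[OF IFT_square_int[OF g] h] IFT_Parseval g h)
qed (intro IFT_square_int FT_spec g)+

text \<open>Applying \<open>IFT\<close> to each slice would choose a representative for each
  \<open>t\<close> independently and lose joint measurability. The integral transforms of the
  cutoffs are explicit, hence jointly measurable, and the parametric L2 limit preserves
  this.\<close>

lemma partial_inverse_transform:
  fixes h :: "'a::euclidean_space \<times> real \<Rightarrow> complex"
  assumes [measurable]: "h \<in> borel_measurable lborel2" and h: "\<And>t. square_int lborel (\<lambda>\<xi>. h (\<xi>, t))"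
  shows "\<exists>u \<in> borel_measurable lborel2.
    \<forall>t. square_int lborel (\<lambda>x. u (x, t)) \<and> (AE \<xi> in lborel. FT (\<lambda>x. u (x, t)) \<xi> = h (\<xi>, t))"
proof -
  define hk where "hk k t = cutoff (real k) (\<lambda>\<xi>. cnj (h (\<xi>, t)))" for k t
  have b: "bdd_supp (hk k t)" for k t unfolding hk_def by (intro bdd_supp_cutoff) measurable
  note i = bdd_supp_integrable[OF b]
  have lim: "(\<lambda>k. norm2 lborel (\<lambda>\<xi>. hk k t \<xi> - cnj (h (\<xi>, t)))) \<longlonglongrightarrow> 0" for t
    unfolding hk_def by (intro cutoff_tendsto square_int_cnj h)
  have [measurable]: "(\<lambda>p. hk k (snd p) (fst p)) \<in> borel_measurable lborel2" for k
    unfolding hk_def cutoff_def by measurable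
  have hm [measurable]: "(\<lambda>p. ft (hk k (snd p)) (fst p)) \<in> borel_measurable lborel2" for k
    unfolding ft_def hk_def cutoff_def by measurable
  define v where "v k p = cnj (ft (hk k (snd p)) (fst p))" for k p
  have vm: "v k \<in> borel_measurable lborel2" for k unfolding v_def[abs_def] by measurable
  have vs: "square_int lborel (\<lambda>x. v k (x, t))" for k t
    unfolding v_def by (simp, intro square_int_cnj ft_norm2_le i)
  have vl: "(\<lambda>k. norm2 lborel (\<lambda>x. v k (x, t) - IFT (\<lambda>\<xi>. h (\<xi>, t)) x)) \<longlonglongrightarrow> 0" for t
    using FT_tendsto_ft[OF i square_int_cnj[OF h] lim, of t]
    by (simp add: v_def IFT_def norm2_cnj flip: complex_cnj_diff)
  from L2_limit_parametric[OF lborel.sigma_finite_measure_axioms vm vs norm2_Cauchy[OF vs IFT_square_int[OF h] vl]]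
  obtain u where u: "u \<in> borel_measurable lborel2" "\<And>t. square_int lborel (\<lambda>x. u (x, t))"
    "\<And>t. (\<lambda>k. norm2 lborel (\<lambda>x. v k (x, t) - u (x, t))) \<longlonglongrightarrow> 0" by auto
  have "AE \<xi> in lborel. FT (\<lambda>x. u (x, t)) \<xi> = h (\<xi>, t)" for t
  proof -
    have "AE x in lborel. u (x, t) = IFT (\<lambda>\<xi>. h (\<xi>, t)) x"
      by (rule norm2_limit_AE_unique[OF vs u(2) IFT_square_int[OF h] u(3) vl])
    from FT_cong_AE[OF u(2) IFT_square_int[OF h] this] FT_IFT[OF h, of t] show ?thesis
      by eventually_elim simp
  qed
  with u(1,2) show ?thesis by blast
qed

section \<open>The damped Duhamel kernel\<close>

text \<open>The retarded kernel exp (- (e + \<i>\<mu>) \<tau>) for \<tau> > 0. With \<mu> =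
  |\<xi>|^2 it is the Fourier multiplier of the free evolution, damped by exp (- e \<tau>).\<close>

definition damped_kernel :: "real \<Rightarrow> real \<Rightarrow> real \<Rightarrow> complex" where
  "damped_kernel e \<mu> \<tau> = (if 0 < \<tau> then complex_of_real (exp (- (e * \<tau>))) * cis (- (\<tau> * \<mu>)) else 0)"

lemma damped_kernel_measurable [measurable]:
  assumes [measurable]: "f \<in> borel_measurable N" "g \<in> borel_measurable N"
  shows "(\<lambda>p. damped_kernel e (f p) (g p)) \<in> borel_measurable N"
  unfolding damped_kernel_def by measurable

lemma norm_damped_kernel_le: "0 \<le> e \<Longrightarrow> cmod (damped_kernel e \<mu> \<tau>) \<le> 1"
  by (auto simp: damped_kernel_def norm_mult mult_nonneg_nonneg)

lemma damped_kernel_cis: "damped_kernel e \<mu> \<tau> * cis (- (\<tau> * l)) = damped_kernel e (\<mu> + l) \<tau>"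
  by (simp add: damped_kernel_def cis_mult algebra_simps)

lemma damped_kernel_eq_indicator: "damped_kernel e \<mu> \<tau> = indicator {0<..} \<tau> *\<^sub>R exp (- (Complex e \<mu>) * complex_of_real \<tau>)"
proof -
  have "exp (- (Complex e \<mu>) * complex_of_real \<tau>) = complex_of_real (exp (- (e * \<tau>))) * cis (- (\<tau> * \<mu>))"
    by (subst exp_eq_polar) (simp add: mult.commute)
  then show ?thesis by (simp add: damped_kernel_def indicator_def)
qed

lemma damped_kernel_integrable:
  assumes "0 < e"
  shows "integrable lborel (damped_kernel e \<mu>)"
proof (rule Bochner_Integration.integrable_bound)
  show "integrable lborel (\<lambda>x. indicator {0 <..} x *\<^sub>R exp (- (x * e)))"
    using integrable_I0i_exp_mscale[OF assms] by (simp add: set_integrable_def)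
  show "damped_kernel e \<mu> \<in> borel_measurable lborel" by measurable
qed (auto simp: damped_kernel_def norm_mult mult.commute)

lemma damped_kernel_integral:
  assumes e: "0 < e"
  shows "(\<integral>\<tau>. damped_kernel e \<mu> \<tau> \<partial>lborel) = 1 / Complex e \<mu>"
proof -
  let ?c = "Complex e \<mu>"
  have c: "?c \<noteq> 0" using e by (simp add: complex_eq_iff)
  let ?F = "\<lambda>\<tau>::real. - exp (- ?c * complex_of_real \<tau>) / ?c"
  have "(LBINT \<tau>=0..\<infinity>. exp (- ?c * complex_of_real \<tau>)) = 0 - (- 1 / ?c)"
  proof (rule interval_integral_FTC_integrable)
    show "(?F has_vector_derivative exp (- ?c * complex_of_real x)) (at x)" for x
      using c by (auto intro!: derivative_eq_intros has_vector_derivative_real_field simp: field_simps)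
    show "isCont (\<lambda>\<tau>. exp (- ?c * complex_of_real \<tau>)) x" for x
      by (intro continuous_intros)
    show "set_integrable lborel (einterval 0 \<infinity>) (\<lambda>\<tau>. exp (- ?c * complex_of_real \<tau>))"
      using damped_kernel_integrable[OF e, of \<mu>] unfolding set_integrable_def damped_kernel_eq_indicator[abs_def]
      by (simp add: zero_ereal_def)
    have "(?F \<longlongrightarrow> ?F 0) (at_right 0)"
      by (intro tendsto_intros) (use c in auto)
    then show "((?F \<circ> real_of_ereal) \<longlongrightarrow> - 1 / ?c) (at_right 0)"
      unfolding zero_ereal_def by (simp add: ereal_tendsto_simps)
    \<comment> \<open>Positive damping kills the boundary term at infinity; only the one at 0
      remains and gives 1 / c.\<close>
    have "((\<lambda>\<tau>. exp (- (e * \<tau>)) / cmod ?c) \<longlongrightarrow> 0) at_top"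
      using e c by real_asymp
    then have "((\<lambda>\<tau>. cmod (?F \<tau>)) \<longlongrightarrow> 0) at_top"
      by (simp add: norm_divide)
    then have "(?F \<longlongrightarrow> 0) at_top" by (rule tendsto_norm_zero_cancel)
    then show "((?F \<circ> real_of_ereal) \<longlongrightarrow> 0) (at_left \<infinity>)"
      by (simp add: ereal_tendsto_simps)
  qed simp
  then show ?thesis
    unfolding damped_kernel_eq_indicator[abs_def] by (simp add: interval_integral_to_infinity_eq zero_ereal_def set_lebesgue_integral_def)
qed

lemma integral_shift_real:
  fixes f :: "real \<Rightarrow> complex"
  shows "(\<integral>t. f (t - s) \<partial>lborel) = (\<integral>t. f t \<partial>lborel)" "integrable lborel (\<lambda>t. f (t - s)) \<longleftrightarrow> integrable lborel f"
  using lborel_integral_real_affine[of 1 f "-s"] lborel_integrable_real_affine_iff[of 1 f "-s"] by simp_all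

lemma ft_Parseval:
  assumes "integrable lborel f" "square_int lborel f" "integrable lborel g" "square_int lborel g"
  shows "(\<integral>x. f x * cnj (g x) \<partial>lborel) = (\<integral>x. ft f x * cnj (ft g x) \<partial>lborel)"
proof -
  have [measurable]: "FT f \<in> borel_measurable borel" "FT g \<in> borel_measurable borel"
    "ft f \<in> borel_measurable borel" "ft g \<in> borel_measurable borel"
    using FT_spec(1)[OF assms(2)] FT_spec(1)[OF assms(4)] ft_measurable[of f] ft_measurable[of g] assms by (auto simp: square_int_def)
  have "(\<integral>x. ft f x * cnj (ft g x) \<partial>lborel) = inner2 lborel (FT f) (FT g)"
    unfolding inner2_def using FT_eq_ft[OF assms(1,2)] FT_eq_ft[OF assms(3,4)]
    by (intro integral_cong_AE) auto
  then show ?thesis using FT_Parseval[OF assms(2,4)] by (simp add: inner2_def)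
qed

text \<open>At a fixed space frequency the Duhamel operator is a convolution in time, so its time
  transform is a division by the symbol e + \<i>(\<mu> + l). Parseval for integrable L2 functions
  then rewrites the pairing.\<close>

lemma damped_duhamel_Parseval:
  fixes \<alpha> \<beta> :: "real \<Rightarrow> complex"
  assumes e: "0 < e" and \<alpha>: "bdd_supp \<alpha>" and \<beta>: "bdd_supp \<beta>"
  shows "(\<integral>t. (\<integral>s. damped_kernel e \<mu> (t - s) * \<alpha> s \<partial>lborel) * cnj (\<beta> t) \<partial>lborel)
    = (\<integral>l. ft \<alpha> l * cnj (ft \<beta> l) / Complex e (\<mu> + l) \<partial>lborel)"
proof -
  note i = bdd_supp_integrable[OF \<alpha>] and j = bdd_supp_integrable[OF \<beta>]
  have [measurable]: "\<alpha> \<in> borel_measurable borel" using \<alpha> by (simp add: bdd_supp_def)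
  define y where "y t = (\<integral>s. damped_kernel e \<mu> (t - s) * \<alpha> s \<partial>lborel)" for t
  \<comment> \<open>Integrability is checked with \<open>t\<close> as the inner variable: there the
    kernel mass is independent of \<open>s\<close> by translation.\<close>
  have "integrable lborel2 (\<lambda>(s, t). damped_kernel e \<mu> (t - s) * \<alpha> s)"
  proof (rule lborel_pair.Fubini_integrable)
    have "(\<integral>t. cmod (damped_kernel e \<mu> (t - s)) \<partial>lborel) = (\<integral>t. cmod (damped_kernel e \<mu> t) \<partial>lborel)" for s
      using integral_shift_real(1)[of "\<lambda>t. complex_of_real (cmod (damped_kernel e \<mu> t))" s]
      by (simp only: integral_complex_of_real of_real_eq_iff)
    then show "integrable lborel (\<lambda>s. \<integral>t. norm (case (s, t) of (s, t) \<Rightarrow> damped_kernel e \<mu> (t - s) * \<alpha> s) \<partial>lborel)"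
      using i(1) by (simp add: norm_mult)
    show "AE s in lborel. integrable lborel (\<lambda>t. case (s, t) of (s, t) \<Rightarrow> damped_kernel e \<mu> (t - s) * \<alpha> s)"
      using damped_kernel_integrable[OF e] by (simp add: integral_shift_real(2))
  qed measurable
  then have I: "integrable lborel2 (\<lambda>(t, s). damped_kernel e \<mu> (t - s) * \<alpha> s)"
    using lborel_pair.integrable_product_swap by fastforce
  have yi: "integrable lborel y"
    using lborel_pair.integrable_fst'[OF I] by (simp add: y_def[abs_def])
  have yb: "cmod (y t) \<le> (\<integral>s. cmod (\<alpha> s) \<partial>lborel)" for t
  proof -
    have "cmod (y t) \<le> (\<integral>s. cmod (damped_kernel e \<mu> (t - s) * \<alpha> s) \<partial>lborel)" unfolding y_def by (rule integral_norm_bound)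
    also have "\<dots> \<le> (\<integral>s. cmod (\<alpha> s) \<partial>lborel)"
      using i(1) e by (intro integral_mono') (auto simp: norm_mult norm_damped_kernel_le mult_left_le_one_le)
    finally show ?thesis .
  qed
  \<comment> \<open>\<open>y\<close> is integrable and bounded by the L1 norm of \<alpha>, hence
    square integrable.\<close>
  have ys: "square_int lborel y"
    unfolding square_int_def
  proof
    show "y \<in> borel_measurable lborel" using yi by auto
    show "integrable lborel (\<lambda>x. (cmod (y x))\<^sup>2)"
    proof (rule Bochner_Integration.integrable_bound)
      show "integrable lborel (\<lambda>t. (\<integral>s. cmod (\<alpha> s) \<partial>lborel) * cmod (y t))" using yi by auto
      show "(\<lambda>x. (cmod (y x))\<^sup>2) \<in> borel_measurable lborel" using yi by auto
      show "AE t in lborel. norm ((cmod (y t))\<^sup>2) \<le> norm ((\<integral>s. cmod (\<alpha> s) \<partial>lborel) * cmod (y t))"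
      proof (rule AE_I2)
        fix t
        have "(cmod (y t))\<^sup>2 \<le> (\<integral>s. cmod (\<alpha> s) \<partial>lborel) * cmod (y t)"
          using mult_right_mono[OF yb[of t], of "cmod (y t)"] by (simp add: power2_eq_square)
        then show "norm ((cmod (y t))\<^sup>2) \<le> norm ((\<integral>s. cmod (\<alpha> s) \<partial>lborel) * cmod (y t))" by simp
      qed
    qed
  qed
  have fty: "ft y l = ft \<alpha> l / Complex e (\<mu> + l)" for l
  proof -
    have I2: "integrable lborel2 (\<lambda>(t, s). cis (- (t * l)) * (damped_kernel e \<mu> (t - s) * \<alpha> s))"
      by (rule Bochner_Integration.integrable_bound[OF I]) auto
    have "(\<integral>t. cis (- (t * l)) * y t \<partial>lborel) = (\<integral>t. \<integral>s. cis (- (t * l)) * (damped_kernel e \<mu> (t - s) * \<alpha> s) \<partial>lborel \<partial>lborel)"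
      by (simp only: y_def integral_mult_right_zero)
    also have "\<dots> = (\<integral>s. \<integral>t. cis (- (t * l)) * (damped_kernel e \<mu> (t - s) * \<alpha> s) \<partial>lborel \<partial>lborel)"
      by (rule lborel_pair.Fubini_integral[OF I2, symmetric])
    also have "\<dots> = (\<integral>s. cis (- (s * l)) * \<alpha> s * (1 / Complex e (\<mu> + l)) \<partial>lborel)"
    proof (rule Bochner_Integration.integral_cong[OF refl])
      fix s
      have "(\<integral>t. cis (- (t * l)) * (damped_kernel e \<mu> (t - s) * \<alpha> s) \<partial>lborel) = (\<integral>t. cis (- (s * l)) * \<alpha> s * damped_kernel e (\<mu> + l) (t - s) \<partial>lborel)"
      proof (rule Bochner_Integration.integral_cong[OF refl])
        fix t
        have "cis (- (t * l)) = cis (- (s * l)) * cis (- ((t - s) * l))"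
          by (simp add: cis_mult algebra_simps)
        then show "cis (- (t * l)) * (damped_kernel e \<mu> (t - s) * \<alpha> s) = cis (- (s * l)) * \<alpha> s * damped_kernel e (\<mu> + l) (t - s)"
          by (simp add: damped_kernel_cis[symmetric])
      qed
      also have "\<dots> = cis (- (s * l)) * \<alpha> s * (1 / Complex e (\<mu> + l))"
        unfolding integral_mult_right_zero integral_shift_real(1)[of "damped_kernel e (\<mu> + l)" s] damped_kernel_integral[OF e] ..
      finally show "(\<integral>t. cis (- (t * l)) * (damped_kernel e \<mu> (t - s) * \<alpha> s) \<partial>lborel) = cis (- (s * l)) * \<alpha> s * (1 / Complex e (\<mu> + l))" .
    qed
    also have "\<dots> = (\<integral>s. cis (- (s * l)) * \<alpha> s \<partial>lborel) * (1 / Complex e (\<mu> + l))"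
      by (rule integral_mult_left_zero)
    finally show ?thesis by (simp add: ft_def)
  qed
  show ?thesis
    using ft_Parseval[OF yi ys j] by (simp add: fty y_def)
qed

section \<open>Partial Fourier transforms\<close>

definition bdd_supp2 :: "('a::euclidean_space \<times> real \<Rightarrow> complex) \<Rightarrow> bool" where
  "bdd_supp2 f \<longleftrightarrow> f \<in> borel_measurable lborel2 \<and>
     (\<exists>K\<ge>0. \<forall>x t. cmod (f (x, t)) \<le> K \<and> (f (x, t) \<noteq> 0 \<longrightarrow> norm x \<le> K \<and> \<bar>t\<bar> \<le> K))"

lemma bdd_supp2_measurable [measurable_dest]: "bdd_supp2 f \<Longrightarrow> f \<in> borel_measurable lborel2"
  by (simp add: bdd_supp2_def)

lemma bdd_supp2E:
  assumes "bdd_supp2 f"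
  obtains K where "0 \<le> K" "\<And>x t. cmod (f (x, t)) \<le> K" "\<And>x t. K < norm x \<Longrightarrow> f (x, t) = 0"
    "\<And>x t. K < \<bar>t\<bar> \<Longrightarrow> f (x, t) = 0"
proof -
  obtain K where "0 \<le> K" and K: "\<forall>x t. cmod (f (x, t)) \<le> K \<and> (f (x, t) \<noteq> 0 \<longrightarrow> norm x \<le> K \<and> \<bar>t\<bar> \<le> K)"
    using assms unfolding bdd_supp2_def by blast
  show thesis
    by (rule that[of K]) (use \<open>0 \<le> K\<close> K in \<open>auto simp: not_less[symmetric]\<close>)
qed

lemma bdd_supp2_slices:
  assumes "bdd_supp2 f"
  shows "bdd_supp (\<lambda>x. f (x, t))" "bdd_supp (\<lambda>t. f (x, t))"
proof -
  obtain K where K: "0 \<le> K" "\<forall>x t. cmod (f (x, t)) \<le> K \<and> (f (x, t) \<noteq> 0 \<longrightarrow> norm x \<le> K \<and> \<bar>t\<bar> \<le> K)"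
    using assms unfolding bdd_supp2_def by blast
  have [measurable]: "f \<in> borel_measurable lborel2" using assms by (rule bdd_supp2_measurable)
  have "(\<lambda>x. f (x, t)) \<in> borel_measurable lborel" "(\<lambda>t. f (x, t)) \<in> borel_measurable lborel" by measurable
  then show "bdd_supp (\<lambda>x. f (x, t))" "bdd_supp (\<lambda>t. f (x, t))" unfolding bdd_supp_def using K by auto
qed

lemma bdd_supp2_integrable:
  assumes "bdd_supp2 f"
  shows "integrable lborel2 f" "square_int lborel2 f"
proof -
  obtain K where K: "0 \<le> K" "\<forall>x t. cmod (f (x, t)) \<le> K \<and> (f (x, t) \<noteq> 0 \<longrightarrow> norm x \<le> K \<and> \<bar>t\<bar> \<le> K)"
    using assms unfolding bdd_supp2_def by blast
  have "norm p \<le> 2 * K" if "f p \<noteq> 0" for p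
    using norm_Pair_le[of "fst p" "snd p"] K(2)[rule_format, of "fst p" "snd p"] that by simp
  moreover have "cmod (f p) \<le> 2 * K" for p
    using K(2)[rule_format, of "fst p" "snd p"] K(1) by simp
  ultimately have "bdd_supp f"
    unfolding bdd_supp_def using K(1) bdd_supp2_measurable[OF assms] by (intro conjI exI[of _ "2 * K"]) (auto simp: lborel_prod)
  from bdd_supp_integrable[OF this] show "integrable lborel2 f" "square_int lborel2 f"
    by (simp_all add: lborel_prod)
qed

lemma bdd_supp2_mult_bounded:
  assumes "bdd_supp2 f" and m: "m \<in> borel_measurable lborel2" "\<And>p. cmod (m p) \<le> 1"
  shows "bdd_supp2 (\<lambda>p. m p * f p)"
proof -
  obtain K where K: "0 \<le> K" "\<forall>x t. cmod (f (x, t)) \<le> K \<and> (f (x, t) \<noteq> 0 \<longrightarrow> norm x \<le> K \<and> \<bar>t\<bar> \<le> K)"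
    using assms unfolding bdd_supp2_def by blast
  have [measurable]: "f \<in> borel_measurable lborel2" using assms by (auto simp: bdd_supp2_def)
  have le: "cmod (m p * f p) \<le> cmod (f p)" for p
    using m(2)[of p] by (simp add: norm_mult mult_left_le_one_le)
  show ?thesis
    unfolding bdd_supp2_def
  proof (intro conjI exI[of _ K] allI impI K(1))
    show "(\<lambda>p. m p * f p) \<in> borel_measurable lborel2" using m(1) by measurable
    fix x t
    show "cmod (m (x, t) * f (x, t)) \<le> K" using le[of "(x, t)"] K(2) order_trans by blast
    assume "m (x, t) * f (x, t) \<noteq> 0"
    then show "norm x \<le> K" "\<bar>t\<bar> \<le> K" using K(2) by auto
  qed
qed

definition ft1 :: "('a::euclidean_space \<times> real \<Rightarrow> complex) \<Rightarrow> 'a \<times> real \<Rightarrow> complex" where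
  "ft1 f p = ft (\<lambda>x. f (x, snd p)) (fst p)"

definition ft2 :: "('a::euclidean_space \<times> real \<Rightarrow> complex) \<Rightarrow> 'a \<times> real \<Rightarrow> complex" where
  "ft2 f p = ft (\<lambda>t. f (fst p, t)) (snd p)"

lemma ft1_measurable [measurable]:
  assumes [measurable]: "f \<in> borel_measurable lborel2"
  shows "ft1 f \<in> borel_measurable lborel2" "ft2 f \<in> borel_measurable lborel2"
  unfolding ft1_def[abs_def] ft2_def[abs_def] ft_def by measurable

lemma square_int_pairI:
  fixes f g :: "'a::euclidean_space \<times> real \<Rightarrow> complex"
  assumes [measurable]: "f \<in> borel_measurable lborel2" and g: "square_int lborel2 g"
    and eq: "(\<integral>\<^sup>+p. ennreal ((cmod (f p))\<^sup>2) \<partial>lborel2) = (\<integral>\<^sup>+p. ennreal ((cmod (g p))\<^sup>2) \<partial>lborel2)"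
  shows "square_int lborel2 f" "norm2 lborel2 f = norm2 lborel2 g"
proof -
  show s: "square_int lborel2 f" using g unfolding square_int_iff_nn_integral eq by simp
  have "(norm2 lborel2 f)\<^sup>2 = (norm2 lborel2 g)\<^sup>2"
    using eq unfolding nn_integral_square_int[OF g] nn_integral_square_int[OF s] by simp
  then show "norm2 lborel2 f = norm2 lborel2 g"
    using power2_eq_iff_nonneg[OF norm2_nonneg norm2_nonneg] by blast
qed

text \<open>The isometry is used on every slice and integrated by Tonelli.\<close>

lemma ft1_square_int:
  assumes f: "square_int lborel2 f" and sl: "\<And>t. integrable lborel (\<lambda>x. f (x, t))" "\<And>t. square_int lborel (\<lambda>x. f (x, t))"
  shows "square_int lborel2 (ft1 f)" "norm2 lborel2 (ft1 f) = norm2 lborel2 f"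
proof -
  have [measurable]: "f \<in> borel_measurable lborel2" using f by (simp add: square_int_def)
  have "(\<integral>\<^sup>+p. ennreal ((cmod (ft1 f p))\<^sup>2) \<partial>lborel2) = (\<integral>\<^sup>+t. \<integral>\<^sup>+x. ennreal ((cmod (ft1 f (x, t)))\<^sup>2) \<partial>lborel \<partial>lborel)"
    by (rule lborel_pair.nn_integral_snd[symmetric]) measurable
  also have "\<dots> = (\<integral>\<^sup>+t. \<integral>\<^sup>+x. ennreal ((cmod (f (x, t)))\<^sup>2) \<partial>lborel \<partial>lborel)"
    using nn_integral_square_int[OF ft_norm2_le(1)[OF sl]] nn_integral_square_int[OF sl(2)] ft_isometry[OF sl] by (simp add: ft1_def)
  also have "\<dots> = (\<integral>\<^sup>+p. ennreal ((cmod (f p))\<^sup>2) \<partial>lborel2)"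
    by (rule lborel_pair.nn_integral_snd) measurable
  finally show "square_int lborel2 (ft1 f)" "norm2 lborel2 (ft1 f) = norm2 lborel2 f"
    by (intro square_int_pairI[OF _ f]; measurable)+
qed

lemma ft2_square_int:
  assumes f: "square_int lborel2 f" and sl: "\<And>x. integrable lborel (\<lambda>t. f (x, t))" "\<And>x. square_int lborel (\<lambda>t. f (x, t))"
  shows "square_int lborel2 (ft2 f)" "norm2 lborel2 (ft2 f) = norm2 lborel2 f"
proof -
  have [measurable]: "f \<in> borel_measurable lborel2" using f by (simp add: square_int_def)
  have "(\<integral>\<^sup>+p. ennreal ((cmod (ft2 f p))\<^sup>2) \<partial>lborel2) = (\<integral>\<^sup>+x. \<integral>\<^sup>+t. ennreal ((cmod (ft2 f (x, t)))\<^sup>2) \<partial>lborel \<partial>lborel)"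
    by (rule lborel.nn_integral_fst[symmetric]) measurable
  also have "\<dots> = (\<integral>\<^sup>+x. \<integral>\<^sup>+t. ennreal ((cmod (f (x, t)))\<^sup>2) \<partial>lborel \<partial>lborel)"
    using nn_integral_square_int[OF ft_norm2_le(1)[OF sl]] nn_integral_square_int[OF sl(2)] ft_isometry[OF sl] by (simp add: ft2_def)
  also have "\<dots> = (\<integral>\<^sup>+p. ennreal ((cmod (f p))\<^sup>2) \<partial>lborel2)"
    by (rule lborel.nn_integral_fst) measurable
  finally show "square_int lborel2 (ft2 f)" "norm2 lborel2 (ft2 f) = norm2 lborel2 f"
    by (intro square_int_pairI[OF _ f]; measurable)+
qed

lemma bdd_supp_integral_norm_le:
  fixes f :: "'a::euclidean_space \<Rightarrow> complex"
  assumes "\<And>x. cmod (f x) \<le> K" "\<And>x. K < norm x \<Longrightarrow> f x = 0"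
  shows "(\<integral>x. cmod (f x) \<partial>lborel) \<le> K * measure lborel (cball (0::'a) K)"
proof -
  have K: "0 \<le> K" using assms(1) norm_ge_zero order_trans by blast
  have "(\<integral>x. cmod (f x) \<partial>lborel) \<le> (\<integral>x. K * indicator (cball 0 K) x \<partial>(lborel::'a measure))"
    by (rule integral_mono'[OF integrable_mult_right[OF integrable_indicator_cball]]) (use bdd_supp_le_indicator[OF assms] K in auto)
  also have "\<dots> = K * measure lborel (cball (0::'a) K)" by simp
  finally show ?thesis .
qed

lemma bdd_supp_ft1:
  fixes f :: "'a::euclidean_space \<times> real \<Rightarrow> complex"
  assumes "bdd_supp2 f"
  shows "bdd_supp (\<lambda>t. ft1 f (\<xi>, t))"
proof -
  have [measurable]: "f \<in> borel_measurable lborel2" using assms by (rule bdd_supp2_measurable)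
  obtain K where K: "0 \<le> K" "\<And>x t. cmod (f (x, t)) \<le> K" "\<And>x t. K < norm x \<Longrightarrow> f (x, t) = 0"
    "\<And>x t. K < \<bar>t\<bar> \<Longrightarrow> f (x, t) = 0" using assms by (rule bdd_supp2E) blast
  define C where "C = K * measure lborel (cball (0::'a) K) / ft_const TYPE('a)"
  have C: "0 \<le> C" unfolding C_def using K(1) by (intro divide_nonneg_nonneg mult_nonneg_nonneg) (auto intro: less_imp_le[OF ft_const_pos])
  have b: "cmod (ft1 f (\<xi>, t)) \<le> C" for t
  proof -
    have "cmod (ft (\<lambda>x. f (x, t)) \<xi>) \<le> C"
      unfolding C_def by (intro order_trans[OF norm_ft_le] divide_right_mono bdd_supp_integral_norm_le K less_imp_le[OF ft_const_pos])
    then show ?thesis by (simp add: ft1_def)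
  qed
  have z: "ft1 f (\<xi>, t) = 0" if "K < \<bar>t\<bar>" for t using K(4)[OF that] by (simp add: ft1_def ft_def)
  show ?thesis unfolding bdd_supp_def
  proof (intro conjI exI[of _ "max K C"] allI impI)
    show "cmod (ft1 f (\<xi>, t)) \<le> max K C" for t using b[of t] by simp
    show "norm t \<le> max K C" if "ft1 f (\<xi>, t) \<noteq> 0" for t using z[of t] that by force
  qed (use C in \<open>measurable, auto\<close>)
qed

lemma bdd_supp_ft2:
  fixes f :: "'a::euclidean_space \<times> real \<Rightarrow> complex"
  assumes "bdd_supp2 f"
  shows "bdd_supp (\<lambda>x. ft2 f (x, l))"
proof -
  have [measurable]: "f \<in> borel_measurable lborel2" using assms by (rule bdd_supp2_measurable)
  obtain K where K: "0 \<le> K" "\<And>x t. cmod (f (x, t)) \<le> K" "\<And>x t. K < norm x \<Longrightarrow> f (x, t) = 0"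
    "\<And>x t. K < \<bar>t\<bar> \<Longrightarrow> f (x, t) = 0" using assms by (rule bdd_supp2E) blast
  define C where "C = K * measure lborel (cball (0::real) K) / ft_const TYPE(real)"
  have C: "0 \<le> C" unfolding C_def using K(1) by (intro divide_nonneg_nonneg mult_nonneg_nonneg) (auto intro: less_imp_le[OF ft_const_pos])
  have b: "cmod (ft2 f (x, l)) \<le> C" for x
  proof -
    have "cmod (ft (\<lambda>t. f (x, t)) l) \<le> C"
      unfolding C_def by (intro order_trans[OF norm_ft_le] divide_right_mono bdd_supp_integral_norm_le K less_imp_le[OF ft_const_pos]) (simp add: K(4))
    then show ?thesis by (simp add: ft2_def)
  qed
  have z: "ft2 f (x, l) = 0" if "K < norm x" for x using K(3)[OF that] by (simp add: ft2_def ft_def)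
  show ?thesis unfolding bdd_supp_def
  proof (intro conjI exI[of _ "max K C"] allI impI)
    show "cmod (ft2 f (x, l)) \<le> max K C" for x using b[of x] by simp
    show "norm x \<le> max K C" if "ft2 f (x, l) \<noteq> 0" for x using z[of x] that by force
  qed (use C in \<open>measurable, auto\<close>)
qed

text \<open>Space first is the order in which the evolution is explicit at fixed \<xi>; time first
  is the order in which the resolvent bound applies at fixed l. Fubini identifies the two.\<close>

lemma ft_ft1_swap:
  assumes "bdd_supp2 f"
  shows "ft (\<lambda>t. ft1 f (\<xi>, t)) l = ft (\<lambda>x. ft2 f (x, l)) \<xi>"
proof -
  have [measurable]: "f \<in> borel_measurable lborel2" using assms by (rule bdd_supp2_measurable)
  have I: "integrable lborel2 (\<lambda>(x, t). cis (- (t * l)) * (cis (- (x \<bullet> \<xi>)) * f (x, t)))"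
    by (rule Bochner_Integration.integrable_bound[OF bdd_supp2_integrable(1)[OF assms]]) auto
  have "(\<integral>t. \<integral>x. cis (- (t * l)) * (cis (- (x \<bullet> \<xi>)) * f (x, t)) \<partial>lborel \<partial>lborel)
    = (\<integral>x. \<integral>t. cis (- (t * l)) * (cis (- (x \<bullet> \<xi>)) * f (x, t)) \<partial>lborel \<partial>lborel)"
    by (rule lborel_pair.Fubini_integral[OF I])
  also have "\<dots> = (\<integral>x. \<integral>t. cis (- (x \<bullet> \<xi>)) * (cis (- (t * l)) * f (x, t)) \<partial>lborel \<partial>lborel)"
    by (simp only: mult.left_commute)
  finally show ?thesis
    by (simp add: ft_def ft1_def ft2_def)
qed

section \<open>Kato smoothing from a uniform resolvent bound\<close>

text \<open>The resolvent estimate as a sesquilinear form, <(-\<Delta> - z)^(-1) (a f), a g>,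
  written on the Fourier side. Both \<open>f\<close> and \<open>a f\<close> have bounded support and
  bounded values, so the explicit integral \<open>ft\<close> can be used throughout; the potential
  enters only through \<open>a\<close> and \<open>M\<close>.\<close>

locale smoothing =
  fixes a :: "'a::euclidean_space \<Rightarrow> real" and M :: real
  assumes a_measurable [measurable]: "a \<in> borel_measurable borel"
    and M_nonneg: "0 \<le> M"
    and resolvent_bound: "\<And>z (f :: 'a \<Rightarrow> complex) g. z \<notin> \<real> \<Longrightarrow> bdd_supp f \<Longrightarrow> bdd_supp g \<Longrightarrow> bdd_supp (\<lambda>x. complex_of_real (a x) * f x) \<Longrightarrow> bdd_supp (\<lambda>x. complex_of_real (a x) * g x) \<Longrightarrow>
      cmod (\<integral>\<xi>. ft (\<lambda>x. complex_of_real (a x) * f x) \<xi> * cnj (ft (\<lambda>x. complex_of_real (a x) * g x) \<xi>) / (complex_of_real ((norm \<xi>)\<^sup>2) - z) \<partial>lborel)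
        \<le> M * norm2 lborel f * norm2 lborel g"
begin

abbreviation wgt :: "('a \<times> real \<Rightarrow> complex) \<Rightarrow> 'a \<times> real \<Rightarrow> complex" where
  "wgt f \<equiv> (\<lambda>p. complex_of_real (a (fst p)) * f p)"

text \<open>Boundedness of \<open>f\<close> does not pass to \<open>a f\<close> when
  \<open>a\<close> is unbounded, so both are required.\<close>

definition admissible :: "('a \<times> real \<Rightarrow> complex) \<Rightarrow> bool" where
  "admissible f \<longleftrightarrow> bdd_supp2 f \<and> bdd_supp2 (wgt f)"

text \<open>Integrated over \<xi>, this is the double integral over s < t of <exp (- e (t - s)) exp
  (\<i>(t - s)\<Delta>) F(s), G(t)>.\<close>

definition ret_form :: "real \<Rightarrow> ('a \<times> real \<Rightarrow> complex) \<Rightarrow> ('a \<times> real \<Rightarrow> complex) \<Rightarrow> 'a \<Rightarrow> complex" where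
  "ret_form e F G \<xi> = (\<integral>t. (\<integral>s. damped_kernel e ((norm \<xi>)\<^sup>2) (t - s) * ft1 F (\<xi>, s) \<partial>lborel) * cnj (ft1 G (\<xi>, t)) \<partial>lborel)"

abbreviation "L2xt \<equiv> lborel2 :: ('a \<times> real) measure"

lemma admissibleD:
  assumes "admissible f" shows "bdd_supp2 f" "bdd_supp2 (wgt f)"
  using assms by (auto simp: admissible_def)

lemma integral_slice_norm2:
  assumes f: "square_int L2xt f" and sl: "\<And>t. square_int lborel (\<lambda>x. f (x, t))"
  shows "square_int lborel (\<lambda>t. complex_of_real (norm2 lborel (\<lambda>x. f (x, t))))"
    "norm2 lborel (\<lambda>t. complex_of_real (norm2 lborel (\<lambda>x. f (x, t)))) \<le> norm2 L2xt f"
proof -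
  have [measurable]: "f \<in> borel_measurable lborel2" using f by (simp add: square_int_def)
  have m: "(\<lambda>t. complex_of_real (norm2 lborel (\<lambda>x. f (x, t)))) \<in> borel_measurable lborel"
    unfolding norm2_def by measurable
  have "(\<integral>\<^sup>+t. ennreal ((cmod (complex_of_real (norm2 lborel (\<lambda>x. f (x, t)))))\<^sup>2) \<partial>lborel)
      = (\<integral>\<^sup>+t. \<integral>\<^sup>+x. ennreal ((cmod (f (x, t)))\<^sup>2) \<partial>lborel \<partial>lborel)"
    by (simp add: nn_integral_square_int[OF sl])
  also have "\<dots> = ennreal ((norm2 L2xt f)\<^sup>2)"
    unfolding nn_integral_square_int[OF f, symmetric] by (rule lborel_pair.nn_integral_snd) measurable
  finally show "square_int lborel (\<lambda>t. complex_of_real (norm2 lborel (\<lambda>x. f (x, t))))"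
    "norm2 lborel (\<lambda>t. complex_of_real (norm2 lborel (\<lambda>x. f (x, t)))) \<le> norm2 L2xt f"
    using square_int_boundI[OF m, of "norm2 L2xt f"] by auto
qed

lemma integral_slice_nrm1:
  assumes f: "square_int L2xt f" and sl: "\<And>x. square_int lborel (\<lambda>t. f (x, t))"
  shows "square_int lborel (\<lambda>x. complex_of_real (norm2 lborel (\<lambda>t. f (x, t))))"
    "norm2 lborel (\<lambda>x. complex_of_real (norm2 lborel (\<lambda>t. f (x, t)))) \<le> norm2 L2xt f"
proof -
  have [measurable]: "f \<in> borel_measurable lborel2" using f by (simp add: square_int_def)
  have m: "(\<lambda>x. complex_of_real (norm2 lborel (\<lambda>t. f (x, t)))) \<in> borel_measurable lborel"
    unfolding norm2_def by measurable
  have "(\<integral>\<^sup>+x. ennreal ((cmod (complex_of_real (norm2 lborel (\<lambda>t. f (x, t)))))\<^sup>2) \<partial>lborel)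
      = (\<integral>\<^sup>+x. \<integral>\<^sup>+t. ennreal ((cmod (f (x, t)))\<^sup>2) \<partial>lborel \<partial>lborel)"
    by (simp add: nn_integral_square_int[OF sl])
  also have "\<dots> = ennreal ((norm2 L2xt f)\<^sup>2)"
    unfolding nn_integral_square_int[OF f, symmetric] by (rule lborel.nn_integral_fst) measurable
  finally show "square_int lborel (\<lambda>x. complex_of_real (norm2 lborel (\<lambda>t. f (x, t))))"
    "norm2 lborel (\<lambda>x. complex_of_real (norm2 lborel (\<lambda>t. f (x, t)))) \<le> norm2 L2xt f"
    using square_int_boundI[OF m, of "norm2 L2xt f"] by auto
qed

lemma ft2_wgt: "ft2 (wgt f) (x, l) = a x * ft2 f (x, l)"
  unfolding ft2_def by (simp add: ft_cmult)

text \<open>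
  In the time frequency \<open>l\<close> the damped Duhamel operator is the free resolvent at \<open>- l + \<i>e\<close>, up to
  a factor \<open>- \<i>\<close>; Plancherel in time then transfers the resolvent bound.
\<close>

lemma ret_form_damped_le:
  assumes f: "admissible f" and g: "admissible g" and e: "0 < e"
  shows "cmod (\<integral>\<xi>. ret_form e (wgt f) (wgt g) \<xi> \<partial>lborel) \<le> M * norm2 L2xt f * norm2 L2xt g"
proof -
  note f' = admissibleD[OF f] and g' = admissibleD[OF g]
  define T where "T h p = ft1 (ft2 (wgt h)) p" for h p
  have s2: "square_int L2xt (ft2 (wgt h))" if "admissible h" for h
    by (intro ft2_square_int(1) bdd_supp2_integrable bdd_supp_integrable bdd_supp2_slices admissibleD(2)[OF that])
  have sT: "square_int L2xt (T h)" if "admissible h" for h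
    unfolding T_def by (intro ft1_square_int(1) s2 that bdd_supp_integrable bdd_supp_ft2 admissibleD(2)[OF that])
  have T_swap: "T h (\<xi>, l) = ft (\<lambda>t. ft1 (wgt h) (\<xi>, t)) l" if "admissible h" for h \<xi> l
    unfolding T_def by (subst ft_ft1_swap[OF admissibleD(2)[OF that]]) (simp add: ft1_def)
  \<comment> \<open>At fixed \<xi> this is the scalar time Parseval identity with \<mu> =
    |\<xi>|^2.\<close>
  have step1: "ret_form e (wgt f) (wgt g) \<xi> = (\<integral>l. T f (\<xi>, l) * cnj (T g (\<xi>, l)) / Complex e ((norm \<xi>)\<^sup>2 + l) \<partial>lborel)" for \<xi>
    unfolding ret_form_def T_swap[OF f] T_swap[OF g]
    by (rule damped_duhamel_Parseval[OF e bdd_supp_ft1[OF f'(2)] bdd_supp_ft1[OF g'(2)]])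
  have [measurable]: "T f \<in> borel_measurable lborel2" "T g \<in> borel_measurable lborel2"
    using sT[OF f] sT[OF g] by (auto simp: square_int_def)
  have Ceq: "Complex e y = complex_of_real e + \<i> * complex_of_real y" for y by (simp add: complex_eq_iff)
  \<comment> \<open>The damping keeps the denominator at least \<open>e\<close> in modulus, which is
    what justifies exchanging the integrals in \<xi> and l.\<close>
  have I: "integrable L2xt (\<lambda>(\<xi>, l). T f (\<xi>, l) * cnj (T g (\<xi>, l)) / Complex e ((norm \<xi>)\<^sup>2 + l))"
  proof (rule Bochner_Integration.integrable_bound)
    show "integrable L2xt (\<lambda>p. (1 / e) * (cmod (T f p) * cmod (T g p)))"
      by (intro integrable_mult_right square_int_mult_integrable sT f g)
    show "AE p in L2xt. norm (case p of (\<xi>, l) \<Rightarrow> T f (\<xi>, l) * cnj (T g (\<xi>, l)) / Complex e ((norm \<xi>)\<^sup>2 + l))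
        \<le> norm ((1 / e) * (cmod (T f p) * cmod (T g p)))"
    proof (rule AE_I2, clarify)
      fix \<xi> :: 'a and l :: real
      have "e \<le> cmod (Complex e ((norm \<xi>)\<^sup>2 + l))" using abs_Re_le_cmod[of "Complex e ((norm \<xi>)\<^sup>2 + l)"] by simp
      then have "(cmod (T f (\<xi>, l)) * cmod (T g (\<xi>, l))) / cmod (Complex e ((norm \<xi>)\<^sup>2 + l)) \<le> (cmod (T f (\<xi>, l)) * cmod (T g (\<xi>, l))) / e"
        using e by (intro divide_left_mono mult_pos_pos) auto
      then show "norm (T f (\<xi>, l) * cnj (T g (\<xi>, l)) / Complex e ((norm \<xi>)\<^sup>2 + l)) \<le> norm ((1 / e) * (cmod (T f (\<xi>, l)) * cmod (T g (\<xi>, l))))"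
        using e by (simp add: norm_mult norm_divide abs_mult)
    qed
    show "(\<lambda>(\<xi>, l). T f (\<xi>, l) * cnj (T g (\<xi>, l)) / Complex e ((norm \<xi>)\<^sup>2 + l)) \<in> borel_measurable L2xt"
      unfolding Ceq by measurable
  qed
  have sl: "square_int lborel (\<lambda>x. ft2 h (x, l))" if "admissible h" for h l
    by (intro bdd_supp_integrable bdd_supp_ft2 admissibleD(1)[OF that])
  \<comment> \<open>\<open>a\<close> does not depend on time and so commutes with the time
    transform: the slice of \<open>T h\<close> at l is the space transform of \<open>a\<close> times
    \<open>ft2 h (\<cdot>, l)\<close>, to which the resolvent bound applies. Cauchy-Schwarz in l
    finishes the estimate afterwards.\<close>
  have step4: "cmod (\<integral>\<xi>. T f (\<xi>, l) * cnj (T g (\<xi>, l)) / Complex e ((norm \<xi>)\<^sup>2 + l) \<partial>lborel)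
      \<le> M * (norm2 lborel (\<lambda>x. ft2 f (x, l)) * norm2 lborel (\<lambda>x. ft2 g (x, l)))" for l
  proof -
    let ?z = "Complex (- l) e"
    have z: "?z \<notin> \<real>" using e by (auto simp: complex_is_Real_iff)
    have Cz: "Complex e ((norm \<xi>)\<^sup>2 + l) = \<i> * (complex_of_real ((norm \<xi>)\<^sup>2) - ?z)" for \<xi> :: 'a
      by (simp add: complex_eq_iff)
    have "(\<integral>\<xi>. T f (\<xi>, l) * cnj (T g (\<xi>, l)) / Complex e ((norm \<xi>)\<^sup>2 + l) \<partial>lborel)
       = (\<integral>\<xi>. (1 / \<i>) * (T f (\<xi>, l) * cnj (T g (\<xi>, l)) / (complex_of_real ((norm \<xi>)\<^sup>2) - ?z)) \<partial>lborel)"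
      by (simp only: Cz times_divide_times_eq mult_1_left)
    also have "\<dots> = (1 / \<i>) * (\<integral>\<xi>. T f (\<xi>, l) * cnj (T g (\<xi>, l)) / (complex_of_real ((norm \<xi>)\<^sup>2) - ?z) \<partial>lborel)"
      by (rule integral_mult_right_zero)
    finally have "cmod (\<integral>\<xi>. T f (\<xi>, l) * cnj (T g (\<xi>, l)) / Complex e ((norm \<xi>)\<^sup>2 + l) \<partial>lborel)
       = cmod (\<integral>\<xi>. T f (\<xi>, l) * cnj (T g (\<xi>, l)) / (complex_of_real ((norm \<xi>)\<^sup>2) - ?z) \<partial>lborel)"
      by (simp add: norm_mult norm_divide)
    moreover have Th: "T h (\<xi>, l) = ft (\<lambda>x. a x * ft2 h (x, l)) \<xi>" for h \<xi>
      unfolding T_def ft1_def by (simp add: ft2_wgt)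
    moreover have bl: "bdd_supp (\<lambda>x. ft2 h (x, l))" "bdd_supp (\<lambda>x. a x * ft2 h (x, l))" if "admissible h" for h
      using bdd_supp_ft2[OF admissibleD(1)[OF that]] bdd_supp_ft2[OF admissibleD(2)[OF that], of l] by (simp_all add: ft2_wgt)
    ultimately show ?thesis
      using resolvent_bound[OF z bl(1)[OF f] bl(1)[OF g] bl(2)[OF f] bl(2)[OF g]] by (simp add: mult.assoc)
  qed
  have "(\<integral>\<xi>. ret_form e (wgt f) (wgt g) \<xi> \<partial>lborel)
     = (\<integral>l. \<integral>\<xi>. T f (\<xi>, l) * cnj (T g (\<xi>, l)) / Complex e ((norm \<xi>)\<^sup>2 + l) \<partial>lborel \<partial>lborel)"
    unfolding step1 by (rule lborel_pair.Fubini_integral[OF I, symmetric])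
  also have "cmod \<dots> \<le> (\<integral>l. M * (norm2 lborel (\<lambda>x. ft2 f (x, l)) * norm2 lborel (\<lambda>x. ft2 g (x, l))) \<partial>lborel)"
  proof -
    have s: "square_int L2xt (ft2 h)" "norm2 L2xt (ft2 h) = norm2 L2xt h" if "admissible h" for h
      using ft2_square_int[OF bdd_supp2_integrable(2)[OF admissibleD(1)[OF that]] bdd_supp_integrable[OF bdd_supp2_slices(2)[OF admissibleD(1)[OF that]]]] by auto
    note A = integral_slice_norm2[OF s(1)[OF f] sl[OF f]] and B = integral_slice_norm2[OF s(1)[OF g] sl[OF g]]
    show ?thesis
    proof (rule order_trans[OF integral_norm_bound], rule integral_mono')
      show "integrable lborel (\<lambda>l. M * (norm2 lborel (\<lambda>x. ft2 f (x, l)) * norm2 lborel (\<lambda>x. ft2 g (x, l))))"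
        using square_int_mult_integrable(2)[OF A(1) B(1)] by simp
    qed (use step4 M_nonneg in auto)
  qed
  also have "\<dots> = M * (\<integral>l. norm2 lborel (\<lambda>x. ft2 f (x, l)) * norm2 lborel (\<lambda>x. ft2 g (x, l)) \<partial>lborel)"
    by (rule integral_mult_right_zero)
  also have "\<dots> \<le> M * (norm2 L2xt f * norm2 L2xt g)"
  proof (rule mult_left_mono[OF _ M_nonneg])
    have s: "square_int L2xt (ft2 h)" "norm2 L2xt (ft2 h) = norm2 L2xt h" if "admissible h" for h
      using ft2_square_int[OF bdd_supp2_integrable(2)[OF admissibleD(1)[OF that]] bdd_supp_integrable[OF bdd_supp2_slices(2)[OF admissibleD(1)[OF that]]]] by auto
    note A = integral_slice_norm2[OF s(1)[OF f] sl[OF f]] and B = integral_slice_norm2[OF s(1)[OF g] sl[OF g]]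
    have "(\<integral>l. norm2 lborel (\<lambda>x. ft2 f (x, l)) * norm2 lborel (\<lambda>x. ft2 g (x, l)) \<partial>lborel)
      \<le> norm2 lborel (\<lambda>l. complex_of_real (norm2 lborel (\<lambda>x. ft2 f (x, l)))) * norm2 lborel (\<lambda>l. complex_of_real (norm2 lborel (\<lambda>x. ft2 g (x, l))))"
      using integral_mult_le_norm2[OF A(1) B(1)] by simp
    also have "\<dots> \<le> norm2 L2xt (ft2 f) * norm2 L2xt (ft2 g)"
      by (intro mult_mono A(2) B(2)) auto
    finally show "(\<integral>l. norm2 lborel (\<lambda>x. ft2 f (x, l)) * norm2 lborel (\<lambda>x. ft2 g (x, l)) \<partial>lborel) \<le> norm2 L2xt f * norm2 L2xt g"
      by (simp add: s f g)
  qed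
  finally show ?thesis by (simp add: mult.assoc)
qed

text \<open>A majorant in \<xi> for the inner time integrals that does not see the damping.\<close>

definition time_L1 :: "('a \<times> real \<Rightarrow> complex) \<Rightarrow> 'a \<Rightarrow> real" where
  "time_L1 F \<xi> = (\<integral>s. cmod (ft1 F (\<xi>, s)) \<partial>lborel)"

lemma ft1_bdd_supp2_square_int:
  assumes "bdd_supp2 F"
  shows "square_int L2xt (ft1 F)" "norm2 L2xt (ft1 F) = norm2 L2xt F"
  using ft1_square_int[OF bdd_supp2_integrable(2)[OF assms] bdd_supp_integrable[OF bdd_supp2_slices(1)[OF assms]]] by auto

text \<open>The source vanishes outside a bounded time interval, so Cauchy-Schwarz against its
  indicator compares the L1 norm in time with the L2 norm, and Plancherel in space makes the latter
  square integrable in \<xi>.\<close>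

lemma time_L1_square_int:
  assumes F: "bdd_supp2 F"
  shows "square_int lborel (\<lambda>\<xi>. complex_of_real (time_L1 F \<xi>))"
proof -
  have [measurable]: "F \<in> borel_measurable lborel2" using F by (rule bdd_supp2_measurable)
  obtain K where K: "0 \<le> K" "\<And>x t. cmod (F (x, t)) \<le> K" "\<And>x t. K < norm x \<Longrightarrow> F (x, t) = 0"
    "\<And>x t. K < \<bar>t\<bar> \<Longrightarrow> F (x, t) = 0" using F by (rule bdd_supp2E) blast
  let ?I = "\<lambda>t::real. complex_of_real (indicator (cball 0 K) t)"
  have bI: "bdd_supp ?I" unfolding bdd_supp_def using K(1) by (intro conjI exI[of _ "max K 1"]) (auto simp: indicator_def)
  note sF = ft1_bdd_supp2_square_int[OF F]
  have sl: "square_int lborel (\<lambda>t. ft1 F (\<xi>, t))" for \<xi> by (intro bdd_supp_integrable bdd_supp_ft1 F)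
  show ?thesis
  proof (rule square_int_mono(1)[OF integral_slice_nrm1(1)[OF sF(1) sl]])
    show "(\<lambda>\<xi>. complex_of_real (time_L1 F \<xi>)) \<in> borel_measurable lborel" unfolding time_L1_def by measurable
    show "AE \<xi> in lborel. cmod (complex_of_real (time_L1 F \<xi>)) \<le> norm2 lborel ?I * cmod (complex_of_real (norm2 lborel (\<lambda>t. ft1 F (\<xi>, t))))"
    proof (rule AE_I2)
      fix \<xi> :: 'a
      have z: "ft1 F (\<xi>, t) = 0" if "K < \<bar>t\<bar>" for t using K(4)[OF that] by (simp add: ft1_def ft_def)
      have "time_L1 F \<xi> = (\<integral>s. cmod (ft1 F (\<xi>, s)) * cmod (?I s) \<partial>lborel)"
        unfolding time_L1_def by (rule Bochner_Integration.integral_cong) (use z in \<open>auto simp: indicator_def not_le\<close>)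
      also have "\<dots> \<le> norm2 lborel (\<lambda>t. ft1 F (\<xi>, t)) * norm2 lborel ?I"
        by (intro integral_mult_le_norm2 sl bdd_supp_integrable bI)
      finally have "time_L1 F \<xi> \<le> norm2 lborel ?I * norm2 lborel (\<lambda>t. ft1 F (\<xi>, t))" by (simp add: mult.commute)
      moreover have "0 \<le> time_L1 F \<xi>" by (simp add: time_L1_def)
      ultimately show "cmod (complex_of_real (time_L1 F \<xi>)) \<le> norm2 lborel ?I * cmod (complex_of_real (norm2 lborel (\<lambda>t. ft1 F (\<xi>, t))))" by simp
    qed
  qed simp
qed

lemma time_L1_mult_integrable:
  assumes "bdd_supp2 F" "bdd_supp2 G" shows "integrable lborel (\<lambda>\<xi>. time_L1 F \<xi> * time_L1 G \<xi>)"
  using square_int_mult_integrable(2)[OF time_L1_square_int[OF assms(1)] time_L1_square_int[OF assms(2)]]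
  by (simp add: time_L1_def)

lemma ret_form_inner_le:
  assumes F: "bdd_supp2 F" and e: "0 \<le> e"
  shows "cmod (\<integral>s. damped_kernel e \<mu> (t - s) * ft1 F (\<xi>, s) \<partial>lborel) \<le> time_L1 F \<xi>"
proof -
  have i: "integrable lborel (\<lambda>s. cmod (ft1 F (\<xi>, s)))" using bdd_supp_integrable(1)[OF bdd_supp_ft1[OF F]] by (rule integrable_norm)
  have "cmod (\<integral>s. damped_kernel e \<mu> (t - s) * ft1 F (\<xi>, s) \<partial>lborel) \<le> (\<integral>s. cmod (damped_kernel e \<mu> (t - s) * ft1 F (\<xi>, s)) \<partial>lborel)"
    by (rule integral_norm_bound)
  also have "\<dots> \<le> time_L1 F \<xi>"
    unfolding time_L1_def using i e
    by (intro integral_mono') (auto simp: norm_mult norm_damped_kernel_le mult_left_le_one_le)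
  finally show ?thesis .
qed

lemma ret_form_le:
  assumes F: "bdd_supp2 F" and G: "bdd_supp2 G" and e: "0 \<le> e"
  shows "cmod (ret_form e F G \<xi>) \<le> time_L1 F \<xi> * time_L1 G \<xi>"
proof -
  have i: "integrable lborel (\<lambda>s. cmod (ft1 G (\<xi>, s)))" using bdd_supp_integrable(1)[OF bdd_supp_ft1[OF G]] by (rule integrable_norm)
  have "cmod (ret_form e F G \<xi>) \<le> (\<integral>t. cmod ((\<integral>s. damped_kernel e ((norm \<xi>)\<^sup>2) (t - s) * ft1 F (\<xi>, s) \<partial>lborel) * cnj (ft1 G (\<xi>, t))) \<partial>lborel)"
    unfolding ret_form_def by (rule integral_norm_bound)
  also have "\<dots> \<le> (\<integral>t. time_L1 F \<xi> * cmod (ft1 G (\<xi>, t)) \<partial>lborel)"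
    using i by (intro integral_mono') (auto simp: norm_mult time_L1_def intro!: mult_right_mono ret_form_inner_le[OF F e, unfolded time_L1_def])
  also have "\<dots> = time_L1 F \<xi> * time_L1 G \<xi>" unfolding time_L1_def by (rule integral_mult_right_zero)
  finally show ?thesis .
qed

lemma ret_form_measurable [measurable]:
  assumes [measurable]: "F \<in> borel_measurable lborel2" "G \<in> borel_measurable lborel2"
  shows "ret_form e F G \<in> borel_measurable lborel"
  unfolding ret_form_def[abs_def] by measurable

lemma ret_form_integrable:
  assumes F: "bdd_supp2 F" and G: "bdd_supp2 G" and e: "0 \<le> e"
  shows "integrable lborel (ret_form e F G)"
proof (rule Bochner_Integration.integrable_bound[OF time_L1_mult_integrable[OF F G]])
  show "ret_form e F G \<in> borel_measurable lborel" using F G by (intro ret_form_measurable bdd_supp2_measurable)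
  show "AE \<xi> in lborel. norm (ret_form e F G \<xi>) \<le> norm (time_L1 F \<xi> * time_L1 G \<xi>)"
    using ret_form_le[OF F G e] by (auto intro: order_trans[OF _ abs_ge_self])
qed

lemma ret_form_tendsto:
  assumes F: "bdd_supp2 F" and G: "bdd_supp2 G" and e: "\<And>k. 0 \<le> e k" "e \<longlonglongrightarrow> 0"
  shows "(\<lambda>k::nat. ret_form (e k) F G \<xi>) \<longlonglongrightarrow> ret_form 0 F G \<xi>"
  unfolding ret_form_def
proof (rule integral_dominated_convergence)
  have [measurable]: "F \<in> borel_measurable lborel2" "G \<in> borel_measurable lborel2"
    using F G by (auto intro: bdd_supp2_measurable)
  have iF: "integrable lborel (\<lambda>s. cmod (ft1 F (\<xi>, s)))" using bdd_supp_integrable(1)[OF bdd_supp_ft1[OF F]] by (rule integrable_norm)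
  have iG: "integrable lborel (\<lambda>s. cmod (ft1 G (\<xi>, s)))" using bdd_supp_integrable(1)[OF bdd_supp_ft1[OF G]] by (rule integrable_norm)
  show "integrable lborel (\<lambda>t. time_L1 F \<xi> * cmod (ft1 G (\<xi>, t)))" using iG by simp
  show "AE t in lborel. norm ((\<integral>s. damped_kernel (e k) ((norm \<xi>)\<^sup>2) (t - s) * ft1 F (\<xi>, s) \<partial>lborel) * cnj (ft1 G (\<xi>, t)))
      \<le> time_L1 F \<xi> * cmod (ft1 G (\<xi>, t))" for k
    using ret_form_inner_le[OF F e(1)[of k]] by (auto simp: norm_mult intro!: mult_right_mono)
  have "(\<lambda>k. \<integral>s. damped_kernel (e k) ((norm \<xi>)\<^sup>2) (t - s) * ft1 F (\<xi>, s) \<partial>lborel) \<longlonglongrightarrow> (\<integral>s. damped_kernel 0 ((norm \<xi>)\<^sup>2) (t - s) * ft1 F (\<xi>, s) \<partial>lborel)" for t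
  proof (rule integral_dominated_convergence[OF _ _ iF])
    show "AE s in lborel. (\<lambda>k. damped_kernel (e k) ((norm \<xi>)\<^sup>2) (t - s) * ft1 F (\<xi>, s)) \<longlonglongrightarrow> damped_kernel 0 ((norm \<xi>)\<^sup>2) (t - s) * ft1 F (\<xi>, s)"
    proof (rule AE_I2, rule tendsto_mult_right)
      fix s
      have "(\<lambda>k. complex_of_real (exp (- (e k * (t - s))))) \<longlonglongrightarrow> complex_of_real (exp (- (0 * (t - s))))"
        by (intro tendsto_intros e(2))
      then show "(\<lambda>k. damped_kernel (e k) ((norm \<xi>)\<^sup>2) (t - s)) \<longlonglongrightarrow> damped_kernel 0 ((norm \<xi>)\<^sup>2) (t - s)"
        using tendsto_mult_right[OF \<open>(\<lambda>k. complex_of_real (exp (- (e k * (t - s))))) \<longlonglongrightarrow> _\<close>, of "cis (- ((t - s) * (norm \<xi>)\<^sup>2))"]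
        by (cases "s < t") (simp_all add: damped_kernel_def)
    qed
    show "AE s in lborel. norm (damped_kernel (e k) ((norm \<xi>)\<^sup>2) (t - s) * ft1 F (\<xi>, s)) \<le> cmod (ft1 F (\<xi>, s))" for k
      using norm_damped_kernel_le[OF e(1)[of k]] by (auto simp: norm_mult intro!: mult_left_le_one_le)
  qed measurable
  then show "AE t in lborel. (\<lambda>k. (\<integral>s. damped_kernel (e k) ((norm \<xi>)\<^sup>2) (t - s) * ft1 F (\<xi>, s) \<partial>lborel) * cnj (ft1 G (\<xi>, t)))
     \<longlonglongrightarrow> (\<integral>s. damped_kernel 0 ((norm \<xi>)\<^sup>2) (t - s) * ft1 F (\<xi>, s) \<partial>lborel) * cnj (ft1 G (\<xi>, t))"
    by (intro AE_I2 tendsto_mult_right)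
  show "(\<lambda>t. (\<integral>s. damped_kernel 0 ((norm \<xi>)\<^sup>2) (t - s) * ft1 F (\<xi>, s) \<partial>lborel) * cnj (ft1 G (\<xi>, t))) \<in> borel_measurable lborel"
    by measurable
  show "(\<lambda>t. (\<integral>s. damped_kernel (e k) ((norm \<xi>)\<^sup>2) (t - s) * ft1 F (\<xi>, s) \<partial>lborel) * cnj (ft1 G (\<xi>, t))) \<in> borel_measurable lborel" for k
    by measurable
qed

text \<open>The damped bound does not involve \<open>e\<close>, and the product of the two
  \<open>time_L1\<close> functions dominates for all \<open>e \<ge> 0\<close>.\<close>

theorem ret_form_retarded_le:
  assumes f: "admissible f" and g: "admissible g"
  shows "cmod (\<integral>\<xi>. ret_form 0 (wgt f) (wgt g) \<xi> \<partial>lborel) \<le> M * norm2 L2xt f * norm2 L2xt g"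
proof -
  note F = admissibleD(2)[OF f] and G = admissibleD(2)[OF g]
  define e where "e k = 1 / real (Suc k)" for k
  have e: "0 < e k" for k by (simp add: e_def)
  have e0: "e \<longlonglongrightarrow> 0" unfolding e_def[abs_def] using LIMSEQ_inverse_real_of_nat by (simp add: inverse_eq_divide)
  have "(\<lambda>k. \<integral>\<xi>. ret_form (e k) (wgt f) (wgt g) \<xi> \<partial>lborel) \<longlonglongrightarrow> (\<integral>\<xi>. ret_form 0 (wgt f) (wgt g) \<xi> \<partial>lborel)"
  proof (rule integral_dominated_convergence[OF _ _ time_L1_mult_integrable[OF F G]])
    show "AE \<xi> in lborel. (\<lambda>k. ret_form (e k) (wgt f) (wgt g) \<xi>) \<longlonglongrightarrow> ret_form 0 (wgt f) (wgt g) \<xi>"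
      by (intro AE_I2 ret_form_tendsto F G e0 less_imp_le[OF e])
    show "AE \<xi> in lborel. norm (ret_form (e k) (wgt f) (wgt g) \<xi>) \<le> time_L1 (wgt f) \<xi> * time_L1 (wgt g) \<xi>" for k
      by (intro AE_I2 ret_form_le F G less_imp_le[OF e])
  qed (intro ret_form_measurable bdd_supp2_measurable F G)+
  from tendsto_norm[OF this] show ?thesis
    by (rule LIMSEQ_le_const2) (auto intro!: ret_form_damped_le f g e)
qed

end

section \<open>Multipliers in the time variable, and pairings over bounded time intervals\<close>

definition time_mult :: "(real \<Rightarrow> complex) \<Rightarrow> ('a \<times> real \<Rightarrow> complex) \<Rightarrow> 'a \<times> real \<Rightarrow> complex" where
  "time_mult m f p = m (snd p) * f p"

text \<open>The weight that turns the oriented integral from \<open>0\<close> to \<open>t\<close> into an integral over the line.\<close>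

definition dsign :: "real \<Rightarrow> real \<Rightarrow> complex" where
  "dsign t s = (if 0 < s \<and> s < t then 1 else if t < s \<and> s < 0 then -1 else 0)"

lemma norm_dsign_le: "cmod (dsign t s) \<le> 1"
  by (simp add: dsign_def)

lemma dsign_measurable [measurable]:
  assumes [measurable]: "f \<in> borel_measurable N" "g \<in> borel_measurable N"
  shows "(\<lambda>p. dsign (f p) (g p)) \<in> borel_measurable N"
  unfolding dsign_def by measurable

lemma time_mult_measurable [measurable]:
  assumes [measurable]: "m \<in> borel_measurable borel" "f \<in> borel_measurable lborel2"
  shows "time_mult m f \<in> borel_measurable lborel2"
  unfolding time_mult_def[abs_def] by measurable

lemma square_int_time_mult:
  fixes f :: "'a::euclidean_space \<times> real \<Rightarrow> complex"
  assumes f: "square_int lborel2 f" and m [measurable]: "m \<in> borel_measurable borel" and le: "\<And>s. cmod (m s) \<le> 1"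
  shows "square_int lborel2 (time_mult m f)" "norm2 lborel2 (time_mult m f) \<le> norm2 lborel2 f"
proof -
  have [measurable]: "f \<in> borel_measurable lborel2" using f by (simp add: square_int_def)
  have "cmod (time_mult m f p) \<le> cmod (f p)" for p
    using le[of "snd p"] by (simp add: time_mult_def norm_mult mult_left_le_one_le)
  then show "square_int lborel2 (time_mult m f)" "norm2 lborel2 (time_mult m f) \<le> norm2 lborel2 f"
    by (intro square_int_mono1[OF f]; measurable)+
qed

lemma bdd_supp2_time_mult:
  assumes "bdd_supp2 f" "m \<in> borel_measurable borel" "\<And>s. cmod (m s) \<le> 1"
  shows "bdd_supp2 (time_mult m f)"
  unfolding time_mult_def[abs_def] using assms by (intro bdd_supp2_mult_bounded) auto

lemma ft1_time_mult: "ft1 (time_mult m F) (\<xi>, s) = m s * ft1 F (\<xi>, s)"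
  by (simp add: ft1_def time_mult_def ft_cmult)

text \<open>An evolution has uniformly bounded slices but need not be square integrable over all
  times; restricting it to a slab makes space-time L2 pairings available.\<close>

lemma slab_square_int:
  fixes u :: "'a::euclidean_space \<times> real \<Rightarrow> complex"
  assumes [measurable]: "u \<in> borel_measurable lborel2"
    and s: "\<And>t. square_int lborel (\<lambda>x. u (x, t))" "\<And>t. norm2 lborel (\<lambda>x. u (x, t)) \<le> C"
  shows "square_int lborel2 (time_mult (indicator (cball 0 K)) u)"
    "norm2 lborel2 (time_mult (indicator (cball 0 K)) u) \<le> C * sqrt (measure lborel (cball (0::real) K))"
proof -
  have C: "0 \<le> C" using s(2)[of 0] norm2_nonneg order_trans by blast
  have m [measurable]: "time_mult (indicator (cball 0 K)) u \<in> borel_measurable lborel2"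
    by (intro time_mult_measurable borel_measurable_indicator) auto
  have "(\<integral>\<^sup>+p. ennreal ((cmod (time_mult (indicator (cball 0 K)) u p))\<^sup>2) \<partial>lborel2)
     = (\<integral>\<^sup>+t. \<integral>\<^sup>+x. ennreal ((cmod (time_mult (indicator (cball 0 K)) u (x, t)))\<^sup>2) \<partial>lborel \<partial>lborel)"
    by (rule lborel_pair.nn_integral_snd[symmetric]) measurable
  also have "\<dots> \<le> (\<integral>\<^sup>+t. ennreal (C\<^sup>2) * indicator (cball (0::real) K) t \<partial>lborel)"
  proof (rule nn_integral_mono)
    fix t :: real
    show "(\<integral>\<^sup>+x. ennreal ((cmod (time_mult (indicator (cball 0 K)) u (x, t)))\<^sup>2) \<partial>lborel) \<le> ennreal (C\<^sup>2) * indicator (cball (0::real) K) t"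
      using nn_integral_square_int[OF s(1)[of t]] s(2)[of t]
      by (cases "t \<in> cball 0 K") (auto simp: time_mult_def intro!: power_mono)
  qed
  also have "\<dots> = ennreal (C\<^sup>2) * emeasure lborel (cball (0::real) K)"
    by (rule nn_integral_cmult_indicator) simp
  also have "\<dots> = ennreal ((C * sqrt (measure lborel (cball (0::real) K)))\<^sup>2)"
    using emeasure_lborel_cball_finite[of "0::real" K]
    by (subst emeasure_eq_ennreal_measure) (auto simp: power_mult_distrib ennreal_mult)
  finally have *: "(\<integral>\<^sup>+p. ennreal ((cmod (time_mult (indicator (cball 0 K)) u p))\<^sup>2) \<partial>lborel2)
    \<le> ennreal ((C * sqrt (measure lborel (cball (0::real) K)))\<^sup>2)" .
  show "square_int lborel2 (time_mult (indicator (cball 0 K)) u)"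
    "norm2 lborel2 (time_mult (indicator (cball 0 K)) u) \<le> C * sqrt (measure lborel (cball (0::real) K))"
    using square_int_boundI[OF m *] C by auto
qed

lemma bdd_supp2_pairing_integrable:
  fixes u :: "'a::euclidean_space \<times> real \<Rightarrow> complex"
  assumes m: "u \<in> borel_measurable lborel2"
    and s: "\<And>t. square_int lborel (\<lambda>x. u (x, t))" "\<And>t. norm2 lborel (\<lambda>x. u (x, t)) \<le> C"
    and F: "square_int lborel2 F" and K: "\<And>x t. K < \<bar>t\<bar> \<Longrightarrow> F (x, t) = 0"
  shows "integrable lborel2 (\<lambda>p. F p * cnj (u p))"
proof -
  have "(\<lambda>p. F p * cnj (u p)) = (\<lambda>p. F p * cnj (time_mult (indicator (cball 0 K)) u p))"
  proof
    fix p show "F p * cnj (u p) = F p * cnj (time_mult (indicator (cball 0 K)) u p)"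
      using K[of "snd p" "fst p"] by (cases "K < \<bar>snd p\<bar>") (auto simp: time_mult_def)
  qed
  then show ?thesis using square_int_mult_integrable(3)[OF F slab_square_int(1)[OF m s]] by simp
qed

lemma ft1_eq_0: "(\<And>x. F (x, t) = 0) \<Longrightarrow> ft1 F (\<xi>, t) = 0"
  by (simp add: ft1_def ft_def)

text \<open>Parseval at each time, integrated over time. The transform of \<open>u\<close> enters
  through a jointly measurable \<open>v\<close>, since \<open>FT\<close> of the slices is chosen
  separately for each \<open>t\<close>.\<close>

lemma slice_Parseval:
  fixes u v :: "'a::euclidean_space \<times> real \<Rightarrow> complex"
  assumes u: "u \<in> borel_measurable lborel2" "\<And>t. square_int lborel (\<lambda>x. u (x, t))" "\<And>t. norm2 lborel (\<lambda>x. u (x, t)) \<le> C"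
    and v: "v \<in> borel_measurable lborel2" "\<And>t. square_int lborel (\<lambda>x. v (x, t))"
    and ft: "\<And>t. AE \<xi> in lborel. FT (\<lambda>x. u (x, t)) \<xi> = v (\<xi>, t)"
    and F: "bdd_supp2 F"
  shows "(\<integral>p. F p * cnj (u p) \<partial>lborel2) = (\<integral>p. ft1 F p * cnj (v p) \<partial>lborel2)"
    "integrable lborel2 (\<lambda>p. ft1 F p * cnj (v p))"
    "norm2 lborel (\<lambda>\<xi>. v (\<xi>, t)) = norm2 lborel (\<lambda>x. u (x, t))"
proof -
  have [measurable]: "FT (\<lambda>x. u (x, t)) \<in> borel_measurable borel" for t
    using FT_spec(1)[OF u(2)] by (auto simp: square_int_def)
  have vm [measurable]: "(\<lambda>x. v (x, t)) \<in> borel_measurable borel" for t using v(2)[of t] by (simp add: square_int_def)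
  show nv: "norm2 lborel (\<lambda>\<xi>. v (\<xi>, t)) = norm2 lborel (\<lambda>x. u (x, t))" for t
    using norm2_cong_AE[OF _ _ ft[of t]] FT_isometry[OF u(2)[of t]] by simp
  obtain K where K: "0 \<le> K" "\<And>x t. cmod (F (x, t)) \<le> K" "\<And>x t. K < norm x \<Longrightarrow> F (x, t) = 0"
    "\<And>x t. K < \<bar>t\<bar> \<Longrightarrow> F (x, t) = 0" using F by (rule bdd_supp2E) blast
  note bF = bdd_supp_integrable[OF bdd_supp2_slices(1)[OF F]]
  have I1: "integrable lborel2 (\<lambda>(x, t). F (x, t) * cnj (u (x, t)))"
    using bdd_supp2_pairing_integrable[OF u bdd_supp2_integrable(2)[OF F] K(4)] by (simp add: case_prod_unfold)
  have sF: "square_int lborel2 (ft1 F)"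
    using ft1_square_int(1)[OF bdd_supp2_integrable(2)[OF F] bF] .
  show I2': "integrable lborel2 (\<lambda>p. ft1 F p * cnj (v p))"
    by (rule bdd_supp2_pairing_integrable[OF v(1,2) _ sF, of C K]) (auto simp: nv u(3) K(4) intro!: ft1_eq_0)
  then have I2: "integrable lborel2 (\<lambda>(x, t). ft1 F (x, t) * cnj (v (x, t)))"
    by (simp add: case_prod_unfold)
  have "(\<integral>x. F (x, t) * cnj (u (x, t)) \<partial>lborel) = (\<integral>\<xi>. ft1 F (\<xi>, t) * cnj (v (\<xi>, t)) \<partial>lborel)" for t
  proof -
    have [measurable]: "FT (\<lambda>x. F (x, t)) \<in> borel_measurable borel" "ft (\<lambda>x. F (x, t)) \<in> borel_measurable borel"
      using FT_spec(1)[OF bF(2)[of t]] ft_norm2_le(1)[OF bF, of t] by (auto simp: square_int_def)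
    have "(\<integral>x. F (x, t) * cnj (u (x, t)) \<partial>lborel) = inner2 lborel (FT (\<lambda>x. F (x, t))) (FT (\<lambda>x. u (x, t)))"
      unfolding FT_Parseval[OF bF(2) u(2)] by (simp add: inner2_def)
    also have "\<dots> = (\<integral>\<xi>. ft (\<lambda>x. F (x, t)) \<xi> * cnj (v (\<xi>, t)) \<partial>lborel)"
      unfolding inner2_def using ft[of t] FT_eq_ft[OF bF, of t] by (intro integral_cong_AE) auto
    finally show ?thesis by (simp add: ft1_def)
  qed
  then show "(\<integral>p. F p * cnj (u p) \<partial>lborel2) = (\<integral>p. ft1 F p * cnj (v p) \<partial>lborel2)"
    using lborel_pair.integral_snd[OF I1] lborel_pair.integral_snd[OF I2] by (simp add: case_prod_unfold)
qed

section \<open>The square of the time-integrated evolution and its bound\<close>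

context smoothing
begin

lemma admissible_time_mult:
  assumes "admissible f" "m \<in> borel_measurable borel" "\<And>s. cmod (m s) \<le> 1"
  shows "admissible (time_mult m f)" "wgt (time_mult m f) = time_mult m (wgt f)"
proof -
  show e: "wgt (time_mult m f) = time_mult m (wgt f)" by (simp add: time_mult_def fun_eq_iff mult.left_commute)
  show "admissible (time_mult m f)" unfolding admissible_def e using assms admissibleD[OF assms(1)] by (auto intro!: bdd_supp2_time_mult)
qed

text \<open>On the Fourier side, \<open>\<integral> exp (- \<i>s\<Delta>) F(s) ds\<close>.\<close>

definition kato_op :: "('a \<times> real \<Rightarrow> complex) \<Rightarrow> 'a \<Rightarrow> complex" where
  "kato_op F \<xi> = (\<integral>s. cis (s * (norm \<xi>)\<^sup>2) * ft1 F (\<xi>, s) \<partial>lborel)"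

lemma ft1_mult_integrable:
  assumes "bdd_supp2 F" "bdd_supp2 G"
    and m: "m \<in> borel_measurable lborel2" "\<And>t s. cmod (m (t, s)) \<le> 1"
  shows "integrable lborel2 (\<lambda>(t, s). m (t, s) * ft1 F (\<xi>, s) * cnj (ft1 G (\<xi>, t)))"
proof -
  have [measurable]: "F \<in> borel_measurable lborel2" "G \<in> borel_measurable lborel2"
    "m \<in> borel_measurable lborel2"
    using assms by (auto intro: bdd_supp2_measurable)
  note i = bdd_supp_integrable(1)[OF bdd_supp_ft1[OF assms(1)], of \<xi>] and j = bdd_supp_integrable(1)[OF bdd_supp_ft1[OF assms(2)], of \<xi>]
  have "integrable lborel2 (\<lambda>(t, s). ft1 F (\<xi>, s) * cnj (ft1 G (\<xi>, t)))"
    by (rule lborel_pair.Fubini_integrable) (use i j in \<open>auto simp: norm_mult\<close>)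
  then show ?thesis
    by (rule Bochner_Integration.integrable_bound) (use m(2) in \<open>auto simp: norm_mult mult.assoc mult_left_le_one_le\<close>)
qed

text \<open>Conjugation exchanges the two time variables, so the adjoint form carries the kernel on
  s > t, the half plane complementary to that of the retarded form.\<close>

lemma cnj_ret_form:
  assumes F: "bdd_supp2 F" and G: "bdd_supp2 G"
  shows "cnj (ret_form 0 G F \<xi>) = (\<integral>t. \<integral>s. cnj (damped_kernel 0 ((norm \<xi>)\<^sup>2) (s - t)) * ft1 F (\<xi>, s) * cnj (ft1 G (\<xi>, t)) \<partial>lborel \<partial>lborel)"
proof -
  have I: "integrable lborel2 (\<lambda>(t, s). cnj (damped_kernel 0 ((norm \<xi>)\<^sup>2) (s - t)) * ft1 F (\<xi>, s) * cnj (ft1 G (\<xi>, t)))"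
    using ft1_mult_integrable[OF F G, of "\<lambda>(t, s). cnj (damped_kernel 0 ((norm \<xi>)\<^sup>2) (s - t))" \<xi>] by (simp add: norm_damped_kernel_le)
  have "cnj (ret_form 0 G F \<xi>) = (\<integral>t. cnj (\<integral>s. damped_kernel 0 ((norm \<xi>)\<^sup>2) (t - s) * ft1 G (\<xi>, s) \<partial>lborel) * ft1 F (\<xi>, t) \<partial>lborel)"
  proof -
    have "cnj (ret_form 0 G F \<xi>) = (\<integral>t. cnj ((\<integral>s. damped_kernel 0 ((norm \<xi>)\<^sup>2) (t - s) * ft1 G (\<xi>, s) \<partial>lborel) * cnj (ft1 F (\<xi>, t))) \<partial>lborel)"
      unfolding ret_form_def by (rule Bochner_Integration.integral_cnj[symmetric])
    then show ?thesis by (simp only: complex_cnj_mult complex_cnj_cnj)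
  qed
  also have "\<dots> = (\<integral>t. \<integral>s. cnj (damped_kernel 0 ((norm \<xi>)\<^sup>2) (t - s)) * ft1 F (\<xi>, t) * cnj (ft1 G (\<xi>, s)) \<partial>lborel \<partial>lborel)"
  proof (rule Bochner_Integration.integral_cong[OF refl])
    fix t
    have "cnj (\<integral>s. damped_kernel 0 ((norm \<xi>)\<^sup>2) (t - s) * ft1 G (\<xi>, s) \<partial>lborel) * ft1 F (\<xi>, t)
      = (\<integral>s. cnj (damped_kernel 0 ((norm \<xi>)\<^sup>2) (t - s) * ft1 G (\<xi>, s)) * ft1 F (\<xi>, t) \<partial>lborel)"
      by (simp only: Bochner_Integration.integral_cnj integral_mult_left_zero)
    also have "\<dots> = (\<integral>s. cnj (damped_kernel 0 ((norm \<xi>)\<^sup>2) (t - s)) * ft1 F (\<xi>, t) * cnj (ft1 G (\<xi>, s)) \<partial>lborel)"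
      by (intro Bochner_Integration.integral_cong refl) simp
    finally show "cnj (\<integral>s. damped_kernel 0 ((norm \<xi>)\<^sup>2) (t - s) * ft1 G (\<xi>, s) \<partial>lborel) * ft1 F (\<xi>, t)
      = (\<integral>s. cnj (damped_kernel 0 ((norm \<xi>)\<^sup>2) (t - s)) * ft1 F (\<xi>, t) * cnj (ft1 G (\<xi>, s)) \<partial>lborel)" .
  qed
  also have "\<dots> = (\<integral>t. \<integral>s. cnj (damped_kernel 0 ((norm \<xi>)\<^sup>2) (s - t)) * ft1 F (\<xi>, s) * cnj (ft1 G (\<xi>, t)) \<partial>lborel \<partial>lborel)"
    by (rule lborel_pair.Fubini_integral[OF I])
  finally show ?thesis .
qed

lemma ret_form_eq:
  "ret_form 0 F G \<xi> = (\<integral>t. \<integral>s. damped_kernel 0 ((norm \<xi>)\<^sup>2) (t - s) * ft1 F (\<xi>, s) * cnj (ft1 G (\<xi>, t)) \<partial>lborel \<partial>lborel)"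
  unfolding ret_form_def by simp

text \<open>The retarded kernel and its adjoint are both 0 on the diagonal s = t, where splitting
  identities therefore fail; the diagonal is null in each slice. The factor \<open>c\<close> is 1
  for the square of \<open>kato_op\<close> and -1 for the oriented Duhamel integral.\<close>

lemma double_integral_diff:
  fixes p q :: "real \<Rightarrow> real \<Rightarrow> complex"
  assumes p: "integrable lborel2 (\<lambda>(t, s). p t s)" and q: "integrable lborel2 (\<lambda>(t, s). q t s)"
    and r: "\<And>t s. s \<noteq> t \<Longrightarrow> r t s = p t s + c * q t s"
    and rm: "(\<lambda>(t, s). r t s) \<in> borel_measurable lborel2"
  shows "(\<integral>t. \<integral>s. r t s \<partial>lborel \<partial>lborel) = (\<integral>t. \<integral>s. p t s \<partial>lborel \<partial>lborel) + c * (\<integral>t. \<integral>s. q t s \<partial>lborel \<partial>lborel)"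
proof -
  have pm [measurable]: "(\<lambda>(t, s). p t s) \<in> borel_measurable lborel2" "(\<lambda>(t, s). q t s) \<in> borel_measurable lborel2"
    "(\<lambda>(t, s). r t s) \<in> borel_measurable lborel2"
    using p q rm by auto
  have "(\<integral>t. \<integral>s. r t s \<partial>lborel \<partial>lborel) = (\<integral>t. \<integral>s. p t s + c * q t s \<partial>lborel \<partial>lborel)"
  proof (rule Bochner_Integration.integral_cong[OF refl], rule integral_cong_AE)
    fix t
    show "AE s in lborel. r t s = p t s + c * q t s"
      using AE_lborel_singleton[of t] by eventually_elim (simp add: r)
    show "r t \<in> borel_measurable lborel" "(\<lambda>s. p t s + c * q t s) \<in> borel_measurable lborel" by measurable
  qed
  also have "\<dots> = (\<integral>(t, s). p t s + c * q t s \<partial>lborel2)"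
    using lborel_pair.integral_fst'[of "\<lambda>(t, s). p t s + c * q t s"] p q by (simp add: case_prod_unfold)
  also have "\<dots> = (\<integral>(t, s). p t s \<partial>lborel2) + c * (\<integral>(t, s). q t s \<partial>lborel2)"
    using p q by (simp add: case_prod_unfold)
  also have "\<dots> = (\<integral>t. \<integral>s. p t s \<partial>lborel \<partial>lborel) + c * (\<integral>t. \<integral>s. q t s \<partial>lborel \<partial>lborel)"
    using lborel_pair.integral_fst'[OF p] lborel_pair.integral_fst'[OF q] by simp
  finally show ?thesis .
qed

text \<open>Expanding the square gives the kernel exp (- \<i>(t - s)\<mu>) over all pairs of times,
  and off the diagonal this is the retarded kernel plus its adjoint.\<close>

lemma kato_op_square:
  assumes F: "bdd_supp2 F"
  shows "kato_op F \<xi> * cnj (kato_op F \<xi>) = ret_form 0 F F \<xi> + cnj (ret_form 0 F F \<xi>)"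
proof -
  have [measurable]: "F \<in> borel_measurable lborel2" using F by (rule bdd_supp2_measurable)
  let ?\<mu> = "(norm \<xi>)\<^sup>2"
  have "kato_op F \<xi> * cnj (kato_op F \<xi>) = (\<integral>t. kato_op F \<xi> * cnj (cis (t * ?\<mu>) * ft1 F (\<xi>, t)) \<partial>lborel)"
    by (simp only: integral_mult_right_zero Bochner_Integration.integral_cnj kato_op_def)
  also have "\<dots> = (\<integral>t. \<integral>s. cis (- ((t - s) * ?\<mu>)) * ft1 F (\<xi>, s) * cnj (ft1 F (\<xi>, t)) \<partial>lborel \<partial>lborel)"
  proof (rule Bochner_Integration.integral_cong[OF refl])
    fix t
    have "kato_op F \<xi> * cnj (cis (t * ?\<mu>) * ft1 F (\<xi>, t)) = (\<integral>s. (cis (s * ?\<mu>) * ft1 F (\<xi>, s)) * cnj (cis (t * ?\<mu>) * ft1 F (\<xi>, t)) \<partial>lborel)"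
      unfolding kato_op_def by (simp only: integral_mult_left_zero)
    also have "\<dots> = (\<integral>s. cis (- ((t - s) * ?\<mu>)) * ft1 F (\<xi>, s) * cnj (ft1 F (\<xi>, t)) \<partial>lborel)"
    proof (intro Bochner_Integration.integral_cong refl)
      fix s
      have "cis (- ((t - s) * ?\<mu>)) = cis (s * ?\<mu>) * cis (- (t * ?\<mu>))" by (simp add: cis_mult algebra_simps)
      then show "(cis (s * ?\<mu>) * ft1 F (\<xi>, s)) * cnj (cis (t * ?\<mu>) * ft1 F (\<xi>, t)) = cis (- ((t - s) * ?\<mu>)) * ft1 F (\<xi>, s) * cnj (ft1 F (\<xi>, t))"
        by (simp add: cis_cnj)
    qed
    finally show "kato_op F \<xi> * cnj (cis (t * ?\<mu>) * ft1 F (\<xi>, t)) = (\<integral>s. cis (- ((t - s) * ?\<mu>)) * ft1 F (\<xi>, s) * cnj (ft1 F (\<xi>, t)) \<partial>lborel)" .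
  qed
  also have "\<dots> = (\<integral>t. \<integral>s. damped_kernel 0 ?\<mu> (t - s) * ft1 F (\<xi>, s) * cnj (ft1 F (\<xi>, t)) \<partial>lborel \<partial>lborel)
     + 1 * (\<integral>t. \<integral>s. cnj (damped_kernel 0 ?\<mu> (s - t)) * ft1 F (\<xi>, s) * cnj (ft1 F (\<xi>, t)) \<partial>lborel \<partial>lborel)"
  proof (rule double_integral_diff)
    show "integrable lborel2 (\<lambda>(t, s). damped_kernel 0 ?\<mu> (t - s) * ft1 F (\<xi>, s) * cnj (ft1 F (\<xi>, t)))"
      using ft1_mult_integrable[OF F F, of "\<lambda>(t, s). damped_kernel 0 ?\<mu> (t - s)" \<xi>] by (simp add: norm_damped_kernel_le)
    show "integrable lborel2 (\<lambda>(t, s). cnj (damped_kernel 0 ?\<mu> (s - t)) * ft1 F (\<xi>, s) * cnj (ft1 F (\<xi>, t)))"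
      using ft1_mult_integrable[OF F F, of "\<lambda>(t, s). cnj (damped_kernel 0 ?\<mu> (s - t))" \<xi>] by (simp add: norm_damped_kernel_le)
    show "cis (- ((t - s) * ?\<mu>)) * ft1 F (\<xi>, s) * cnj (ft1 F (\<xi>, t)) =
      damped_kernel 0 ?\<mu> (t - s) * ft1 F (\<xi>, s) * cnj (ft1 F (\<xi>, t)) + 1 * (cnj (damped_kernel 0 ?\<mu> (s - t)) * ft1 F (\<xi>, s) * cnj (ft1 F (\<xi>, t)))"
      if "s \<noteq> t" for t s
      using that by (cases "s < t") (auto simp: damped_kernel_def cis_cnj algebra_simps)
  qed measurable
  finally show ?thesis unfolding ret_form_eq[symmetric] cnj_ret_form[OF F F, symmetric] by simp
qed

lemma kato_op_measurable [measurable]: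
  assumes [measurable]: "F \<in> borel_measurable lborel2"
  shows "kato_op F \<in> borel_measurable lborel"
  unfolding kato_op_def[abs_def] by measurable

lemma kato_op_square_int:
  assumes F: "bdd_supp2 F" shows "square_int lborel (kato_op F)"
proof (rule square_int_mono1(1)[OF time_L1_square_int[OF F]])
  show "kato_op F \<in> borel_measurable lborel" by (intro kato_op_measurable bdd_supp2_measurable F)
  fix \<xi>
  have "cmod (kato_op F \<xi>) \<le> (\<integral>s. cmod (cis (s * (norm \<xi>)\<^sup>2) * ft1 F (\<xi>, s)) \<partial>lborel)" unfolding kato_op_def by (rule integral_norm_bound)
  then show "cmod (kato_op F \<xi>) \<le> cmod (complex_of_real (time_L1 F \<xi>))" by (simp add: time_L1_def)
qed

abbreviation "sqrt2M \<equiv> sqrt (2 * M)"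

theorem kato_op_bound:
  assumes f: "admissible f"
  shows "norm2 lborel (kato_op (wgt f)) \<le> sqrt2M * norm2 L2xt f"
proof -
  note F = admissibleD(2)[OF f]
  note I = ret_form_integrable[OF F F, of 0, simplified]
  have "complex_of_real ((norm2 lborel (kato_op (wgt f)))\<^sup>2) = (\<integral>\<xi>. ret_form 0 (wgt f) (wgt f) \<xi> + cnj (ret_form 0 (wgt f) (wgt f) \<xi>) \<partial>lborel)"
    unfolding inner2_self[symmetric] inner2_def kato_op_square[OF F] ..
  also have "\<dots> = (\<integral>\<xi>. ret_form 0 (wgt f) (wgt f) \<xi> \<partial>lborel) + cnj (\<integral>\<xi>. ret_form 0 (wgt f) (wgt f) \<xi> \<partial>lborel)"
    using I by simp
  finally have "cmod (complex_of_real ((norm2 lborel (kato_op (wgt f)))\<^sup>2)) \<le> 2 * cmod (\<integral>\<xi>. ret_form 0 (wgt f) (wgt f) \<xi> \<partial>lborel)"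
    using norm_triangle_ineq[of "\<integral>\<xi>. ret_form 0 (wgt f) (wgt f) \<xi> \<partial>lborel" "cnj (\<integral>\<xi>. ret_form 0 (wgt f) (wgt f) \<xi> \<partial>lborel)"]
    by (simp only: complex_mod_cnj mult_2)
  also have "\<dots> \<le> 2 * (M * norm2 L2xt f * norm2 L2xt f)" using ret_form_retarded_le[OF f f] by simp
  also have "\<dots> = (sqrt2M * norm2 L2xt f)\<^sup>2" using M_nonneg by (simp add: power_mult_distrib power2_eq_square)
  finally have "(norm2 lborel (kato_op (wgt f)))\<^sup>2 \<le> (sqrt2M * norm2 L2xt f)\<^sup>2" by (simp add: norm_power)
  then show ?thesis by (rule power2_le_imp_le) (simp add: M_nonneg)
qed

lemma admissible_diff:
  assumes "admissible f" "admissible g"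
  shows "admissible (\<lambda>p. f p - g p)"
proof -
  have d: "bdd_supp2 (\<lambda>p. f p - g p)" if fg: "bdd_supp2 f" "bdd_supp2 g" for f g :: "'a \<times> real \<Rightarrow> complex"
  proof -
    obtain K where K: "0 \<le> K" "\<And>x t. cmod (f (x, t)) \<le> K" "\<And>x t. K < norm x \<Longrightarrow> f (x, t) = 0"
      "\<And>x t. K < \<bar>t\<bar> \<Longrightarrow> f (x, t) = 0" using fg(1) by (rule bdd_supp2E) blast
    obtain L where L: "0 \<le> L" "\<And>x t. cmod (g (x, t)) \<le> L" "\<And>x t. L < norm x \<Longrightarrow> g (x, t) = 0"
      "\<And>x t. L < \<bar>t\<bar> \<Longrightarrow> g (x, t) = 0" using fg(2) by (rule bdd_supp2E) blast
    show ?thesis unfolding bdd_supp2_def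
    proof (intro conjI exI[of _ "K + L"] allI impI)
      show "(\<lambda>p. f p - g p) \<in> borel_measurable lborel2" using fg by (auto intro: bdd_supp2_measurable)
      show "0 \<le> K + L" using K(1) L(1) by simp
      fix x t
      show "cmod (f (x, t) - g (x, t)) \<le> K + L"
        using norm_triangle_ineq4[of "f (x, t)" "g (x, t)"] K(2)[of x t] L(2)[of x t] by linarith
      assume "f (x, t) - g (x, t) \<noteq> 0"
      then have nz: "f (x, t) \<noteq> 0 \<or> g (x, t) \<noteq> 0" by auto
      show "norm x \<le> K + L"
      proof (rule ccontr)
        assume "\<not> norm x \<le> K + L"
        then have "K < norm x" "L < norm x" using K(1) L(1) by linarith+
        then show False using nz K(3)[of x t] L(3)[of x t] by simp
      qed
      show "\<bar>t\<bar> \<le> K + L"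
      proof (rule ccontr)
        assume "\<not> \<bar>t\<bar> \<le> K + L"
        then have "K < \<bar>t\<bar>" "L < \<bar>t\<bar>" using K(1) L(1) by linarith+
        then show False using nz K(4)[of t x] L(4)[of t x] by simp
      qed
    qed
  qed
  show ?thesis
    using d[OF admissibleD(1)[OF assms(1)] admissibleD(1)[OF assms(2)]] d[OF admissibleD(2)[OF assms(1)] admissibleD(2)[OF assms(2)]]
    by (simp add: admissible_def right_diff_distrib)
qed

lemma kato_op_diff:
  assumes F: "bdd_supp2 F" and G: "bdd_supp2 G"
  shows "kato_op (\<lambda>p. F p - G p) \<xi> = kato_op F \<xi> - kato_op G \<xi>"
proof -
  have f1: "ft1 (\<lambda>p. F p - G p) (\<xi>, s) = ft1 F (\<xi>, s) - ft1 G (\<xi>, s)" for s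
    unfolding ft1_def using bdd_supp_integrable(1)[OF bdd_supp2_slices(1)[OF F]] bdd_supp_integrable(1)[OF bdd_supp2_slices(1)[OF G]]
    by (simp add: ft_diff)
  have i: "integrable lborel (\<lambda>s. cis (s * (norm \<xi>)\<^sup>2) * ft1 H (\<xi>, s))" if "bdd_supp2 H" for H
    by (rule bdd_supp_integrable(1)[OF bdd_supp_mult_bounded[OF bdd_supp_ft1[OF that]], of _ 1]) auto
  show ?thesis
    unfolding kato_op_def f1 using Bochner_Integration.integral_diff[OF i[OF F] i[OF G]] by (simp add: right_diff_distrib)
qed

lemma kato_op_diff_bound:
  assumes f: "admissible f" and g: "admissible g"
  shows "norm2 lborel (\<lambda>\<xi>. kato_op (wgt f) \<xi> - kato_op (wgt g) \<xi>) \<le> sqrt2M * norm2 L2xt (\<lambda>p. f p - g p)"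
proof -
  have eq: "wgt (\<lambda>p. f p - g p) = (\<lambda>p. wgt f p - wgt g p)" by (simp add: right_diff_distrib)
  have "kato_op (wgt (\<lambda>p. f p - g p)) = (\<lambda>\<xi>. kato_op (wgt f) \<xi> - kato_op (wgt g) \<xi>)"
    by (intro ext) (simp only: eq kato_op_diff[OF admissibleD(2)[OF f] admissibleD(2)[OF g]])
  then show ?thesis using kato_op_bound[OF admissible_diff[OF f g]] by simp
qed

text \<open>The last condition also removes the points where \<open>a\<close> is large, so that
  truncations are admissible for unbounded \<open>a\<close>.\<close>

definition trunc :: "nat \<Rightarrow> ('a \<times> real \<Rightarrow> complex) \<Rightarrow> 'a \<times> real \<Rightarrow> complex" where
  "trunc k f p = (if cmod (f p) \<le> k \<and> norm (fst p) \<le> k \<and> \<bar>snd p\<bar> \<le> k \<and> \<bar>a (fst p)\<bar> \<le> k then f p else 0)"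

lemma trunc_measurable [measurable]:
  assumes [measurable]: "f \<in> borel_measurable lborel2"
  shows "trunc k f \<in> borel_measurable lborel2"
  unfolding trunc_def[abs_def] by measurable

lemma admissible_trunc:
  assumes [measurable]: "f \<in> borel_measurable lborel2"
  shows "admissible (trunc k f)"
  unfolding admissible_def
proof
  show "bdd_supp2 (trunc k f)" unfolding bdd_supp2_def
    by (intro conjI exI[of _ "real k"]) (auto simp: trunc_def)
  show "bdd_supp2 (wgt (trunc k f))" unfolding bdd_supp2_def
  \<comment> \<open>k^2 bounds the product of \<open>a\<close> with the truncation, and the summand
    k covers the support.\<close>
  proof (intro conjI exI[of _ "real k + (real k)\<^sup>2"] allI impI)
    fix x t
    show "cmod (complex_of_real (a (fst (x, t))) * trunc k f (x, t)) \<le> real k + (real k)\<^sup>2"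
      using mult_mono[of "\<bar>a x\<bar>" "real k" "cmod (f (x, t))" "real k"]
      by (auto simp: trunc_def norm_mult power2_eq_square)
    assume "complex_of_real (a (fst (x, t))) * trunc k f (x, t) \<noteq> 0"
    then show "norm x \<le> real k + (real k)\<^sup>2" "\<bar>t\<bar> \<le> real k + (real k)\<^sup>2"
      by (auto simp: trunc_def split: if_splits intro: add_increasing2)
  qed auto
qed

lemma trunc_tendsto_pointwise: "(\<lambda>k. trunc k f p) \<longlonglongrightarrow> f p"
proof (rule tendsto_eventually)
  let ?m = "max (max (cmod (f p)) (norm (fst p))) (max \<bar>snd p\<bar> \<bar>a (fst p)\<bar>)"
  show "\<forall>\<^sub>F k in sequentially. trunc k f p = f p"
    using eventually_ge_at_top[of "nat \<lceil>?m\<rceil>"]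
  proof eventually_elim
    case (elim k)
    then have "?m \<le> real k" by linarith
    then show ?case by (simp add: trunc_def)
  qed
qed

lemma norm_trunc_le: "cmod (trunc k f p) \<le> cmod (f p)"
  by (simp add: trunc_def)

lemma trunc_tendsto:
  assumes "square_int L2xt f"
  shows "(\<lambda>k. norm2 L2xt (\<lambda>p. trunc k f p - f p)) \<longlonglongrightarrow> 0"
proof (rule norm2_tendsto_dominated[OF assms])
  show "f \<in> borel_measurable lborel2" using assms by (simp add: square_int_def)
  then show "trunc k f \<in> borel_measurable lborel2" for k by measurable
qed (auto intro!: AE_I2 trunc_tendsto_pointwise norm_trunc_le)

lemma trunc_square_int:
  assumes "square_int L2xt f" shows "square_int L2xt (trunc k f)"
  using assms by (intro bdd_supp2_integrable(2) admissibleD admissible_trunc) (simp add: square_int_def)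

text \<open>Weighted integrability of \<open>u\<close> is a conclusion: testing with the truncation
  h of \<open>a u\<close> itself gives |h|^2 as integrand, so its norm squared is at most C times
  its norm, and Fatou removes the truncation.\<close>

lemma smoothing_duality:
  assumes [measurable]: "u \<in> borel_measurable lborel2" and C: "0 \<le> C"
    and le: "\<And>h. admissible h \<Longrightarrow> cmod (\<integral>p. wgt h p * cnj (u p) \<partial>L2xt) \<le> C * norm2 L2xt h"
  shows "square_int L2xt (wgt u)" "norm2 L2xt (wgt u) \<le> C"
proof -
  have m: "wgt u \<in> borel_measurable lborel2" by measurable
  have h: "admissible (trunc k (wgt u))" for k by (rule admissible_trunc[OF m])
  have b: "norm2 L2xt (trunc k (wgt u)) \<le> C" for k
  proof -
    have "(\<integral>p. wgt (trunc k (wgt u)) p * cnj (u p) \<partial>L2xt) = inner2 L2xt (trunc k (wgt u)) (trunc k (wgt u))"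
      unfolding inner2_def by (rule Bochner_Integration.integral_cong) (auto simp: trunc_def)
    then have "(norm2 L2xt (trunc k (wgt u)))\<^sup>2 \<le> C * norm2 L2xt (trunc k (wgt u))"
      using le[OF h[of k]] by (simp add: inner2_self norm_power)
    then show ?thesis using C norm2_nonneg[of L2xt "trunc k (wgt u)"]
      by (cases "norm2 L2xt (trunc k (wgt u)) = 0") (auto simp: power2_eq_square)
  qed
  have "(\<integral>\<^sup>+p. ennreal ((cmod (wgt u p))\<^sup>2) \<partial>L2xt) = (\<integral>\<^sup>+p. liminf (\<lambda>k. ennreal ((cmod (trunc k (wgt u) p))\<^sup>2)) \<partial>L2xt)"
  proof (rule nn_integral_cong)
    fix p
    have "(\<lambda>k. ennreal ((cmod (trunc k (wgt u) p))\<^sup>2)) \<longlonglongrightarrow> ennreal ((cmod (wgt u p))\<^sup>2)"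
      by (intro tendsto_ennrealI tendsto_power tendsto_norm trunc_tendsto_pointwise)
    then show "ennreal ((cmod (wgt u p))\<^sup>2) = liminf (\<lambda>k. ennreal ((cmod (trunc k (wgt u) p))\<^sup>2))"
      by (intro lim_imp_Liminf[symmetric]) auto
  qed
  also have "\<dots> \<le> liminf (\<lambda>k. \<integral>\<^sup>+p. ennreal ((cmod (trunc k (wgt u) p))\<^sup>2) \<partial>L2xt)"
    by (rule nn_integral_liminf) measurable
  also have "\<dots> \<le> ennreal (C\<^sup>2)"
  proof (rule Liminf_le)
    show "\<forall>\<^sub>F k in sequentially. (\<integral>\<^sup>+p. ennreal ((cmod (trunc k (wgt u) p))\<^sup>2) \<partial>L2xt) \<le> ennreal (C\<^sup>2)"
      using b by (intro always_eventually allI) (simp add: nn_integral_square_int[OF bdd_supp2_integrable(2)[OF admissibleD(1)[OF h]]] power_mono)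
  qed simp
  finally show "square_int L2xt (wgt u)" "norm2 L2xt (wgt u) \<le> C"
    using square_int_boundI[OF m _ C] by auto
qed

section \<open>The homogeneous equation\<close>

text \<open>A relation instead of \<open>propagator\<close>: it asks for joint measurability and
  prescribes the transform of each slice, and \<open>propagator\<close> is matched with it almost
  everywhere later on.\<close>

definition free_evol :: "('a \<Rightarrow> complex) \<Rightarrow> ('a \<times> real \<Rightarrow> complex) \<Rightarrow> bool" where
  "free_evol \<phi> U \<longleftrightarrow> U \<in> borel_measurable lborel2 \<and> (\<forall>t. square_int lborel (\<lambda>x. U (x, t)) \<and>
     (AE \<xi> in lborel. FT (\<lambda>x. U (x, t)) \<xi> = cis (- (t * (norm \<xi>)\<^sup>2)) * FT \<phi> \<xi>))"

lemma norm2_cis_mult: "norm2 N (\<lambda>x. cis (g x) * f x) = norm2 N f"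
  by (simp add: norm2_def)

lemma square_int_cis_mult:
  assumes "square_int N f" and [measurable]: "g \<in> borel_measurable N"
  shows "square_int N (\<lambda>x. cis (g x) * f x)"
  by (rule square_int_mult_bounded(1)[OF assms(1), of _ 1]) auto

lemma free_exists:
  assumes "square_int lborel \<phi>" shows "\<exists>U. free_evol \<phi> U"
proof -
  have [measurable]: "FT \<phi> \<in> borel_measurable borel" using FT_spec(1)[OF assms] by (simp add: square_int_def)
  have "(\<lambda>p. cis (- (snd p * (norm (fst p))\<^sup>2)) * FT \<phi> (fst p)) \<in> borel_measurable lborel2" by measurable
  from partial_inverse_transform[OF this] show ?thesis
    unfolding free_evol_def using square_int_cis_mult[OF FT_spec(1)[OF assms]] by fastforce
qed

lemma free_norm2:
  assumes "square_int lborel \<phi>" "free_evol \<phi> U"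
  shows "norm2 lborel (\<lambda>x. U (x, t)) = norm2 lborel \<phi>"
proof -
  have s: "square_int lborel (\<lambda>x. U (x, t))" using assms(2) by (simp add: free_evol_def)
  have [measurable]: "FT \<phi> \<in> borel_measurable borel" "FT (\<lambda>x. U (x, t)) \<in> borel_measurable borel"
    using FT_spec(1)[OF assms(1)] FT_spec(1)[OF s] by (simp_all add: square_int_def)
  have "norm2 lborel (\<lambda>x. U (x, t)) = norm2 lborel (FT (\<lambda>x. U (x, t)))" by (rule FT_isometry[OF s, symmetric])
  also have "\<dots> = norm2 lborel (\<lambda>\<xi>. cis (- (t * (norm \<xi>)\<^sup>2)) * FT \<phi> \<xi>)"
    using assms(2) by (intro norm2_cong_AE) (auto simp: free_evol_def)
  also have "\<dots> = norm2 lborel \<phi>" by (simp only: norm2_cis_mult FT_isometry[OF assms(1)])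
  finally show ?thesis .
qed

text \<open>\<open>kato_op\<close> is the adjoint of the free evolution map, seen on the Fourier
  side, so its bound becomes Kato smoothing by duality.\<close>

lemma free_pairing:
  assumes \<phi>: "square_int lborel \<phi>" and U: "free_evol \<phi> U" and F: "bdd_supp2 F"
  shows "(\<integral>p. F p * cnj (U p) \<partial>L2xt) = inner2 lborel (kato_op F) (FT \<phi>)"
proof -
  have [measurable]: "FT \<phi> \<in> borel_measurable borel" using FT_spec(1)[OF \<phi>] by (simp add: square_int_def)
  define v where "v p = cis (- (snd p * (norm (fst p))\<^sup>2)) * FT \<phi> (fst p)" for p
  have vm [measurable]: "v \<in> borel_measurable lborel2" unfolding v_def[abs_def] by measurable
  have vs: "square_int lborel (\<lambda>x. v (x, t))" for t unfolding v_def by (simp, intro square_int_cis_mult FT_spec \<phi>) measurable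
  note P = slice_Parseval[of U "norm2 lborel \<phi>" v F]
  have U': "U \<in> borel_measurable lborel2" "\<And>t. square_int lborel (\<lambda>x. U (x, t))" "\<And>t. norm2 lborel (\<lambda>x. U (x, t)) \<le> norm2 lborel \<phi>"
    "\<And>t. AE \<xi> in lborel. FT (\<lambda>x. U (x, t)) \<xi> = v (\<xi>, t)"
    using U by (auto simp: free_evol_def free_norm2[OF \<phi> U] v_def)
  note P = slice_Parseval[OF U'(1,2,3) vm vs U'(4) F]
  have "(\<integral>p. F p * cnj (U p) \<partial>L2xt) = (\<integral>\<xi>. \<integral>t. ft1 F (\<xi>, t) * cnj (v (\<xi>, t)) \<partial>lborel \<partial>lborel)"
    unfolding P(1) using lborel_pair.integral_fst'[OF P(2)] by simp
  also have "\<dots> = (\<integral>\<xi>. \<integral>t. (cis (t * (norm \<xi>)\<^sup>2) * ft1 F (\<xi>, t)) * cnj (FT \<phi> \<xi>) \<partial>lborel \<partial>lborel)"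
    by (intro Bochner_Integration.integral_cong refl) (simp add: v_def cis_cnj)
  also have "\<dots> = inner2 lborel (kato_op F) (FT \<phi>)"
    unfolding inner2_def kato_op_def by (simp only: integral_mult_left_zero)
  finally show ?thesis .
qed

theorem free_smoothing:
  assumes \<phi>: "square_int lborel \<phi>" and U: "free_evol \<phi> U"
  shows "square_int L2xt (wgt U)" "norm2 L2xt (wgt U) \<le> sqrt2M * norm2 lborel \<phi>"
proof -
  have "cmod (\<integral>p. wgt h p * cnj (U p) \<partial>L2xt) \<le> (sqrt2M * norm2 lborel \<phi>) * norm2 L2xt h" if h: "admissible h" for h
  proof -
    have "cmod (\<integral>p. wgt h p * cnj (U p) \<partial>L2xt) \<le> norm2 lborel (kato_op (wgt h)) * norm2 lborel (FT \<phi>)"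
      unfolding free_pairing[OF \<phi> U admissibleD(2)[OF h]] by (intro norm_inner2_le kato_op_square_int admissibleD h FT_spec \<phi>)
    also have "\<dots> \<le> (sqrt2M * norm2 L2xt h) * norm2 lborel \<phi>"
      unfolding FT_isometry[OF \<phi>] by (intro mult_right_mono kato_op_bound h) simp
    finally show ?thesis by (simp add: mult_ac)
  qed
  then show "square_int L2xt (wgt U)" "norm2 L2xt (wgt U) \<le> sqrt2M * norm2 lborel \<phi>"
    using smoothing_duality[of U "sqrt2M * norm2 lborel \<phi>"] U M_nonneg by (auto simp: free_evol_def)
qed

end

section \<open>Continuity in time\<close>

lemma norm2_le_limit:
  assumes "\<And>k. square_int N (h k)" "square_int N g" "(\<lambda>k. norm2 N (\<lambda>x. h k x - g x)) \<longlonglongrightarrow> 0" "\<And>k. norm2 N (h k) \<le> b k" "b \<longlonglongrightarrow> c"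
  shows "norm2 N g \<le> c"
  using norm2_tendsto[OF assms(1,2,3)] assms(4,5) by (intro LIMSEQ_le[of "\<lambda>k. norm2 N (h k)" _ b]) auto

lemma modulation_tendsto:
  fixes j :: "'a::euclidean_space \<Rightarrow> complex"
  assumes "square_int lborel j"
  shows "((\<lambda>s. norm2 lborel (\<lambda>\<xi>. (cis (- (s * (norm \<xi>)\<^sup>2)) - cis (- (t * (norm \<xi>)\<^sup>2))) * j \<xi>)) \<longlongrightarrow> 0) (at t)"
proof (subst tendsto_at_iff_sequentially, intro allI impI, unfold o_def)
  fix X :: "nat \<Rightarrow> real" assume X: "X \<longlonglongrightarrow> t"
  have [measurable]: "j \<in> borel_measurable borel" using assms by (simp add: square_int_def)
  have "(\<lambda>k. norm2 lborel (\<lambda>\<xi>. (cis (- (X k * (norm \<xi>)\<^sup>2)) - cis (- (t * (norm \<xi>)\<^sup>2))) * j \<xi> - 0)) \<longlonglongrightarrow> 0"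
  proof (rule norm2_tendsto_dominated)
    show "square_int lborel (\<lambda>\<xi>. 2 * j \<xi>)" using assms by auto
    show "AE \<xi> in lborel. (\<lambda>k. (cis (- (X k * (norm \<xi>)\<^sup>2)) - cis (- (t * (norm \<xi>)\<^sup>2))) * j \<xi>) \<longlonglongrightarrow> 0"
    proof (intro AE_I2 tendsto_mult_left_zero)
      fix \<xi> :: 'a
      have "(\<lambda>k. cis (- (X k * (norm \<xi>)\<^sup>2))) \<longlonglongrightarrow> cis (- (t * (norm \<xi>)\<^sup>2))" by (intro tendsto_intros X)
      then show "(\<lambda>k. cis (- (X k * (norm \<xi>)\<^sup>2)) - cis (- (t * (norm \<xi>)\<^sup>2))) \<longlonglongrightarrow> 0" by (simp add: LIM_zero)
    qed
    show "AE \<xi> in lborel. cmod ((cis (- (X k * (norm \<xi>)\<^sup>2)) - cis (- (t * (norm \<xi>)\<^sup>2))) * j \<xi>) \<le> cmod (2 * j \<xi>)" for k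
      by (intro AE_I2) (auto simp: norm_mult intro!: mult_right_mono order_trans[OF norm_triangle_ineq4])
  qed measurable
  then show "(\<lambda>k. norm2 lborel (\<lambda>\<xi>. (cis (- (X k * (norm \<xi>)\<^sup>2)) - cis (- (t * (norm \<xi>)\<^sup>2))) * j \<xi>)) \<longlonglongrightarrow> 0" by simp
qed

text \<open>The increment of a phase times a profile splits into the change of the profile, the
  phase having modulus one, and the change of the phase on the fixed profile at time
  \<open>t\<close>.\<close>

lemma modulated_continuity:
  fixes u :: "'a::euclidean_space \<times> real \<Rightarrow> complex"
  assumes u: "\<And>t. square_int lborel (\<lambda>x. u (x, t))" and j: "\<And>t. square_int lborel (j t)"
    and ft: "\<And>t. AE \<xi> in lborel. FT (\<lambda>x. u (x, t)) \<xi> = cis (- (t * (norm \<xi>)\<^sup>2)) * j t \<xi>"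
    and cont: "((\<lambda>s. norm2 lborel (\<lambda>\<xi>. j s \<xi> - j t \<xi>)) \<longlongrightarrow> 0) (at t)"
  shows "((\<lambda>s. norm2 lborel (\<lambda>x. u (x, s) - u (x, t))) \<longlongrightarrow> 0) (at t)"
proof (rule Lim_null_comparison)
  show "((\<lambda>s. norm2 lborel (\<lambda>\<xi>. j s \<xi> - j t \<xi>) + norm2 lborel (\<lambda>\<xi>. (cis (- (s * (norm \<xi>)\<^sup>2)) - cis (- (t * (norm \<xi>)\<^sup>2))) * j t \<xi>)) \<longlongrightarrow> 0) (at t)"
    by (intro tendsto_add_zero cont modulation_tendsto j)
  have "norm2 lborel (\<lambda>x. u (x, s) - u (x, t)) \<le> norm2 lborel (\<lambda>\<xi>. j s \<xi> - j t \<xi>)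
      + norm2 lborel (\<lambda>\<xi>. (cis (- (s * (norm \<xi>)\<^sup>2)) - cis (- (t * (norm \<xi>)\<^sup>2))) * j t \<xi>)" for s
  proof -
    have [measurable]: "j r \<in> borel_measurable borel" "FT (\<lambda>x. u (x, r)) \<in> borel_measurable borel" for r
      using j[of r] FT_spec(1)[OF u[of r]] by (auto simp: square_int_def)
    have "norm2 lborel (\<lambda>x. u (x, s) - u (x, t)) = norm2 lborel (\<lambda>\<xi>. FT (\<lambda>x. u (x, s)) \<xi> - FT (\<lambda>x. u (x, t)) \<xi>)"
      by (rule FT_norm2_diff[OF u u, symmetric])
    also have "\<dots> = norm2 lborel (\<lambda>\<xi>. cis (- (s * (norm \<xi>)\<^sup>2)) * j s \<xi> - cis (- (t * (norm \<xi>)\<^sup>2)) * j t \<xi>)"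
      using ft[of s] ft[of t] by (intro norm2_cong_AE) auto
    also have "\<dots> = norm2 lborel (\<lambda>\<xi>. cis (- (s * (norm \<xi>)\<^sup>2)) * (j s \<xi> - j t \<xi>) + (cis (- (s * (norm \<xi>)\<^sup>2)) - cis (- (t * (norm \<xi>)\<^sup>2))) * j t \<xi>)"
      by (simp add: algebra_simps)
    also have "\<dots> \<le> norm2 lborel (\<lambda>\<xi>. cis (- (s * (norm \<xi>)\<^sup>2)) * (j s \<xi> - j t \<xi>)) + norm2 lborel (\<lambda>\<xi>. (cis (- (s * (norm \<xi>)\<^sup>2)) - cis (- (t * (norm \<xi>)\<^sup>2))) * j t \<xi>)"
    proof (rule square_int_add(2))
      show "square_int lborel (\<lambda>\<xi>. cis (- (s * (norm \<xi>)\<^sup>2)) * (j s \<xi> - j t \<xi>))"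
        by (rule square_int_mult_bounded(1)[OF square_int_diff(1)[OF j j], of _ 1]) auto
      show "square_int lborel (\<lambda>\<xi>. (cis (- (s * (norm \<xi>)\<^sup>2)) - cis (- (t * (norm \<xi>)\<^sup>2))) * j t \<xi>)"
        by (rule square_int_mult_bounded(1)[OF j, of _ 2]) (auto intro!: order_trans[OF norm_triangle_ineq4])
    qed
    finally show ?thesis by (simp add: norm2_def)
  qed
  then show "\<forall>\<^sub>F s in at t. norm (norm2 lborel (\<lambda>x. u (x, s) - u (x, t))) \<le> norm2 lborel (\<lambda>\<xi>. j s \<xi> - j t \<xi>)
      + norm2 lborel (\<lambda>\<xi>. (cis (- (s * (norm \<xi>)\<^sup>2)) - cis (- (t * (norm \<xi>)\<^sup>2))) * j t \<xi>)"
    by (intro always_eventually allI) simp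
qed

lemma AE_snd_neq:
  fixes t :: real
  shows "AE p in (lborel :: 'a::euclidean_space measure) \<Otimes>\<^sub>M lborel. snd p \<noteq> t"
proof -
  have "{t} \<in> null_sets (lborel :: real measure)" by (auto simp: null_sets_def)
  then have "UNIV \<times> {t} \<in> null_sets ((lborel :: 'a measure) \<Otimes>\<^sub>M (lborel :: real measure))"
    using lborel.times_in_null_sets2[of UNIV "lborel :: 'a measure" "{t}"] by simp
  from AE_not_in[OF this] show ?thesis by eventually_elim auto
qed

text \<open>For fixed \<open>u\<close> the weight jumps, as a function of its first argument, only
  at \<open>u\<close> itself; this excludes a null set of times.\<close>

lemma dsign_tendsto:
  assumes "X \<longlonglongrightarrow> t" "u \<noteq> t"
  shows "\<forall>\<^sub>F k in sequentially. dsign (X k) u = dsign t u"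
proof (cases "u < t")
  case True
  from order_tendstoD(1)[OF assms(1) True] show ?thesis
    by eventually_elim (use True in \<open>auto simp: dsign_def\<close>)
next
  case False
  then have "t < u" using assms(2) by simp
  from order_tendstoD(2)[OF assms(1) this] show ?thesis
    by eventually_elim (use \<open>t < u\<close> in \<open>auto simp: dsign_def\<close>)
qed

lemma dsign_multiplication_tendsto:
  fixes f :: "'a::euclidean_space \<times> real \<Rightarrow> complex"
  assumes f: "square_int lborel2 f"
  shows "((\<lambda>s. norm2 lborel2 (\<lambda>p. (dsign s (snd p) - dsign t (snd p)) * f p)) \<longlongrightarrow> 0) (at t)"
proof (subst tendsto_at_iff_sequentially, intro allI impI, unfold o_def)
  fix X :: "nat \<Rightarrow> real" assume X: "X \<longlonglongrightarrow> t"
  have [measurable]: "f \<in> borel_measurable lborel2" using f by (simp add: square_int_def)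
  have "(\<lambda>k. norm2 lborel2 (\<lambda>p. (dsign (X k) (snd p) - dsign t (snd p)) * f p - 0)) \<longlonglongrightarrow> 0"
  proof (rule norm2_tendsto_dominated)
    show "square_int lborel2 (\<lambda>p. 2 * f p)" using f by auto
    show "AE p in lborel2. (\<lambda>k. (dsign (X k) (snd p) - dsign t (snd p)) * f p) \<longlonglongrightarrow> 0"
      using AE_snd_neq[of t]
    proof eventually_elim
      case (elim p)
      show ?case
        by (rule tendsto_eventually, rule eventually_mono[OF dsign_tendsto[OF X elim]]) simp
    qed
    show "AE p in lborel2. cmod ((dsign (X k) (snd p) - dsign t (snd p)) * f p) \<le> cmod (2 * f p)" for k
    proof (rule AE_I2)
      fix p :: "'a \<times> real"
      have "cmod (dsign (X k) (snd p) - dsign t (snd p)) \<le> 2"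
        using norm_triangle_ineq4[of "dsign (X k) (snd p)" "dsign t (snd p)"] norm_dsign_le[of "X k" "snd p"] norm_dsign_le[of t "snd p"] by linarith
      then show "cmod ((dsign (X k) (snd p) - dsign t (snd p)) * f p) \<le> cmod (2 * f p)"
        by (simp add: norm_mult mult_right_mono)
    qed
  qed measurable
  then show "(\<lambda>k. norm2 lborel2 (\<lambda>p. (dsign (X k) (snd p) - dsign t (snd p)) * f p)) \<longlonglongrightarrow> 0" by simp
qed

context smoothing
begin

section \<open>The inhomogeneous equation\<close>

text \<open>The Fourier transform of the Duhamel term at time \<open>t\<close>, pulled back by \<open>exp (- \<i>t\<Delta>)\<close>.\<close>

definition profile :: "('a \<times> real \<Rightarrow> complex) \<Rightarrow> real \<Rightarrow> 'a \<Rightarrow> complex" where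
  "profile f t = kato_op (wgt (time_mult (dsign t) f))"

lemma admissible_dsign: "admissible f \<Longrightarrow> admissible (time_mult (dsign t) f)" "admissible f \<Longrightarrow> wgt (time_mult (dsign t) f) = time_mult (dsign t) (wgt f)"
  using admissible_time_mult[of f "dsign t"] norm_dsign_le by auto

lemma profile_square_int: "admissible f \<Longrightarrow> square_int lborel (profile f t)"
  unfolding profile_def by (intro kato_op_square_int admissibleD admissible_dsign)

lemma profile_explicit: "admissible f \<Longrightarrow> profile f t \<xi> = (\<integral>s. cis (s * (norm \<xi>)\<^sup>2) * (dsign t s * ft1 (wgt f) (\<xi>, s)) \<partial>lborel)"
  by (simp add: profile_def admissible_dsign kato_op_def ft1_time_mult)

lemma profile_measurable:
  assumes "admissible f" shows "(\<lambda>p. profile f (snd p) (fst p)) \<in> borel_measurable lborel2"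
proof -
  have [measurable]: "wgt f \<in> borel_measurable lborel2" using admissibleD(2)[OF assms] by (rule bdd_supp2_measurable)
  show ?thesis unfolding profile_explicit[OF assms] by measurable
qed

lemma profile_bound: "admissible f \<Longrightarrow> norm2 lborel (profile f t) \<le> sqrt2M * norm2 L2xt (time_mult (dsign t) f)"
  unfolding profile_def by (intro kato_op_bound admissible_dsign)

lemma profile_diff_bound:
  assumes "admissible f" "admissible g"
  shows "norm2 lborel (\<lambda>\<xi>. profile f t \<xi> - profile g s \<xi>) \<le> sqrt2M * norm2 L2xt (\<lambda>p. time_mult (dsign t) f p - time_mult (dsign s) g p)"
  unfolding profile_def by (intro kato_op_diff_bound admissible_dsign assms)

lemma norm2_time_mult_dsign_le:
  assumes "square_int L2xt f" shows "norm2 L2xt (time_mult (dsign t) f) \<le> norm2 L2xt f" "square_int L2xt (time_mult (dsign t) f)"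
  using square_int_time_mult[OF assms, of "dsign t"] norm_dsign_le by auto

text \<open>For a source that is merely in L2, the integral defining \<open>profile\<close> need not
  converge pointwise, so it is replaced by an L2 limit at every time, chosen jointly
  measurable.\<close>

definition profile_limit :: "('a \<times> real \<Rightarrow> complex) \<Rightarrow> ('a \<times> real \<Rightarrow> complex) \<Rightarrow> bool" where
  "profile_limit f J \<longleftrightarrow> J \<in> borel_measurable lborel2 \<and> (\<forall>t. square_int lborel (\<lambda>\<xi>. J (\<xi>, t)) \<and>
     (\<lambda>k. norm2 lborel (\<lambda>\<xi>. profile (trunc k f) t \<xi> - J (\<xi>, t))) \<longlonglongrightarrow> 0)"

lemma profile_trunc_diff:
  assumes f: "square_int L2xt f"
  shows "norm2 lborel (\<lambda>\<xi>. profile (trunc k f) t \<xi> - profile (trunc l f) t \<xi>) \<le> sqrt2M * norm2 L2xt (\<lambda>p. trunc k f p - trunc l f p)"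
proof -
  have n: "admissible (trunc k f)" for k using f by (intro admissible_trunc) (simp add: square_int_def)
  have "norm2 lborel (\<lambda>\<xi>. profile (trunc k f) t \<xi> - profile (trunc l f) t \<xi>) \<le> sqrt2M * norm2 L2xt (\<lambda>p. time_mult (dsign t) (trunc k f) p - time_mult (dsign t) (trunc l f) p)"
    by (rule profile_diff_bound[OF n n])
  also have "(\<lambda>p. time_mult (dsign t) (trunc k f) p - time_mult (dsign t) (trunc l f) p) = time_mult (dsign t) (\<lambda>p. trunc k f p - trunc l f p)"
    by (simp add: time_mult_def fun_eq_iff right_diff_distrib)
  also have "sqrt2M * norm2 L2xt \<dots> \<le> sqrt2M * norm2 L2xt (\<lambda>p. trunc k f p - trunc l f p)"
    by (intro mult_left_mono norm2_time_mult_dsign_le square_int_diff trunc_square_int f) (simp add: M_nonneg)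
  finally show ?thesis .
qed

lemma profile_limit_exists:
  assumes f: "square_int L2xt f" shows "\<exists>J. profile_limit f J"
proof -
  have n: "admissible (trunc k f)" for k using f by (intro admissible_trunc) (simp add: square_int_def)
  have c: "\<exists>K. \<forall>k\<ge>K. \<forall>l\<ge>K. norm2 lborel (\<lambda>\<xi>. profile (trunc k f) t \<xi> - profile (trunc l f) t \<xi>) \<le> e" if e: "0 < e" for t e
  proof -
    have m: "0 < sqrt2M + 1" using M_nonneg by (intro add_nonneg_pos) auto
    have "0 < e / (sqrt2M + 1)" using e m by (rule divide_pos_pos)
    from norm2_Cauchy[OF trunc_square_int[OF f] f trunc_tendsto[OF f] this]
    obtain K where K: "\<And>k l. k \<ge> K \<Longrightarrow> l \<ge> K \<Longrightarrow> norm2 L2xt (\<lambda>p. trunc k f p - trunc l f p) \<le> e / (sqrt2M + 1)" by blast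
    have "norm2 lborel (\<lambda>\<xi>. profile (trunc k f) t \<xi> - profile (trunc l f) t \<xi>) \<le> e" if "k \<ge> K" "l \<ge> K" for k l
    proof -
      have "norm2 lborel (\<lambda>\<xi>. profile (trunc k f) t \<xi> - profile (trunc l f) t \<xi>) \<le> sqrt2M * (e / (sqrt2M + 1))"
        by (rule order_trans[OF profile_trunc_diff[OF f]], rule mult_left_mono[OF K[OF that]]) (simp add: M_nonneg)
      also have "\<dots> \<le> (sqrt2M + 1) * (e / (sqrt2M + 1))" using \<open>0 < e / (sqrt2M + 1)\<close> by (intro mult_right_mono) auto
      also have "\<dots> = e" using less_imp_neq[OF m] by simp
      finally show ?thesis .
    qed
    then show ?thesis by blast
  qed
  have "\<exists>g\<in>borel_measurable lborel2. \<forall>t\<in>space lborel. square_int lborel (\<lambda>\<xi>. g (\<xi>, t)) \<and>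
    (\<lambda>k. norm2 lborel (\<lambda>\<xi>. (\<lambda>p. profile (trunc k f) (snd p) (fst p)) (\<xi>, t) - g (\<xi>, t))) \<longlonglongrightarrow> 0"
    by (rule L2_limit_parametric[OF lborel.sigma_finite_measure_axioms profile_measurable[OF n]]) (auto intro!: profile_square_int n c)
  then show ?thesis unfolding profile_limit_def by auto
qed

text \<open>The rate of convergence is the same for all times, as needed to pass to the limit in
  pairings integrated over a slab.\<close>

lemma profile_limit_trunc_bound:
  assumes f: "square_int L2xt f" and J: "profile_limit f J"
  shows "norm2 lborel (\<lambda>\<xi>. profile (trunc k f) t \<xi> - J (\<xi>, t)) \<le> sqrt2M * norm2 L2xt (\<lambda>p. trunc k f p - f p)"
proof (rule norm2_le_limit)
  have n: "admissible (trunc k f)" for k using f by (intro admissible_trunc) (simp add: square_int_def)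
  have Js: "square_int lborel (\<lambda>\<xi>. J (\<xi>, t))" using J by (simp add: profile_limit_def)
  show "square_int lborel (\<lambda>\<xi>. profile (trunc k f) t \<xi> - profile (trunc l f) t \<xi>)" for l by (intro square_int_diff profile_square_int n)
  show "square_int lborel (\<lambda>\<xi>. profile (trunc k f) t \<xi> - J (\<xi>, t))" by (intro square_int_diff profile_square_int n Js)
  show "norm2 lborel (\<lambda>\<xi>. profile (trunc k f) t \<xi> - profile (trunc l f) t \<xi>) \<le> sqrt2M * norm2 L2xt (\<lambda>p. trunc k f p - trunc l f p)" for l
    by (rule profile_trunc_diff[OF f])
  have "(\<lambda>l. norm2 lborel (\<lambda>\<xi>. profile (trunc l f) t \<xi> - J (\<xi>, t))) \<longlonglongrightarrow> 0" using J by (simp add: profile_limit_def)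
  then show "(\<lambda>l. norm2 lborel (\<lambda>\<xi>. profile (trunc k f) t \<xi> - profile (trunc l f) t \<xi> - (profile (trunc k f) t \<xi> - J (\<xi>, t)))) \<longlonglongrightarrow> 0"
    by (simp add: norm2_commute[of lborel "\<lambda>\<xi>. J (\<xi>, t)"])
  have "(\<lambda>l. norm2 L2xt (\<lambda>p. (trunc k f p - trunc l f p) - (trunc k f p - f p))) \<longlonglongrightarrow> 0"
    using trunc_tendsto[OF f] by (simp add: norm2_commute[of L2xt f])
  from norm2_tendsto[OF _ _ this]
  show "(\<lambda>l. sqrt2M * norm2 L2xt (\<lambda>p. trunc k f p - trunc l f p)) \<longlonglongrightarrow> sqrt2M * norm2 L2xt (\<lambda>p. trunc k f p - f p)"
    by (intro tendsto_mult_left) (auto intro!: square_int_diff trunc_square_int f)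
qed

lemma profile_limit_bound:
  assumes f: "square_int L2xt f" and J: "profile_limit f J"
  shows "norm2 lborel (\<lambda>\<xi>. J (\<xi>, t)) \<le> sqrt2M * norm2 L2xt f"
proof (rule norm2_le_limit)
  have n: "admissible (trunc k f)" for k using f by (intro admissible_trunc) (simp add: square_int_def)
  show "square_int lborel (profile (trunc k f) t)" for k by (intro profile_square_int n)
  show "norm2 lborel (profile (trunc k f) t) \<le> sqrt2M * norm2 L2xt f" for k
  proof -
    have "norm2 L2xt (time_mult (dsign t) (trunc k f)) \<le> norm2 L2xt f"
      by (rule order_trans[OF norm2_time_mult_dsign_le(1)[OF trunc_square_int[OF f]]], rule square_int_mono1(2)[OF f])
         (use trunc_square_int[OF f] in \<open>auto simp: square_int_def norm_trunc_le\<close>)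
    then show ?thesis by (intro order_trans[OF profile_bound[OF n]] mult_left_mono) (auto simp: M_nonneg)
  qed
qed (use J in \<open>auto simp: profile_limit_def\<close>)

text \<open>The increment between s and t is the Kato operator applied to the source cut to the
  times between them, so it is controlled by the L2 mass of \<open>f\<close> there.\<close>

lemma profile_limit_continuous:
  assumes f: "square_int L2xt f" and J: "profile_limit f J"
  shows "((\<lambda>s. norm2 lborel (\<lambda>\<xi>. J (\<xi>, s) - J (\<xi>, t))) \<longlongrightarrow> 0) (at t)"
proof (rule Lim_null_comparison)
  have n: "admissible (trunc k f)" for k using f by (intro admissible_trunc) (simp add: square_int_def)
  have fm [measurable]: "f \<in> borel_measurable lborel2" using f by (simp add: square_int_def)
  have Js: "square_int lborel (\<lambda>\<xi>. J (\<xi>, t))" "(\<lambda>k. norm2 lborel (\<lambda>\<xi>. profile (trunc k f) t \<xi> - J (\<xi>, t))) \<longlonglongrightarrow> 0" for t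
    using J by (auto simp: profile_limit_def)
  have "norm2 lborel (\<lambda>\<xi>. J (\<xi>, s) - J (\<xi>, t)) \<le> sqrt2M * norm2 L2xt (\<lambda>p. (dsign s (snd p) - dsign t (snd p)) * f p)" for s
  proof (rule norm2_le_limit)
    show "square_int lborel (\<lambda>\<xi>. profile (trunc k f) s \<xi> - profile (trunc k f) t \<xi>)" for k by (intro square_int_diff profile_square_int n)
    show "square_int lborel (\<lambda>\<xi>. J (\<xi>, s) - J (\<xi>, t))" by (intro square_int_diff Js)
    show "(\<lambda>k. norm2 lborel (\<lambda>\<xi>. profile (trunc k f) s \<xi> - profile (trunc k f) t \<xi> - (J (\<xi>, s) - J (\<xi>, t)))) \<longlonglongrightarrow> 0"
    proof (rule Lim_null_comparison[OF always_eventually])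
      show "\<forall>k. norm (norm2 lborel (\<lambda>\<xi>. profile (trunc k f) s \<xi> - profile (trunc k f) t \<xi> - (J (\<xi>, s) - J (\<xi>, t))))
        \<le> norm2 lborel (\<lambda>\<xi>. profile (trunc k f) s \<xi> - J (\<xi>, s)) + norm2 lborel (\<lambda>\<xi>. profile (trunc k f) t \<xi> - J (\<xi>, t))"
      proof
        fix k
        have "norm2 lborel (\<lambda>\<xi>. (profile (trunc k f) s \<xi> - J (\<xi>, s)) - (profile (trunc k f) t \<xi> - J (\<xi>, t)))
         \<le> norm2 lborel (\<lambda>\<xi>. profile (trunc k f) s \<xi> - J (\<xi>, s)) + norm2 lborel (\<lambda>\<xi>. profile (trunc k f) t \<xi> - J (\<xi>, t))"
          by (intro square_int_diff profile_square_int n Js)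
        then show "norm (norm2 lborel (\<lambda>\<xi>. profile (trunc k f) s \<xi> - profile (trunc k f) t \<xi> - (J (\<xi>, s) - J (\<xi>, t))))
        \<le> norm2 lborel (\<lambda>\<xi>. profile (trunc k f) s \<xi> - J (\<xi>, s)) + norm2 lborel (\<lambda>\<xi>. profile (trunc k f) t \<xi> - J (\<xi>, t))"
          by (simp add: algebra_simps)
      qed
      show "(\<lambda>k. norm2 lborel (\<lambda>\<xi>. profile (trunc k f) s \<xi> - J (\<xi>, s)) + norm2 lborel (\<lambda>\<xi>. profile (trunc k f) t \<xi> - J (\<xi>, t))) \<longlonglongrightarrow> 0"
        by (intro tendsto_add_zero Js)
    qed
    show "norm2 lborel (\<lambda>\<xi>. profile (trunc k f) s \<xi> - profile (trunc k f) t \<xi>) \<le> sqrt2M * norm2 L2xt (\<lambda>p. (dsign s (snd p) - dsign t (snd p)) * f p)" for k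
    proof (rule order_trans[OF profile_diff_bound[OF n n]], rule mult_left_mono)
      have eq: "(\<lambda>p. time_mult (dsign s) (trunc k f) p - time_mult (dsign t) (trunc k f) p) = (\<lambda>p. (dsign s (snd p) - dsign t (snd p)) * trunc k f p)"
        by (simp add: time_mult_def left_diff_distrib)
      show "norm2 L2xt (\<lambda>p. time_mult (dsign s) (trunc k f) p - time_mult (dsign t) (trunc k f) p) \<le> norm2 L2xt (\<lambda>p. (dsign s (snd p) - dsign t (snd p)) * f p)"
        unfolding eq
      proof (rule square_int_mono1(2))
        have e: "(\<lambda>p. (dsign s (snd p) - dsign t (snd p)) * f p) = (\<lambda>p. time_mult (dsign s) f p - time_mult (dsign t) f p)"
          by (simp add: time_mult_def left_diff_distrib)
        show "square_int L2xt (\<lambda>p. (dsign s (snd p) - dsign t (snd p)) * f p)"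
          unfolding e by (intro square_int_diff norm2_time_mult_dsign_le f)
        show "(\<lambda>p. (dsign s (snd p) - dsign t (snd p)) * trunc k f p) \<in> borel_measurable L2xt" by measurable
      qed (auto simp: norm_mult intro!: mult_left_mono norm_trunc_le)
    qed (simp add: M_nonneg)
  qed (rule tendsto_const)
  then show "\<forall>\<^sub>F s in at t. norm (norm2 lborel (\<lambda>\<xi>. J (\<xi>, s) - J (\<xi>, t))) \<le> sqrt2M * norm2 L2xt (\<lambda>p. (dsign s (snd p) - dsign t (snd p)) * f p)"
    by (intro always_eventually allI) simp
  show "((\<lambda>s. sqrt2M * norm2 L2xt (\<lambda>p. (dsign s (snd p) - dsign t (snd p)) * f p)) \<longlongrightarrow> 0) (at t)"
    by (intro tendsto_mult_right_zero dsign_multiplication_tendsto f)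
qed

section \<open>Smoothing of the Duhamel term by splitting at time zero\<close>

definition after0 :: "real \<Rightarrow> complex" where "after0 s = (if 0 < s then 1 else 0)"
definition before0 :: "real \<Rightarrow> complex" where "before0 s = (if s < 0 then 1 else 0)"

lemma after0_before0 [measurable]: "after0 \<in> borel_measurable borel" "before0 \<in> borel_measurable borel"
  unfolding after0_def[abs_def] before0_def[abs_def] by measurable

lemma admissible_after0_before0:
  assumes "admissible f"
  shows "admissible (time_mult after0 f)" "admissible (time_mult before0 f)" "wgt (time_mult after0 f) = time_mult after0 (wgt f)" "wgt (time_mult before0 f) = time_mult before0 (wgt f)"
    "norm2 L2xt (time_mult after0 f) \<le> norm2 L2xt f" "norm2 L2xt (time_mult before0 f) \<le> norm2 L2xt f"
proof -
  have le: "cmod (after0 s) \<le> 1" "cmod (before0 s) \<le> 1" for s by (auto simp: after0_def before0_def)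
  show "admissible (time_mult after0 f)" "admissible (time_mult before0 f)" "wgt (time_mult after0 f) = time_mult after0 (wgt f)" "wgt (time_mult before0 f) = time_mult before0 (wgt f)"
    using admissible_time_mult[OF assms after0_before0(1) le(1)] admissible_time_mult[OF assms after0_before0(2) le(2)] by auto
  show "norm2 L2xt (time_mult after0 f) \<le> norm2 L2xt f" "norm2 L2xt (time_mult before0 f) \<le> norm2 L2xt f"
    using square_int_time_mult(2)[OF bdd_supp2_integrable(2)[OF admissibleD(1)[OF assms]] _ le(1)] square_int_time_mult(2)[OF bdd_supp2_integrable(2)[OF admissibleD(1)[OF assms]] _ le(2)] by auto
qed

text \<open>Restoring the phase: this is the space transform of the Duhamel term at time t.\<close>

definition mod_profile :: "('a \<times> real \<Rightarrow> complex) \<Rightarrow> 'a \<times> real \<Rightarrow> complex" where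
  "mod_profile f p = cis (- (snd p * (norm (fst p))\<^sup>2)) * profile f (snd p) (fst p)"

lemma mod_profile_props:
  assumes "admissible f"
  shows "mod_profile f \<in> borel_measurable lborel2" "square_int lborel (\<lambda>\<xi>. mod_profile f (\<xi>, t))"
    "norm2 lborel (\<lambda>\<xi>. mod_profile f (\<xi>, t)) \<le> sqrt2M * norm2 L2xt f"
proof -
  note [measurable] = profile_measurable[OF assms]
  show "mod_profile f \<in> borel_measurable lborel2" unfolding mod_profile_def[abs_def] by measurable
  show "square_int lborel (\<lambda>\<xi>. mod_profile f (\<xi>, t))"
    unfolding mod_profile_def by (simp, intro square_int_cis_mult profile_square_int assms) measurable
  have "norm2 lborel (\<lambda>\<xi>. mod_profile f (\<xi>, t)) = norm2 lborel (profile f t)"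
    by (simp add: mod_profile_def norm2_def)
  also have "\<dots> \<le> sqrt2M * norm2 L2xt f"
    using norm2_time_mult_dsign_le(1)[OF bdd_supp2_integrable(2)[OF admissibleD(1)[OF assms]]]
    by (intro order_trans[OF profile_bound[OF assms]] mult_left_mono) (auto simp: M_nonneg)
  finally show "norm2 lborel (\<lambda>\<xi>. mod_profile f (\<xi>, t)) \<le> sqrt2M * norm2 L2xt f" .
qed

text \<open>For t > 0 the oriented integral runs over 0 < s < t and is the retarded form of the
  parts at positive times. For t < 0 it is minus the integral over t < s < 0, where s > t, hence
  minus the adjoint form of the parts at negative times.\<close>

lemma mod_profile_pairing:
  assumes g: "admissible g" and h: "admissible h"
  shows "(\<integral>t. ft1 (wgt g) (\<xi>, t) * cnj (mod_profile h (\<xi>, t)) \<partial>lborel)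
    = cnj (ret_form 0 (wgt (time_mult after0 h)) (wgt (time_mult after0 g)) \<xi> - cnj (ret_form 0 (wgt (time_mult before0 g)) (wgt (time_mult before0 h)) \<xi>))"
proof -
  let ?\<mu> = "(norm \<xi>)\<^sup>2"
  note bg = admissibleD(2)[OF g] and bh = admissibleD(2)[OF h]
  have [measurable]: "wgt g \<in> borel_measurable lborel2" "wgt h \<in> borel_measurable lborel2"
    using bg bh by (auto intro: bdd_supp2_measurable)
  have P: "bdd_supp2 (wgt (time_mult after0 h))" "bdd_supp2 (wgt (time_mult after0 g))" "bdd_supp2 (wgt (time_mult before0 h))" "bdd_supp2 (wgt (time_mult before0 g))"
    by (rule admissibleD(2)[OF admissible_after0_before0(1)[OF h]] admissibleD(2)[OF admissible_after0_before0(1)[OF g]]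
      admissibleD(2)[OF admissible_after0_before0(2)[OF h]] admissibleD(2)[OF admissible_after0_before0(2)[OF g]])+
  have "(\<integral>t. ft1 (wgt g) (\<xi>, t) * cnj (mod_profile h (\<xi>, t)) \<partial>lborel) = (\<integral>t. cnj (mod_profile h (\<xi>, t) * cnj (ft1 (wgt g) (\<xi>, t))) \<partial>lborel)"
    by (simp add: mult.commute)
  also have "\<dots> = cnj (\<integral>t. mod_profile h (\<xi>, t) * cnj (ft1 (wgt g) (\<xi>, t)) \<partial>lborel)"
    by (rule Bochner_Integration.integral_cnj)
  also have "(\<integral>t. mod_profile h (\<xi>, t) * cnj (ft1 (wgt g) (\<xi>, t)) \<partial>lborel)
     = (\<integral>t. \<integral>s. dsign t s * cis (- ((t - s) * ?\<mu>)) * ft1 (wgt h) (\<xi>, s) * cnj (ft1 (wgt g) (\<xi>, t)) \<partial>lborel \<partial>lborel)"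
  proof (rule Bochner_Integration.integral_cong[OF refl])
    fix t
    have "mod_profile h (\<xi>, t) * cnj (ft1 (wgt g) (\<xi>, t))
      = (\<integral>s. cis (- (t * ?\<mu>)) * (cis (s * ?\<mu>) * (dsign t s * ft1 (wgt h) (\<xi>, s))) * cnj (ft1 (wgt g) (\<xi>, t)) \<partial>lborel)"
      by (simp only: mod_profile_def profile_explicit[OF h] fst_conv snd_conv integral_mult_left_zero integral_mult_right_zero)
    also have "\<dots> = (\<integral>s. dsign t s * cis (- ((t - s) * ?\<mu>)) * ft1 (wgt h) (\<xi>, s) * cnj (ft1 (wgt g) (\<xi>, t)) \<partial>lborel)"
    proof (intro Bochner_Integration.integral_cong refl)
      fix s
      have "cis (- ((t - s) * ?\<mu>)) = cis (- (t * ?\<mu>)) * cis (s * ?\<mu>)" by (simp add: cis_mult algebra_simps)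
      then show "cis (- (t * ?\<mu>)) * (cis (s * ?\<mu>) * (dsign t s * ft1 (wgt h) (\<xi>, s))) * cnj (ft1 (wgt g) (\<xi>, t))
        = dsign t s * cis (- ((t - s) * ?\<mu>)) * ft1 (wgt h) (\<xi>, s) * cnj (ft1 (wgt g) (\<xi>, t))" by simp
    qed
    finally show "mod_profile h (\<xi>, t) * cnj (ft1 (wgt g) (\<xi>, t))
      = (\<integral>s. dsign t s * cis (- ((t - s) * ?\<mu>)) * ft1 (wgt h) (\<xi>, s) * cnj (ft1 (wgt g) (\<xi>, t)) \<partial>lborel)" .
  qed
  also have "\<dots> = (\<integral>t. \<integral>s. damped_kernel 0 ?\<mu> (t - s) * ft1 (wgt (time_mult after0 h)) (\<xi>, s) * cnj (ft1 (wgt (time_mult after0 g)) (\<xi>, t)) \<partial>lborel \<partial>lborel)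
    + (- 1) * (\<integral>t. \<integral>s. cnj (damped_kernel 0 ?\<mu> (s - t)) * ft1 (wgt (time_mult before0 h)) (\<xi>, s) * cnj (ft1 (wgt (time_mult before0 g)) (\<xi>, t)) \<partial>lborel \<partial>lborel)"
  proof (rule double_integral_diff)
    show "integrable lborel2 (\<lambda>(t, s). damped_kernel 0 ?\<mu> (t - s) * ft1 (wgt (time_mult after0 h)) (\<xi>, s) * cnj (ft1 (wgt (time_mult after0 g)) (\<xi>, t)))"
      using ft1_mult_integrable[OF P(1,2), of "\<lambda>(t, s). damped_kernel 0 ?\<mu> (t - s)" \<xi>] by (simp add: norm_damped_kernel_le)
    show "integrable lborel2 (\<lambda>(t, s). cnj (damped_kernel 0 ?\<mu> (s - t)) * ft1 (wgt (time_mult before0 h)) (\<xi>, s) * cnj (ft1 (wgt (time_mult before0 g)) (\<xi>, t)))"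
      using ft1_mult_integrable[OF P(3,4), of "\<lambda>(t, s). cnj (damped_kernel 0 ?\<mu> (s - t))" \<xi>] by (simp add: norm_damped_kernel_le)
    show "dsign t s * cis (- ((t - s) * ?\<mu>)) * ft1 (wgt h) (\<xi>, s) * cnj (ft1 (wgt g) (\<xi>, t)) =
       damped_kernel 0 ?\<mu> (t - s) * ft1 (wgt (time_mult after0 h)) (\<xi>, s) * cnj (ft1 (wgt (time_mult after0 g)) (\<xi>, t)) +
       (- 1) * (cnj (damped_kernel 0 ?\<mu> (s - t)) * ft1 (wgt (time_mult before0 h)) (\<xi>, s) * cnj (ft1 (wgt (time_mult before0 g)) (\<xi>, t)))"
      if "s \<noteq> t" for t s
      unfolding admissible_after0_before0(3,4)[OF g] admissible_after0_before0(3,4)[OF h] ft1_time_mult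
      using that by (cases "s < t") (auto simp: damped_kernel_def dsign_def after0_def before0_def cis_cnj algebra_simps)
  qed measurable
  finally show ?thesis
    unfolding ret_form_eq[symmetric] cnj_ret_form[OF P(3,4), symmetric] by simp
qed

text \<open>Each half line contributes the retarded bound M, and the norms of the restricted
  functions are bounded by the full ones; this is the factor 2.\<close>

lemma mod_profile_smoothing:
  assumes g: "admissible g" and h: "admissible h"
  shows "cmod (\<integral>p. ft1 (wgt g) p * cnj (mod_profile h p) \<partial>L2xt) \<le> 2 * M * norm2 L2xt h * norm2 L2xt g"
proof -
  obtain K where K: "\<And>x t. K < \<bar>t\<bar> \<Longrightarrow> wgt g (x, t) = 0" using admissibleD(2)[OF g] by (rule bdd_supp2E) blast
  have I: "integrable L2xt (\<lambda>p. ft1 (wgt g) p * cnj (mod_profile h p))"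
    by (rule bdd_supp2_pairing_integrable[OF mod_profile_props[OF h] ft1_bdd_supp2_square_int(1)[OF admissibleD(2)[OF g]], of K]) (intro ft1_eq_0 K)
  note P = admissible_after0_before0[OF g] and Q = admissible_after0_before0[OF h]
  note i1 = ret_form_integrable[OF admissibleD(2)[OF Q(1)] admissibleD(2)[OF P(1)], of 0, simplified]
  note i2 = ret_form_integrable[OF admissibleD(2)[OF P(2)] admissibleD(2)[OF Q(2)], of 0, simplified]
  let ?A = "\<integral>\<xi>. ret_form 0 (wgt (time_mult after0 h)) (wgt (time_mult after0 g)) \<xi> \<partial>lborel"
  let ?B = "\<integral>\<xi>. ret_form 0 (wgt (time_mult before0 g)) (wgt (time_mult before0 h)) \<xi> \<partial>lborel"
  have "(\<integral>p. ft1 (wgt g) p * cnj (mod_profile h p) \<partial>L2xt) = (\<integral>\<xi>. \<integral>t. ft1 (wgt g) (\<xi>, t) * cnj (mod_profile h (\<xi>, t)) \<partial>lborel \<partial>lborel)"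
    by (rule lborel_pair.integral_fst'[OF I, symmetric])
  also have "\<dots> = (\<integral>\<xi>. cnj (ret_form 0 (wgt (time_mult after0 h)) (wgt (time_mult after0 g)) \<xi> - cnj (ret_form 0 (wgt (time_mult before0 g)) (wgt (time_mult before0 h)) \<xi>)) \<partial>lborel)"
    by (simp only: mod_profile_pairing[OF g h])
  also have "\<dots> = cnj (?A - cnj ?B)"
    using i1 i2 by (simp add: Bochner_Integration.integral_cnj)
  finally have "cmod (\<integral>p. ft1 (wgt g) p * cnj (mod_profile h p) \<partial>L2xt) = cmod (?A - cnj ?B)" by (simp only: complex_mod_cnj)
  also have "\<dots> \<le> cmod ?A + cmod ?B" using norm_triangle_ineq4[of ?A "cnj ?B"] by (simp only: complex_mod_cnj)
  also have "\<dots> \<le> M * norm2 L2xt (time_mult after0 h) * norm2 L2xt (time_mult after0 g) + M * norm2 L2xt (time_mult before0 g) * norm2 L2xt (time_mult before0 h)"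
    by (intro add_mono ret_form_retarded_le P Q)
  also have "\<dots> \<le> M * norm2 L2xt h * norm2 L2xt g + M * norm2 L2xt g * norm2 L2xt h"
    using M_nonneg by (intro add_mono mult_mono P Q) auto
  finally show ?thesis by (simp add: algebra_simps)
qed

text \<open>In the last clause \<open>U(s) = exp (\<i>(s - t)\<Delta>) \<phi>\<close>: the propagator acts on the test function, as in \<open>is_duhamel\<close>.\<close>

definition duhamel_evol :: "('a \<times> real \<Rightarrow> complex) \<Rightarrow> ('a \<times> real \<Rightarrow> complex) \<Rightarrow> bool" where
  "duhamel_evol f D \<longleftrightarrow> D \<in> borel_measurable lborel2 \<and>
     (\<forall>t. square_int lborel (\<lambda>x. D (x, t)) \<and> norm2 lborel (\<lambda>x. D (x, t)) \<le> sqrt2M * norm2 L2xt f \<and>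
        ((\<lambda>s. norm2 lborel (\<lambda>x. D (x, s) - D (x, t))) \<longlongrightarrow> 0) (at t)) \<and>
     square_int L2xt (wgt D) \<and> norm2 L2xt (wgt D) \<le> 2 * M * norm2 L2xt f \<and>
     (\<forall>t \<phi> \<psi> U. square_int lborel \<phi> \<longrightarrow> square_int lborel \<psi> \<longrightarrow> (AE \<xi> in lborel. FT \<psi> \<xi> = cis (t * (norm \<xi>)\<^sup>2) * FT \<phi> \<xi>) \<longrightarrow>
        free_evol \<psi> U \<longrightarrow> inner2 lborel (\<lambda>x. D (x, t)) \<phi> = inner2 L2xt (time_mult (dsign t) f) (wgt U))"

theorem duhamel_exists:
  assumes f: "square_int L2xt f" shows "\<exists>D. duhamel_evol f D"
proof -
  have n: "admissible (trunc k f)" for k using f by (intro admissible_trunc) (simp add: square_int_def)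
  obtain J where J: "profile_limit f J" using profile_limit_exists[OF f] ..
  have Js: "square_int lborel (\<lambda>\<xi>. J (\<xi>, t))" "(\<lambda>k. norm2 lborel (\<lambda>\<xi>. profile (trunc k f) t \<xi> - J (\<xi>, t))) \<longlonglongrightarrow> 0" for t
    using J by (auto simp: profile_limit_def)
  have Jm [measurable]: "J \<in> borel_measurable lborel2" using J by (simp add: profile_limit_def)
  define v where "v p = cis (- (snd p * (norm (fst p))\<^sup>2)) * J p" for p
  have vm [measurable]: "v \<in> borel_measurable lborel2" unfolding v_def[abs_def] by measurable
  have vs: "square_int lborel (\<lambda>\<xi>. v (\<xi>, t))" for t unfolding v_def by (simp, intro square_int_cis_mult Js) measurable
  have vn: "norm2 lborel (\<lambda>\<xi>. v (\<xi>, t)) = norm2 lborel (\<lambda>\<xi>. J (\<xi>, t))" for t by (simp add: v_def norm2_def)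
  obtain D where Dm: "D \<in> borel_measurable lborel2" and D: "\<And>t. square_int lborel (\<lambda>x. D (x, t))"
    "\<And>t. AE \<xi> in lborel. FT (\<lambda>x. D (x, t)) \<xi> = v (\<xi>, t)"
    using partial_inverse_transform[OF vm vs] by blast
  have [measurable]: "FT (\<lambda>x. D (x, t)) \<in> borel_measurable borel" for t using FT_spec(1)[OF D(1)] by (simp add: square_int_def)
  have [measurable]: "(\<lambda>\<xi>. v (\<xi>, t)) \<in> borel_measurable borel" for t using vs[of t] by (simp add: square_int_def)
  have Dn: "norm2 lborel (\<lambda>x. D (x, t)) \<le> sqrt2M * norm2 L2xt f" for t
  proof -
    have "norm2 lborel (\<lambda>x. D (x, t)) = norm2 lborel (FT (\<lambda>x. D (x, t)))" by (rule FT_isometry[OF D(1), symmetric])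
    also have "\<dots> = norm2 lborel (\<lambda>\<xi>. v (\<xi>, t))" using D(2)[of t] by (intro norm2_cong_AE) auto
    also have "\<dots> \<le> sqrt2M * norm2 L2xt f" unfolding vn by (rule profile_limit_bound[OF f J])
    finally show ?thesis .
  qed
  have cont: "((\<lambda>s. norm2 lborel (\<lambda>x. D (x, s) - D (x, t))) \<longlongrightarrow> 0) (at t)" for t
    using D(2) by (intro modulated_continuity[OF D(1) Js(1) _ profile_limit_continuous[OF f J]]) (simp add: v_def)
  \<comment> \<open>The weighted bound is proved in dual form because it survives the removal of
    truncations as a bound on numbers, before \<open>wgt D\<close> is known to be square
    integrable.\<close>
  have smooth: "cmod (\<integral>p. wgt g p * cnj (D p) \<partial>L2xt) \<le> (2 * M * norm2 L2xt f) * norm2 L2xt g" if g: "admissible g" for g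
  proof -
    obtain K where K: "\<And>x t. K < \<bar>t\<bar> \<Longrightarrow> wgt g (x, t) = 0" using admissibleD(2)[OF g] by (rule bdd_supp2E) blast
    note S = slice_Parseval[OF Dm D(1) Dn vm vs D(2) admissibleD(2)[OF g]]
    note sg1 = ft1_bdd_supp2_square_int(1)[OF admissibleD(2)[OF g]]
    let ?I = "\<lambda>u. \<integral>p. ft1 (wgt g) p * cnj (u p) \<partial>L2xt"
    let ?c = "\<lambda>k. sqrt2M * norm2 L2xt (\<lambda>p. trunc k f p - f p)"
    have lim: "(\<lambda>k. ?I (mod_profile (trunc k f))) \<longlonglongrightarrow> ?I v"
    proof (rule LIM_zero_cancel, rule Lim_null_comparison[OF always_eventually])
      \<comment> \<open>The error is the uniform-in-time rate times the square root of the length of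
        the slab carrying \<open>g\<close>.\<close>
      show "\<forall>k. norm (?I (mod_profile (trunc k f)) - ?I v) \<le> norm2 L2xt (ft1 (wgt g)) * (?c k * sqrt (measure lborel (cball (0::real) K)))"
      proof
        fix k
        define d where "d p = mod_profile (trunc k f) p - v p" for p
        note m = mod_profile_props[OF n[of k]]
        have dm: "d \<in> borel_measurable lborel2" unfolding d_def[abs_def] using m(1) by measurable
        have ds: "square_int lborel (\<lambda>\<xi>. d (\<xi>, t))" for t unfolding d_def by (intro square_int_diff m vs)
        have dn: "norm2 lborel (\<lambda>\<xi>. d (\<xi>, t)) \<le> ?c k" for t
        proof -
          have "norm2 lborel (\<lambda>\<xi>. d (\<xi>, t)) = norm2 lborel (\<lambda>\<xi>. cis (- (t * (norm \<xi>)\<^sup>2)) * (profile (trunc k f) t \<xi> - J (\<xi>, t)))"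
            by (simp add: d_def mod_profile_def v_def right_diff_distrib)
          also have "\<dots> \<le> ?c k" unfolding norm2_cis_mult by (rule profile_limit_trunc_bound[OF f J])
          finally show ?thesis .
        qed
        have i: "integrable L2xt (\<lambda>p. ft1 (wgt g) p * cnj (mod_profile (trunc k f) p))"
          by (rule bdd_supp2_pairing_integrable[OF m sg1, of K]) (intro ft1_eq_0 K)
        have "?I (mod_profile (trunc k f)) - ?I v = ?I d"
          using Bochner_Integration.integral_diff[OF i S(2)] by (simp add: d_def right_diff_distrib)
        also have "?I d = inner2 L2xt (ft1 (wgt g)) (time_mult (indicator (cball 0 K)) d)"
          unfolding inner2_def
        proof (rule Bochner_Integration.integral_cong[OF refl])
          fix p
          have "ft1 (wgt g) p = 0" if "K < \<bar>snd p\<bar>" using ft1_eq_0[of "wgt g" "snd p" "fst p"] K[OF that] by simp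
          then show "ft1 (wgt g) p * cnj (d p) = ft1 (wgt g) p * cnj (time_mult (indicator (cball 0 K)) d p)"
            by (cases "K < \<bar>snd p\<bar>") (auto simp: time_mult_def)
        qed
        also have "cmod \<dots> \<le> norm2 L2xt (ft1 (wgt g)) * norm2 L2xt (time_mult (indicator (cball 0 K)) d)"
          by (intro norm_inner2_le sg1 slab_square_int(1)[OF dm ds dn])
        also have "\<dots> \<le> norm2 L2xt (ft1 (wgt g)) * (?c k * sqrt (measure lborel (cball (0::real) K)))"
          by (intro mult_left_mono slab_square_int(2)[OF dm ds dn]) simp
        finally show "norm (?I (mod_profile (trunc k f)) - ?I v) \<le> norm2 L2xt (ft1 (wgt g)) * (?c k * sqrt (measure lborel (cball (0::real) K)))" .
      qed
      show "(\<lambda>k. norm2 L2xt (ft1 (wgt g)) * (?c k * sqrt (measure lborel (cball (0::real) K)))) \<longlonglongrightarrow> 0"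
        by (intro tendsto_mult_right_zero tendsto_mult_left_zero trunc_tendsto f)
    qed
    have "cmod (?I v) \<le> 2 * M * norm2 L2xt f * norm2 L2xt g"
    proof (rule LIMSEQ_le_const2[OF tendsto_norm[OF lim]], intro exI[of _ 0] allI impI)
      fix k
      have "cmod (?I (mod_profile (trunc k f))) \<le> 2 * M * norm2 L2xt (trunc k f) * norm2 L2xt g" by (rule mod_profile_smoothing[OF g n])
      also have "\<dots> \<le> 2 * M * norm2 L2xt f * norm2 L2xt g"
        using M_nonneg trunc_square_int[OF f, of k]
        by (intro mult_right_mono mult_left_mono square_int_mono1(2)[OF f]) (auto simp: norm_trunc_le square_int_def)
      finally show "cmod (?I (mod_profile (trunc k f))) \<le> 2 * M * norm2 L2xt f * norm2 L2xt g" .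
    qed
    then show ?thesis unfolding S(1) .
  qed
  have pairing: "inner2 lborel (\<lambda>x. D (x, t)) \<phi> = inner2 L2xt (time_mult (dsign t) f) (wgt U)"
    if \<phi>: "square_int lborel \<phi>" and \<psi>: "square_int lborel \<psi>" and ae: "AE \<xi> in lborel. FT \<psi> \<xi> = cis (t * (norm \<xi>)\<^sup>2) * FT \<phi> \<xi>"
      and U: "free_evol \<psi> U" for t \<phi> \<psi> U
  proof -
    have [measurable]: "FT \<phi> \<in> borel_measurable borel" "FT \<psi> \<in> borel_measurable borel"
      using FT_spec(1)[OF \<phi>] FT_spec(1)[OF \<psi>] by (auto simp: square_int_def)
    have [measurable]: "(\<lambda>\<xi>. J (\<xi>, t)) \<in> borel_measurable borel" using Js(1)[of t] by (simp add: square_int_def)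
    have "inner2 lborel (\<lambda>x. D (x, t)) \<phi> = inner2 lborel (FT (\<lambda>x. D (x, t))) (FT \<phi>)"
      by (rule FT_Parseval[OF D(1) \<phi>, symmetric])
    \<comment> \<open>The phase exp (- \<i>t |\<xi>|^2) in \<open>v\<close> moves to the second
      slot, where conjugation turns it into the phase relating \<open>FT \<psi>\<close> to
      \<open>FT \<phi>\<close>.\<close>
    also have "\<dots> = inner2 lborel (\<lambda>\<xi>. J (\<xi>, t)) (FT \<psi>)"
      unfolding inner2_def using ae D(2)[of t]
      by (intro integral_cong_AE) (measurable, auto simp: v_def cis_cnj)
    finally have 1: "inner2 lborel (\<lambda>x. D (x, t)) \<phi> = inner2 lborel (\<lambda>\<xi>. J (\<xi>, t)) (FT \<psi>)" .
    have A: "(\<lambda>k. inner2 lborel (profile (trunc k f) t) (FT \<psi>)) \<longlonglongrightarrow> inner2 lborel (\<lambda>\<xi>. J (\<xi>, t)) (FT \<psi>)"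
      by (intro inner2_tendsto profile_square_int n Js FT_spec \<psi>)
    have e: "inner2 lborel (profile (trunc k f) t) (FT \<psi>) = inner2 L2xt (time_mult (dsign t) (trunc k f)) (wgt U)" for k
    proof -
      have "inner2 lborel (profile (trunc k f) t) (FT \<psi>) = (\<integral>p. wgt (time_mult (dsign t) (trunc k f)) p * cnj (U p) \<partial>L2xt)"
        unfolding profile_def by (rule free_pairing[OF \<psi> U admissibleD(2)[OF admissible_dsign(1)[OF n]], symmetric])
      also have "\<dots> = inner2 L2xt (time_mult (dsign t) (trunc k f)) (wgt U)"
        unfolding inner2_def by (intro Bochner_Integration.integral_cong refl) simp
      finally show ?thesis .
    qed
    \<comment> \<open>Free smoothing puts \<open>wgt U\<close> in L2, so this side is continuous in
      the source.\<close>
    have B: "(\<lambda>k. inner2 L2xt (time_mult (dsign t) (trunc k f)) (wgt U)) \<longlonglongrightarrow> inner2 L2xt (time_mult (dsign t) f) (wgt U)"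
    proof (rule inner2_tendsto)
      show "square_int L2xt (wgt U)" by (rule free_smoothing(1)[OF \<psi> U])
      have "norm2 L2xt (\<lambda>p. time_mult (dsign t) (trunc k f) p - time_mult (dsign t) f p) \<le> norm2 L2xt (\<lambda>p. trunc k f p - f p)" for k
        using norm2_time_mult_dsign_le(1)[OF square_int_diff(1)[OF trunc_square_int[OF f, of k] f], of t] by (simp add: time_mult_def[abs_def] right_diff_distrib)
      then show "(\<lambda>k. norm2 L2xt (\<lambda>p. time_mult (dsign t) (trunc k f) p - time_mult (dsign t) f p)) \<longlonglongrightarrow> 0"
        by (intro Lim_null_comparison[OF always_eventually trunc_tendsto[OF f]]) simp
    qed (intro norm2_time_mult_dsign_le trunc_square_int f)+
    show ?thesis unfolding 1 using LIMSEQ_unique[OF A B[folded e]] .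
  qed
  have "square_int L2xt (wgt D)" "norm2 L2xt (wgt D) \<le> 2 * M * norm2 L2xt f"
    using smoothing_duality[OF Dm _ smooth] M_nonneg by auto
  with Dm D(1) Dn cont pairing show ?thesis unfolding duhamel_evol_def by blast
qed

lemma free_continuous:
  assumes \<phi>: "square_int lborel \<phi>" and U: "free_evol \<phi> U"
  shows "((\<lambda>s. norm2 lborel (\<lambda>x. U (x, s) - U (x, t))) \<longlongrightarrow> 0) (at t)"
  by (rule modulated_continuity[of U "\<lambda>_. FT \<phi>"]) (use U FT_spec(1)[OF \<phi>] in \<open>auto simp: free_evol_def\<close>)

end

section \<open>Consequences of the weak description of the Duhamel term\<close>

context smoothing
begin

lemma duhamel_evolD:
  assumes "duhamel_evol f D"
  shows "D \<in> borel_measurable lborel2" "square_int lborel (\<lambda>x. D (x, t))" "norm2 lborel (\<lambda>x. D (x, t)) \<le> sqrt2M * norm2 L2xt f"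
    "((\<lambda>s. norm2 lborel (\<lambda>x. D (x, s) - D (x, t))) \<longlongrightarrow> 0) (at t)" "square_int L2xt (wgt D)" "norm2 L2xt (wgt D) \<le> 2 * M * norm2 L2xt f"
    "square_int lborel \<phi> \<Longrightarrow> square_int lborel \<psi> \<Longrightarrow> (AE \<xi> in lborel. FT \<psi> \<xi> = cis (t * (norm \<xi>)\<^sup>2) * FT \<phi> \<xi>) \<Longrightarrow>
        free_evol \<psi> U \<Longrightarrow> inner2 lborel (\<lambda>x. D (x, t)) \<phi> = inner2 L2xt (time_mult (dsign t) f) (wgt U)"
  using assms unfolding duhamel_evol_def by blast+

text \<open>\<psi> is exp (- \<i>t\<Delta>) \<phi>, so its free evolution at time s is exp (\<i>(s -
  t)\<Delta>) \<phi>, the test function in \<open>is_duhamel\<close>.\<close>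

lemma backward_data_exists:
  assumes \<phi>: "square_int lborel \<phi>"
  obtains \<psi> U where "square_int lborel \<psi>" "AE \<xi> in lborel. FT \<psi> \<xi> = cis (t * (norm \<xi>)\<^sup>2) * FT \<phi> \<xi>" "free_evol \<psi> U"
proof -
  have s: "square_int lborel (\<lambda>\<xi>. cis (t * (norm \<xi>)\<^sup>2) * FT \<phi> \<xi>)" by (intro square_int_cis_mult FT_spec \<phi>) measurable
  obtain U where "free_evol (IFT (\<lambda>\<xi>. cis (t * (norm \<xi>)\<^sup>2) * FT \<phi> \<xi>)) U" using free_exists[OF IFT_square_int[OF s]] ..
  with that[OF IFT_square_int[OF s] FT_IFT[OF s]] show thesis by blast
qed

text \<open>Duhamel evolutions come from an existence statement, which carries no linearity. It is
  recovered from the pairing clause, which determines each slice up to a null set.\<close>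

lemma duhamel_pairing_diff:
  assumes f: "square_int L2xt f" and g: "square_int L2xt g" and D: "duhamel_evol f D" and E: "duhamel_evol g E" and H: "duhamel_evol (\<lambda>p. f p - g p) H"
  shows "AE x in lborel. D (x, t) - E (x, t) = H (x, t)"
proof (rule inner2_eq_imp_AE_eq)
  show "square_int lborel (\<lambda>x. D (x, t) - E (x, t))" by (intro square_int_diff duhamel_evolD(2)[OF D] duhamel_evolD(2)[OF E])
  show "square_int lborel (\<lambda>x. H (x, t))" by (rule duhamel_evolD(2)[OF H])
  fix \<phi> :: "'a \<Rightarrow> complex" assume \<phi>: "square_int lborel \<phi>"
  obtain \<psi> U where \<psi>: "square_int lborel \<psi>" "AE \<xi> in lborel. FT \<psi> \<xi> = cis (t * (norm \<xi>)\<^sup>2) * FT \<phi> \<xi>" "free_evol \<psi> U"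
    using backward_data_exists[OF \<phi>] by blast
  have e: "time_mult (dsign t) (\<lambda>p. f p - g p) = (\<lambda>p. time_mult (dsign t) f p - time_mult (dsign t) g p)" by (simp add: time_mult_def fun_eq_iff right_diff_distrib)
  show "inner2 lborel (\<lambda>x. D (x, t) - E (x, t)) \<phi> = inner2 lborel (\<lambda>x. H (x, t)) \<phi>"
    unfolding inner2_diff_left[OF duhamel_evolD(2)[OF D] duhamel_evolD(2)[OF E] \<phi>] duhamel_evolD(7)[OF D \<phi> \<psi>] duhamel_evolD(7)[OF E \<phi> \<psi>] duhamel_evolD(7)[OF H \<phi> \<psi>] e
    by (intro inner2_diff_left[symmetric] norm2_time_mult_dsign_le f g free_smoothing(1)[OF \<psi>(1,3)])
qed

text \<open>By Tonelli, equality on almost all slices is equality almost everywhere in space-time;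
  joint measurability of both functions is what makes this correct.\<close>

lemma norm2_cong_slices:
  fixes u v :: "'a \<times> real \<Rightarrow> complex"
  assumes [measurable]: "u \<in> borel_measurable lborel2" "v \<in> borel_measurable lborel2"
    and ae: "AE t in lborel. AE x in lborel. u (x, t) = v (x, t)"
  shows "AE p in L2xt. u p = v p"
proof -
  have "(\<integral>\<^sup>+p. ennreal (cmod (u p - v p)) \<partial>L2xt) = (\<integral>\<^sup>+t. \<integral>\<^sup>+x. ennreal (cmod (u (x, t) - v (x, t))) \<partial>lborel \<partial>lborel)"
    by (rule lborel_pair.nn_integral_snd[symmetric]) measurable
  also have "\<dots> = (\<integral>\<^sup>+t. 0 \<partial>(lborel :: real measure))"
  proof (rule nn_integral_cong_AE, use ae in eventually_elim)
    case (elim t)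
    then have "AE x in lborel. ennreal (cmod (u (x, t) - v (x, t))) = 0" by eventually_elim simp
    then have "(\<integral>\<^sup>+x. ennreal (cmod (u (x, t) - v (x, t))) \<partial>lborel) = (\<integral>\<^sup>+x. 0 \<partial>(lborel :: 'a measure))"
      by (rule nn_integral_cong_AE)
    then show ?case by simp
  qed
  finally have "(\<integral>\<^sup>+p. ennreal (cmod (u p - v p)) \<partial>L2xt) = 0" by simp
  then have "AE p in L2xt. ennreal (cmod (u p - v p)) = 0"
    by (subst (asm) nn_integral_0_iff_AE) measurable
  then show ?thesis by eventually_elim simp
qed

lemma duhamel_diff_bounds:
  assumes f: "square_int L2xt f" and g: "square_int L2xt g" and D: "duhamel_evol f D" and E: "duhamel_evol g E"
  shows "norm2 L2xt (\<lambda>p. wgt D p - wgt E p) \<le> 2 * M * norm2 L2xt (\<lambda>p. f p - g p)"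
    "norm2 lborel (\<lambda>x. D (x, t) - E (x, t)) \<le> sqrt2M * norm2 L2xt (\<lambda>p. f p - g p)"
proof -
  obtain H where H: "duhamel_evol (\<lambda>p. f p - g p) H" using duhamel_exists[OF square_int_diff(1)[OF f g]] ..
  note ae = duhamel_pairing_diff[OF f g D E H]
  note m [measurable] = duhamel_evolD(1)[OF D] duhamel_evolD(1)[OF E] duhamel_evolD(1)[OF H]
  have "AE p in L2xt. D p - E p = H p" by (rule norm2_cong_slices) (auto intro: ae)
  then have "norm2 L2xt (\<lambda>p. wgt D p - wgt E p) = norm2 L2xt (wgt H)"
    by (intro norm2_cong_AE) (measurable, auto simp: right_diff_distrib[symmetric])
  then show "norm2 L2xt (\<lambda>p. wgt D p - wgt E p) \<le> 2 * M * norm2 L2xt (\<lambda>p. f p - g p)"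
    using duhamel_evolD(6)[OF H] by simp
  have "norm2 lborel (\<lambda>x. D (x, t) - E (x, t)) = norm2 lborel (\<lambda>x. H (x, t))"
    by (intro norm2_cong_AE ae) measurable
  then show "norm2 lborel (\<lambda>x. D (x, t) - E (x, t)) \<le> sqrt2M * norm2 L2xt (\<lambda>p. f p - g p)"
    using duhamel_evolD(3)[OF H, of t] by simp
qed

lemma duhamel_at_0:
  assumes D: "duhamel_evol f D" shows "AE x in lborel. D (x, 0) = 0"
proof (rule inner2_eq_imp_AE_eq[OF duhamel_evolD(2)[OF D]])
  fix \<phi> :: "'a \<Rightarrow> complex" assume \<phi>: "square_int lborel \<phi>"
  obtain \<psi> U where \<psi>: "square_int lborel \<psi>" "AE \<xi> in lborel. FT \<psi> \<xi> = cis (0 * (norm \<xi>)\<^sup>2) * FT \<phi> \<xi>" "free_evol \<psi> U"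
    using backward_data_exists[OF \<phi>] by blast
  have "time_mult (dsign 0) f = (\<lambda>_. 0)" by (auto simp: fun_eq_iff time_mult_def dsign_def)
  then show "inner2 lborel (\<lambda>x. D (x, 0)) \<phi> = inner2 lborel (\<lambda>x. 0) \<phi>"
    unfolding duhamel_evolD(7)[OF D \<phi> \<psi>] by (simp add: inner2_def)
qed simp

lemma free_at_0:
  assumes \<phi>: "square_int lborel \<phi>" and U: "free_evol \<phi> U" shows "AE x in lborel. U (x, 0) = \<phi> x"
proof (rule FT_inject[OF _ \<phi>])
  show "square_int lborel (\<lambda>x. U (x, 0))" using U by (simp add: free_evol_def)
  have "AE \<xi> in lborel. FT (\<lambda>x. U (x, 0)) \<xi> = cis (- (0 * (norm \<xi>)\<^sup>2)) * FT \<phi> \<xi>" using U unfolding free_evol_def by blast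
  then show "AE \<xi> in lborel. FT (\<lambda>x. U (x, 0)) \<xi> = FT \<phi> \<xi>" by simp
qed

end

section \<open>The fixed point argument for the amplitude\<close>

text \<open>\<open>norm2\<close> is only a seminorm on functions, so the Picard iteration is run by
  hand and the fixed point equation holds almost everywhere.\<close>

lemma contraction_fixed_point:
  assumes N: "sigma_finite_measure N" and sq: "\<And>g. square_int N g \<Longrightarrow> square_int N (\<Phi> g)"
    and contr: "\<And>g h. square_int N g \<Longrightarrow> square_int N h \<Longrightarrow> norm2 N (\<lambda>x. \<Phi> g x - \<Phi> h x) \<le> 1/2 * norm2 N (\<lambda>x. g x - h x)"
  shows "\<exists>g. square_int N g \<and> (AE x in N. \<Phi> g x = g x)"
proof -
  define G where "G k = (\<Phi> ^^ k) (\<lambda>_. 0)" for k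
  have G0: "G 0 = (\<lambda>_. 0)" and GS: "G (Suc k) = \<Phi> (G k)" for k by (simp_all add: G_def)
  have Gs: "square_int N (G k)" for k by (induction k) (simp_all add: G0 GS sq)
  define c where "c = norm2 N (\<lambda>x. G 1 x - G 0 x)"
  have step: "norm2 N (\<lambda>x. G (Suc k) x - G k x) \<le> (1/2)^k * c" for k
  proof (induction k)
    case (Suc k)
    have "norm2 N (\<lambda>x. G (Suc (Suc k)) x - G (Suc k) x) \<le> 1/2 * norm2 N (\<lambda>x. G (Suc k) x - G k x)"
      using contr[OF Gs Gs, of "Suc k" k] by (simp only: GS)
    then show ?case using Suc by simp
  qed (simp add: c_def)
  \<comment> \<open>The first factor is the partial geometric sum of 2^(-i) over i < n.\<close>
  have far: "norm2 N (\<lambda>x. G (k + n) x - G k x) \<le> (2 - 2 * (1/2)^n) * ((1/2)^k * c)" for k n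
  proof (induction n)
    case (Suc n)
    have "norm2 N (\<lambda>x. G (k + Suc n) x - G k x) \<le> norm2 N (\<lambda>x. G (Suc (k + n)) x - G (k + n) x) + norm2 N (\<lambda>x. G (k + n) x - G k x)"
      using norm2_triangle[OF Gs[of "Suc (k + n)"] Gs[of "k + n"] Gs[of k]] by simp
    also have "\<dots> \<le> (1/2)^(k + n) * c + (2 - 2 * (1/2)^n) * ((1/2)^k * c)" by (intro add_mono step Suc)
    also have "\<dots> = (2 - 2 * (1/2)^Suc n) * ((1/2)^k * c)" by (simp add: power_add algebra_simps)
    finally show ?case .
  qed simp
  have c0: "0 \<le> c" by (simp add: c_def)
  have far': "norm2 N (\<lambda>x. G l x - G k x) \<le> 2 * ((1/2)^k * c)" if "k \<le> l" for k l
  proof -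
    have "norm2 N (\<lambda>x. G l x - G k x) \<le> (2 - 2 * (1/2)^(l - k)) * ((1/2)^k * c)" using far[of k "l - k"] that by simp
    also have "\<dots> \<le> 2 * ((1/2)^k * c)" using c0 by (intro mult_right_mono) auto
    finally show ?thesis .
  qed
  have "\<exists>g. square_int N g \<and> (\<lambda>k. norm2 N (\<lambda>x. G k x - g x)) \<longlonglongrightarrow> 0"
  proof (rule L2_complete[OF Gs _ N])
    fix e :: real assume e: "0 < e"
    \<comment> \<open>Two tails of size 2 (1/2)^K c, since k and l are both compared with K.\<close>
    have "(\<lambda>k. 4 * ((1/2)^k * c)) \<longlonglongrightarrow> 4 * (0 * c)" by (intro tendsto_intros LIMSEQ_power_zero) auto
    then have "\<forall>\<^sub>F k in sequentially. 4 * ((1/2)^k * c) < e" using e by (intro order_tendstoD(2)) auto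
    then obtain K where K: "4 * ((1/2)^K * c) < e" by (auto simp: eventually_sequentially)
    have "norm2 N (\<lambda>x. G k x - G l x) \<le> e" if "k \<ge> K" "l \<ge> K" for k l
      using norm2_triangle[OF Gs[of k] Gs[of K] Gs[of l]] far'[OF that(1)] far'[OF that(2)] K by (simp add: norm2_commute[of N "G K"])
    then show "\<exists>K. \<forall>k\<ge>K. \<forall>l\<ge>K. norm2 N (\<lambda>x. G k x - G l x) \<le> e" by blast
  qed
  then obtain g where g: "square_int N g" "(\<lambda>k. norm2 N (\<lambda>x. G k x - g x)) \<longlonglongrightarrow> 0" by blast
  have "(\<lambda>k. norm2 N (\<lambda>x. G (Suc k) x - \<Phi> g x)) \<longlonglongrightarrow> 0"
  proof (rule Lim_null_comparison[OF always_eventually])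
    show "\<forall>k. norm (norm2 N (\<lambda>x. G (Suc k) x - \<Phi> g x)) \<le> 1/2 * norm2 N (\<lambda>x. G k x - g x)"
      using contr[OF Gs g(1)] by (simp add: GS)
    show "(\<lambda>k. 1/2 * norm2 N (\<lambda>x. G k x - g x)) \<longlonglongrightarrow> 0" by (intro tendsto_mult_right_zero g)
  qed
  from norm2_limit_AE_unique[OF Gs sq[OF g(1)] g(1) this LIMSEQ_Suc[OF g(2)]] g(1) show ?thesis by blast
qed

context smoothing
begin

text \<open>\<theta> will be the phase of the potential, so that V = a \<theta> a and
  \<open>V u = a g\<close>. The unknown \<open>g\<close> lies in plain L2 and is exactly the kind of
  source for which Duhamel evolutions exist.\<close>

definition solves :: "('a \<Rightarrow> complex) \<Rightarrow> ('a \<times> real \<Rightarrow> complex) \<Rightarrow> ('a \<times> real \<Rightarrow> complex) \<Rightarrow>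
    ('a \<times> real \<Rightarrow> complex) \<Rightarrow> ('a \<times> real \<Rightarrow> complex) \<Rightarrow> bool" where
  "solves \<theta> U D g E \<longleftrightarrow> square_int L2xt g \<and> duhamel_evol g E \<and>
     (AE p in L2xt. g p = \<theta> (fst p) * wgt (\<lambda>p. U p - \<i> * D p - \<i> * E p) p)"

lemma wgt_combination:
  assumes "square_int L2xt (wgt U)" "square_int L2xt (wgt D)" "square_int L2xt (wgt E)"
  shows "square_int L2xt (wgt (\<lambda>p. U p - \<i> * D p - \<i> * E p))"
    "norm2 L2xt (wgt (\<lambda>p. U p - \<i> * D p - \<i> * E p)) \<le> norm2 L2xt (wgt U) + norm2 L2xt (wgt D) + norm2 L2xt (wgt E)"
proof -
  have e: "wgt (\<lambda>p. U p - \<i> * D p - \<i> * E p) = (\<lambda>p. (wgt U p - \<i> * wgt D p) - \<i> * wgt E p)"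
    by (simp add: algebra_simps)
  have i: "square_int L2xt (\<lambda>p. \<i> * wgt D p)" "square_int L2xt (\<lambda>p. \<i> * wgt E p)" using assms by auto
  show "square_int L2xt (wgt (\<lambda>p. U p - \<i> * D p - \<i> * E p))" unfolding e by (intro square_int_diff assms i)
  have "norm2 L2xt (\<lambda>p. (wgt U p - \<i> * wgt D p) - \<i> * wgt E p) \<le> norm2 L2xt (\<lambda>p. wgt U p - \<i> * wgt D p) + norm2 L2xt (\<lambda>p. \<i> * wgt E p)"
    by (intro square_int_diff assms i)
  also have "norm2 L2xt (\<lambda>p. wgt U p - \<i> * wgt D p) \<le> norm2 L2xt (wgt U) + norm2 L2xt (\<lambda>p. \<i> * wgt D p)"
    by (intro square_int_diff assms i)
  finally show "norm2 L2xt (wgt (\<lambda>p. U p - \<i> * D p - \<i> * E p)) \<le> norm2 L2xt (wgt U) + norm2 L2xt (wgt D) + norm2 L2xt (wgt E)"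
    unfolding e by (simp only: norm2_cmult norm_ii mult_1_left)
qed

context
  fixes \<theta> :: "'a \<Rightarrow> complex"
  assumes small: "4 * M \<le> 1" and \<theta> [measurable]: "\<theta> \<in> borel_measurable borel" and \<theta>_le: "\<And>x. cmod (\<theta> x) \<le> 1"
begin

lemma norm2_\<theta>:
  assumes "square_int L2xt h"
  shows "square_int L2xt (\<lambda>p. \<theta> (fst p) * h p)" "norm2 L2xt (\<lambda>p. \<theta> (fst p) * h p) \<le> norm2 L2xt h"
  using square_int_mult_bounded[OF assms, of "\<lambda>p. \<theta> (fst p)" 1] \<theta>_le by auto

theorem solves_exists:
  assumes U: "square_int L2xt (wgt U)" and D: "square_int L2xt (wgt D)"
  shows "\<exists>g E. solves \<theta> U D g E"
proof -
  define duhamel where "duhamel g = (SOME E. duhamel_evol g E)" for g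
  have duhamel: "duhamel_evol g (duhamel g)" if "square_int L2xt g" for g
    unfolding duhamel_def using duhamel_exists[OF that] by (rule someI_ex)
  define \<Phi> where "\<Phi> g p = \<theta> (fst p) * wgt (\<lambda>p. U p - \<i> * D p - \<i> * duhamel g p) p" for g p
  have "\<exists>g. square_int L2xt g \<and> (AE p in L2xt. \<Phi> g p = g p)"
  proof (rule contraction_fixed_point)
    show "sigma_finite_measure L2xt" by (rule lborel_pair.P.sigma_finite_measure_axioms)
    show "square_int L2xt (\<Phi> g)" if "square_int L2xt g" for g
      unfolding \<Phi>_def by (intro norm2_\<theta> wgt_combination U D duhamel_evolD(5)[OF duhamel[OF that]])
    show "norm2 L2xt (\<lambda>p. \<Phi> g p - \<Phi> h p) \<le> 1/2 * norm2 L2xt (\<lambda>p. g p - h p)" if g: "square_int L2xt g" and h: "square_int L2xt h" for g h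
    proof -
      have "norm2 L2xt (\<lambda>p. \<Phi> g p - \<Phi> h p) = norm2 L2xt (\<lambda>p. (- \<i>) * (\<theta> (fst p) * (wgt (duhamel g) p - wgt (duhamel h) p)))"
        unfolding \<Phi>_def by (simp add: algebra_simps)
      also have "\<dots> = norm2 L2xt (\<lambda>p. \<theta> (fst p) * (wgt (duhamel g) p - wgt (duhamel h) p))"
        by (simp only: norm2_cmult norm_minus_cancel norm_ii mult_1_left)
      also have "\<dots> \<le> norm2 L2xt (\<lambda>p. wgt (duhamel g) p - wgt (duhamel h) p)"
        by (intro norm2_\<theta> square_int_diff duhamel_evolD(5)[OF duhamel] g h)
      also have "\<dots> \<le> 2 * M * norm2 L2xt (\<lambda>p. g p - h p)"
        by (intro duhamel_diff_bounds g h duhamel)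
      \<comment> \<open>The smallness 4 M \<le> 1, read as 2 M \<le> 1/2.\<close>
      also have "\<dots> \<le> 1/2 * norm2 L2xt (\<lambda>p. g p - h p)"
        using small by (intro mult_right_mono) auto
      finally show ?thesis .
    qed
  qed
  then obtain g where g: "square_int L2xt g" "AE p in L2xt. \<Phi> g p = g p" by blast
  have "AE p in L2xt. g p = \<theta> (fst p) * wgt (\<lambda>p. U p - \<i> * D p - \<i> * duhamel g p) p"
    using g(2) unfolding \<Phi>_def by eventually_elim simp
  with g(1) duhamel[OF g(1)] show ?thesis unfolding solves_def by blast
qed

text \<open>Subtraction removes \<open>U\<close> and \<open>D\<close>, and the difference of the
  amplitudes has norm at most half of itself. The conclusion is drawn for the Duhamel terms at every
  time, because these determine the solution also where \<open>a\<close> vanishes.\<close>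

lemma solves_unique:
  assumes g: "solves \<theta> U D g E" and g': "solves \<theta> U D g' E'"
  shows "AE x in lborel. E (x, t) = E' (x, t)"
proof -
  have s: "square_int L2xt g" "duhamel_evol g E" "square_int L2xt g'" "duhamel_evol g' E'" using g g' by (auto simp: solves_def)
  have [measurable]: "g \<in> borel_measurable L2xt" "g' \<in> borel_measurable L2xt" "E \<in> borel_measurable L2xt" "E' \<in> borel_measurable L2xt"
    using s duhamel_evolD(1) by (auto simp: square_int_def)
  have ae: "AE p in L2xt. g p - g' p = (- \<i>) * (\<theta> (fst p) * (wgt E p - wgt E' p))"
  proof -
    have "AE p in L2xt. g p = \<theta> (fst p) * wgt (\<lambda>p. U p - \<i> * D p - \<i> * E p) p"
      "AE p in L2xt. g' p = \<theta> (fst p) * wgt (\<lambda>p. U p - \<i> * D p - \<i> * E' p) p"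
      using g g' by (auto simp: solves_def)
    then show ?thesis
    proof eventually_elim
      case (elim p)
      show ?case by (subst elim(1), subst elim(2)) (simp add: algebra_simps)
    qed
  qed
  have "norm2 L2xt (\<lambda>p. g p - g' p) = norm2 L2xt (\<lambda>p. (- \<i>) * (\<theta> (fst p) * (wgt E p - wgt E' p)))"
    using ae by (intro norm2_cong_AE) auto
  also have "\<dots> = norm2 L2xt (\<lambda>p. \<theta> (fst p) * (wgt E p - wgt E' p))"
    by (simp only: norm2_cmult norm_minus_cancel norm_ii mult_1_left)
  also have "\<dots> \<le> norm2 L2xt (\<lambda>p. wgt E p - wgt E' p)"
    by (intro norm2_\<theta> square_int_diff duhamel_evolD(5)[OF s(2)] duhamel_evolD(5)[OF s(4)])
  also have "\<dots> \<le> 2 * M * norm2 L2xt (\<lambda>p. g p - g' p)"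
    by (rule duhamel_diff_bounds(1)[OF s(1,3,2,4)])
  also have "\<dots> \<le> 1/2 * norm2 L2xt (\<lambda>p. g p - g' p)"
    using small by (intro mult_right_mono) auto
  finally have "norm2 L2xt (\<lambda>p. g p - g' p) = 0" using norm2_nonneg[of L2xt "\<lambda>p. g p - g' p"] by linarith
  then have "norm2 lborel (\<lambda>x. E (x, t) - E' (x, t)) = 0"
    using duhamel_diff_bounds(2)[OF s(1,3,2,4), of t] norm2_nonneg[of lborel "\<lambda>x. E (x, t) - E' (x, t)"] by simp
  then show ?thesis using AE_eq_norm2[OF duhamel_evolD(2)[OF s(2)] duhamel_evolD(2)[OF s(4)]] by simp
qed

text \<open>The amplitude is bounded by \<open>wgt u\<close>, as \<theta> has modulus at most 1;
  this closes the weighted estimate first, and the bound in L2 at fixed time then follows from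
  it.\<close>

lemma solves_bounds:
  assumes \<phi>: "square_int lborel \<phi>" and U: "free_evol \<phi> U" and D: "duhamel_evol f D" and g: "solves \<theta> U D g E"
  defines "u \<equiv> \<lambda>p. U p - \<i> * D p - \<i> * E p"
  shows "square_int L2xt (wgt u)" "norm2 L2xt (wgt u) \<le> 2 * sqrt2M * norm2 lborel \<phi> + 4 * M * norm2 L2xt f"
    "square_int lborel (\<lambda>x. u (x, t))" "norm2 lborel (\<lambda>x. u (x, t)) \<le> 2 * norm2 lborel \<phi> + 2 * sqrt2M * norm2 L2xt f"
    "((\<lambda>s. norm2 lborel (\<lambda>x. u (x, s) - u (x, t))) \<longlongrightarrow> 0) (at t)"
    "AE x in lborel. u (x, 0) = \<phi> x"
proof -
  have s: "square_int L2xt g" "duhamel_evol g E" and ae: "AE p in L2xt. g p = \<theta> (fst p) * wgt u p" using g by (auto simp: solves_def u_def)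
  note F = free_smoothing[OF \<phi> U] and D' = duhamel_evolD[OF D] and E' = duhamel_evolD[OF s(2)]
  have Us: "square_int lborel (\<lambda>x. U (x, t))" for t using U by (simp add: free_evol_def)
  have [measurable]: "U \<in> borel_measurable L2xt" using U by (simp add: free_evol_def)
  note [measurable] = D'(1) E'(1)
  have um [measurable]: "u \<in> borel_measurable L2xt" unfolding u_def by measurable
  show us: "square_int L2xt (wgt u)" unfolding u_def by (intro wgt_combination F D' E')
  have "norm2 L2xt g = norm2 L2xt (\<lambda>p. \<theta> (fst p) * wgt u p)"
    using ae s(1) by (intro norm2_cong_AE) (auto simp: square_int_def)
  also have "\<dots> \<le> norm2 L2xt (wgt u)" by (intro norm2_\<theta> us)
  finally have gu: "norm2 L2xt g \<le> norm2 L2xt (wgt u)" .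
  have "norm2 L2xt (wgt u) \<le> sqrt2M * norm2 lborel \<phi> + 2 * M * norm2 L2xt f + 2 * M * norm2 L2xt g"
    unfolding u_def by (intro order_trans[OF wgt_combination(2)] add_mono F D' E')
  \<comment> \<open>This half of the weighted norm is absorbed on the left, which is legitimate as
    that norm is finite, and it doubles the other terms.\<close>
  also have "2 * M * norm2 L2xt g \<le> 1/2 * norm2 L2xt (wgt u)"
    using small gu M_nonneg by (intro mult_mono) auto
  finally show B: "norm2 L2xt (wgt u) \<le> 2 * sqrt2M * norm2 lborel \<phi> + 4 * M * norm2 L2xt f" by simp
  have i: "square_int lborel (\<lambda>x. \<i> * D (x, t))" "square_int lborel (\<lambda>x. \<i> * E (x, t))" for t using D'(2) E'(2) by auto
  show "square_int lborel (\<lambda>x. u (x, t))" unfolding u_def by (intro square_int_diff Us i)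
  have tri: "norm2 lborel (\<lambda>x. (p x - \<i> * q x) - \<i> * r x) \<le> norm2 lborel p + norm2 lborel q + norm2 lborel r"
    if "square_int lborel p" "square_int lborel q" "square_int lborel r" for p q r :: "'a \<Rightarrow> complex"
  proof -
    have "square_int lborel (\<lambda>x. \<i> * q x)" "square_int lborel (\<lambda>x. \<i> * r x)" using that by auto
    note square_int_diff(2)[OF square_int_diff(1)[OF that(1) this(1)] this(2)] square_int_diff(2)[OF that(1) this(1)]
    then show ?thesis by (simp add: norm2_cmult)
  qed
  have "norm2 lborel (\<lambda>x. u (x, t)) \<le> norm2 lborel \<phi> + sqrt2M * norm2 L2xt f + sqrt2M * norm2 L2xt g"
    unfolding u_def using free_norm2[OF \<phi> U, of t]
    by (intro order_trans[OF tri[OF Us D'(2) E'(2)]] add_mono D'(3) E'(3)) simp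
  also have "sqrt2M * norm2 L2xt g \<le> sqrt2M * (2 * sqrt2M * norm2 lborel \<phi> + 4 * M * norm2 L2xt f)"
    using gu B M_nonneg by (intro mult_left_mono) auto
  \<comment> \<open>The product of the two factors sqrt (2 M) is 2 M; after that 4 M \<le> 1 leaves
    one more copy of each term.\<close>
  also have "\<dots> = 4 * M * norm2 lborel \<phi> + (4 * M) * (sqrt2M * norm2 L2xt f)"
    using M_nonneg by (simp add: algebra_simps power2_eq_square[symmetric])
  also have "\<dots> \<le> 1 * norm2 lborel \<phi> + 1 * (sqrt2M * norm2 L2xt f)"
    using small M_nonneg by (intro add_mono mult_right_mono) auto
  finally show "norm2 lborel (\<lambda>x. u (x, t)) \<le> 2 * norm2 lborel \<phi> + 2 * sqrt2M * norm2 L2xt f" by (simp add: mult_ac)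
  show "((\<lambda>s. norm2 lborel (\<lambda>x. u (x, s) - u (x, t))) \<longlongrightarrow> 0) (at t)"
  proof (rule Lim_null_comparison[OF always_eventually])
    show "((\<lambda>s. norm2 lborel (\<lambda>x. U (x, s) - U (x, t)) + norm2 lborel (\<lambda>x. D (x, s) - D (x, t)) + norm2 lborel (\<lambda>x. E (x, s) - E (x, t))) \<longlongrightarrow> 0) (at t)"
      by (intro tendsto_add_zero free_continuous[OF \<phi> U] D'(4) E'(4))
    show "\<forall>s. norm (norm2 lborel (\<lambda>x. u (x, s) - u (x, t)))
      \<le> norm2 lborel (\<lambda>x. U (x, s) - U (x, t)) + norm2 lborel (\<lambda>x. D (x, s) - D (x, t)) + norm2 lborel (\<lambda>x. E (x, s) - E (x, t))"
    proof
      fix s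
      have "(\<lambda>x. u (x, s) - u (x, t)) = (\<lambda>x. ((U (x, s) - U (x, t)) - \<i> * (D (x, s) - D (x, t))) - \<i> * (E (x, s) - E (x, t)))"
        by (simp add: u_def algebra_simps)
      then show "norm (norm2 lborel (\<lambda>x. u (x, s) - u (x, t)))
        \<le> norm2 lborel (\<lambda>x. U (x, s) - U (x, t)) + norm2 lborel (\<lambda>x. D (x, s) - D (x, t)) + norm2 lborel (\<lambda>x. E (x, s) - E (x, t))"
        using tri[OF square_int_diff(1)[OF Us Us] square_int_diff(1)[OF D'(2) D'(2)] square_int_diff(1)[OF E'(2) E'(2)], of s t s t s t] by simp
    qed
  qed
  show "AE x in lborel. u (x, 0) = \<phi> x"
    using free_at_0[OF \<phi> U] duhamel_at_0[OF D] duhamel_at_0[OF s(2)] by eventually_elim (simp add: u_def)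
qed

end

end

section \<open>Lebesgue measurable representatives\<close>

text \<open>The bridge between the Lebesgue measurable functions of the statement and the Borel
  functions of the proof; it respects products, integrals and weighted norms.\<close>

definition borel_rep :: "('a::euclidean_space \<Rightarrow> complex) \<Rightarrow> ('a \<Rightarrow> complex) \<Rightarrow> bool" where
  "borel_rep f f' \<longleftrightarrow> f' \<in> borel_measurable lborel \<and> (AE x in lborel. f x = f' x)"

lemma borel_rep_refl: "f \<in> borel_measurable lborel \<Longrightarrow> borel_rep f f"
  by (simp add: borel_rep_def)

lemma borel_rep_measurable:
  assumes "borel_rep f f'" shows "f \<in> borel_measurable lebesgue"
proof (rule borel_measurable_AE)
  show "f' \<in> borel_measurable lebesgue" using assms by (intro measurable_completion) (simp add: borel_rep_def)
  show "AE x in lebesgue. f' x = f x" unfolding AE_completion_iff using assms by (auto simp: borel_rep_def)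
qed

lemma borel_rep_exists:
  fixes f :: "'a::euclidean_space \<Rightarrow> complex"
  assumes "f \<in> borel_measurable lebesgue"
  obtains f' where "borel_rep f f'"
proof -
  have "(\<lambda>x. Re (f x)) \<in> borel_measurable lebesgue" "(\<lambda>x. Im (f x)) \<in> borel_measurable lebesgue"
    using assms by auto
  then obtain r i where [measurable]: "r \<in> borel_measurable lborel" "i \<in> borel_measurable lborel"
    and ae: "AE x in lborel. Re (f x) = r x" "AE x in lborel. Im (f x) = i x"
    using completion_ex_borel_measurable_real by metis
  from ae have "AE x in lborel. f x = complex_of_real (r x) + \<i> * complex_of_real (i x)"
    by eventually_elim (simp add: complex_eq_iff)
  then show thesis by (intro that[of "\<lambda>x. complex_of_real (r x) + \<i> * complex_of_real (i x)"]) (simp add: borel_rep_def)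
qed

lemma borel_rep_integral:
  assumes "borel_rep f f'"
  shows "integral\<^sup>L lebesgue f = integral\<^sup>L lborel f'" "integrable lebesgue f \<longleftrightarrow> integrable lborel f'"
proof -
  have f': "f' \<in> borel_measurable lborel" and ae: "AE x in lebesgue. f x = f' x"
    using assms by (auto simp: borel_rep_def AE_completion_iff)
  have m: "f \<in> borel_measurable lebesgue" "f' \<in> borel_measurable lebesgue"
    using borel_rep_measurable[OF assms] measurable_completion[OF f'] by auto
  show "integral\<^sup>L lebesgue f = integral\<^sup>L lborel f'"
    using integral_cong_AE[OF m ae] integral_completion[OF f'] by simp
  show "integrable lebesgue f \<longleftrightarrow> integrable lborel f'"
    using integrable_cong_AE[OF m ae] integrable_completion[OF f'] by simp
qed

lemma borel_rep_mult: "borel_rep f f' \<Longrightarrow> borel_rep g g' \<Longrightarrow> borel_rep (\<lambda>x. f x * g x) (\<lambda>x. f' x * g' x)"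
  and borel_rep_diff: "borel_rep f f' \<Longrightarrow> borel_rep g g' \<Longrightarrow> borel_rep (\<lambda>x. f x - g x) (\<lambda>x. f' x - g' x)"
  and borel_rep_cnj: "borel_rep f f' \<Longrightarrow> borel_rep (\<lambda>x. cnj (f x)) (\<lambda>x. cnj (f' x))"
  by (auto simp: borel_rep_def)

lemma ennreal_sqrt_power2: "0 \<le> c \<Longrightarrow> ennreal_sqrt (ennreal (c\<^sup>2)) = ennreal c"
  by (simp add: ennreal_sqrt_def)

lemma ennreal_sqrt_less_top: "ennreal_sqrt x < top \<longleftrightarrow> x < top"
  by (auto simp: ennreal_sqrt_def less_top)

text \<open>Stated for a general Euclidean space, because the same lemma serves in x and in (x,
  t).\<close>

lemma wnorm_weight:
  fixes b :: "'a::euclidean_space \<Rightarrow> real" and f f' :: "'a \<Rightarrow> complex"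
  assumes f: "borel_rep f f'" and b [measurable]: "b \<in> borel_measurable lborel" and w: "AE x in lborel. w x = ennreal ((b x)\<^sup>2)"
  shows "f \<in> L2w w \<longleftrightarrow> square_int lborel (\<lambda>x. complex_of_real (b x) * f' x)"
    "square_int lborel (\<lambda>x. complex_of_real (b x) * f' x) \<Longrightarrow> wnorm w f = ennreal (norm2 lborel (\<lambda>x. complex_of_real (b x) * f' x))"
proof -
  have [measurable]: "f' \<in> borel_measurable lborel" using f by (simp add: borel_rep_def)
  have eq: "(\<integral>\<^sup>+x. ennreal ((cmod (f x))\<^sup>2) * w x \<partial>lebesgue) = (\<integral>\<^sup>+x. ennreal ((cmod (complex_of_real (b x) * f' x))\<^sup>2) \<partial>lborel)"
    unfolding nn_integral_completion
  proof (rule nn_integral_cong_AE)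
    have "AE x in lborel. f x = f' x" using f by (simp add: borel_rep_def)
    then show "AE x in lborel. ennreal ((cmod (f x))\<^sup>2) * w x = ennreal ((cmod (complex_of_real (b x) * f' x))\<^sup>2)"
      using w by eventually_elim (simp add: ennreal_mult[symmetric] norm_mult power_mult_distrib mult.commute)
  qed
  show "f \<in> L2w w \<longleftrightarrow> square_int lborel (\<lambda>x. complex_of_real (b x) * f' x)"
    using borel_rep_measurable[OF f] by (simp add: L2w_def wnorm_def eq ennreal_sqrt_less_top square_int_iff_nn_integral)
  show "wnorm w f = ennreal (norm2 lborel (\<lambda>x. complex_of_real (b x) * f' x))" if "square_int lborel (\<lambda>x. complex_of_real (b x) * f' x)"
    unfolding wnorm_def eq nn_integral_square_int[OF that] by (simp add: ennreal_sqrt_power2)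
qed

lemma L2_borel_rep:
  assumes "borel_rep f f'"
  shows "f \<in> L2 \<longleftrightarrow> square_int lborel f'" "square_int lborel f' \<Longrightarrow> L2norm f = ennreal (norm2 lborel f')"
  using wnorm_weight[OF assms, of "\<lambda>_. 1" "\<lambda>_. 1"] by simp_all

text \<open>Where b = 0 the weight is infinite, so finiteness of the norm makes f vanish there
  almost everywhere. The quotient is 0 at these points by the convention on division by zero, and
  the factorisation f = b (f / b) still holds.\<close>

lemma wnorm_dual_weight:
  fixes b :: "'a::euclidean_space \<Rightarrow> real" and f f' :: "'a \<Rightarrow> complex"
  assumes f: "borel_rep f f'" and b [measurable]: "b \<in> borel_measurable lborel"
    and w: "AE x in lborel. w x = inverse (ennreal ((b x)\<^sup>2))" and fw: "f \<in> L2w w"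
  shows "square_int lborel (\<lambda>x. f' x / complex_of_real (b x))" "wnorm w f = ennreal (norm2 lborel (\<lambda>x. f' x / complex_of_real (b x)))"
    "AE x in lborel. f x = complex_of_real (b x) * (f' x / complex_of_real (b x))"
proof -
  have fm [measurable]: "f' \<in> borel_measurable lborel" and ae: "AE x in lborel. f x = f' x" using f by (auto simp: borel_rep_def)
  let ?h = "\<lambda>x. ennreal ((cmod (f' x))\<^sup>2) * inverse (ennreal ((b x)\<^sup>2))"
  have eq: "(\<integral>\<^sup>+x. ennreal ((cmod (f x))\<^sup>2) * w x \<partial>lebesgue) = (\<integral>\<^sup>+x. ?h x \<partial>lborel)"
    unfolding nn_integral_completion by (rule nn_integral_cong_AE, use w ae in eventually_elim) simp
  have "wnorm w f < top" using fw by (simp add: L2w_def)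
  then have "(\<integral>\<^sup>+x. ?h x \<partial>lborel) < top" unfolding wnorm_def eq ennreal_sqrt_less_top .
  then have "AE x in lborel. ?h x \<noteq> \<infinity>"
    by (intro nn_integral_PInf_AE) (simp_all add: less_top)
  then have z: "AE x in lborel. b x = 0 \<longrightarrow> f' x = 0"
    by eventually_elim (auto simp: ennreal_mult_eq_top_iff)
  have "AE x in lborel. ?h x = ennreal ((cmod (f' x / complex_of_real (b x)))\<^sup>2)"
    using z
  proof eventually_elim
    case (elim x)
    show ?case
    proof (cases "b x = 0")
      case False
      then have "inverse (ennreal ((b x)\<^sup>2)) = ennreal (inverse ((b x)\<^sup>2))" by (intro inverse_ennreal) simp
      moreover have "(cmod (f' x / complex_of_real (b x)))\<^sup>2 = (cmod (f' x))\<^sup>2 * inverse ((b x)\<^sup>2)"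
        by (simp add: norm_divide power_divide field_simps)
      ultimately show ?thesis by (simp only: ennreal_mult zero_le_power2 inverse_nonnegative_iff_nonnegative)
    qed (use elim in simp)
  qed
  then have eq2: "(\<integral>\<^sup>+x. ?h x \<partial>lborel) = (\<integral>\<^sup>+x. ennreal ((cmod (f' x / complex_of_real (b x)))\<^sup>2) \<partial>lborel)" by (rule nn_integral_cong_AE)
  show s: "square_int lborel (\<lambda>x. f' x / complex_of_real (b x))"
    unfolding square_int_iff_nn_integral using \<open>(\<integral>\<^sup>+x. ?h x \<partial>lborel) < top\<close> eq2 by simp
  show "wnorm w f = ennreal (norm2 lborel (\<lambda>x. f' x / complex_of_real (b x)))"
    unfolding wnorm_def eq eq2 nn_integral_square_int[OF s] by (simp add: ennreal_sqrt_power2)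
  show "AE x in lborel. f x = complex_of_real (b x) * (f' x / complex_of_real (b x))"
    using z ae by eventually_elim auto
qed

text \<open>Only an inequality: where b = 0 the product vanishes, while g may still contribute to
  its own norm.\<close>

lemma wnorm_dual_weight_le:
  fixes b :: "'a::euclidean_space \<Rightarrow> real" and g :: "'a \<Rightarrow> complex"
  assumes g: "square_int lborel g" and b [measurable]: "b \<in> borel_measurable lborel"
    and w: "AE x in lborel. w x = inverse (ennreal ((b x)\<^sup>2))"
  shows "(\<lambda>x. complex_of_real (b x) * g x) \<in> L2w w" "wnorm w (\<lambda>x. complex_of_real (b x) * g x) \<le> ennreal (norm2 lborel g)"
proof -
  have [measurable]: "g \<in> borel_measurable lborel" using g by (simp add: square_int_def)
  have "(\<integral>\<^sup>+x. ennreal ((cmod (complex_of_real (b x) * g x))\<^sup>2) * w x \<partial>lebesgue) \<le> (\<integral>\<^sup>+x. ennreal ((cmod (g x))\<^sup>2) \<partial>lborel)"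
    unfolding nn_integral_completion
  proof (rule nn_integral_mono_AE, use w in eventually_elim)
    case (elim x)
    show ?case
    proof (cases "b x = 0")
      case False
      then have "inverse (ennreal ((b x)\<^sup>2)) = ennreal (inverse ((b x)\<^sup>2))" by (intro inverse_ennreal) simp
      then show ?thesis using False
        by (simp add: elim ennreal_mult[symmetric] norm_mult power_mult_distrib field_simps)
    qed simp
  qed
  also have "\<dots> = ennreal ((norm2 lborel g)\<^sup>2)" by (rule nn_integral_square_int[OF g])
  finally have le: "(\<integral>\<^sup>+x. ennreal ((cmod (complex_of_real (b x) * g x))\<^sup>2) * w x \<partial>lebesgue) \<le> ennreal ((norm2 lborel g)\<^sup>2)" .
  then have fin: "(\<integral>\<^sup>+x. ennreal ((cmod (complex_of_real (b x) * g x))\<^sup>2) * w x \<partial>lebesgue) < top"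
    by (metis ennreal_less_top order_le_less_trans)
  have "(\<lambda>x. complex_of_real (b x) * g x) \<in> borel_measurable lebesgue" by (rule measurable_completion) measurable
  with fin show "(\<lambda>x. complex_of_real (b x) * g x) \<in> L2w w" by (simp add: L2w_def wnorm_def ennreal_sqrt_less_top)
  have mono: "ennreal_sqrt x \<le> ennreal_sqrt y" if "x \<le> y" "y < top" for x y
    using that by (auto simp: ennreal_sqrt_def less_top top_unique intro!: ennreal_leI real_sqrt_le_mono enn2real_mono)
  show "wnorm w (\<lambda>x. complex_of_real (b x) * g x) \<le> ennreal (norm2 lborel g)"
    unfolding wnorm_def using mono[OF le] by (simp add: ennreal_sqrt_power2)
qed

section \<open>The Fourier transform of a Lebesgue measurable function\<close>

lemma fourier_L1_borel_rep:
  assumes f: "borel_rep f f'" shows "fourier_L1 f = ft f'"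
proof
  fix \<xi>
  have "borel_rep (\<lambda>x. cis (- (x \<bullet> \<xi>)) * f x) (\<lambda>x. cis (- (x \<bullet> \<xi>)) * f' x)"
    by (intro borel_rep_mult f borel_rep_refl) measurable
  from borel_rep_integral(1)[OF this] show "fourier_L1 f \<xi> = ft f' \<xi>" by (simp add: fourier_L1_def ft_def ft_const_def)
qed

text \<open>\<open>FT f'\<close> is shown to satisfy the property from which
  \<open>fourier_L2\<close> selects, so the selection is meaningful; uniqueness of L2 limits then
  identifies whatever was selected.\<close>

lemma fourier_L2_borel_rep:
  fixes f :: "'a::euclidean_space \<Rightarrow> complex"
  assumes f: "borel_rep f f'" and s: "square_int lborel f'"
  shows "borel_rep (fourier_L2 f) (FT f')"
proof -
  have [measurable]: "f' \<in> borel_measurable lborel" using s by (simp add: square_int_def)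
  have [measurable]: "cball (0::'a) r \<in> sets borel" for r by auto
  define c where "c r x = indicator (cball 0 r) x * f' x" for r and x :: 'a
  have cm [measurable]: "c r \<in> borel_measurable lborel" for r unfolding c_def[abs_def] by measurable
  have "bdd_supp (indicator (cball 0 r) :: 'a \<Rightarrow> complex)" for r
    unfolding bdd_supp_def by (intro conjI exI[of _ "max \<bar>r\<bar> 1"]) (auto simp: indicator_def)
  note ind = bdd_supp_integrable(2)[OF this]
  have ci: "integrable lborel (c r)" for r unfolding c_def[abs_def] by (rule square_int_mult_integrable(1)[OF ind s])
  have cs: "square_int lborel (c r)" for r
    by (rule square_int_mono1(1)[OF s]) (auto simp: c_def indicator_def)
  have rc: "fourier_L1 (\<lambda>x. indicator (cball 0 r) x * f x) = ft (c r)" for r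
    unfolding c_def[abs_def] by (intro fourier_L1_borel_rep borel_rep_mult f borel_rep_refl) measurable
  have lim: "(\<lambda>k. norm2 lborel (\<lambda>\<xi>. ft (c (X k)) \<xi> - FT f' \<xi>)) \<longlonglongrightarrow> 0" if X: "filterlim X at_top sequentially" for X
  proof -
    have "(\<lambda>k. norm2 lborel (\<lambda>x. c (X k) x - f' x)) \<longlonglongrightarrow> 0"
    proof (rule norm2_tendsto_dominated[OF s])
      show "AE x in lborel. (\<lambda>k. c (X k) x) \<longlonglongrightarrow> f' x"
      proof (intro AE_I2 tendsto_eventually)
        fix x :: 'a
        have "\<forall>\<^sub>F k in sequentially. norm x \<le> X k" using X by (simp add: filterlim_at_top)
        then show "\<forall>\<^sub>F k in sequentially. c (X k) x = f' x" by eventually_elim (simp add: c_def)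
      qed
      show "AE x in lborel. cmod (c (X k) x) \<le> cmod (f' x)" for k by (auto simp: c_def indicator_def)
    qed measurable
    then show ?thesis using FT_tendsto_ft[OF ci cs s, of X] by simp
  qed
  define P where "P g \<longleftrightarrow> g \<in> L2 \<and>
     ((\<lambda>r. L2norm (\<lambda>\<xi>. g \<xi> - fourier_L1 (\<lambda>x. indicator (cball 0 r) x * f x) \<xi>)) \<longlongrightarrow> 0) at_top" for g
  have nP: "L2norm (\<lambda>\<xi>. g \<xi> - fourier_L1 (\<lambda>x. indicator (cball 0 r) x * f x) \<xi>) = ennreal (norm2 lborel (\<lambda>\<xi>. ft (c r) \<xi> - g' \<xi>))"
    if "borel_rep g g'" "square_int lborel g'" for g g' r
  proof -
    have "borel_rep (\<lambda>\<xi>. g \<xi> - ft (c r) \<xi>) (\<lambda>\<xi>. g' \<xi> - ft (c r) \<xi>)" by (intro borel_rep_diff that borel_rep_refl) measurable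
    from L2_borel_rep(2)[OF this] show ?thesis
      unfolding rc using square_int_diff(1)[OF that(2) ft_norm2_le(1)[OF ci cs], of r] by (simp add: norm2_commute[of lborel g'])
  qed
  have FTs: "square_int lborel (FT f')" by (rule FT_spec(1)[OF s])
  have FTr: "borel_rep (FT f') (FT f')" using FTs by (intro borel_rep_refl) (simp add: square_int_def)
  \<comment> \<open>Convergence along every sequence of radii tending to infinity gives the limit in
    the real parameter.\<close>
  have "((\<lambda>r. ennreal (norm2 lborel (\<lambda>\<xi>. ft (c r) \<xi> - FT f' \<xi>))) \<longlongrightarrow> ennreal 0) at_top"
    by (intro tendsto_ennrealI tendsto_at_topI_sequentially lim)
  then have "P (FT f')"
    unfolding P_def nP[OF FTr FTs] using L2_borel_rep(1)[OF FTr] FTs by simp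
  then have "P (fourier_L2 f)" unfolding fourier_L2_def P_def[symmetric] by (rule someI[of P])
  then have g: "fourier_L2 f \<in> L2"
    and gl: "((\<lambda>r. L2norm (\<lambda>\<xi>. fourier_L2 f \<xi> - fourier_L1 (\<lambda>x. indicator (cball 0 r) x * f x) \<xi>)) \<longlongrightarrow> 0) at_top"
    by (auto simp: P_def)
  obtain g' where g': "borel_rep (fourier_L2 f) g'" using g by (auto simp: L2w_def intro: borel_rep_exists)
  have gs: "square_int lborel g'" using L2_borel_rep(1)[OF g'] g by simp
  have "((\<lambda>r. ennreal (norm2 lborel (\<lambda>\<xi>. ft (c r) \<xi> - g' \<xi>))) \<longlongrightarrow> ennreal 0) at_top"
    using gl unfolding nP[OF g' gs] by simp
  then have "((\<lambda>r. norm2 lborel (\<lambda>\<xi>. ft (c r) \<xi> - g' \<xi>)) \<longlongrightarrow> 0) at_top"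
    by (subst (asm) tendsto_ennreal_iff) auto
  then have "(\<lambda>k. norm2 lborel (\<lambda>\<xi>. ft (c (real k)) \<xi> - g' \<xi>)) \<longlonglongrightarrow> 0"
    by (rule filterlim_compose[OF _ filterlim_real_sequentially])
  then have "AE \<xi> in lborel. g' \<xi> = FT f' \<xi>"
    by (rule norm2_limit_AE_unique[OF ft_norm2_le(1)[OF ci cs] gs FTs _ lim[OF filterlim_real_sequentially]])
  moreover have "AE \<xi> in lborel. fourier_L2 f \<xi> = g' \<xi>" using g' by (simp add: borel_rep_def)
  ultimately have "AE \<xi> in lborel. fourier_L2 f \<xi> = FT f' \<xi>" by eventually_elim simp
  then show ?thesis using FTs by (simp add: borel_rep_def square_int_def)
qed

text \<open>Surjectivity of the transform provides a candidate, the inverse transform of m times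
  \<open>FT f'\<close>, so the selection in \<open>multiplier\<close> has its defining
  property.\<close>

lemma multiplier_borel_rep:
  fixes f :: "'a::euclidean_space \<Rightarrow> complex"
  assumes f: "borel_rep f f'" and s: "square_int lborel f'" and m: "m \<in> borel_measurable lborel" "\<And>\<xi>. cmod (m \<xi>) \<le> K"
  obtains h' where "square_int lborel h'" "borel_rep (multiplier m f) h'" "AE \<xi> in lborel. FT h' \<xi> = m \<xi> * FT f' \<xi>"
proof -
  have K: "0 \<le> K" using m(2)[of 0] norm_ge_zero order_trans by blast
  have ms: "square_int lborel (\<lambda>\<xi>. m \<xi> * FT f' \<xi>)" by (intro square_int_mult_bounded(1)[OF FT_spec(1)[OF s] m K])
  define h where "h = IFT (\<lambda>\<xi>. m \<xi> * FT f' \<xi>)"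
  have hs: "square_int lborel h" unfolding h_def by (rule IFT_square_int[OF ms])
  have hr: "borel_rep h h" using hs by (intro borel_rep_refl) (simp add: square_int_def)
  have af: "AE \<xi> in lborel. fourier_L2 f \<xi> = FT f' \<xi>" using fourier_L2_borel_rep[OF f s] by (simp add: borel_rep_def)
  have ah: "AE \<xi> in lborel. fourier_L2 h \<xi> = FT h \<xi>" using fourier_L2_borel_rep[OF hr hs] by (simp add: borel_rep_def)
  have "AE \<xi> in lborel. fourier_L2 h \<xi> = m \<xi> * fourier_L2 f \<xi>"
    using af ah FT_IFT[OF ms, folded h_def] by eventually_elim simp
  then have "h \<in> L2 \<and> (AE \<xi> in lebesgue. fourier_L2 h \<xi> = m \<xi> * fourier_L2 f \<xi>)"
    using L2_borel_rep(1)[OF hr] hs by (simp add: AE_completion_iff)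
  then have k: "multiplier m f \<in> L2 \<and> (AE \<xi> in lebesgue. fourier_L2 (multiplier m f) \<xi> = m \<xi> * fourier_L2 f \<xi>)"
    unfolding multiplier_def by (rule someI[where P="\<lambda>h. h \<in> L2 \<and> (AE \<xi> in lebesgue. fourier_L2 h \<xi> = m \<xi> * fourier_L2 f \<xi>)"])
  obtain k' where k': "borel_rep (multiplier m f) k'" using k by (auto simp: L2w_def intro: borel_rep_exists)
  have ks: "square_int lborel k'" using L2_borel_rep(1)[OF k'] k by simp
  have ak: "AE \<xi> in lborel. fourier_L2 (multiplier m f) \<xi> = FT k' \<xi>" using fourier_L2_borel_rep[OF k' ks] by (simp add: borel_rep_def)
  have "AE \<xi> in lborel. fourier_L2 (multiplier m f) \<xi> = m \<xi> * fourier_L2 f \<xi>" using k by (simp add: AE_completion_iff)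
  then have "AE \<xi> in lborel. FT k' \<xi> = m \<xi> * FT f' \<xi>"
    using ak af by eventually_elim simp
  with that[OF ks k'] show thesis .
qed

text \<open>The phases of both sides agree on the Fourier side and the transform is injective. This
  replaces separately selected values of \<open>propagator\<close> by slices of one measurable
  function.\<close>

lemma (in smoothing) propagator_eq_free:
  assumes \<phi>: "borel_rep \<phi> \<phi>'" "square_int lborel \<phi>'" and U: "free_evol \<psi> U"
    and ae: "AE \<xi> in lborel. FT \<psi> \<xi> = cis (t * (norm \<xi>)\<^sup>2) * FT \<phi>' \<xi>"
  shows "AE x in lborel. propagator (s - t) \<phi> x = U (x, s)"
proof -
  obtain h' where h': "square_int lborel h'" "borel_rep (propagator (s - t) \<phi>) h'"
    "AE \<xi> in lborel. FT h' \<xi> = cis (- (s - t) * (norm \<xi>)\<^sup>2) * FT \<phi>' \<xi>"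
    unfolding propagator_def by (rule multiplier_borel_rep[OF \<phi>, of "\<lambda>\<xi>. cis (- (s - t) * (norm \<xi>)\<^sup>2)" 1]) auto
  have Us: "square_int lborel (\<lambda>x. U (x, s))" "AE \<xi> in lborel. FT (\<lambda>x. U (x, s)) \<xi> = cis (- (s * (norm \<xi>)\<^sup>2)) * FT \<psi> \<xi>"
    using U by (auto simp: free_evol_def)
  have "AE \<xi> in lborel. FT h' \<xi> = FT (\<lambda>x. U (x, s)) \<xi>"
    using h'(3) Us(2) ae
  proof eventually_elim
    case (elim \<xi>)
    have "cis (- (s - t) * (norm \<xi>)\<^sup>2) = cis (- (s * (norm \<xi>)\<^sup>2)) * cis (t * (norm \<xi>)\<^sup>2)"
      by (simp add: cis_mult algebra_simps)
    then show ?case using elim by simp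
  qed
  from FT_inject[OF h'(1) Us(1) this] have "AE x in lborel. h' x = U (x, s)" .
  moreover have "AE x in lborel. propagator (s - t) \<phi> x = h' x" using h'(2) by (simp add: borel_rep_def)
  ultimately show ?thesis by eventually_elim simp
qed

section \<open>From the weighted resolvent estimate to the form bound\<close>

text \<open>With h the resolvent applied to a f, Parseval turns the form into <h, a g> = <a h, g>.
  The norm of a h is the weighted norm of h, and the dual norm of a f is at most the norm of
  f.\<close>

lemma smoothing_of_resolvent_bound:
  fixes V :: "'a::euclidean_space \<Rightarrow> complex"
  assumes V: "borel_rep V V'" and M: "0 \<le> M"
    and bound: "\<And>z f. z \<notin> \<real> \<Longrightarrow> f \<in> L2 \<inter> L2w (dual_weight V) \<Longrightarrow>
        wnorm (weight V) (free_resolvent z f) \<le> ennreal M * wnorm (dual_weight V) f"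
  shows "smoothing (\<lambda>x. sqrt (cmod (V' x))) M"
proof
  have [measurable]: "V' \<in> borel_measurable lborel" and ae: "AE x in lborel. V x = V' x" using V by (auto simp: borel_rep_def)
  let ?a = "\<lambda>x. sqrt (cmod (V' x))"
  show am: "?a \<in> borel_measurable borel" by measurable
  show "0 \<le> M" by (rule M)
  have w: "AE x in lborel. weight V x = ennreal ((?a x)\<^sup>2)" and dw: "AE x in lborel. dual_weight V x = inverse (ennreal ((?a x)\<^sup>2))"
    using ae by (eventually_elim, simp add: weight_def dual_weight_def)+
  fix z :: complex and f g :: "'a \<Rightarrow> complex"
  assume z: "z \<notin> \<real>" and f: "bdd_supp f" and g: "bdd_supp g" and F: "bdd_supp (\<lambda>x. complex_of_real (?a x) * f x)" and G: "bdd_supp (\<lambda>x. complex_of_real (?a x) * g x)"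
  note iF = bdd_supp_integrable[OF F] and iG = bdd_supp_integrable[OF G]
  have rF: "borel_rep (\<lambda>x. complex_of_real (?a x) * f x) (\<lambda>x. complex_of_real (?a x) * f x)" using F by (intro borel_rep_refl) (rule bdd_supp_measurable)
  have FL: "(\<lambda>x. complex_of_real (?a x) * f x) \<in> L2 \<inter> L2w (dual_weight V)"
    using L2_borel_rep(1)[OF rF] iF wnorm_dual_weight_le(1)[OF bdd_supp_integrable(2)[OF f] _ dw] by simp
  let ?m = "\<lambda>\<xi>::'a. 1 / (complex_of_real ((norm \<xi>)\<^sup>2) - z)"
  have Im: "Im z \<noteq> 0" using z by (simp add: complex_is_Real_iff)
  \<comment> \<open>Off the real axis the symbol is bounded by 1 / |Im z|, so the resolvent is a
    bounded multiplier on L2.\<close>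
  have mb: "cmod (?m \<xi>) \<le> 1 / \<bar>Im z\<bar>" for \<xi>
  proof -
    have "\<bar>Im z\<bar> \<le> cmod (complex_of_real ((norm \<xi>)\<^sup>2) - z)"
      using abs_Im_le_cmod[of "complex_of_real ((norm \<xi>)\<^sup>2) - z"] by simp
    then show ?thesis using Im by (simp add: norm_divide frac_le)
  qed
  obtain h where h: "square_int lborel h" "borel_rep (free_resolvent z (\<lambda>x. complex_of_real (?a x) * f x)) h"
    "AE \<xi> in lborel. FT h \<xi> = ?m \<xi> * FT (\<lambda>x. complex_of_real (?a x) * f x) \<xi>"
    unfolding free_resolvent_def by (rule multiplier_borel_rep[OF rF iF(2), of ?m, OF _ mb]) measurable
  have "wnorm (weight V) (free_resolvent z (\<lambda>x. complex_of_real (?a x) * f x)) \<le> ennreal M * ennreal (norm2 lborel f)"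
    using bound[OF z FL] wnorm_dual_weight_le(2)[OF bdd_supp_integrable(2)[OF f] _ dw]
    by (simp add: order_trans mult_left_mono)
  then have wle: "wnorm (weight V) (free_resolvent z (\<lambda>x. complex_of_real (?a x) * f x)) \<le> ennreal (M * norm2 lborel f)"
    using M by (simp add: ennreal_mult)
  \<comment> \<open>Membership of the resolvent in the weighted space is read off from the
    finiteness of the bound itself.\<close>
  then have "wnorm (weight V) (free_resolvent z (\<lambda>x. complex_of_real (?a x) * f x)) < top"
    using ennreal_less_top order_le_less_trans by blast
  then have "free_resolvent z (\<lambda>x. complex_of_real (?a x) * f x) \<in> L2w (weight V)"
    using borel_rep_measurable[OF h(2)] by (simp add: L2w_def)
  then have ah: "square_int lborel (\<lambda>x. complex_of_real (?a x) * h x)" using wnorm_weight(1)[OF h(2) _ w] by simp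
  have ahn: "norm2 lborel (\<lambda>x. complex_of_real (?a x) * h x) \<le> M * norm2 lborel f"
    using wle wnorm_weight(2)[OF h(2) _ w ah] M by simp
  have [measurable]: "ft (\<lambda>x. complex_of_real (?a x) * f x) \<in> borel_measurable lborel" "ft (\<lambda>x. complex_of_real (?a x) * g x) \<in> borel_measurable lborel"
    "FT h \<in> borel_measurable lborel" "FT (\<lambda>x. complex_of_real (?a x) * g x) \<in> borel_measurable lborel"
    using ft_norm2_le(1)[OF iF] ft_norm2_le(1)[OF iG] FT_spec(1)[OF h(1)] FT_spec(1)[OF iG(2)] by (auto simp: square_int_def)
  have "(\<integral>\<xi>. ft (\<lambda>x. complex_of_real (?a x) * f x) \<xi> * cnj (ft (\<lambda>x. complex_of_real (?a x) * g x) \<xi>) / (complex_of_real ((norm \<xi>)\<^sup>2) - z) \<partial>lborel)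
     = inner2 lborel (FT h) (FT (\<lambda>x. complex_of_real (?a x) * g x))"
    unfolding inner2_def
  proof (rule integral_cong_AE)
    show "AE \<xi> in lborel. ft (\<lambda>x. complex_of_real (?a x) * f x) \<xi> * cnj (ft (\<lambda>x. complex_of_real (?a x) * g x) \<xi>) / (complex_of_real ((norm \<xi>)\<^sup>2) - z)
       = FT h \<xi> * cnj (FT (\<lambda>x. complex_of_real (?a x) * g x) \<xi>)"
      using h(3) FT_eq_ft[OF iF] FT_eq_ft[OF iG] by eventually_elim simp
  qed measurable
  also have "\<dots> = inner2 lborel h (\<lambda>x. complex_of_real (?a x) * g x)" by (rule FT_Parseval[OF h(1) iG(2)])
  also have "\<dots> = inner2 lborel (\<lambda>x. complex_of_real (?a x) * h x) g"
    unfolding inner2_def by (intro Bochner_Integration.integral_cong refl) simp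
  also have "cmod \<dots> \<le> norm2 lborel (\<lambda>x. complex_of_real (?a x) * h x) * norm2 lborel g" by (intro norm_inner2_le ah bdd_supp_integrable g)
  also have "\<dots> \<le> M * norm2 lborel f * norm2 lborel g" by (intro mult_right_mono ahn) simp
  finally show "cmod (\<integral>\<xi>. ft (\<lambda>x. complex_of_real (?a x) * f x) \<xi> * cnj (ft (\<lambda>x. complex_of_real (?a x) * g x) \<xi>) / (complex_of_real ((norm \<xi>)\<^sup>2) - z) \<partial>lborel)
     \<le> M * norm2 lborel f * norm2 lborel g" .
qed

section \<open>Weak Duhamel integrals\<close>

lemma AE_slices:
  assumes "AE p in (lborel :: 'a::euclidean_space measure) \<Otimes>\<^sub>M (lborel :: real measure). P p"
  shows "AE t in lborel. AE x in lborel. P (x, t)"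
proof -
  from assms obtain N where N: "{p \<in> space lborel2. \<not> P p} \<subseteq> N" "emeasure lborel2 N = 0"
    "N \<in> sets ((lborel :: 'a measure) \<Otimes>\<^sub>M (lborel :: real measure))" by (rule AE_E)
  note [measurable] = N(3)
  have "(\<integral>\<^sup>+t. \<integral>\<^sup>+x. indicator N (x, t) \<partial>lborel \<partial>lborel) = (\<integral>\<^sup>+p. indicator N p \<partial>((lborel :: 'a measure) \<Otimes>\<^sub>M (lborel :: real measure)))"
    by (rule lborel_pair.nn_integral_snd) measurable
  also have "\<dots> = 0" using N by simp
  finally have "AE t in lborel. (\<integral>\<^sup>+x. indicator N (x, t) \<partial>lborel) = 0"
    by (subst (asm) nn_integral_0_iff_AE) measurable
  then show ?thesis
  proof eventually_elim
    case (elim t)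
    then have "AE x in lborel. (indicator N (x, t) :: ennreal) = 0"
      by (subst (asm) nn_integral_0_iff_AE) measurable
    then show ?case
      by eventually_elim (use N(1) in \<open>auto simp: space_pair_measure indicator_def split: if_splits\<close>)
  qed
qed

lemma AE_fst_lborel:
  assumes "AE x in lborel. P x"
  shows "AE p in (lborel :: 'a::euclidean_space measure) \<Otimes>\<^sub>M (lborel :: real measure). P (fst p)"
proof -
  from assms obtain N where N: "{x \<in> space lborel. \<not> P x} \<subseteq> N" "emeasure lborel N = 0" "N \<in> sets lborel" by (rule AE_E)
  then have "N \<times> UNIV \<in> null_sets ((lborel :: 'a measure) \<Otimes>\<^sub>M (lborel :: real measure))"
    using lborel.times_in_null_sets1[of N "lborel :: 'a measure" UNIV] by (auto simp: null_sets_def)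
  from AE_not_in[OF this] show ?thesis by eventually_elim (use N(1) in auto)
qed

text \<open>The right side of the weak identity depends on the source and the test function only, so
  D and E have the same pairing with every L2 function.\<close>

lemma is_duhamel_unique:
  assumes D: "is_duhamel G t D" and E: "is_duhamel G t E"
  shows "AE x in lborel. D x = E x"
proof -
  have L: "D \<in> L2" "E \<in> L2" using D E by (auto simp: is_duhamel_def)
  obtain D' where D': "borel_rep D D'" using L by (auto simp: L2w_def intro: borel_rep_exists)
  obtain E' where E': "borel_rep E E'" using L by (auto simp: L2w_def intro: borel_rep_exists)
  have s: "square_int lborel D'" "square_int lborel E'" using L L2_borel_rep(1)[OF D'] L2_borel_rep(1)[OF E'] by auto
  have "AE x in lborel. D' x = E' x"
  proof (rule inner2_eq_imp_AE_eq[OF s])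
    fix h :: "'a \<Rightarrow> complex" assume h: "square_int lborel h"
    have r: "borel_rep h h" using h by (intro borel_rep_refl) (simp add: square_int_def)
    have "h \<in> L2" using L2_borel_rep(1)[OF r] h by simp
    then have "(\<integral>x. D x * cnj (h x) \<partial>lebesgue) = (\<integral>x. E x * cnj (h x) \<partial>lebesgue)"
      using D E unfolding is_duhamel_def by simp
    then show "inner2 lborel D' h = inner2 lborel E' h"
      using borel_rep_integral(1)[OF borel_rep_mult[OF D' borel_rep_cnj[OF r]]] borel_rep_integral(1)[OF borel_rep_mult[OF E' borel_rep_cnj[OF r]]]
      by (simp add: inner2_def)
  qed
  moreover have "AE x in lborel. D x = D' x" "AE x in lborel. E x = E' x" using D' E' by (auto simp: borel_rep_def)
  ultimately show ?thesis by eventually_elim simp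
qed

text \<open>Slices of the source need not lie in L2, so each integrability clause comes from Fubini
  for one integrable function on space-time, with the propagator slices replaced by a free
  evolution.\<close>

lemma (in smoothing) is_duhamel_of_duhamel_evol:
  assumes f: "square_int L2xt f" and D: "duhamel_evol f D" and G: "AE p in L2xt. G p = wgt f p"
  shows "is_duhamel G t (\<lambda>x. D (x, t))"
  unfolding is_duhamel_def
proof (intro conjI ballI)
  note Ds = duhamel_evolD(2)[OF D, of t]
  have rD: "borel_rep (\<lambda>x. D (x, t)) (\<lambda>x. D (x, t))" using Ds by (intro borel_rep_refl) (simp add: square_int_def)
  show "(\<lambda>x. D (x, t)) \<in> L2" using L2_borel_rep(1)[OF rD] Ds by simp
  fix \<phi> :: "'a \<Rightarrow> complex" assume \<phi>: "\<phi> \<in> L2"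
  obtain \<phi>' where r: "borel_rep \<phi> \<phi>'" using \<phi> by (auto simp: L2w_def intro: borel_rep_exists)
  have \<phi>s: "square_int lborel \<phi>'" using L2_borel_rep(1)[OF r] \<phi> by simp
  obtain \<psi> U where \<psi>: "square_int lborel \<psi>" "AE \<xi> in lborel. FT \<psi> \<xi> = cis (t * (norm \<xi>)\<^sup>2) * FT \<phi>' \<xi>" "free_evol \<psi> U"
    using backward_data_exists[OF \<phi>s] by blast
  note pr = propagator_eq_free[OF r \<phi>s \<psi>(3,2)]
  have [measurable]: "f \<in> borel_measurable L2xt" "U \<in> borel_measurable L2xt" using f \<psi>(3) by (auto simp: square_int_def free_evol_def)
  define k where "k p = wgt f p * cnj (U p)" for p
  have km [measurable]: "k \<in> borel_measurable L2xt" unfolding k_def[abs_def] by measurable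
  \<comment> \<open>The real weight moves from the source to the free evolution, where Kato
    smoothing makes the product integrable.\<close>
  have "(\<lambda>p. f p * cnj (wgt U p)) = k" by (simp add: k_def fun_eq_iff)
  then have ki: "integrable L2xt k"
    using square_int_mult_integrable(3)[OF f free_smoothing(1)[OF \<psi>(1,3)]] by simp
  then have ki': "integrable L2xt (\<lambda>(x, s). k (x, s))" by simp
  define I where "I s = (\<integral>x. G (x, s) * cnj (propagator (s - t) \<phi> x) \<partial>lebesgue)" for s
  define I' where "I' s = (\<integral>x. k (x, s) \<partial>lborel)" for s
  have I'i: "integrable lborel I'" unfolding I'_def[abs_def] using lborel_pair.integrable_snd[OF ki'] .
  have slice: "AE s in lborel. borel_rep (\<lambda>x. G (x, s) * cnj (propagator (s - t) \<phi> x)) (\<lambda>x. k (x, s))"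
    using AE_slices[OF G]
  proof eventually_elim
    case (elim s)
    have "AE x in lborel. G (x, s) * cnj (propagator (s - t) \<phi> x) = k (x, s)"
      using elim pr[of s] by eventually_elim (simp add: k_def)
    then show ?case by (simp add: borel_rep_def)
  qed
  have "AE s in lborel. integrable lebesgue (\<lambda>x. G (x, s) * cnj (propagator (s - t) \<phi> x))"
    using slice lborel_pair.AE_integrable_snd[OF ki'] by eventually_elim (simp add: borel_rep_integral(2))
  then show "AE s in lebesgue. s \<in> closed_segment 0 t \<longrightarrow> integrable lebesgue (\<lambda>x. G (x, s) * cnj (propagator (s - t) \<phi> x))"
    unfolding AE_completion_iff by eventually_elim simp
  have rI: "borel_rep I I'"
    unfolding borel_rep_def
  proof
    show "I' \<in> borel_measurable lborel" using I'i by simp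
    show "AE s in lborel. I s = I' s" using slice by eventually_elim (simp add: I_def I'_def borel_rep_integral(1))
  qed
  have rS: "borel_rep (\<lambda>s. indicator S s *\<^sub>R I s) (\<lambda>s. indicator S s *\<^sub>R I' s)" if [measurable]: "S \<in> sets borel" for S
    using rI by (auto simp: borel_rep_def)
  have iS: "integrable lborel (\<lambda>s. indicator S s *\<^sub>R I' s)" if [measurable]: "S \<in> sets borel" for S
    by (rule Bochner_Integration.integrable_bound[OF I'i]) (use I'i in \<open>auto simp: indicator_def\<close>)
  show "interval_lebesgue_integrable lebesgue 0 (ereal t) (\<lambda>s. \<integral>x. G (x, s) * cnj (propagator (s - t) \<phi> x) \<partial>lebesgue)"
    unfolding interval_lebesgue_integrable_def set_integrable_def I_def[symmetric]
    by (auto simp: borel_rep_integral(2)[OF rS] iS)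
  \<comment> \<open>For t < 0 the oriented integral is minus the integral over (t, 0), the value -1
    of \<open>dsign\<close>; both sides use open intervals.\<close>
  have "interval_lebesgue_integral lebesgue 0 (ereal t) I = (\<integral>s. dsign t s * I' s \<partial>lborel)"
  proof (cases "0 \<le> t")
    case True
    then have "interval_lebesgue_integral lebesgue 0 (ereal t) I = (\<integral>s. indicator (einterval 0 (ereal t)) s *\<^sub>R I' s \<partial>lborel)"
      unfolding interval_lebesgue_integral_def set_lebesgue_integral_def by (simp add: borel_rep_integral(1)[OF rS])
    also have "\<dots> = (\<integral>s. dsign t s * I' s \<partial>lborel)"
      using True by (intro Bochner_Integration.integral_cong refl) (auto simp: dsign_def einterval_def indicator_def zero_ereal_def)
    finally show ?thesis .
  next
    case False
    then have "interval_lebesgue_integral lebesgue 0 (ereal t) I = - (\<integral>s. indicator (einterval (ereal t) 0) s *\<^sub>R I' s \<partial>lborel)"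
      unfolding interval_lebesgue_integral_def set_lebesgue_integral_def by (simp add: borel_rep_integral(1)[OF rS])
    also have "\<dots> = (\<integral>s. - (indicator (einterval (ereal t) 0) s *\<^sub>R I' s) \<partial>lborel)"
      by (rule Bochner_Integration.integral_minus[symmetric])
    also have "\<dots> = (\<integral>s. dsign t s * I' s \<partial>lborel)"
      using False by (intro Bochner_Integration.integral_cong refl) (auto simp: dsign_def einterval_def indicator_def zero_ereal_def)
    finally show ?thesis .
  qed
  also have "\<dots> = (\<integral>s. \<integral>x. dsign t s * k (x, s) \<partial>lborel \<partial>lborel)"
    by (simp add: I'_def)
  also have "\<dots> = (\<integral>(x, s). dsign t s * k (x, s) \<partial>L2xt)"
  proof (rule lborel_pair.integral_snd)
    show "integrable L2xt (\<lambda>(x, s). dsign t s * k (x, s))"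
    proof (rule Bochner_Integration.integrable_bound[OF ki])
      have "cmod (dsign t s * k (x, s)) \<le> cmod (k (x, s))" for x s
        by (simp add: norm_mult mult_left_le_one_le norm_dsign_le)
      then show "AE p in L2xt. norm (case p of (x, s) \<Rightarrow> dsign t s * k (x, s)) \<le> norm (k p)" by auto
    qed measurable
  qed
  also have "\<dots> = inner2 L2xt (time_mult (dsign t) f) (wgt U)"
    unfolding inner2_def by (intro Bochner_Integration.integral_cong refl) (auto simp: k_def time_mult_def)
  also have "\<dots> = inner2 lborel (\<lambda>x. D (x, t)) \<phi>'" by (rule duhamel_evolD(7)[OF D \<phi>s \<psi>, symmetric])
  also have "\<dots> = (\<integral>x. D (x, t) * cnj (\<phi> x) \<partial>lebesgue)"
    unfolding inner2_def by (rule borel_rep_integral(1)[OF borel_rep_mult[OF rD borel_rep_cnj[OF r]], symmetric])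
  finally show "(\<integral>x. D (x, t) * cnj (\<phi> x) \<partial>lebesgue) =
      interval_lebesgue_integral lebesgue 0 (ereal t) (\<lambda>s. \<integral>x. G (x, s) * cnj (propagator (s - t) \<phi> x) \<partial>lebesgue)"
    unfolding I_def[abs_def] by simp
qed

section \<open>Well-posedness\<close>

text \<open>One potential with one value of M. The initial value is listed separately because an
  equation for almost every \<open>t\<close> does not mention time 0.\<close>

lemma well_posed:
  fixes V :: "'a::euclidean_space \<Rightarrow> complex"
  assumes V: "borel_rep V V'" and sm: "smoothing (\<lambda>x. sqrt (cmod (V' x))) M" and small: "4 * M \<le> 1"
    and u0: "u0 \<in> L2" and F: "F \<in> L2w (tx (dual_weight V))"
  shows "\<exists>u. is_solution V u0 F u \<and>
          (\<forall>v. is_solution V u0 F v \<longrightarrow> (AE p in lebesgue. v p = u p)) \<and>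
          in_Ct_L2x u \<and>
          (AE x in lebesgue. u (x, 0) = u0 x) \<and>
          wnorm (tx (weight V)) u
            \<le> ennreal (2 * sqrt (2 * M)) * L2norm u0 + ennreal (4 * M) * wnorm (tx (dual_weight V)) F \<and>
          (\<forall>t. L2norm (\<lambda>x. u (x, t))
            \<le> ennreal 2 * L2norm u0 + ennreal (2 * sqrt (2 * M)) * wnorm (tx (dual_weight V)) F)"
proof -
  let ?a = "\<lambda>x. sqrt (cmod (V' x))"
  interpret smoothing ?a M by (rule sm)
  have V'm [measurable]: "V' \<in> borel_measurable lborel" and Vae: "AE x in lborel. V x = V' x" using V by (auto simp: borel_rep_def)
  \<comment> \<open>The phase of the potential, equal to 0 where the potential vanishes, so that V'
    = a \<theta> a everywhere.\<close>
  define \<theta> where "\<theta> x = sgn (V' x)" for x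
  have \<theta>m [measurable]: "\<theta> \<in> borel_measurable borel" unfolding \<theta>_def[abs_def] using V'm by simp
  have \<theta>le: "cmod (\<theta> x) \<le> 1" for x by (simp add: \<theta>_def norm_sgn)
  have V'eq: "V' x = complex_of_real (?a x) * \<theta> x * complex_of_real (?a x)" for x
  proof -
    have "complex_of_real (?a x) * complex_of_real (?a x) = complex_of_real (cmod (V' x))"
      by (simp flip: of_real_mult)
    moreover have "V' x = complex_of_real (cmod (V' x)) * \<theta> x" by (simp add: \<theta>_def sgn_eq)
    ultimately show ?thesis by (metis mult.assoc mult.commute)
  qed
  have Vp: "AE p in L2xt. V (fst p) = V' (fst p)" by (rule AE_fst_lborel[OF Vae])
  have w: "AE p in lborel. tx (weight V) p = ennreal ((?a (fst p))\<^sup>2)"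
    and dw: "AE p in lborel. tx (dual_weight V) p = inverse (ennreal ((?a (fst p))\<^sup>2))"
    using Vp unfolding lborel_prod by (eventually_elim, auto simp: tx_def weight_def dual_weight_def)+
  have am: "(\<lambda>p. ?a (fst p)) \<in> borel_measurable (lborel :: ('a \<times> real) measure)"
    unfolding lborel_prod[symmetric] by measurable
  obtain \<phi> where \<phi>: "borel_rep u0 \<phi>" using u0 by (auto simp: L2w_def intro: borel_rep_exists)
  have \<phi>s: "square_int lborel \<phi>" using L2_borel_rep(1)[OF \<phi>] u0 by simp
  have n0: "L2norm u0 = ennreal (norm2 lborel \<phi>)" by (rule L2_borel_rep(2)[OF \<phi> \<phi>s])
  obtain F' where F': "borel_rep F F'" using F by (auto simp: L2w_def intro: borel_rep_exists)
  \<comment> \<open>Points with a = 0 are harmless: there the quotient is 0, and F vanishes almost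
    everywhere by finiteness of its dual norm.\<close>
  define f where "f = (\<lambda>p. F' p / complex_of_real (?a (fst p)))"
  note Fd = wnorm_dual_weight[OF F' am dw F]
  have f: "square_int L2xt f" and nF: "wnorm (tx (dual_weight V)) F = ennreal (norm2 L2xt f)" and Fae: "AE p in L2xt. F p = wgt f p"
    using Fd unfolding f_def lborel_prod by blast+
  obtain U where U: "free_evol \<phi> U" using free_exists[OF \<phi>s] ..
  obtain D where D: "duhamel_evol f D" using duhamel_exists[OF f] ..
  have free_eq: "AE x in lborel. propagator t u0 x = U (x, t)" for t
    using propagator_eq_free[OF \<phi> \<phi>s U, of 0 t] by simp
  obtain g E where g: "solves \<theta> U D g E"
    using solves_exists[OF small \<theta>m \<theta>le free_smoothing(1)[OF \<phi>s U] duhamel_evolD(5)[OF D]] by blast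
  have gs: "square_int L2xt g" and E: "duhamel_evol g E" and gae: "AE p in L2xt. g p = \<theta> (fst p) * wgt (\<lambda>p. U p - \<i> * D p - \<i> * E p) p"
    using g by (auto simp: solves_def)
  define u where "u p = U p - \<i> * D p - \<i> * E p" for p
  note B = solves_bounds[OF small \<theta>m \<theta>le \<phi>s U D g, folded u_def]
  have [measurable]: "U \<in> borel_measurable L2xt" using U by (simp add: free_evol_def)
  note [measurable] = duhamel_evolD(1)[OF D] duhamel_evolD(1)[OF E]
  have um: "u \<in> borel_measurable L2xt" unfolding u_def[abs_def] by measurable
  have ru: "borel_rep u u" using um by (intro borel_rep_refl) (simp add: lborel_prod)
  have us: "borel_rep (\<lambda>x. u (x, t)) (\<lambda>x. u (x, t))" for t using B(3)[of t] by (intro borel_rep_refl) (simp add: square_int_def)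
  have rV: "AE p in L2xt. V (fst p) * v p = wgt (\<lambda>p. \<theta> (fst p) * wgt v p) p" for v
    using Vp
  proof eventually_elim
    case (elim p)
    show ?case unfolding elim mult.assoc[symmetric] by (rule arg_cong[where f="\<lambda>c. c * v p", OF V'eq])
  qed
  have uw: "u \<in> L2w (tx (weight V))" "wnorm (tx (weight V)) u = ennreal (norm2 L2xt (wgt u))"
    using wnorm_weight[OF ru am w] B(1) by (simp_all add: lborel_prod)
  have Vu: "AE p in L2xt. (case p of (x, s) \<Rightarrow> V x * u (x, s)) = wgt g p"
    using rV[of u] gae by eventually_elim (simp add: case_prod_unfold u_def)
  have sol: "is_solution V u0 F u"
    unfolding is_solution_def
  proof (rule conjI[OF uw(1)], rule AE_I2, intro exI conjI)
    fix t :: real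
    show "is_duhamel F t (\<lambda>x. D (x, t))" by (rule is_duhamel_of_duhamel_evol[OF f D Fae])
    show "is_duhamel (\<lambda>(x, s). V x * u (x, s)) t (\<lambda>x. E (x, t))" by (rule is_duhamel_of_duhamel_evol[OF gs E Vu])
    show "AE x in lebesgue. u (x, t) = propagator t u0 x - \<i> * D (x, t) - \<i> * E (x, t)"
      unfolding AE_completion_iff using free_eq[of t] by eventually_elim (simp add: u_def)
  qed
  \<comment> \<open>A competitor v is only known in the weighted space. Its source V v is again a
    times an L2 amplitude; uniqueness of weak Duhamel integrals gives v the form of u with another
    Duhamel term, and uniqueness of the amplitude problem identifies the two.\<close>
  have uniq: "AE p in lebesgue. v p = u p" if v: "is_solution V u0 F v" for v
  proof -
    have vw: "v \<in> L2w (tx (weight V))" using v by (simp add: is_solution_def)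
    obtain v' where v': "borel_rep v v'" using vw by (auto simp: L2w_def intro: borel_rep_exists)
    have v'ae: "AE p in L2xt. v p = v' p" and v'm [measurable]: "v' \<in> borel_measurable L2xt"
      using v' unfolding borel_rep_def lborel_prod by auto
    have v's: "square_int L2xt (wgt v')" using wnorm_weight(1)[OF v' am w] vw by (simp add: lborel_prod)
    define h where "h p = \<theta> (fst p) * wgt v' p" for p
    have hs: "square_int L2xt h" unfolding h_def by (rule norm2_\<theta>[OF small \<theta>m \<theta>le v's])
    obtain H where H: "duhamel_evol h H" using duhamel_exists[OF hs] ..
    have Vv: "AE p in L2xt. (case p of (x, s) \<Rightarrow> V x * v (x, s)) = wgt h p"
      using rV[of v] v'ae by eventually_elim (simp add: case_prod_unfold h_def)
    have "AE t in lborel. AE x in lborel. v' (x, t) = U (x, t) - \<i> * D (x, t) - \<i> * H (x, t)"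
    proof -
      have "AE t in lborel. \<exists>D E. is_duhamel F t D \<and> is_duhamel (\<lambda>(x, s). V x * v (x, s)) t E \<and>
          (AE x in lebesgue. v (x, t) = propagator t u0 x - \<i> * D x - \<i> * E x)"
        using v by (simp add: is_solution_def AE_completion_iff)
      then show ?thesis using AE_slices[OF v'ae]
      proof eventually_elim
        case (elim t)
        then obtain D1 E1 where 1: "is_duhamel F t D1" "is_duhamel (\<lambda>(x, s). V x * v (x, s)) t E1"
          "AE x in lborel. v (x, t) = propagator t u0 x - \<i> * D1 x - \<i> * E1 x" by (auto simp: AE_completion_iff)
        show ?case
          using elim(2) 1(3) free_eq[of t] is_duhamel_unique[OF 1(1) is_duhamel_of_duhamel_evol[OF f D Fae]]
            is_duhamel_unique[OF 1(2) is_duhamel_of_duhamel_evol[OF hs H Vv]]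
          by eventually_elim simp
      qed
    qed
    then have v'eq: "AE p in L2xt. v' p = U p - \<i> * D p - \<i> * H p"
      using duhamel_evolD(1)[OF H] by (intro norm2_cong_slices) auto
    have "solves \<theta> U D h H"
      unfolding solves_def using hs H v'eq by (auto simp: h_def elim!: eventually_mono)
    from solves_unique[OF small \<theta>m \<theta>le this g] have HE: "AE x in lborel. H (x, t) = E (x, t)" for t .
    have "AE p in L2xt. H p = E p" using HE duhamel_evolD(1)[OF H] by (intro norm2_cong_slices) auto
    then have "AE p in L2xt. v p = u p" using v'eq v'ae by eventually_elim (simp add: u_def)
    then show ?thesis unfolding AE_completion_iff lborel_prod .
  qed
  have Ct: "in_Ct_L2x u"
    unfolding in_Ct_L2x_def
  proof (intro allI conjI)
    fix t
    show "(\<lambda>x. u (x, t)) \<in> L2" using L2_borel_rep(1)[OF us] B(3) by simp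
    have "L2norm (\<lambda>x. u (x, s) - u (x, t)) = ennreal (norm2 lborel (\<lambda>x. u (x, s) - u (x, t)))" for s
      by (intro L2_borel_rep(2) borel_rep_diff us square_int_diff B(3))
    then show "((\<lambda>s. L2norm (\<lambda>x. u (x, s) - u (x, t))) \<longlongrightarrow> 0) (at t)"
      using tendsto_ennrealI[OF B(5)[of t]] by simp
  qed
  have init: "AE x in lebesgue. u (x, 0) = u0 x"
    unfolding AE_completion_iff using B(6) \<phi> unfolding borel_rep_def by (auto elim!: eventually_elim2)
  have add_le: "ennreal n \<le> ennreal c * ennreal x + ennreal d * ennreal y"
    if "n \<le> c * x + d * y" "0 \<le> c" "0 \<le> d" "0 \<le> x" "0 \<le> y" for n c d x y :: real
    using that by (simp add: ennreal_mult[symmetric] ennreal_plus[symmetric] del: ennreal_plus)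
  have b1: "wnorm (tx (weight V)) u \<le> ennreal (2 * sqrt (2 * M)) * L2norm u0 + ennreal (4 * M) * wnorm (tx (dual_weight V)) F"
    unfolding uw(2) n0 nF by (rule add_le[OF B(2)]) (auto simp: M_nonneg)
  have b2: "L2norm (\<lambda>x. u (x, t)) \<le> ennreal 2 * L2norm u0 + ennreal (2 * sqrt (2 * M)) * wnorm (tx (dual_weight V)) F" for t
    unfolding L2_borel_rep(2)[OF us B(3)] n0 nF by (rule add_le[OF B(4)]) (auto simp: M_nonneg)
  show ?thesis using sol uniq Ct init b1 b2 by blast
qed

theorem theorem8p3:
  fixes R :: "(real ^ 'n \<Rightarrow> complex) set"
    and br :: "(real ^ 'n \<Rightarrow> complex) \<Rightarrow> real"
  assumes "CARD('n) \<ge> 2"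
    and "resolvent_type R br"
  shows "\<exists>\<epsilon>>0. \<exists>C>0. \<forall>V\<in>R. br V < \<epsilon> \<longrightarrow>
    (\<forall>u0\<in>L2. \<forall>F\<in>L2w (tx (dual_weight V)).
      \<exists>u. is_solution V u0 F u \<and>
          (\<forall>v. is_solution V u0 F v \<longrightarrow> (AE p in lebesgue. v p = u p)) \<and>
          in_Ct_L2x u \<and>
          (AE x in lebesgue. u (x, 0) = u0 x) \<and>
          wnorm (tx (weight V)) u
            \<le> ennreal (C * sqrt (br V)) * L2norm u0
              + ennreal (C * br V) * wnorm (tx (dual_weight V)) F \<and>
          (SUP t. L2norm (\<lambda>x. u (x, t)))
            \<le> ennreal C * L2norm u0
              + ennreal (C * sqrt (br V)) * wnorm (tx (dual_weight V)) F)"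
proof -
  obtain K where K: "0 \<le> K" and R: "R \<subseteq> borel_measurable lebesgue" "\<And>V. V \<in> R \<Longrightarrow> 0 \<le> br V"
    and bound: "\<And>V z f. V \<in> R \<Longrightarrow> z \<notin> \<real> \<Longrightarrow> f \<in> L2 \<inter> L2w (dual_weight V) \<Longrightarrow>
      wnorm (weight V) (free_resolvent z f) \<le> ennreal (K * br V) * wnorm (dual_weight V) f"
    using assms(2) unfolding resolvent_type_def by blast
  \<comment> \<open>The sum of the three constants 2, 2 sqrt (2 K) and 4 K of the single-potential
    bounds, so it dominates each of them and is positive even if K = 0.\<close>
  define C where "C = 2 + 2 * sqrt (2 * K) + 4 * K"
  have C: "2 \<le> C" "2 * sqrt (2 * K) \<le> C" "4 * K \<le> C" using K by (auto simp: C_def)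
  have main: "\<exists>u. is_solution V u0 F u \<and>
          (\<forall>v. is_solution V u0 F v \<longrightarrow> (AE p in lebesgue. v p = u p)) \<and>
          in_Ct_L2x u \<and>
          (AE x in lebesgue. u (x, 0) = u0 x) \<and>
          wnorm (tx (weight V)) u
            \<le> ennreal (C * sqrt (br V)) * L2norm u0
              + ennreal (C * br V) * wnorm (tx (dual_weight V)) F \<and>
          (SUP t. L2norm (\<lambda>x. u (x, t)))
            \<le> ennreal C * L2norm u0
              + ennreal (C * sqrt (br V)) * wnorm (tx (dual_weight V)) F"
    if V: "V \<in> R" and small: "br V < 1 / (4 * K + 1)" and u0: "u0 \<in> L2" and F: "F \<in> L2w (tx (dual_weight V))" for V u0 F
  proof -
    let ?M = "K * br V"
    note br = R(2)[OF V]
    have M: "0 \<le> ?M" using K br by simp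
    \<comment> \<open>The threshold 1 / (4 K + 1) is positive for every K \<ge> 0, and below it 4 K
      \<open>br V\<close> is at most 1.\<close>
    have "(4 * K + 1) * br V < 1" using small K by (simp add: field_simps)
    then have M4: "4 * ?M \<le> 1" using br by (simp add: algebra_simps)
    obtain V' where V': "borel_rep V V'" using R(1) V by (auto intro: borel_rep_exists)
    have sm: "smoothing (\<lambda>x. sqrt (cmod (V' x))) ?M"
      by (rule smoothing_of_resolvent_bound[OF V' M bound[OF V]])
    obtain u where u: "is_solution V u0 F u" "\<forall>v. is_solution V u0 F v \<longrightarrow> (AE p in lebesgue. v p = u p)"
      "in_Ct_L2x u" "AE x in lebesgue. u (x, 0) = u0 x"
      and b1: "wnorm (tx (weight V)) u \<le> ennreal (2 * sqrt (2 * ?M)) * L2norm u0 + ennreal (4 * ?M) * wnorm (tx (dual_weight V)) F"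
      and b2: "\<And>t. L2norm (\<lambda>x. u (x, t)) \<le> ennreal 2 * L2norm u0 + ennreal (2 * sqrt (2 * ?M)) * wnorm (tx (dual_weight V)) F"
      using well_posed[OF V' sm M4 u0 F] by blast
    have c1: "2 * sqrt (2 * ?M) \<le> C * sqrt (br V)"
      using mult_right_mono[OF C(2), of "sqrt (br V)"] br by (simp add: real_sqrt_mult mult.assoc)
    have c2: "4 * ?M \<le> C * br V" using mult_right_mono[OF C(3) br] by (simp add: mult.assoc)
    have "wnorm (tx (weight V)) u \<le> ennreal (C * sqrt (br V)) * L2norm u0 + ennreal (C * br V) * wnorm (tx (dual_weight V)) F"
      by (rule order_trans[OF b1]) (intro add_mono mult_right_mono ennreal_leI c1 c2; simp)
    moreover have "(SUP t. L2norm (\<lambda>x. u (x, t))) \<le> ennreal C * L2norm u0 + ennreal (C * sqrt (br V)) * wnorm (tx (dual_weight V)) F"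
      by (intro SUP_least order_trans[OF b2] add_mono mult_right_mono ennreal_leI c1 C) simp_all
    ultimately show ?thesis using u by blast
  qed
  have "0 < 1 / (4 * K + 1)" "0 < C" using K C by auto
  with main show ?thesis by blast
qed

end
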